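(* Let $\theta>0$, $s\in\mathbb{R}$, $p,q\in[1,\infty]$, let $\phi_\theta$ be the surface spline kernel of order $\theta$ on $\mathbb{R}^N$, and let $L\in\mathbb{N}$ satisfy $L>\theta+N/p$. If $\mu\in B^s_{p,q}(\mathbb{R}^N)$ is a compactly supported distribution which annihilates all polynomials of total degree at most $L-1$, then $\phi_\theta*\mu\in B^{s+\theta+N}_{p,q}(\mathbb{R}^N)$. Moreover, for every compact $K\subset\mathbb{R}^N$ there is a constant $C$ such that every such $\mu$ with $\mathrm{supp}(\mu)\subset K$ satisfies $$\|\phi_\theta*\mu\|_{B^{s+\theta+N}_{p,q}(\mathbb{R}^N)}\le C\,\|\mu\|_{B^s_{p,q}(\mathbb{R}^N)}.$$
   Context: Surface spline: $\phi_\theta(x)=|x|^\theta$ if $\theta\notin2\mathbb{N}$ and $\phi_\theta(x)=|x|^\theta\log|x|$ if $\theta\in2\mathbb{N}$. $B^s_{p,q}(\mathbb{R}^N)$ is the standard inhomogeneous Besov space of tempered distributions (Littlewood–Paley definition). The convolution of the tempered distribution $\phi_\theta$ with the compactly supported distribution $\mu$ is taken in the sense of distributions. *)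

theory Defs
  imports "HOL-Analysis.Analysis" "HOL-Probability.Essential_Supremum"
begin

section \<open>Smooth, test and Schwartz functions on \<open>\<real>\<^sup>N\<close>\<close>

definition partial_deriv :: "'n \<Rightarrow> (real^'n \<Rightarrow> complex) \<Rightarrow> real^'n::finite \<Rightarrow> complex" where
  "partial_deriv i f x = frechet_derivative f (at x) (axis i 1)"

text \<open>Iterated partial derivatives are indexed by the list of coordinate directions, so a
  derivative of order \<open>k\<close> corresponds to a list of length \<open>k\<close>.\<close>

definition iter_partial :: "'n list \<Rightarrow> (real^'n \<Rightarrow> complex) \<Rightarrow> real^'n::finite \<Rightarrow> complex" where
  "iter_partial is f = foldr partial_deriv is f"

text \<open>Differentiability of all iterated partial derivatives entails their continuity, hence
  this is \<open>C\<^sup>\<infinity>\<close>.\<close>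

definition smooth :: "(real^'n::finite \<Rightarrow> complex) \<Rightarrow> bool" where
  "smooth f \<longleftrightarrow> (\<forall>is x. iter_partial is f differentiable (at x))"

definition fun_support :: "(real^'n::finite \<Rightarrow> complex) \<Rightarrow> (real^'n) set" where
  "fun_support f = closure {x. f x \<noteq> 0}"

definition test_functions :: "(real^'n::finite \<Rightarrow> complex) set" where
  "test_functions = {\<psi>. smooth \<psi> \<and> compact (fun_support \<psi>)}"

definition schwartz :: "(real^'n::finite \<Rightarrow> complex) set" where
  "schwartz = {\<psi>. smooth \<psi> \<and>
     (\<forall>k is. bounded (range (\<lambda>x. of_real ((1 + norm x) ^ k) * iter_partial is \<psi> x)))}"

definition schwartz_seminorm :: "nat \<Rightarrow> (real^'n::finite \<Rightarrow> complex) \<Rightarrow> real" where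
  "schwartz_seminorm k \<psi> =
     Sup {(1 + norm x) ^ k * cmod (iter_partial is \<psi> x) | x is. length is \<le> k}"


section \<open>Tempered distributions\<close>

text \<open>Distributions are functionals on all functions of which only the values on Schwartz
  functions are meaningful; everything below uses a tempered distribution on Schwartz
  functions only.\<close>

type_synonym 'n distr = "(real^'n \<Rightarrow> complex) \<Rightarrow> complex"

definition tempered :: "'n::finite distr \<Rightarrow> bool" where
  "tempered T \<longleftrightarrow>
     (\<forall>\<phi>\<in>schwartz. \<forall>\<psi>\<in>schwartz. \<forall>a b. T (\<lambda>x. a * \<phi> x + b * \<psi> x) = a * T \<phi> + b * T \<psi>) \<and>
     (\<exists>C k. \<forall>\<psi>\<in>schwartz. cmod (T \<psi>) \<le> C * schwartz_seminorm k \<psi>)"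

definition distr_of_fun :: "(real^'n \<Rightarrow> complex) \<Rightarrow> 'n::finite distr" where
  "distr_of_fun f \<psi> = (\<integral>x. f x * \<psi> x \<partial>lborel)"

definition represents :: "(real^'n \<Rightarrow> complex) \<Rightarrow> 'n::finite distr \<Rightarrow> bool" where
  "represents f T \<longleftrightarrow> f \<in> borel_measurable lborel \<and>
     (\<forall>\<psi>\<in>schwartz. integrable lborel (\<lambda>x. f x * \<psi> x) \<and> T \<psi> = distr_of_fun f \<psi>)"

definition distr_support :: "'n::finite distr \<Rightarrow> (real^'n) set" where
  "distr_support T =
     {x. \<forall>U. open U \<and> x \<in> U \<longrightarrow> (\<exists>\<psi>\<in>test_functions. fun_support \<psi> \<subseteq> U \<and> T \<psi> \<noteq> 0)}"

definition support_cutoff :: "'n::finite distr \<Rightarrow> (real^'n \<Rightarrow> complex) \<Rightarrow> bool" where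
  "support_cutoff T \<zeta> \<longleftrightarrow> \<zeta> \<in> test_functions \<and>
     (\<exists>U. open U \<and> distr_support T \<subseteq> U \<and> (\<forall>x\<in>U. \<zeta> x = 1))"

text \<open>The canonical extension of a compactly supported distribution to smooth functions; its
  value does not depend on the chosen cutoff.\<close>

definition pairing :: "'n::finite distr \<Rightarrow> (real^'n \<Rightarrow> complex) \<Rightarrow> complex" where
  "pairing T f = T (\<lambda>x. (SOME \<zeta>. support_cutoff T \<zeta>) x * f x)"

text \<open>Convolution of a tempered distribution \<open>S\<close> with a compactly supported one \<open>T\<close>:
  \<open>\<langle>S * T, \<psi>\<rangle> = \<langle>T\<^sub>y, \<langle>S\<^sub>x, \<psi>(x + y)\<rangle>\<rangle>\<close>.\<close>

definition distr_conv :: "'n::finite distr \<Rightarrow> 'n distr \<Rightarrow> 'n distr" where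
  "distr_conv S T \<psi> = pairing T (\<lambda>y. S (\<lambda>x. \<psi> (x + y)))"


section \<open>Polynomials and the surface spline kernel\<close>

definition poly_degree_le :: "nat \<Rightarrow> (real^'n::finite \<Rightarrow> complex) set" where
  "poly_degree_le d =
     {\<lambda>x. \<Sum>\<alpha>\<in>A. c \<alpha> * of_real (\<Prod>i\<in>UNIV. (x $ i) ^ \<alpha> i) | A c.
        finite (A :: ('n \<Rightarrow> nat) set) \<and> (\<forall>\<alpha>\<in>A. (\<Sum>i\<in>UNIV. \<alpha> i) \<le> d)}"

definition annihilates_polys :: "'n::finite distr \<Rightarrow> nat \<Rightarrow> bool" where
  "annihilates_polys T d \<longleftrightarrow> (\<forall>P\<in>poly_degree_le d. pairing T P = 0)"

text \<open>For \<open>\<theta> > 0\<close> both branches take the value \<open>0\<close> at the origin.\<close>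

definition surface_spline :: "real \<Rightarrow> real^'n::finite \<Rightarrow> complex" where
  "surface_spline \<theta> x = of_real
     (if \<exists>k::nat. \<theta> = 2 * real k then norm x powr \<theta> * ln (norm x) else norm x powr \<theta>)"


section \<open>Fourier transform\<close>

definition fourier :: "(real^'n \<Rightarrow> complex) \<Rightarrow> real^'n::finite \<Rightarrow> complex" where
  "fourier f \<xi> = of_real ((2 * pi) powr (- real CARD('n) / 2)) *
     (\<integral>x. cis (- (x \<bullet> \<xi>)) * f x \<partial>lborel)"

definition inv_fourier :: "(real^'n \<Rightarrow> complex) \<Rightarrow> real^'n::finite \<Rightarrow> complex" where
  "inv_fourier f x = of_real ((2 * pi) powr (- real CARD('n) / 2)) *
     (\<integral>\<xi>. cis (x \<bullet> \<xi>) * f \<xi> \<partial>lborel)"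

definition fourier_distr :: "'n::finite distr \<Rightarrow> 'n distr" where
  "fourier_distr T \<psi> = T (fourier \<psi>)"

definition inv_fourier_distr :: "'n::finite distr \<Rightarrow> 'n distr" where
  "inv_fourier_distr T \<psi> = T (inv_fourier \<psi>)"

definition mult_distr :: "(real^'n \<Rightarrow> complex) \<Rightarrow> 'n::finite distr \<Rightarrow> 'n distr" where
  "mult_distr m T \<psi> = T (\<lambda>\<xi>. m \<xi> * \<psi> \<xi>)"


section \<open>Extended \<open>L\<^sup>p\<close> and \<open>\<ell>\<^sup>q\<close> norms\<close>

text \<open>Only used with positive exponents.\<close>

definition ennreal_powr :: "ennreal \<Rightarrow> real \<Rightarrow> ennreal" where
  "ennreal_powr x r = (if x = \<infinity> then \<infinity> else ennreal (enn2real x powr r))"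

definition Lp_norm :: "ennreal \<Rightarrow> (real^'n::finite \<Rightarrow> complex) \<Rightarrow> ennreal" where
  "Lp_norm p f =
     (if p = \<infinity> then esssup lborel (\<lambda>x. ennreal (cmod (f x)))
      else ennreal_powr (\<integral>\<^sup>+x. ennreal_powr (ennreal (cmod (f x))) (enn2real p) \<partial>lborel)
             (1 / enn2real p))"

definition lq_norm :: "ennreal \<Rightarrow> (nat \<Rightarrow> ennreal) \<Rightarrow> ennreal" where
  "lq_norm q a =
     (if q = \<infinity> then (SUP j. a j)
      else ennreal_powr (\<Sum>j. ennreal_powr (a j) (enn2real q)) (1 / enn2real q))"

text \<open>The \<open>L\<^sup>p\<close> norm of a tempered distribution is infinite unless the distribution is a function
  in \<open>L\<^sup>p\<close>. The infimum ranges over almost everywhere equal functions; it is \<open>\<infinity>\<close>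
  if there are none.\<close>

definition distr_Lp_norm :: "ennreal \<Rightarrow> 'n::finite distr \<Rightarrow> ennreal" where
  "distr_Lp_norm p T = Inf {Lp_norm p f | f. represents f T}"


section \<open>Besov spaces\<close>

text \<open>A generator of a smooth dyadic resolution of unity. Besov spaces do not depend on it,
  and different choices give equivalent norms.\<close>

definition lp_generator :: "(real^'n::finite \<Rightarrow> complex) \<Rightarrow> bool" where
  "lp_generator \<Phi> \<longleftrightarrow>
     smooth \<Phi> \<and> (\<forall>\<xi>. norm \<xi> \<le> 1 \<longrightarrow> \<Phi> \<xi> = 1) \<and> (\<forall>\<xi>. norm \<xi> \<ge> 2 \<longrightarrow> \<Phi> \<xi> = 0)"

definition dyadic :: "(real^'n::finite \<Rightarrow> complex) \<Rightarrow> nat \<Rightarrow> real^'n \<Rightarrow> complex" where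
  "dyadic \<Phi> j \<xi> =
     (if j = 0 then \<Phi> \<xi> else \<Phi> ((1 / 2 ^ j) *\<^sub>R \<xi>) - \<Phi> ((1 / 2 ^ (j - 1)) *\<^sub>R \<xi>))"

definition lp_block :: "(real^'n::finite \<Rightarrow> complex) \<Rightarrow> nat \<Rightarrow> 'n distr \<Rightarrow> 'n distr" where
  "lp_block \<Phi> j T = inv_fourier_distr (mult_distr (dyadic \<Phi> j) (fourier_distr T))"

definition besov_norm ::
  "(real^'n::finite \<Rightarrow> complex) \<Rightarrow> real \<Rightarrow> ennreal \<Rightarrow> ennreal \<Rightarrow> 'n distr \<Rightarrow> ennreal" where
  "besov_norm \<Phi> s p q T =
     lq_norm q (\<lambda>j. ennreal (2 powr (real j * s)) * distr_Lp_norm p (lp_block \<Phi> j T))"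

definition besov_space ::
  "(real^'n::finite \<Rightarrow> complex) \<Rightarrow> real \<Rightarrow> ennreal \<Rightarrow> ennreal \<Rightarrow> 'n distr set" where
  "besov_space \<Phi> s p q = {T. tempered T \<and> besov_norm \<Phi> s p q T < \<infinity>}"

end

theory Submission
  imports Defs "HOL-Probability.Characteristic_Functions"
begin

text \<open>The kernel \<open>\<phi>\<^sub>\<theta>\<close> is homogeneous of degree \<open>\<theta>\<close> up to a polynomial. The generators of
  the blocks with \<open>j \<ge> 1\<close> have vanishing moments, so \<open>\<Delta>\<^sub>j(\<phi>\<^sub>\<theta> * \<mu>)\<close> is the convolution of the
  neighbouring blocks of \<open>\<mu>\<close> with a rapidly decreasing kernel whose \<open>L\<^sup>1\<close> norm is
  \<open>O(2 powr (-j(\<theta> + N)))\<close>; Young's inequality gives the gain of \<open>\<theta> + N\<close> derivatives. The block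
  \<open>j = 0\<close> is the function \<open>v \<mapsto> \<mu>(\<kappa>(\<cdot> - v))\<close> with \<open>\<kappa>\<close> a mollified \<open>\<phi>\<^sub>\<theta>\<close>. Because \<open>\<mu>\<close> annihilates
  the Taylor polynomial of \<open>\<kappa>(\<cdot> - v)\<close> of degree \<open>L - 1\<close> and the derivatives of \<open>\<kappa>\<close> of order at
  least \<open>L\<close> are \<open>O(\<bar>v\<bar> powr (\<theta> + \<epsilon> - L))\<close>, this function decays fast enough to lie in \<open>L\<^sup>p\<close>.\<close>

text \<open>The Fourier transform of \<phi>_\<theta>, singular at the origin, is never formed. The
  kernel enters through its correlations with Schwartz functions, and a cutoff splits it into a
  compactly supported non-smooth core and a smooth tail whose derivatives of order m are O((1 + |x|)
  powr (\<theta> + \<epsilon> - m)). The \<epsilon> absorbs the logarithm; the strict inequality L >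
  \<theta> + N/p leaves room for it, since a = L - \<theta> - \<epsilon> can still be kept positive
  with a p > N. Dilating the logarithmic kernel creates a polynomial, and this is what the vanishing
  moments kill. The block j = 0 is the obstacle. Its function has to be bounded by the Besov norm
  with a constant independent of \<mu>, whereas temperedness supplies a constant and a seminorm that
  depend on \<mu>. The way out is to expand the test function h in Littlewood-Paley blocks: these
  decay like 2 powr (-j M) for any M, which beats the factors 2 powr (-j s). Hence |\<mu>(h)| <= C A
  p(h), with C and the seminorm p fixed, whenever the blocks of \<mu> are bounded by A 2 powr (-j
  s).\<close>

section \<open>Iterated partial derivatives\<close>

lemma iter_partial_simps [simp]:
  "iter_partial [] f = f"
  "iter_partial (i # is) f = partial_deriv i (iter_partial is f)"
  by (simp_all add: iter_partial_def)

lemma iter_partial_append: "iter_partial (is @ js) f = iter_partial is (iter_partial js f)"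
  by (simp add: iter_partial_def)

lemma partial_deriv_eq:
  "(f has_derivative f') (at x) \<Longrightarrow> partial_deriv i f x = f' (axis i 1)"
  unfolding partial_deriv_def using frechet_derivative_at by force

lemma has_derivative_partial:
  fixes f :: "real^'n::finite \<Rightarrow> complex"
  assumes "f differentiable at x"
  shows "(f has_derivative (\<lambda>h. \<Sum>i\<in>UNIV. of_real (h $ i) * partial_deriv i f x)) (at x)"
proof -
  have d: "(f has_derivative frechet_derivative f (at x)) (at x)"
    using assms by (simp add: frechet_derivative_works)
  then have lin: "linear (frechet_derivative f (at x))"
    by (rule has_derivative_linear)
  have "frechet_derivative f (at x) h = (\<Sum>i\<in>UNIV. of_real (h $ i) * partial_deriv i f x)" for h
  proof -
    have "frechet_derivative f (at x) h = frechet_derivative f (at x) (\<Sum>i\<in>UNIV. (h $ i) *\<^sub>R axis i 1)"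
      using basis_expansion[of h] by (simp add: scalar_mult_eq_scaleR)
    also have "\<dots> = (\<Sum>i\<in>UNIV. (h $ i) *\<^sub>R frechet_derivative f (at x) (axis i 1))"
      using lin by (simp add: linear_sum linear_cmul)
    finally show ?thesis by (simp add: partial_deriv_def scaleR_conv_of_real)
  qed
  then show ?thesis using d by (metis (no_types, lifting) ext)
qed

text \<open>Differentiability is not assumed: \<open>frechet_derivative\<close> chooses among the
  derivatives at the point, and two functions that agree near it have the same candidates, so the
  choice coincides too.\<close>

lemma partial_deriv_local:
  assumes "open U" "x \<in> U" "\<And>y. y \<in> U \<Longrightarrow> f y = g y"
  shows "partial_deriv i f x = partial_deriv i g x"
proof -
  have "(f has_derivative D) (at x) \<longleftrightarrow> (g has_derivative D) (at x)" for D
    using has_derivative_transform_within_open[OF _ assms(1,2), of f D UNIV g]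
      has_derivative_transform_within_open[OF _ assms(1,2), of g D UNIV f] assms(3) by auto
  then show ?thesis by (simp add: partial_deriv_def frechet_derivative_def)
qed

lemma iter_partial_local:
  assumes "open U" "x \<in> U" "\<And>y. y \<in> U \<Longrightarrow> f y = g y"
  shows "iter_partial is f x = iter_partial is g x"
  using assms(2)
proof (induction "is" arbitrary: x)
  case (Cons i "is")
  then show ?case by (simp add: partial_deriv_local[OF assms(1) Cons.prems Cons.IH])
qed (use assms in auto)

lemma partial_deriv_const [simp]: "partial_deriv i (\<lambda>x. c) = (\<lambda>x. 0)"
  by (rule ext, subst partial_deriv_eq[OF has_derivative_const]) simp

lemma iter_partial_const0 [simp]: "iter_partial is (\<lambda>x. 0) = (\<lambda>x. 0)"
  by (induction "is") auto

lemma iter_partial_zero_on_open: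
  assumes "open U" "x \<in> U" "\<And>y. y \<in> U \<Longrightarrow> f y = 0"
  shows "iter_partial is f x = 0"
  using iter_partial_local[OF assms(1,2), of f "\<lambda>_. 0"] assms(3) by simp

subsection \<open>Smooth functions\<close>

text \<open>A class of differentiable functions that is stable under partial derivatives contains
  all iterated derivatives of its members. Smoothness then needs no formula for derivatives of
  higher order.\<close>

lemma smooth_coinduct:
  assumes "f \<in> C" "\<And>g x. g \<in> C \<Longrightarrow> g differentiable (at x)"
    and "\<And>g i. g \<in> C \<Longrightarrow> partial_deriv i g \<in> C"
  shows "smooth f"
proof -
  have "iter_partial is f \<in> C" for "is"
    by (induction "is") (auto simp: assms)
  then show ?thesis using assms(2) by (auto simp: smooth_def)
qed

lemma smooth_differentiable: "smooth f \<Longrightarrow> f differentiable (at x)"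
  unfolding smooth_def by (metis iter_partial_simps(1))

lemma smooth_iter_partial: "smooth f \<Longrightarrow> smooth (iter_partial js f)"
  unfolding smooth_def by (metis iter_partial_append)

lemma smooth_partial_deriv: "smooth f \<Longrightarrow> smooth (partial_deriv i f)"
  using smooth_iter_partial[of f "[i]"] by simp

lemma smooth_continuous: "smooth f \<Longrightarrow> continuous_on S f"
  by (meson continuous_at_imp_continuous_on differentiable_imp_continuous_within smooth_differentiable)

lemma smooth_borel: "smooth f \<Longrightarrow> f \<in> borel_measurable borel"
  by (intro borel_measurable_continuous_onI smooth_continuous)

lemma smooth_has_derivative:
  "smooth f \<Longrightarrow> (f has_derivative (\<lambda>h. \<Sum>i\<in>UNIV. of_real (h $ i) * partial_deriv i f x)) (at x)"
  by (intro has_derivative_partial smooth_differentiable)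

lemma smooth_const: "smooth (\<lambda>x. c)"
  by (rule smooth_coinduct[where C="range (\<lambda>c x. c)"]) auto

lemma sum_axis: "(\<Sum>j\<in>UNIV. complex_of_real (axis (i::'n::finite) 1 $ j) * F j) = F i"
proof -
  have "(\<Sum>j\<in>UNIV. complex_of_real (axis i 1 $ j) * F j) = (\<Sum>j\<in>UNIV. if j = i then F j else 0)"
    by (intro sum.cong) (auto simp: axis_def)
  then show ?thesis by simp
qed

lemma partial_deriv_add:
  assumes "f differentiable (at x)" "g differentiable (at x)"
  shows "partial_deriv i (\<lambda>x. f x + g x) x = partial_deriv i f x + partial_deriv i g x"
  by (subst partial_deriv_eq[OF has_derivative_add[OF assms[THEN has_derivative_partial]]])
     (simp add: sum_axis)

lemma partial_deriv_mult:
  assumes "f differentiable (at x)" "g differentiable (at x)"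
  shows "partial_deriv i (\<lambda>x. f x * g x) x = partial_deriv i f x * g x + f x * partial_deriv i g x"
  by (subst partial_deriv_eq[OF has_derivative_mult[OF assms[THEN has_derivative_partial]]])
     (simp add: sum_axis)

lemma smooth_add:
  assumes "smooth f" "smooth g" shows "smooth (\<lambda>x. f x + g x)"
proof (rule smooth_coinduct[where C="{\<lambda>x. f x + g x | f g. smooth f \<and> smooth g}"])
  show "(\<lambda>x. f x + g x) \<in> {\<lambda>x. f x + g x | f g. smooth f \<and> smooth g}"
    using assms by (intro CollectI exI[of _ f] exI[of _ g]) simp
next
  fix h x assume "h \<in> {\<lambda>x. f x + g x | f g. smooth f \<and> smooth g}"
  then obtain f g where *: "h = (\<lambda>x. f x + g x)" "smooth f" "smooth g" by blast
  show "h differentiable at x" unfolding *(1)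
    by (rule differentiable_add[OF smooth_differentiable[OF *(2)] smooth_differentiable[OF *(3)]])
next
  fix h i assume "h \<in> {\<lambda>x. f x + g x | f g. smooth f \<and> smooth g}"
  then obtain f g where *: "h = (\<lambda>x. f x + g x)" "smooth f" "smooth g" by blast
  then have "partial_deriv i h = (\<lambda>x. partial_deriv i f x + partial_deriv i g x)"
    by (auto simp: partial_deriv_add smooth_differentiable)
  with * show "partial_deriv i h \<in> {\<lambda>x. f x + g x | f g. smooth f \<and> smooth g}"
    using smooth_partial_deriv by blast
qed

lemma partial_deriv_add_smooth:
  assumes "smooth f" "smooth g"
  shows "partial_deriv i (\<lambda>x. f x + g x) = (\<lambda>x. partial_deriv i f x + partial_deriv i g x)"
  using assms by (auto simp: partial_deriv_add smooth_differentiable)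

lemma iter_partial_add:
  assumes "smooth f" "smooth g"
  shows "iter_partial is (\<lambda>x. f x + g x) = (\<lambda>x. iter_partial is f x + iter_partial is g x)"
  by (induction "is") (auto simp: partial_deriv_add_smooth smooth_iter_partial assms)

text \<open>The product rule leads from a product to a sum of two products, so products alone are
  not stable under differentiation. This closure is the class fed to
  \<open>smooth_coinduct\<close>.\<close>

inductive_set prod_sums :: "(real^'n::finite \<Rightarrow> complex) set" where
  prod: "smooth f \<Longrightarrow> smooth g \<Longrightarrow> (\<lambda>x. f x * g x) \<in> prod_sums"
| sum: "u \<in> prod_sums \<Longrightarrow> v \<in> prod_sums \<Longrightarrow> (\<lambda>x. u x + v x) \<in> prod_sums"

lemma prod_sums_deriv:
  assumes "u \<in> prod_sums"
  shows "(\<forall>x. u differentiable at x) \<and> (\<forall>i. partial_deriv i u \<in> prod_sums)"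
  using assms
proof induction
  case (prod f g)
  then have "partial_deriv i (\<lambda>x. f x * g x) = (\<lambda>x. partial_deriv i f x * g x + f x * partial_deriv i g x)" for i
    by (auto simp: partial_deriv_mult smooth_differentiable)
  moreover have "(\<lambda>x. partial_deriv i f x * g x + f x * partial_deriv i g x) \<in> prod_sums" for i
    using prod by (intro prod_sums.sum prod_sums.prod smooth_partial_deriv)
  moreover have "(\<lambda>x. f x * g x) differentiable at x" for x
    using prod by (intro differentiable_mult smooth_differentiable)
  ultimately show ?case by simp
next
  case (sum u v)
  then have "partial_deriv i (\<lambda>x. u x + v x) = (\<lambda>x. partial_deriv i u x + partial_deriv i v x)" for i
    by (auto simp: partial_deriv_add)
  with sum show ?case by (auto intro!: prod_sums.sum differentiable_add)
qed

lemma smooth_mult: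
  assumes "smooth f" "smooth g" shows "smooth (\<lambda>x. f x * g x)"
  by (rule smooth_coinduct[of _ prod_sums]) (use assms prod_sums_deriv in \<open>blast intro: prod_sums.prod\<close>)+

lemma partial_deriv_mult_smooth:
  assumes "smooth f" "smooth g"
  shows "partial_deriv i (\<lambda>x. f x * g x) = (\<lambda>x. partial_deriv i f x * g x + f x * partial_deriv i g x)"
  using assms by (auto simp: partial_deriv_mult smooth_differentiable)

lemma iter_partial_cmult:
  assumes "smooth f"
  shows "iter_partial is (\<lambda>x. c * f x) = (\<lambda>x. c * iter_partial is f x)"
  by (induction "is") (auto simp: partial_deriv_mult_smooth smooth_iter_partial smooth_const assms)

lemma smooth_cmult: "smooth f \<Longrightarrow> smooth (\<lambda>x. c * f x)"
  by (intro smooth_mult smooth_const)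

lemma smooth_diff: "smooth f \<Longrightarrow> smooth g \<Longrightarrow> smooth (\<lambda>x. f x - g x)"
  using smooth_add[of f "\<lambda>x. (-1) * g x"] smooth_cmult[of g "-1"] by simp

lemma iter_partial_diff:
  assumes "smooth f" "smooth g"
  shows "iter_partial is (\<lambda>x. f x - g x) = (\<lambda>x. iter_partial is f x - iter_partial is g x)"
  using iter_partial_add[OF assms(1) smooth_cmult[OF assms(2), of "-1"], of "is"]
    iter_partial_cmult[OF assms(2), of "is" "-1"] by simp

lemma smooth_coord: "smooth (\<lambda>x::real^'n::finite. of_real (x $ i))"
proof (rule smooth_coinduct[where C="insert (\<lambda>x. of_real (x $ i)) (range (\<lambda>c x. c))"])
  have hd: "((\<lambda>x. of_real (x $ i)) has_derivative (\<lambda>h. complex_of_real (h $ i))) (at x)" for x :: "real^'n"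
    by (intro bounded_linear.has_derivative[OF bounded_linear_of_real] bounded_linear.has_derivative[OF bounded_linear_vec_nth] has_derivative_ident)
  fix g :: "real^'n \<Rightarrow> complex"
  assume "g \<in> insert (\<lambda>x. of_real (x $ i)) (range (\<lambda>c x. c))"
  moreover have "partial_deriv j (\<lambda>x::real^'n. complex_of_real (x $ i)) = (\<lambda>x. of_real (axis j 1 $ i))" for j
    using partial_deriv_eq[OF hd] by auto
  moreover have "(\<lambda>x::real^'n. complex_of_real (x $ i)) differentiable at x" for x
    using hd by (auto simp: differentiable_def)
  ultimately show "g differentiable at x" "partial_deriv j g \<in> insert (\<lambda>x. of_real (x $ i)) (range (\<lambda>c x. c))" for x j
    by auto
qed simp

lemma partial_deriv_affine:
  assumes "smooth f"
  shows "partial_deriv i (\<lambda>x. f (a *\<^sub>R x + b)) = (\<lambda>x. of_real a * partial_deriv i f (a *\<^sub>R x + b))"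
proof
  fix x
  have "((\<lambda>x. f (a *\<^sub>R x + b)) has_derivative (\<lambda>h. \<Sum>j\<in>UNIV. of_real ((a *\<^sub>R h) $ j) * partial_deriv j f (a *\<^sub>R x + b))) (at x)"
    by (rule has_derivative_compose[OF _ smooth_has_derivative[OF assms]])
       (auto intro!: derivative_eq_intros)
  from partial_deriv_eq[OF this, of i]
  show "partial_deriv i (\<lambda>x. f (a *\<^sub>R x + b)) x = of_real a * partial_deriv i f (a *\<^sub>R x + b)"
    by (simp add: axis_def if_distrib[where f="\<lambda>t. t * _"] if_distrib[where f="\<lambda>t. _ * t"] if_distrib[where f=of_real] cong: if_cong)
qed

lemma smooth_affine:
  fixes f :: "real^'n::finite \<Rightarrow> complex"
  assumes "smooth f"
  shows "smooth (\<lambda>x. f (a *\<^sub>R x + b))"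
\<comment> \<open>The scalar \<open>c\<close> collects the factors \<open>a\<close> produced by the
  chain rule.\<close>
proof (rule smooth_coinduct[where C="{\<lambda>x. c * f (a *\<^sub>R x + b) | c f. smooth f}"])
  show "(\<lambda>x. f (a *\<^sub>R x + b)) \<in> {\<lambda>x. c * f (a *\<^sub>R x + b) | c f. smooth f}"
    using assms by (intro CollectI exI[of _ 1] exI[of _ f]) simp
  fix g :: "real^'n \<Rightarrow> complex" and x i assume "g \<in> {\<lambda>x. c * f (a *\<^sub>R x + b) | c f. smooth f}"
  then obtain c f where g: "g = (\<lambda>x. c * f (a *\<^sub>R x + b))" "smooth f" by blast
  have d: "((\<lambda>x. f (a *\<^sub>R x + b)) has_derivative (\<lambda>h. \<Sum>j\<in>UNIV. of_real ((a *\<^sub>R h) $ j) * partial_deriv j f (a *\<^sub>R x + b))) (at x)" for x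
    by (rule has_derivative_compose[OF _ smooth_has_derivative[OF g(2)]])
       (auto intro!: derivative_eq_intros)
  then have d': "(\<lambda>x. f (a *\<^sub>R x + b)) differentiable at x" for x by (auto simp: differentiable_def)
  then show "g differentiable at x" unfolding g by (intro differentiable_mult) auto
  have "partial_deriv i g = (\<lambda>x. (c * of_real a) * partial_deriv i f (a *\<^sub>R x + b))"
    unfolding g using d' by (auto simp: partial_deriv_mult partial_deriv_affine[OF g(2)])
  then show "partial_deriv i g \<in> {\<lambda>x. c * f (a *\<^sub>R x + b) | c f. smooth f}"
    using smooth_partial_deriv[OF g(2), of i] by blast
qed

lemma iter_partial_affine:
  assumes "smooth f"
  shows "iter_partial is (\<lambda>x. f (a *\<^sub>R x + b)) = (\<lambda>x. of_real a ^ length is * iter_partial is f (a *\<^sub>R x + b))"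
proof (induction "is")
  case (Cons i "is")
  have "smooth (\<lambda>x. iter_partial is f (a *\<^sub>R x + b))"
    by (intro smooth_affine smooth_iter_partial assms)
  then show ?case
    using Cons by (auto simp: partial_deriv_mult_smooth[OF smooth_const] partial_deriv_affine smooth_iter_partial assms)
qed simp

text \<open>Each derivative doubles the number of summands in the product rule, hence at most
  \<open>2 ^ n\<close> terms, each bounded by \<open>A * B\<close>.\<close>

lemma leibniz_bound:
  assumes "smooth f" "smooth g" "A \<ge> 0"
    and "\<And>is. length is \<le> n \<Longrightarrow> cmod (iter_partial is f x) \<le> A"
    and "\<And>is. length is \<le> n \<Longrightarrow> cmod (iter_partial is g x) \<le> B"
    and "length is \<le> n"
  shows "cmod (iter_partial is (\<lambda>x. f x * g x) x) \<le> 2 ^ n * A * B"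
  using assms
proof (induction n arbitrary: f g "is")
  case 0
  then have "is = []" by auto
  with 0(4)[of "[]"] 0(5)[of "[]"] 0(3) show ?case by (auto simp: norm_mult intro!: mult_mono)
next
  case (Suc n)
  have B: "B \<ge> 0" using Suc.prems(5)[of "[]"] norm_ge_zero order_trans by (metis le0 list.size(3))
  show ?case
  proof (cases "length is \<le> n")
    case True
    have "cmod (iter_partial is (\<lambda>x. f x * g x) x) \<le> 2 ^ n * A * B"
      using Suc.prems True by (intro Suc.IH) auto
    also have "\<dots> \<le> 2 ^ Suc n * A * B" using B Suc.prems(3) by (intro mult_right_mono) auto
    finally show ?thesis .
  next
    case False
    \<comment> \<open>\<open>iter_partial\<close> applies the last entry of the list first.
      Splitting it off places the product rule innermost, and the induction hypothesis applies to
      the two resulting products.\<close>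
    then obtain js i where js: "is = js @ [i]" "length js = n" using Suc.prems(6)
      by (metis append_butlast_last_id le_antisym length_append_singleton list.size(3) nat.inject not_less_eq_eq le0)
    have e: "iter_partial is (\<lambda>x. f x * g x) = (\<lambda>x. iter_partial js (\<lambda>x. partial_deriv i f x * g x) x
         + iter_partial js (\<lambda>x. f x * partial_deriv i g x) x)"
      unfolding js iter_partial_append using Suc.prems(1,2)
      by (simp add: partial_deriv_mult_smooth iter_partial_add smooth_mult smooth_partial_deriv)
    have 1: "cmod (iter_partial js (\<lambda>x. partial_deriv i f x * g x) x) \<le> 2 ^ n * A * B"
    proof (rule Suc.IH)
      fix ks :: "'a list" assume "length ks \<le> n"
      then show "cmod (iter_partial ks (partial_deriv i f) x) \<le> A"
        using Suc.prems(4)[of "ks @ [i]"] by (simp add: iter_partial_append)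
    qed (use Suc.prems js smooth_partial_deriv in auto)
    have 2: "cmod (iter_partial js (\<lambda>x. f x * partial_deriv i g x) x) \<le> 2 ^ n * A * B"
    proof (rule Suc.IH)
      fix ks :: "'a list" assume "length ks \<le> n"
      then show "cmod (iter_partial ks (partial_deriv i g) x) \<le> B"
        using Suc.prems(5)[of "ks @ [i]"] by (simp add: iter_partial_append)
    qed (use Suc.prems js smooth_partial_deriv in auto)
    show ?thesis using norm_triangle_mono[OF 1 2] by (simp add: e mult_ac)
  qed
qed

lemma finite_lists_le: "finite {is :: 'n::finite list. length is \<le> k}"
  using finite_lists_length_le[of "UNIV :: 'n set" k] by simp

lemma smooth_bounded_compact:
  assumes "smooth f" "compact K"
  obtains B where "B \<ge> 0" "\<And>is x. length is \<le> k \<Longrightarrow> x \<in> K \<Longrightarrow> cmod (iter_partial is f x) \<le> B"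
proof -
  have "\<exists>B. \<forall>x\<in>K. cmod (iter_partial is f x) \<le> B" for "is"
  proof -
    have "compact (iter_partial is f ` K)"
      using assms by (intro compact_continuous_image smooth_continuous smooth_iter_partial)
    then show ?thesis by (meson bounded_iff compact_imp_bounded imageI)
  qed
  then obtain b where b: "\<And>is x. x \<in> K \<Longrightarrow> cmod (iter_partial is f x) \<le> b is" by metis
  show thesis
  proof
    show "(\<Sum>is\<in>{is. length is \<le> k}. \<bar>b is\<bar>) \<ge> 0" by (intro sum_nonneg) auto
    fix "is" :: "'a list" and x assume "length is \<le> k" "x \<in> K"
    then have "cmod (iter_partial is f x) \<le> \<bar>b is\<bar>" using b[of x "is"] by linarith
    also have "\<dots> \<le> (\<Sum>is\<in>{is. length is \<le> k}. \<bar>b is\<bar>)"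
      using \<open>length is \<le> k\<close> by (intro member_le_sum finite_lists_le) auto
    finally show "cmod (iter_partial is f x) \<le> (\<Sum>is\<in>{is. length is \<le> k}. \<bar>b is\<bar>)" .
  qed
qed

subsection \<open>Weights and Schwartz functions\<close>

text \<open>Real exponents of either sign, so that growth and decay are handled by the same
  lemmas.\<close>

definition wt :: "real \<Rightarrow> 'a::real_normed_vector \<Rightarrow> real" where
  "wt r x = (1 + norm x) powr r"

lemma wt_pos: "wt r x > 0"
  unfolding wt_def using norm_ge_zero[of x] by (intro powr_gt_zero[THEN iffD2]) linarith

lemma wt_nonneg [simp]: "wt r x \<ge> 0" using wt_pos less_imp_le by blast

lemma wt_mult: "wt r x * wt t x = wt (r + t) x"
  by (simp add: wt_def powr_add)

lemma wt_0 [simp]: "wt 0 x = 1" "wt r 0 = 1"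
  using norm_ge_zero[of x] by (auto simp: wt_def simp del: norm_ge_zero)

lemma wt_nat: "wt (real k) x = (1 + norm x) ^ k"
  unfolding wt_def by (rule powr_realpow) (use norm_ge_zero[of x] in linarith)

lemma wt_mono: "r \<le> t \<Longrightarrow> wt r x \<le> wt t x"
  unfolding wt_def by (intro powr_mono) auto

lemma wt_minus [simp]: "wt r (- x) = wt r x" by (simp add: wt_def)

text \<open>Peetre's inequality. For \<open>r >= 0\<close> it follows from 1 + |x + y| <= (1 +
  |x|)(1 + |y|); for negative \<open>r\<close> the same estimate is applied to x = (x + y) - y and
  inverted.\<close>

lemma wt_peetre: "wt r (x + y) \<le> wt r x * wt \<bar>r\<bar> y"
proof (cases "r \<ge> 0")
  case True
  have "1 + norm (x + y) \<le> (1 + norm x) * (1 + norm y)"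
    using norm_triangle_ineq[of x y] mult_nonneg_nonneg[OF norm_ge_zero[of x] norm_ge_zero[of y]]
    unfolding distrib_left distrib_right by linarith
  then have "(1 + norm (x + y)) powr r \<le> ((1 + norm x) * (1 + norm y)) powr r"
    using True by (intro powr_mono2) auto
  then show ?thesis using True by (simp add: wt_def powr_mult)
next
  case False
  have "1 + norm x \<le> (1 + norm (x + y)) * (1 + norm y)"
  proof -
    have "norm x \<le> norm (x + y) + norm y" using norm_triangle_ineq[of "x + y" "-y"] by simp
    then show ?thesis
      using mult_nonneg_nonneg[OF norm_ge_zero[of "x + y"] norm_ge_zero[of y]]
      unfolding distrib_left distrib_right by linarith
  qed
  then have "(1 + norm x) powr (-r) \<le> ((1 + norm (x + y)) * (1 + norm y)) powr (-r)"
    using False by (intro powr_mono2) auto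
  then have "wt (-r) x \<le> wt (-r) (x + y) * wt \<bar>r\<bar> y" using False by (simp add: wt_def powr_mult)
  then have "wt (-r) x * (wt r x * wt r (x + y)) \<le> (wt (-r) (x + y) * wt \<bar>r\<bar> y) * (wt r x * wt r (x + y))"
    by (intro mult_right_mono) auto
  moreover have "wt (-r) x * (wt r x * wt r (x + y)) = wt r (x + y)"
    by (simp add: mult.assoc[symmetric] wt_mult)
  moreover have "(wt (-r) (x + y) * wt \<bar>r\<bar> y) * (wt r x * wt r (x + y)) = wt r x * wt \<bar>r\<bar> y"
    using wt_mult[of "-r" "x + y" r] by (simp add: mult_ac)
  ultimately show ?thesis by simp
qed

lemma wt_le_1: "r \<le> 0 \<Longrightarrow> wt r x \<le> 1"
  using wt_mono[of r 0 x] by simp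

lemma wt_ge_1: "r \<ge> 0 \<Longrightarrow> 1 \<le> wt r x"
  using wt_mono[of 0 r x] by simp

lemma wt_continuous: "continuous_on S (wt r)"
proof -
  have "1 + norm x \<noteq> 0" for x :: 'a using norm_ge_zero[of x] by linarith
  then show ?thesis unfolding wt_def by (intro continuous_intros) auto
qed

lemma wt_borel [measurable]: "wt r \<in> borel_measurable borel"
  by (intro borel_measurable_continuous_onI wt_continuous)

text \<open>Replaces the natural powers of the definition by arbitrary real exponents, so that later
  proofs can ask for exactly the decay they consume.\<close>

lemma schwartz_iff:
  "\<psi> \<in> schwartz \<longleftrightarrow> smooth \<psi> \<and> (\<forall>r is. \<exists>B. \<forall>x. cmod (iter_partial is \<psi> x) \<le> B * wt r x)"
proof safe
  assume s: "\<psi> \<in> schwartz"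
  show "smooth \<psi>" using s by (simp add: schwartz_def)
  fix r :: real and "is"
  define k where "k = nat \<lceil>- r\<rceil>"
  obtain B where B: "\<And>x. cmod (of_real ((1 + norm x) ^ k) * iter_partial is \<psi> x) \<le> B"
    using s unfolding schwartz_def bounded_iff by blast
  have "cmod (iter_partial is \<psi> x) \<le> B * wt r x" for x
  proof -
    have "cmod (of_real ((1 + norm x) ^ k) * iter_partial is \<psi> x) = wt k x * cmod (iter_partial is \<psi> x)"
      by (simp add: norm_mult wt_nat[symmetric] del: of_real_power of_real_add)
    then have 1: "wt k x * cmod (iter_partial is \<psi> x) \<le> B" using B[of x] by simp
    have "cmod (iter_partial is \<psi> x) = wt (- real k) x * (wt k x * cmod (iter_partial is \<psi> x))"
      by (simp add: mult.assoc[symmetric] wt_mult)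
    also have "\<dots> \<le> wt (- real k) x * B" using 1 by (intro mult_left_mono) auto
    also have "\<dots> \<le> wt r x * B"
      using 1 mult_nonneg_nonneg[OF wt_nonneg[of k x] norm_ge_zero[of "iter_partial is \<psi> x"]]
      by (intro mult_right_mono wt_mono) (unfold k_def, linarith+)
    finally show ?thesis by (simp add: mult.commute)
  qed
  then show "\<exists>B. \<forall>x. cmod (iter_partial is \<psi> x) \<le> B * wt r x" by blast
next
  assume sm: "smooth \<psi>" and b: "\<forall>r is. \<exists>B. \<forall>x. cmod (iter_partial is \<psi> x) \<le> B * wt r x"
  have "bounded (range (\<lambda>x. of_real ((1 + norm x) ^ k) * iter_partial is \<psi> x))" for k "is"
  proof -
    obtain B where B: "\<And>x. cmod (iter_partial is \<psi> x) \<le> B * wt (- real k) x" using b by blast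
    have "cmod (of_real ((1 + norm x) ^ k) * iter_partial is \<psi> x) \<le> B" for x
    proof -
      have "cmod (of_real ((1 + norm x) ^ k) * iter_partial is \<psi> x) = wt k x * cmod (iter_partial is \<psi> x)"
        by (simp add: norm_mult wt_nat[symmetric] del: of_real_power of_real_add)
      also have "\<dots> \<le> wt k x * (B * wt (- real k) x)" using B by (intro mult_left_mono) auto
      also have "\<dots> = B" using wt_mult[of k x "- real k"] by (simp add: mult.left_commute)
      finally show ?thesis .
    qed
    then show ?thesis by (auto simp: bounded_iff)
  qed
  with sm show "\<psi> \<in> schwartz" by (simp add: schwartz_def)
qed

lemma schwartz_smooth: "\<psi> \<in> schwartz \<Longrightarrow> smooth \<psi>" by (simp add: schwartz_def)

lemma schwartz_bound:
  assumes "\<psi> \<in> schwartz"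
  obtains B where "B \<ge> 0" "\<And>x. cmod (iter_partial is \<psi> x) \<le> B * wt r x"
proof -
  obtain B where B: "\<And>x. cmod (iter_partial is \<psi> x) \<le> B * wt r x" using assms schwartz_iff by blast
  have "0 \<le> cmod (iter_partial is \<psi> 0)" by simp
  also have "\<dots> \<le> B" using B[of 0] by simp
  finally show thesis using that B by blast
qed

lemma schwartz_bound0:
  assumes "\<psi> \<in> schwartz"
  obtains B where "B \<ge> 0" "\<And>x. cmod (\<psi> x) \<le> B * wt r x"
  using schwartz_bound[OF assms, of "[]" r] by auto

text \<open>The real \<open>Sup\<close> in \<open>schwartz_seminorm\<close> carries information only
  for a bounded set. Boundedness holds because only finitely many lists have length at most
  \<open>k\<close>.\<close>

lemma seminorm_bdd:
  assumes "\<psi> \<in> schwartz"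
  shows "bdd_above {(1 + norm x) ^ k * cmod (iter_partial is \<psi> x) | x is. length is \<le> k}"
proof -
  have "\<exists>B. \<forall>x. cmod (iter_partial is \<psi> x) \<le> B * wt (- real k) x" for "is" using assms schwartz_iff by blast
  then obtain B where B: "\<And>is x. cmod (iter_partial is \<psi> x) \<le> B is * wt (- real k) x" by metis
  have "(1 + norm x) ^ k * cmod (iter_partial is \<psi> x) \<le> (\<Sum>is\<in>{is. length is \<le> k}. \<bar>B is\<bar>)"
    if "length is \<le> k" for x "is"
  proof -
    have "(1 + norm x) ^ k * cmod (iter_partial is \<psi> x) \<le> wt k x * (B is * wt (- real k) x)"
      unfolding wt_nat[symmetric] using B by (intro mult_left_mono) auto
    also have "\<dots> = B is" using wt_mult[of k x "- real k"] by (simp add: mult.left_commute)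
    also have "\<dots> \<le> \<bar>B is\<bar>" by simp
    also have "\<dots> \<le> (\<Sum>is\<in>{is. length is \<le> k}. \<bar>B is\<bar>)"
      using that by (intro member_le_sum finite_lists_le) auto
    finally show ?thesis .
  qed
  then show ?thesis by (intro bdd_aboveI) blast
qed

lemma seminorm_bound:
  assumes "\<psi> \<in> schwartz" "length is \<le> k"
  shows "cmod (iter_partial is \<psi> x) \<le> schwartz_seminorm k \<psi> * wt (- real k) x"
proof -
  have "wt k x * cmod (iter_partial is \<psi> x) \<le> schwartz_seminorm k \<psi>"
    unfolding schwartz_seminorm_def wt_nat using assms by (intro cSup_upper seminorm_bdd) auto
  then have "wt (- real k) x * (wt k x * cmod (iter_partial is \<psi> x)) \<le> wt (- real k) x * schwartz_seminorm k \<psi>"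
    by (intro mult_left_mono) auto
  then show ?thesis by (simp add: mult.assoc[symmetric] wt_mult) (simp add: mult.commute)
qed

lemma seminorm_least:
  assumes "\<And>is x. length is \<le> k \<Longrightarrow> cmod (iter_partial is \<psi> x) \<le> B * wt (- real k) x"
  shows "schwartz_seminorm k \<psi> \<le> B"
  unfolding schwartz_seminorm_def
proof (rule cSup_least)
  show "{(1 + norm x) ^ k * cmod (iter_partial is \<psi> x) | x is. length is \<le> k} \<noteq> {}"
    by (metis (mono_tags, lifting) empty_iff le0 list.size(3) mem_Collect_eq)
  fix z assume "z \<in> {(1 + norm x) ^ k * cmod (iter_partial is \<psi> x) | x is. length is \<le> k}"
  then obtain x "is" where z: "z = wt k x * cmod (iter_partial is \<psi> x)" "length is \<le> k" by (auto simp: wt_nat)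
  have "z \<le> wt k x * (B * wt (- real k) x)" unfolding z using assms z by (intro mult_left_mono) auto
  also have "\<dots> = B" using wt_mult[of k x "- real k"] by (simp add: mult.left_commute)
  finally show "z \<le> B" .
qed

lemma seminorm_nonneg: "\<psi> \<in> schwartz \<Longrightarrow> schwartz_seminorm k \<psi> \<ge> 0"
proof -
  assume "\<psi> \<in> schwartz"
  from seminorm_bound[OF this, of "[]" k 0] have "cmod (\<psi> 0) \<le> schwartz_seminorm k \<psi>" by simp
  then show ?thesis using norm_ge_zero[of "\<psi> 0"] by linarith
qed

lemma schwartz_iter_partial: "\<psi> \<in> schwartz \<Longrightarrow> iter_partial js \<psi> \<in> schwartz"
  unfolding schwartz_iff by (metis iter_partial_append smooth_iter_partial)

lemma schwartz_partial_deriv: "\<psi> \<in> schwartz \<Longrightarrow> partial_deriv i \<psi> \<in> schwartz"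
  using schwartz_iter_partial[of \<psi> "[i]"] by simp

lemma schwartz_add:
  assumes "f \<in> schwartz" "g \<in> schwartz" shows "(\<lambda>x. f x + g x) \<in> schwartz"
  unfolding schwartz_iff
proof safe
  show "smooth (\<lambda>x. f x + g x)" using assms by (intro smooth_add schwartz_smooth)
  fix r :: real and "is"
  obtain A where A: "\<And>x. cmod (iter_partial is f x) \<le> A * wt r x" using assms schwartz_iff by blast
  obtain B where B: "\<And>x. cmod (iter_partial is g x) \<le> B * wt r x" using assms schwartz_iff by blast
  have "cmod (iter_partial is (\<lambda>x. f x + g x) x) \<le> (A + B) * wt r x" for x
    using norm_triangle_mono[OF A B, of x x] assms
    by (simp add: iter_partial_add schwartz_smooth distrib_right)
  then show "\<exists>B. \<forall>x. cmod (iter_partial is (\<lambda>x. f x + g x) x) \<le> B * wt r x" by blast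
qed

section \<open>Slowly increasing multipliers of the Schwartz space\<close>

text \<open>The multiplier space usually written O_M: the growth exponent may depend on the
  derivative.\<close>

definition slow :: "(real^'n::finite \<Rightarrow> complex) \<Rightarrow> bool" where
  "slow f \<longleftrightarrow> smooth f \<and> (\<forall>is. \<exists>r B. \<forall>x. cmod (iter_partial is f x) \<le> B * wt r x)"

lemma slow_bound:
  fixes f :: "real^'n::finite \<Rightarrow> complex"
  assumes "slow f"
  obtains r B where "B \<ge> 0" "r \<ge> 0" "\<And>is x. length is \<le> k \<Longrightarrow> cmod (iter_partial is f x) \<le> B * wt r x"
proof -
  obtain r B where rB: "\<And>is x. cmod (iter_partial is f x) \<le> B is * wt (r is) x"
    using assms unfolding slow_def by metis
  show thesis
  proof
    let ?L = "{is :: 'n list. length is \<le> k}"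
    show "0 \<le> (\<Sum>is\<in>?L. \<bar>B is\<bar>)" "0 \<le> (\<Sum>is\<in>?L. \<bar>r is\<bar>)" by (auto intro: sum_nonneg)
    fix "is" :: "'n list" and x :: "real^'n" assume l: "length is \<le> k"
    have "r is \<le> (\<Sum>is\<in>?L. \<bar>r is\<bar>)" "B is \<le> (\<Sum>is\<in>?L. \<bar>B is\<bar>)"
      using member_le_sum[of "is" ?L "\<lambda>is. \<bar>r is\<bar>"] member_le_sum[of "is" ?L "\<lambda>is. \<bar>B is\<bar>"] l finite_lists_le
      by force+
    then have "B is * wt (r is) x \<le> (\<Sum>is\<in>?L. \<bar>B is\<bar>) * wt (\<Sum>is\<in>?L. \<bar>r is\<bar>) x"
      by (intro mult_mono wt_mono) (auto intro: sum_nonneg)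
    then show "cmod (iter_partial is f x) \<le> (\<Sum>is\<in>?L. \<bar>B is\<bar>) * wt (\<Sum>is\<in>?L. \<bar>r is\<bar>) x"
      using rB[of "is" x] by linarith
  qed
qed

lemma slow_mult_schwartz_bound:
  assumes "slow f"
  obtains C m where "C \<ge> 0" "\<And>g. g \<in> schwartz \<Longrightarrow> (\<lambda>x. f x * g x) \<in> schwartz"
    "\<And>g. g \<in> schwartz \<Longrightarrow> schwartz_seminorm k (\<lambda>x. f x * g x) \<le> C * schwartz_seminorm m g"
proof -
  have main: "\<exists>C m. C \<ge> 0 \<and> (\<forall>g\<in>schwartz. \<forall>is x. length is \<le> k \<longrightarrow>
       cmod (iter_partial is (\<lambda>x. f x * g x) x) \<le> C * schwartz_seminorm m g * wt (- real k) x)" for k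
  proof -
    obtain r B where rB: "B \<ge> 0" "r \<ge> 0" "\<And>is x. length is \<le> k \<Longrightarrow> cmod (iter_partial is f x) \<le> B * wt r x"
      using slow_bound[OF assms] by metis
    \<comment> \<open>Beyond the \<open>k\<close> orders of decay demanded of the product,
      \<open>r\<close> further orders of decay of \<open>g\<close> pay for the growth of
      \<open>f\<close>.\<close>
    define m where "m = k + nat \<lceil>r\<rceil>"
    have m: "k \<le> m" "r - real m \<le> - real k" unfolding m_def by linarith+
    have "cmod (iter_partial is (\<lambda>x. f x * g x) x) \<le> 2^k * B * schwartz_seminorm m g * wt (- real k) x"
      if g: "g \<in> schwartz" and l: "length is \<le> k" for g "is" x
    proof -
      have "cmod (iter_partial is (\<lambda>x. f x * g x) x) \<le> 2^k * (B * wt r x) * (schwartz_seminorm m g * wt (- real m) x)"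
        using g l m rB assms
        by (intro leibniz_bound) (auto simp: slow_def intro: seminorm_bound schwartz_smooth)
      also have "\<dots> = 2^k * B * schwartz_seminorm m g * wt (r - real m) x"
        using wt_mult[of r x "- real m"] by (simp add: mult_ac)
      also have "\<dots> \<le> 2^k * B * schwartz_seminorm m g * wt (- real k) x"
        using rB m seminorm_nonneg[OF g] by (intro mult_left_mono wt_mono) auto
      finally show ?thesis .
    qed
    then show ?thesis using rB(1) by (intro exI[of _ "2^k * B"] exI[of _ m]) auto
  qed
  have S: "(\<lambda>x. f x * g x) \<in> schwartz" if g: "g \<in> schwartz" for g
    unfolding schwartz_iff
  proof safe
    show "smooth (\<lambda>x. f x * g x)" using assms g by (auto simp: slow_def intro: smooth_mult schwartz_smooth)
    fix r :: real and "is" :: "'a list"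
    define k where "k = length is + nat \<lceil>- r\<rceil>"
    have k: "- real k \<le> r" "length is \<le> k" unfolding k_def by linarith+
    obtain C m where C: "C \<ge> 0" "\<forall>g\<in>schwartz. \<forall>is x. length is \<le> k \<longrightarrow>
       cmod (iter_partial is (\<lambda>x. f x * g x) x) \<le> C * schwartz_seminorm m g * wt (- real k) x"
      using main by meson
    have "cmod (iter_partial is (\<lambda>x. f x * g x) x) \<le> C * schwartz_seminorm m g * wt r x" for x
    proof -
      have "cmod (iter_partial is (\<lambda>x. f x * g x) x) \<le> C * schwartz_seminorm m g * wt (- real k) x"
        using C g k by blast
      also have "\<dots> \<le> C * schwartz_seminorm m g * wt r x"
        using C(1) seminorm_nonneg[OF g] by (intro mult_left_mono wt_mono k mult_nonneg_nonneg)
      finally show ?thesis .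
    qed
    then show "\<exists>B. \<forall>x. cmod (iter_partial is (\<lambda>x. f x * g x) x) \<le> B * wt r x" by blast
  qed
  obtain C m where C: "C \<ge> 0" "\<forall>g\<in>schwartz. \<forall>is x. length is \<le> k \<longrightarrow>
       cmod (iter_partial is (\<lambda>x. f x * g x) x) \<le> C * schwartz_seminorm m g * wt (- real k) x"
    using main by meson
  show thesis by (rule that[of C m]) (use C S in \<open>auto intro!: seminorm_least\<close>)
qed

lemma slow_mult_schwartz: "slow f \<Longrightarrow> g \<in> schwartz \<Longrightarrow> (\<lambda>x. f x * g x) \<in> schwartz"
  by (rule slow_mult_schwartz_bound)

lemma schwartz_slow: "f \<in> schwartz \<Longrightarrow> slow f"
  unfolding schwartz_iff slow_def by blast

lemma slow_const: "slow (\<lambda>x. c)"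
proof -
  have "\<exists>r B. \<forall>x. cmod (iter_partial is (\<lambda>x. c) x) \<le> B * wt r x" for "is" :: "'a list"
  proof (cases "is" rule: rev_cases)
    case Nil
    then show ?thesis by (intro exI[of _ 0] exI[of _ "cmod c"]) auto
  next
    case (snoc ys y)
    then show ?thesis by (auto simp: iter_partial_append intro!: exI[of _ 0])
  qed
  then show ?thesis by (auto simp: slow_def smooth_const)
qed

lemma slow_coord: "slow (\<lambda>x::real^'n::finite. of_real (x $ i))"
proof -
  have hd: "((\<lambda>x. of_real (x $ i)) has_derivative (\<lambda>h. complex_of_real (h $ i))) (at x)" for x :: "real^'n"
    by (intro bounded_linear.has_derivative[OF bounded_linear_of_real] bounded_linear.has_derivative[OF bounded_linear_vec_nth] has_derivative_ident)
  have pd: "partial_deriv j (\<lambda>x::real^'n. of_real (x $ i)) = (\<lambda>x. of_real (axis j 1 $ i))" for j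
    using partial_deriv_eq[OF hd] by auto
  have "\<exists>r B. \<forall>x. cmod (iter_partial is (\<lambda>x. of_real (x $ i)) x) \<le> B * wt r x" for "is" :: "'n list"
  proof (cases "is" rule: rev_cases)
    case Nil
    have "\<bar>x $ i\<bar> \<le> 1 * wt 1 x" for x :: "real^'n"
      using component_le_norm_cart[of x i] by (simp add: wt_def)
    then show ?thesis using Nil by (intro exI[of _ 1]) auto
  next
    case (snoc ys y)
    then show ?thesis
      using slow_const[of "of_real (axis y 1 $ i)" , where ?'a = 'n] unfolding slow_def
      by (subst snoc) (simp only: iter_partial_append iter_partial_simps pd)
  qed
  then show ?thesis by (auto simp: slow_def smooth_coord)
qed

lemma slow_mult:
  assumes "slow f" "slow g" shows "slow (\<lambda>x. f x * g x)"
proof -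
  have "\<exists>r B. \<forall>x. cmod (iter_partial is (\<lambda>x. f x * g x) x) \<le> B * wt r x" for "is"
  proof -
    obtain r B where 1: "B \<ge> 0" "r \<ge> 0" "\<And>js x. length js \<le> length is \<Longrightarrow> cmod (iter_partial js f x) \<le> B * wt r x"
      using slow_bound[OF assms(1)] by metis
    obtain t A where 2: "A \<ge> 0" "t \<ge> 0" "\<And>js x. length js \<le> length is \<Longrightarrow> cmod (iter_partial js g x) \<le> A * wt t x"
      using slow_bound[OF assms(2)] by metis
    have "cmod (iter_partial is (\<lambda>x. f x * g x) x) \<le> 2 ^ length is * (B * wt r x) * (A * wt t x)" for x
      using assms 1 2 by (intro leibniz_bound) (auto simp: slow_def)
    then have "cmod (iter_partial is (\<lambda>x. f x * g x) x) \<le> (2 ^ length is * B * A) * wt (r + t) x" for x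
      by (simp add: mult_ac wt_mult[symmetric])
    then show ?thesis by blast
  qed
  then show ?thesis using assms by (auto simp: slow_def smooth_mult)
qed

lemma schwartz_cmult: "g \<in> schwartz \<Longrightarrow> (\<lambda>x. c * g x) \<in> schwartz"
  by (intro slow_mult_schwartz slow_const)

lemma schwartz_diff: "f \<in> schwartz \<Longrightarrow> g \<in> schwartz \<Longrightarrow> (\<lambda>x. f x - g x) \<in> schwartz"
  using schwartz_add[of f "\<lambda>x. (-1) * g x"] schwartz_cmult[of g "-1"] by simp

lemma schwartz_zero: "(\<lambda>x. 0) \<in> schwartz"
proof -
  have "\<exists>B. \<forall>x. cmod (iter_partial is (\<lambda>x. 0) x) \<le> B * wt r x" for r and "is" :: "'a list"
    by (rule exI[of _ 0]) simp
  then show ?thesis unfolding schwartz_iff by (simp add: smooth_const)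
qed

lemma schwartz_sum: "(\<And>a. a \<in> A \<Longrightarrow> f a \<in> schwartz) \<Longrightarrow> (\<lambda>x. \<Sum>a\<in>A. f a x) \<in> schwartz"
  by (induction A rule: infinite_finite_induct) (auto intro: schwartz_zero schwartz_add)

lemma schwartz_affine:
  assumes "f \<in> schwartz" "a \<noteq> 0" shows "(\<lambda>x. f (a *\<^sub>R x + b)) \<in> schwartz"
  unfolding schwartz_iff
proof safe
  show "smooth (\<lambda>x. f (a *\<^sub>R x + b))" using assms by (intro smooth_affine schwartz_smooth)
  fix r :: real and "is"
  define c where "c = max (\<bar>a\<bar> powr r) 1 * max (\<bar>1/a\<bar> powr (-r)) 1"
  obtain A where A: "A \<ge> 0" "\<And>x. cmod (iter_partial is f x) \<le> A * wt (-\<bar>r\<bar>) x" using schwartz_bound[OF assms(1)] by metis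
  \<comment> \<open>The least convenient constant with 1 + |x| <= M (1 + |a x|), which turns decay
    in \<open>a x\<close> into decay in \<open>x\<close>.\<close>
  define M where "M = 1 + \<bar>1/a\<bar>"
  have *: "wt (-\<bar>r\<bar>) (a *\<^sub>R x + b) \<le> M powr \<bar>r\<bar> * wt \<bar>r\<bar> b * wt r x" for x
  proof -
    have "wt (-\<bar>r\<bar>) (a *\<^sub>R x + b) \<le> wt (-\<bar>r\<bar>) (a *\<^sub>R x) * wt \<bar>r\<bar> b" using wt_peetre[of "-\<bar>r\<bar>"] by simp
    moreover have "wt (-\<bar>r\<bar>) (a *\<^sub>R x) \<le> M powr \<bar>r\<bar> * wt (-\<bar>r\<bar>) x"
    proof -
      have "1 + norm x \<le> M * (1 + norm (a *\<^sub>R x))"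
        unfolding M_def using assms(2) by (simp add: field_simps)
      then have "(1 + norm x) powr \<bar>r\<bar> \<le> (M * (1 + norm (a *\<^sub>R x))) powr \<bar>r\<bar>"
        by (intro powr_mono2) auto
      then have "(1 + norm x) powr \<bar>r\<bar> \<le> M powr \<bar>r\<bar> * (1 + norm (a *\<^sub>R x)) powr \<bar>r\<bar>"
        by (subst (asm) powr_mult) (auto simp: M_def)
      moreover have "(1 + norm x) powr \<bar>r\<bar> > 0" "(1 + norm (a *\<^sub>R x)) powr \<bar>r\<bar> > 0"
        using wt_pos[of "\<bar>r\<bar>"] unfolding wt_def by blast+
      ultimately show ?thesis unfolding wt_def powr_minus by (simp add: field_simps)
    qed
    moreover have "wt (-\<bar>r\<bar>) x \<le> wt r x" by (intro wt_mono) auto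
    ultimately show ?thesis
      by (smt (verit, ccfv_SIG) mult.assoc mult.commute mult_left_mono powr_ge_zero wt_nonneg)
  qed
  have "cmod (iter_partial is (\<lambda>x. f (a *\<^sub>R x + b)) x) \<le> (\<bar>a\<bar> ^ length is * (A * (M powr \<bar>r\<bar> * wt \<bar>r\<bar> b))) * wt r x" for x
  proof -
    have "cmod (iter_partial is (\<lambda>x. f (a *\<^sub>R x + b)) x) = \<bar>a\<bar> ^ length is * cmod (iter_partial is f (a *\<^sub>R x + b))"
      using assms by (simp add: iter_partial_affine schwartz_smooth norm_mult norm_power)
    also have "\<dots> \<le> \<bar>a\<bar> ^ length is * (A * (M powr \<bar>r\<bar> * wt \<bar>r\<bar> b * wt r x))"
      using A(2)[of "a *\<^sub>R x + b"] mult_left_mono[OF *[of x] A(1)] by (intro mult_left_mono) auto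
    finally show ?thesis by (simp add: mult_ac)
  qed
  then show "\<exists>B. \<forall>x. cmod (iter_partial is (\<lambda>x. f (a *\<^sub>R x + b)) x) \<le> B * wt r x" by blast
qed

lemma schwartz_uminus: "f \<in> schwartz \<Longrightarrow> (\<lambda>x. f (- x)) \<in> schwartz"
  using schwartz_affine[of f "-1" 0] by simp

section \<open>Test functions\<close>

lemma iter_partial_outside_support:
  assumes "x \<notin> fun_support f" shows "iter_partial is f x = 0"
proof (rule iter_partial_zero_on_open[of "- fun_support f"])
  show "open (- fun_support f)" by (simp add: fun_support_def open_Compl)
  show "f y = 0" if "y \<in> - fun_support f" for y
    using that closure_subset[of "{x. f x \<noteq> 0}"] by (auto simp: fun_support_def)
qed (use assms in auto)

lemma test_schwartz:
  assumes "f \<in> test_functions" shows "f \<in> schwartz"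
  unfolding schwartz_iff
proof safe
  show sm: "smooth f" using assms by (simp add: test_functions_def)
  fix r :: real and "is" :: "'a list"
  have K: "compact (fun_support f)" using assms by (simp add: test_functions_def)
  have "compact ((\<lambda>x. cmod (iter_partial is f x) * wt (-r) x) ` fun_support f)"
    by (intro compact_continuous_image K continuous_intros smooth_continuous smooth_iter_partial sm wt_continuous)
  then have "bounded ((\<lambda>x. cmod (iter_partial is f x) * wt (-r) x) ` fun_support f)" by (rule compact_imp_bounded)
  then obtain B where B: "\<And>x. x \<in> fun_support f \<Longrightarrow> \<bar>cmod (iter_partial is f x) * wt (-r) x\<bar> \<le> B"
    unfolding bounded_iff by auto
  have "cmod (iter_partial is f x) \<le> max B 0 * wt r x" for x
  proof (cases "x \<in> fun_support f")
    case True
    have "cmod (iter_partial is f x) = (cmod (iter_partial is f x) * wt (-r) x) * wt r x"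
      by (simp add: mult.assoc wt_mult)
    also have "\<dots> \<le> max B 0 * wt r x" using B[OF True] by (intro mult_right_mono) auto
    finally show ?thesis .
  next
    case False
    then show ?thesis by (simp add: iter_partial_outside_support)
  qed
  then show "\<exists>B. \<forall>x. cmod (iter_partial is f x) \<le> B * wt r x" by blast
qed

subsection \<open>Integration on Euclidean space\<close>

lemma integral_lborel_affine:
  fixes f :: "'a::euclidean_space \<Rightarrow> complex"
  assumes [measurable]: "f \<in> borel_measurable borel" and c: "c \<noteq> 0"
  shows "(\<integral>x. f x \<partial>lborel) = of_real (\<bar>c\<bar> ^ DIM('a)) * (\<integral>x. f (t + c *\<^sub>R x) \<partial>lborel)"
  by (subst lborel_affine[OF c, of t], subst integral_density) (auto simp: integral_distr scaleR_conv_of_real)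

lemma nn_integral_lborel_affine:
  fixes f :: "'a::euclidean_space \<Rightarrow> ennreal"
  assumes [measurable]: "f \<in> borel_measurable borel" and c: "c \<noteq> 0"
  shows "(\<integral>\<^sup>+x. f x \<partial>lborel) = ennreal (\<bar>c\<bar> ^ DIM('a)) * (\<integral>\<^sup>+x. f (t + c *\<^sub>R x) \<partial>lborel)"
  by (subst lborel_affine[OF c, of t])
     (simp add: nn_integral_density nn_integral_distr nn_integral_cmult)

lemma integrable_lborel_affine:
  fixes f :: "'a::euclidean_space \<Rightarrow> 'b::{banach, second_countable_topology}"
  assumes f: "integrable lborel f" and c: "c \<noteq> 0"
  shows "integrable lborel (\<lambda>x. f (t + c *\<^sub>R x))"
proof -
  have [measurable]: "f \<in> borel_measurable borel" using f by auto
  have "ennreal (\<bar>c\<bar> ^ DIM('a)) * (\<integral>\<^sup>+x. ennreal (norm (f (t + c *\<^sub>R x))) \<partial>lborel) < \<infinity>"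
    using f by (subst nn_integral_lborel_affine[OF _ c, symmetric]) (auto simp: integrable_iff_bounded)
  moreover have "\<bar>c\<bar> ^ DIM('a) > 0" using c by simp
  ultimately have "(\<integral>\<^sup>+x. ennreal (norm (f (t + c *\<^sub>R x))) \<partial>lborel) < \<infinity>"
    by (auto simp: ennreal_mult_less_top)
  then show ?thesis by (auto simp: integrable_iff_bounded)
qed

text \<open>A dyadic decomposition: where 1 + |x| is about 2^k the weight is at most 2 powr (-a k),
  and this region lies in a ball of volume proportional to 2^((k + 1) N). The resulting geometric
  series has ratio \<open>q\<close> = 2 powr (N - a) < 1.\<close>

lemma wt_integrable:
  assumes "a > real DIM('a::euclidean_space)"
  shows "integrable lborel (wt (- a) :: 'a \<Rightarrow> real)"
proof (rule integrableI_nonneg)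
  define N where "N = DIM('a)"
  define V where "V = measure lborel (cball (0::'a) 1)"
  have ball: "emeasure lborel (cball (0::'a) r) = ennreal (r ^ N * V)" if "r > 0" for r
  proof -
    have "emeasure lborel (cball (0::'a) r) = (\<integral>\<^sup>+x. indicator (cball (0::'a) r) x \<partial>lborel)"
      by simp
    also have "\<dots> = ennreal (\<bar>r\<bar> ^ N) * (\<integral>\<^sup>+x. indicator (cball 0 r) (0 + r *\<^sub>R x :: 'a) \<partial>lborel)"
      unfolding N_def using that by (intro nn_integral_lborel_affine borel_measurable_indicator) auto
    also have "(\<lambda>x. indicator (cball 0 r) (0 + r *\<^sub>R x :: 'a) :: ennreal) = indicator (cball 0 1)"
      using that by (auto simp: fun_eq_iff indicator_def)
    also have "(\<integral>\<^sup>+x. indicator (cball (0::'a) 1) x \<partial>lborel) = ennreal V"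
      unfolding V_def using emeasure_lborel_cball_finite[of "0::'a" 1] by (simp add: emeasure_eq_ennreal_measure)
    finally show ?thesis using that by (simp add: ennreal_mult' [symmetric])
  qed
  have V: "V \<ge> 0" by (simp add: V_def)
  define q where "q = 2 powr (real N - a)"
  have q: "0 < q" "q < 1" using assms by (auto simp: q_def N_def powr_less_one)
  have le: "ennreal (wt (- a) x) \<le> (\<Sum>k. ennreal ((2 powr (- a)) ^ k) * indicator (cball 0 (2 ^ (k + 1))) x)" for x :: 'a
  proof -
    define k where "k = nat \<lfloor>log 2 (1 + norm x)\<rfloor>"
    have ge1: "1 + norm x \<ge> 1" "1 + norm x > 0" using norm_ge_zero[of x] by linarith+
    then have l0: "log 2 (1 + norm x) \<ge> 0" by (subst zero_le_log_cancel_iff) auto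
    then have "real k \<le> log 2 (1 + norm x)" "log 2 (1 + norm x) < real k + 1" unfolding k_def by linarith+
    then have 1: "2 powr real k \<le> 1 + norm x" "1 + norm x < 2 powr (real k + 1)"
      using ge1 by (auto simp: le_log_iff log_less_iff)
    then have n: "norm x \<le> 2 ^ (k + 1)" using powr_realpow[of 2 "k + 1"] by (simp add: add.commute)
    have "wt (- a) x \<le> (2 powr real k) powr (- a)"
      unfolding wt_def using 1 assms by (intro powr_mono2') auto
    also have "\<dots> = (2 powr (- a)) ^ k" by (simp add: powr_powr powr_realpow[symmetric] mult.commute)
    finally have "ennreal (wt (- a) x) \<le> ennreal ((2 powr (- a)) ^ k) * indicator (cball 0 (2 ^ (k + 1))) x"
      using n by (simp add: indicator_def ennreal_leI)
    also have "\<dots> \<le> (\<Sum>k. ennreal ((2 powr (- a)) ^ k) * indicator (cball 0 (2 ^ (k + 1))) x)"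
      using sum_le_suminf[of "\<lambda>k. ennreal ((2 powr (- a)) ^ k) * indicator (cball 0 (2 ^ (k + 1))) x" "{k}"]
      by (simp only: sum.insert[OF finite.emptyI] sum.empty empty_iff not_False_eq_True add_0_right) auto
    finally show ?thesis .
  qed
  have "(\<integral>\<^sup>+x. ennreal (wt (- a) (x::'a)) \<partial>lborel)
      \<le> (\<integral>\<^sup>+x. (\<Sum>k. ennreal ((2 powr (- a)) ^ k) * indicator (cball 0 (2 ^ (k + 1))) (x::'a)) \<partial>lborel)"
    by (intro nn_integral_mono le)
  also have "\<dots> = (\<Sum>k. \<integral>\<^sup>+x. ennreal ((2 powr (- a)) ^ k) * indicator (cball 0 (2 ^ (k + 1))) (x::'a) \<partial>lborel)"
    by (rule nn_integral_suminf, rule borel_measurable_times_ennreal[OF borel_measurable_const borel_measurable_indicator])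
       (simp only: sets_lborel borel_closed closed_cball)
  also have "\<dots> = (\<Sum>k. ennreal (V * 2 ^ N * q ^ k))"
  proof (rule suminf_cong)
    fix k
    have "(\<integral>\<^sup>+x. ennreal ((2 powr (- a)) ^ k) * indicator (cball 0 (2 ^ (k + 1))) (x::'a) \<partial>lborel)
       = ennreal ((2 powr (- a)) ^ k) * ennreal ((2 ^ (k + 1)) ^ N * V)"
      by (subst nn_integral_cmult_indicator) (simp_all only: sets_lborel borel_closed closed_cball ball zero_less_power zero_less_numeral)
    also have "\<dots> = ennreal ((2 powr (- a)) ^ k * ((2 ^ (k + 1)) ^ N * V))"
      using V by (intro ennreal_mult'[symmetric]) simp
    also have "(2 powr (- a)) ^ k * ((2 ^ (k + 1)) ^ N * V) = V * 2 ^ N * q ^ k"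
    proof -
      have 1: "(2 powr (- a)) ^ k = 2 powr (- a * real k)"
        by (simp add: powr_realpow[symmetric] powr_powr)
      have 2: "(2 ^ (k + 1)) ^ N = (2::real) powr (real N * real k + real N)"
      proof -
        have "(2 ^ (k + 1)) ^ N = (2::real) powr (real ((k + 1) * N))"
          by (simp only: power_mult[symmetric] powr_realpow[OF zero_less_numeral])
        also have "real ((k + 1) * N) = real N * real k + real N" by (simp add: algebra_simps)
        finally show ?thesis .
      qed
      have 3: "2 ^ N * q ^ k = 2 powr (real N + (real N - a) * real k)"
        by (simp add: q_def powr_add powr_realpow[symmetric] powr_powr)
      have "- a * real k + (real N * real k + real N) = real N + (real N - a) * real k"
        by (simp add: algebra_simps)
      then have "(2 powr (- a)) ^ k * (2 ^ (k + 1)) ^ N = 2 ^ N * q ^ k"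
        unfolding 1 2 3 by (simp only: powr_add[symmetric])
      then show ?thesis by (simp add: mult_ac)
    qed
    finally show "(\<integral>\<^sup>+x. ennreal ((2 powr (- a)) ^ k) * indicator (cball 0 (2 ^ (k + 1))) (x::'a) \<partial>lborel)
       = ennreal (V * 2 ^ N * q ^ k)" .
  qed
  also have "\<dots> < \<infinity>"
  proof -
    have "(\<Sum>k. ennreal (V * 2 ^ N * q ^ k)) \<noteq> top"
      by (rule ennreal_suminf_neq_top) (use q V in \<open>auto intro!: summable_mult summable_geometric\<close>)
    then show ?thesis by (simp add: top.not_eq_extremum)
  qed
  finally show "(\<integral>\<^sup>+x. ennreal (wt (- a) (x::'a)) \<partial>lborel) < \<infinity>" .
qed auto

lemma wt_integrable_cart:
  assumes "a > real CARD('n)"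
  shows "integrable lborel (wt (- a) :: real^'n::finite \<Rightarrow> real)"
  using wt_integrable[where 'a="real^'n"] assms by simp

lemma integrable_bound_real:
  fixes f :: "'a \<Rightarrow> 'b::{banach, second_countable_topology}"
  assumes "integrable M g" "f \<in> borel_measurable M" "\<And>x. norm (f x) \<le> g x"
  shows "integrable M f"
  by (rule Bochner_Integration.integrable_bound[OF assms(1,2)])
     (use order_trans[OF assms(3) abs_ge_self] in auto)

lemma integral_bound_real:
  fixes f :: "'a \<Rightarrow> 'b::{banach, second_countable_topology}"
  assumes "integrable M g" "f \<in> borel_measurable M" "\<And>x. norm (f x) \<le> g x"
  shows "norm (integral\<^sup>L M f) \<le> integral\<^sup>L M g"
proof -
  have "norm (integral\<^sup>L M f) \<le> (\<integral>x. norm (f x) \<partial>M)" by (rule integral_norm_bound)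
  also have "\<dots> \<le> integral\<^sup>L M g"
    using assms integrable_bound_real[OF assms] by (intro integral_mono) auto
  finally show ?thesis .
qed

section \<open>Differentiation under the integral sign\<close>

text \<open>By the mean value inequality on the ball the increment is bounded by
  \<open>G y * norm h\<close>, and the linear term is bounded likewise. The normalised remainder is
  therefore dominated by \<open>2 * G\<close>, and dominated convergence applies along every
  sequence tending to 0.\<close>

lemma has_derivative_integral:
  fixes F :: "'a::euclidean_space \<Rightarrow> 'b \<Rightarrow> complex"
  assumes r: "r > 0"
    and der: "\<And>x y. x \<in> ball x0 r \<Longrightarrow> ((\<lambda>x. F x y) has_derivative D x y) (at x)"
    and bound: "\<And>x y h. x \<in> ball x0 r \<Longrightarrow> norm (D x y h) \<le> G y * norm h"
    and G: "integrable M G"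
    and F: "\<And>x. x \<in> ball x0 r \<Longrightarrow> integrable M (F x)"
    and D: "\<And>h. (\<lambda>y. D x0 y h) \<in> borel_measurable M"
  shows "((\<lambda>x. \<integral>y. F x y \<partial>M) has_derivative (\<lambda>h. \<integral>y. D x0 y h \<partial>M)) (at x0)"
proof -
  have x0: "x0 \<in> ball x0 r" using r by simp
  have Di: "integrable M (\<lambda>y. D x0 y h)" for h
    by (rule integrable_bound_real[OF _ D bound[OF x0]]) (use G in auto)
  have linD: "linear (D x0 y)" for y using der[OF x0] has_derivative_linear by blast
  have bl: "bounded_linear (\<lambda>h. \<integral>y. D x0 y h \<partial>M)"
  proof (rule bounded_linear_intro[where K="integral\<^sup>L M G"])
    fix h k :: 'a and c :: real
    show "(\<integral>y. D x0 y (h + k) \<partial>M) = (\<integral>y. D x0 y h \<partial>M) + (\<integral>y. D x0 y k \<partial>M)"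
      using Di by (simp add: linear_add[OF linD])
    show "(\<integral>y. D x0 y (c *\<^sub>R h) \<partial>M) = c *\<^sub>R (\<integral>y. D x0 y h \<partial>M)"
      using Di by (simp add: linear_cmul[OF linD])
    show "norm (\<integral>y. D x0 y h \<partial>M) \<le> norm h * integral\<^sup>L M G"
      using integral_bound_real[OF _ D bound[OF x0], of h] G by (simp add: mult.commute)
  qed
  have mvt: "norm (F (x0 + h) y - F x0 y) \<le> G y * norm h" if "norm h < r" for h y
  proof -
    have "norm (F (x0 + h) y - F x0 y) \<le> G y * norm (x0 + h - x0)"
    proof (rule differentiable_bound[of "ball x0 r" "\<lambda>x. F x y" "\<lambda>x. D x y"])
      show "onorm (D x y) \<le> G y" if "x \<in> ball x0 r" for x
        using bound[OF that] by (rule onorm_le)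
    qed (use that r der in \<open>auto simp: dist_norm intro: has_derivative_at_withinI\<close>)
    then show ?thesis by simp
  qed
  have "(\<lambda>h. norm ((\<integral>y. F (x0 + h) y \<partial>M) - (\<integral>y. F x0 y \<partial>M) - (\<integral>y. D x0 y h \<partial>M)) / norm h) \<midarrow>0\<rightarrow> 0"
    unfolding tendsto_at_iff_sequentially
  proof safe
    fix X :: "nat \<Rightarrow> 'a" assume X: "\<forall>i. X i \<in> UNIV - {0}" "X \<longlonglongrightarrow> 0"
    have ev: "\<forall>\<^sub>F n in sequentially. norm (X n) < r"
      using tendstoD[OF X(2) r] by (simp add: dist_norm)
    then obtain n0 where n0: "\<And>n. norm (X (n + n0)) < r"
      by (meson eventually_sequentially le_add2)
    \<comment> \<open>Only a tail of the sequence stays in the ball. Dropping the first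
      \<open>n0\<close> terms makes the domination hold for every index.\<close>
    define Y where "Y n = X (n + n0)" for n
    have Y: "norm (Y n) < r" "Y n \<noteq> 0" for n using n0 X by (auto simp: Y_def)
    have Y0: "Y \<longlonglongrightarrow> 0" unfolding Y_def by (rule LIMSEQ_ignore_initial_segment[OF X(2)])
    define s where "s n y = (F (x0 + Y n) y - F x0 y - D x0 y (Y n)) /\<^sub>R norm (Y n)" for n y
    have Fb: "x0 + Y n \<in> ball x0 r" for n using Y by (simp add: dist_norm)
    have "(\<lambda>n. integral\<^sup>L M (s n)) \<longlonglongrightarrow> integral\<^sup>L M (\<lambda>y. 0)"
    proof (rule integral_dominated_convergence[where w="\<lambda>y. 2 * G y"])
      show "s n \<in> borel_measurable M" for n
        unfolding s_def using F[OF Fb] F[OF x0] Di by (intro borel_measurable_integrable) auto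
      show "AE y in M. (\<lambda>n. s n y) \<longlonglongrightarrow> 0"
      proof (rule AE_I2)
        fix y
        have "(\<lambda>h. norm (F (x0 + h) y - F x0 y - D x0 y h) / norm h) \<midarrow>0\<rightarrow> 0"
          using der[OF x0, of y] unfolding has_derivative_at by (rule conjunct2)
        then have "((\<lambda>h. norm (F (x0 + h) y - F x0 y - D x0 y h) / norm h) \<circ> Y) \<longlonglongrightarrow> 0"
          unfolding tendsto_at_iff_sequentially using Y Y0 by auto
        then show "(\<lambda>n. s n y) \<longlonglongrightarrow> 0"
          by (subst tendsto_norm_zero_iff[symmetric]) (simp add: s_def o_def divide_inverse mult.commute)
      qed
      show "AE y in M. norm (s n y) \<le> 2 * G y" for n
      proof (rule AE_I2)
        fix y
        have "norm (F (x0 + Y n) y - F x0 y - D x0 y (Y n)) \<le> G y * norm (Y n) + G y * norm (Y n)"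
          using mvt[OF Y(1)[of n], of y] bound[OF x0, of y "Y n"] norm_triangle_ineq4 by (smt (verit))
        moreover have "norm (s n y) = norm (F (x0 + Y n) y - F x0 y - D x0 y (Y n)) / norm (Y n)"
          by (simp add: s_def divide_inverse mult.commute)
        ultimately show "norm (s n y) \<le> 2 * G y" using Y(2)[of n] by (simp add: divide_le_eq)
      qed
    qed (use G in auto)
    then have lim: "(\<lambda>n. norm (integral\<^sup>L M (s n))) \<longlonglongrightarrow> 0" by (simp add: tendsto_norm_zero_iff)
    have eq: "norm (integral\<^sup>L M (s n)) = norm ((\<integral>y. F (x0 + Y n) y \<partial>M) - (\<integral>y. F x0 y \<partial>M) - (\<integral>y. D x0 y (Y n) \<partial>M)) / norm (Y n)" for n
    proof -
      have "integral\<^sup>L M (s n) = ((\<integral>y. F (x0 + Y n) y \<partial>M) - (\<integral>y. F x0 y \<partial>M) - (\<integral>y. D x0 y (Y n) \<partial>M)) /\<^sub>R norm (Y n)"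
        unfolding s_def using F[OF Fb] F[OF x0] Di by simp
      then show ?thesis by (simp add: divide_inverse mult.commute)
    qed
    show "((\<lambda>h. norm ((\<integral>y. F (x0 + h) y \<partial>M) - (\<integral>y. F x0 y \<partial>M) - (\<integral>y. D x0 y h \<partial>M)) / norm h) \<circ> X) \<longlonglongrightarrow> 0"
      by (rule LIMSEQ_offset[of _ n0]) (use lim in \<open>simp only: o_def eq Y_def\<close>)
  qed
  with bl show ?thesis unfolding has_derivative_at by (rule conjI)
qed

subsection \<open>Correlations\<close>

text \<open>The inner pairing of \<open>distr_conv\<close>: the value of the distribution given by
  \<open>g\<close> at the translate of \<open>f\<close>. It is also the convolution of
  \<open>f\<close> with the reflection of \<open>g\<close>.\<close>

definition corr :: "(real^'n \<Rightarrow> complex) \<Rightarrow> (real^'n \<Rightarrow> complex) \<Rightarrow> real^'n::finite \<Rightarrow> complex" where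
  "corr g f y = (\<integral>x. g x * f (x + y) \<partial>lborel)"

text \<open>One condition for two opposite situations: \<open>g\<close> of polynomial growth with
  \<open>f\<close> Schwartz, and \<open>g\<close> rapidly decreasing with \<open>f\<close> slowly
  increasing. It is stable under differentiation of \<open>f\<close>.\<close>

definition dom :: "(real^'n::finite \<Rightarrow> complex) \<Rightarrow> (real^'n \<Rightarrow> complex) \<Rightarrow> bool" where
  "dom g f \<longleftrightarrow> smooth f \<and> g \<in> borel_measurable borel \<and>
     (\<forall>is. \<exists>r B. B \<ge> 0 \<and> (\<forall>x. cmod (iter_partial is f x) \<le> B * wt r x) \<and> integrable lborel (\<lambda>x. cmod (g x) * wt r x))"

lemma dom_iter_partial: "dom g f \<Longrightarrow> dom g (iter_partial js f)"
  unfolding dom_def by (simp add: smooth_iter_partial iter_partial_append[symmetric])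

lemma dom_partial_deriv: "dom g f \<Longrightarrow> dom g (partial_deriv i f)"
  using dom_iter_partial[of g f "[i]"] by simp

lemma measurable_shift [measurable]:
  "f \<in> borel_measurable borel \<Longrightarrow> (\<lambda>x::'a::euclidean_space. f (x + y) :: complex) \<in> borel_measurable borel"
  by (rule measurable_compose[of "\<lambda>x. x + y"]) auto

lemma wt_shift: "wt r (x + y) \<le> wt r x * wt \<bar>r\<bar> y" by (rule wt_peetre)

lemma corr_bound:
  assumes "smooth f" "g \<in> borel_measurable borel"
    "\<And>x. cmod (f x) \<le> B * wt r x" "integrable lborel (\<lambda>x. cmod (g x) * wt r x)"
  shows "integrable lborel (\<lambda>x. g x * f (x + y))"
    "cmod (corr g f y) \<le> B * wt \<bar>r\<bar> y * (\<integral>x. cmod (g x) * wt r x \<partial>lborel)"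
proof -
  have B: "B \<ge> 0"
    using order_trans[OF norm_ge_zero assms(3)[of 0]] by simp
  have [measurable]: "f \<in> borel_measurable borel" "g \<in> borel_measurable borel" using assms smooth_borel by auto
  have le: "norm (g x * f (x + y)) \<le> (B * wt \<bar>r\<bar> y) * (cmod (g x) * wt r x)" for x
  proof -
    have "norm (g x * f (x + y)) \<le> cmod (g x) * (B * wt r (x + y))"
      unfolding norm_mult using assms(3) by (intro mult_left_mono) auto
    also have "\<dots> \<le> cmod (g x) * (B * (wt r x * wt \<bar>r\<bar> y))"
      using B by (intro mult_left_mono wt_shift) auto
    finally show ?thesis by (simp add: mult_ac)
  qed
  have i: "integrable lborel (\<lambda>x. (B * wt \<bar>r\<bar> y) * (cmod (g x) * wt r x))" using assms by simp
  show "integrable lborel (\<lambda>x. g x * f (x + y))"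
    by (rule integrable_bound_real[OF i _ le]) measurable
  show "cmod (corr g f y) \<le> B * wt \<bar>r\<bar> y * (\<integral>x. cmod (g x) * wt r x \<partial>lborel)"
    unfolding corr_def using integral_bound_real[OF i _ le] by simp
qed

text \<open>Peetre's inequality is used the other way round than in \<open>corr_bound\<close>: the
  weight of \<open>f\<close> survives in the variable \<open>y\<close>, and \<open>g\<close> has to
  absorb the weight of exponent \<bar>r\<bar>.\<close>

lemma corr_decay:
  assumes "f \<in> borel_measurable borel" "g \<in> borel_measurable borel"
    "\<And>x. cmod (f x) \<le> B * wt r x" "integrable lborel (\<lambda>x. cmod (g x) * wt \<bar>r\<bar> x)"
  shows "integrable lborel (\<lambda>x. g x * f (x + y))"
    "cmod (corr g f y) \<le> B * (\<integral>x. cmod (g x) * wt \<bar>r\<bar> x \<partial>lborel) * wt r y"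
proof -
  have B: "B \<ge> 0"
    using order_trans[OF norm_ge_zero assms(3)[of 0]] by simp
  have [measurable]: "f \<in> borel_measurable borel" "g \<in> borel_measurable borel" using assms by auto
  have le: "norm (g x * f (x + y)) \<le> (B * wt r y) * (cmod (g x) * wt \<bar>r\<bar> x)" for x
  proof -
    have "norm (g x * f (x + y)) \<le> cmod (g x) * (B * wt r (y + x))"
      unfolding norm_mult using assms(3) by (intro mult_left_mono) (auto simp: add.commute)
    also have "\<dots> \<le> cmod (g x) * (B * (wt r y * wt \<bar>r\<bar> x))"
      using B by (intro mult_left_mono wt_shift) auto
    finally show ?thesis by (simp add: mult_ac)
  qed
  have i: "integrable lborel (\<lambda>x. (B * wt r y) * (cmod (g x) * wt \<bar>r\<bar> x))" using assms by simp
  show "integrable lborel (\<lambda>x. g x * f (x + y))"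
    by (rule integrable_bound_real[OF i _ le]) measurable
  show "cmod (corr g f y) \<le> B * (\<integral>x. cmod (g x) * wt \<bar>r\<bar> x \<partial>lborel) * wt r y"
  proof -
    have "(\<lambda>x. g x * f (x + y)) \<in> borel_measurable lborel" by measurable
    from integral_bound_real[OF i this le] show ?thesis
      unfolding corr_def integral_mult_right_zero by (simp only: mult_ac)
  qed
qed

lemma dom_integrable:
  assumes "dom g f" shows "integrable lborel (\<lambda>x. g x * f (x + y))"
proof -
  obtain r B where "B \<ge> 0" "\<And>x. cmod (iter_partial [] f x) \<le> B * wt r x" "integrable lborel (\<lambda>x. cmod (g x) * wt r x)"
    using assms unfolding dom_def by meson
  then show ?thesis using assms by (intro corr_bound(1)[where B=B and r=r]) (auto simp: dom_def)
qed

lemma corr_has_derivative: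
  fixes f g :: "real^'n::finite \<Rightarrow> complex"
  assumes d: "dom g f"
  shows "(corr g f has_derivative (\<lambda>h. \<Sum>i\<in>UNIV. of_real (h $ i) * corr g (partial_deriv i f) y)) (at y)"
proof -
  have sm: "smooth f" using d by (simp add: dom_def)
  have [measurable]: "g \<in> borel_measurable borel" "partial_deriv i f \<in> borel_measurable borel" for i
    using d smooth_borel[OF smooth_partial_deriv[OF sm]] by (auto simp: dom_def)
  have "\<exists>r B. B \<ge> 0 \<and> (\<forall>x. cmod (partial_deriv i f x) \<le> B * wt r x) \<and> integrable lborel (\<lambda>x. cmod (g x) * wt r x)" for i
    using d unfolding dom_def by (metis iter_partial_simps)
  then obtain r B where rB: "\<And>i. B i \<ge> 0" "\<And>i x. cmod (partial_deriv i f x) \<le> B i * wt (r i) x"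
     "\<And>i. integrable lborel (\<lambda>x. cmod (g x) * wt (r i) x)" by metis
  \<comment> \<open>\<open>axis i 1\<close> stands for a vector of norm one: its weight bounds that
    of \<open>y' - y\<close> for all \<open>y'\<close> in the unit ball around
    \<open>y\<close>.\<close>
  define G where "G x = (\<Sum>i\<in>UNIV. (B i * wt \<bar>r i\<bar> (y) * wt \<bar>r i\<bar> (axis i 1 :: real^'n)) * (cmod (g x) * wt (r i) x))" for x
  have "((\<lambda>y. \<integral>x. g x * f (x + y) \<partial>lborel) has_derivative
        (\<lambda>h. \<integral>x. g x * (\<Sum>i\<in>UNIV. of_real (h $ i) * partial_deriv i f (x + y)) \<partial>lborel)) (at y)"
  proof (rule has_derivative_integral[where r=1 and G=G and D="\<lambda>y x h. g x * (\<Sum>i\<in>UNIV. of_real (h $ i) * partial_deriv i f (x + y))"])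
    fix y' x assume y': "y' \<in> ball y 1"
    have "((\<lambda>y. f (x + y)) has_derivative (\<lambda>h. \<Sum>i\<in>UNIV. of_real (h $ i) * partial_deriv i f (x + y'))) (at y')"
      by (rule has_derivative_compose[OF _ smooth_has_derivative[OF sm]]) (auto intro!: derivative_eq_intros)
    then show "((\<lambda>y. g x * f (x + y)) has_derivative (\<lambda>h. g x * (\<Sum>i\<in>UNIV. of_real (h $ i) * partial_deriv i f (x + y')))) (at y')"
      by (rule has_derivative_mult_right)
    fix h :: "real^'n"
    have "norm (g x * (\<Sum>i\<in>UNIV. of_real (h $ i) * partial_deriv i f (x + y'))) \<le>
       cmod (g x) * (\<Sum>i\<in>UNIV. norm h * (B i * (wt (r i) x * (wt \<bar>r i\<bar> y * wt \<bar>r i\<bar> (axis i 1 :: real^'n)))))"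
      unfolding norm_mult
    proof (intro mult_left_mono order_trans[OF norm_sum] sum_mono)
      fix i
      have "norm (y' - y) \<le> norm (axis i 1 :: real^'n)" using y' by (simp add: dist_norm norm_minus_commute)
      then have "wt \<bar>r i\<bar> (y' - y) \<le> wt \<bar>r i\<bar> (axis i 1 :: real^'n)"
        unfolding wt_def by (intro powr_mono2) auto
      then have 1: "wt \<bar>r i\<bar> y' \<le> wt \<bar>r i\<bar> y * wt \<bar>r i\<bar> (axis i 1 :: real^'n)"
        using wt_peetre[of "\<bar>r i\<bar>" y "y' - y"] mult_left_mono[of _ _ "wt \<bar>r i\<bar> y"]
        by (smt (verit) add_diff_cancel_left' diff_add_cancel add.commute wt_nonneg abs_idempotent)
      have "cmod (of_real (h $ i) * partial_deriv i f (x + y')) = \<bar>h $ i\<bar> * cmod (partial_deriv i f (x + y'))"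
        by (simp add: norm_mult)
      also have "\<dots> \<le> norm h * (B i * wt (r i) (x + y'))"
        using rB(2) component_le_norm_cart[of h i] by (intro mult_mono) auto
      also have "\<dots> \<le> norm h * (B i * (wt (r i) x * wt \<bar>r i\<bar> y'))"
        using rB(1) by (intro mult_left_mono wt_peetre) auto
      also have "\<dots> \<le> norm h * (B i * (wt (r i) x * (wt \<bar>r i\<bar> y * wt \<bar>r i\<bar> (axis i 1 :: real^'n))))"
        using rB(1) 1 by (intro mult_left_mono) auto
      finally show "cmod (of_real (h $ i) * partial_deriv i f (x + y')) \<le> norm h * (B i * (wt (r i) x * (wt \<bar>r i\<bar> y * wt \<bar>r i\<bar> (axis i 1 :: real^'n))))" .
    qed auto
    also have "\<dots> = G x * norm h"
      unfolding G_def sum_distrib_left sum_distrib_right by (intro sum.cong) (auto simp: mult_ac)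
    finally show "norm (g x * (\<Sum>i\<in>UNIV. of_real (h $ i) * partial_deriv i f (x + y'))) \<le> G x * norm h" .
  next
    show "integrable lborel G" unfolding G_def using rB by (intro Bochner_Integration.integrable_sum integrable_mult_right) auto
    show "integrable lborel (\<lambda>x. g x * f (x + y'))" for y' using d by (rule dom_integrable)
  qed auto
  also have "(\<lambda>y. \<integral>x. g x * f (x + y) \<partial>lborel) = corr g f" by (auto simp: corr_def)
  also have "(\<lambda>h. \<integral>x. g x * (\<Sum>i\<in>UNIV. of_real (h $ i) * partial_deriv i f (x + y)) \<partial>lborel)
     = (\<lambda>h. \<Sum>i\<in>UNIV. of_real (h $ i) * corr g (partial_deriv i f) y)"
  proof
    fix h :: "real^'n"
    have "(\<integral>x. g x * (\<Sum>i\<in>UNIV. of_real (h $ i) * partial_deriv i f (x + y)) \<partial>lborel)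
       = (\<integral>x. (\<Sum>i\<in>UNIV. of_real (h $ i) * (g x * partial_deriv i f (x + y))) \<partial>lborel)"
      by (simp add: sum_distrib_left mult_ac)
    also have "\<dots> = (\<Sum>i\<in>UNIV. \<integral>x. of_real (h $ i) * (g x * partial_deriv i f (x + y)) \<partial>lborel)"
      by (intro Bochner_Integration.integral_sum integrable_mult_right dom_integrable dom_partial_deriv d)
    finally show "(\<integral>x. g x * (\<Sum>i\<in>UNIV. of_real (h $ i) * partial_deriv i f (x + y)) \<partial>lborel)
       = (\<Sum>i\<in>UNIV. of_real (h $ i) * corr g (partial_deriv i f) y)" by (simp add: corr_def)
  qed
  finally show ?thesis .
qed

lemma partial_deriv_corr:
  assumes "dom g f" shows "partial_deriv i (corr g f) = corr g (partial_deriv i f)"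
  using partial_deriv_eq[OF corr_has_derivative[OF assms]] by (auto simp: sum_axis)

lemma iter_partial_corr:
  assumes "dom g f" shows "iter_partial is (corr g f) = corr g (iter_partial is f)"
  by (induction "is") (auto simp: partial_deriv_corr dom_iter_partial assms)

lemma smooth_corr:
  assumes "dom g f" shows "smooth (corr g f)"
proof (rule smooth_coinduct[where C="{corr g f | f. dom g f}"])
  fix h x i assume "h \<in> {corr g f | f. dom g f}"
  then obtain f where f: "h = corr g f" "dom g f" by auto
  show "h differentiable at x" using corr_has_derivative[OF f(2)] f(1) by (auto simp: differentiable_def)
  show "partial_deriv i h \<in> {corr g f | f. dom g f}"
    unfolding f(1) partial_deriv_corr[OF f(2)]
    by (intro CollectI exI[of _ "partial_deriv i f"] conjI refl dom_partial_deriv[OF f(2)])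
next
  show "corr g f \<in> {corr g f | f. dom g f}"
    by (intro CollectI exI[of _ f] conjI refl assms)
qed

section \<open>Rapidly decreasing functions\<close>

text \<open>Decay as in the Schwartz space but without smoothness, as required for the truncated
  spline kernel, which is singular at the origin.\<close>

definition rapid :: "(real^'n::finite \<Rightarrow> complex) \<Rightarrow> bool" where
  "rapid g \<longleftrightarrow> g \<in> borel_measurable borel \<and> (\<forall>r. \<exists>B. \<forall>x. cmod (g x) \<le> B * wt r x)"

lemma rapid_borel: "rapid g \<Longrightarrow> g \<in> borel_measurable borel" by (simp add: rapid_def)

lemma rapid_bound:
  assumes "rapid g"
  obtains B where "B \<ge> 0" "\<And>x. cmod (g x) \<le> B * wt r x"
proof -
  obtain B where B: "\<And>x. cmod (g x) \<le> B * wt r x" using assms unfolding rapid_def by blast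
  have "B \<ge> 0" using order_trans[OF norm_ge_zero B[of 0]] by simp
  then show thesis using that B by blast
qed

lemma schwartz_rapid: "f \<in> schwartz \<Longrightarrow> rapid f"
proof -
  assume f: "f \<in> schwartz"
  then have "\<exists>B. \<forall>x. cmod (f x) \<le> B * wt r x" for r using schwartz_bound0 by meson
  then show "rapid f" using f by (simp add: rapid_def smooth_borel schwartz_smooth)
qed

lemma rapid_integrable_wt:
  fixes g :: "real^'n::finite \<Rightarrow> complex"
  assumes "rapid g" shows "integrable lborel (\<lambda>x. cmod (g x) * wt r x)"
proof -
  have [measurable]: "g \<in> borel_measurable borel" using assms by (rule rapid_borel)
  obtain B where B: "\<And>x. cmod (g x) \<le> B * wt (- r - real CARD('n) - 1) x" using rapid_bound[OF assms] by metis
  show ?thesis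
  proof (rule integrable_bound_real[where g="\<lambda>x. B * wt (- (real CARD('n) + 1)) x"])
    show "integrable lborel (\<lambda>x. B * wt (- (real CARD('n) + 1)) (x :: real^'n))"
      by (intro integrable_mult_right wt_integrable_cart) auto
    fix x
    have "norm (cmod (g x) * wt r x) \<le> (B * wt (- r - real CARD('n) - 1) x) * wt r x"
      using B by (auto intro!: mult_right_mono)
    also have "\<dots> = B * wt (- (real CARD('n) + 1)) x" by (simp add: mult.assoc wt_mult)
    finally show "norm (cmod (g x) * wt r x) \<le> B * wt (- (real CARD('n) + 1)) x" .
  qed measurable
qed

lemma rapid_integrable: "rapid g \<Longrightarrow> integrable lborel g"
  using rapid_integrable_wt[of g 0] rapid_borel[of g] by (simp add: integrable_norm_iff)

lemma schwartz_integrable: "f \<in> schwartz \<Longrightarrow> integrable lborel f"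
  by (intro rapid_integrable schwartz_rapid)

text \<open>One weight of exponent -m - N - 1 serves all derivatives: it makes \<open>g\<close>
  integrable, and every derivative of a Schwartz function is bounded by it.\<close>

lemma dom_poly_schwartz:
  fixes g :: "real^'n::finite \<Rightarrow> complex"
  assumes "g \<in> borel_measurable borel" "\<And>x. cmod (g x) \<le> C * wt m x" "f \<in> schwartz"
  shows "dom g f" and "integrable lborel (\<lambda>x. cmod (g x) * wt (- m - real CARD('n) - 1) x)"
proof -
  have [measurable]: "g \<in> borel_measurable borel" by fact
  show int: "integrable lborel (\<lambda>x. cmod (g x) * wt (- m - real CARD('n) - 1) x)"
  proof (rule integrable_bound_real[where g="\<lambda>x. C * wt (- (real CARD('n) + 1)) x"])
    show "integrable lborel (\<lambda>x. C * wt (- (real CARD('n) + 1)) (x :: real^'n))"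
      by (intro integrable_mult_right wt_integrable_cart) auto
    fix x
    have "norm (cmod (g x) * wt (- m - real CARD('n) - 1) x) \<le> (C * wt m x) * wt (- m - real CARD('n) - 1) x"
      using assms(2) by (auto intro!: mult_right_mono)
    also have "\<dots> = C * wt (- (real CARD('n) + 1)) x" by (simp add: mult.assoc wt_mult)
    finally show "norm (cmod (g x) * wt (- m - real CARD('n) - 1) x) \<le> C * wt (- (real CARD('n) + 1)) x" .
  qed measurable
  have "\<exists>r B. B \<ge> 0 \<and> (\<forall>x. cmod (iter_partial is f x) \<le> B * wt r x) \<and> integrable lborel (\<lambda>x. cmod (g x) * wt r x)" for "is"
    using int schwartz_bound[OF assms(3), of "is" "- m - real CARD('n) - 1"] by metis
  then show "dom g f" unfolding dom_def using assms schwartz_smooth by blast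
qed

lemma dom_rapid_slow:
  assumes "rapid g" "slow f"
  shows "dom g f"
proof -
  have "\<exists>r B. B \<ge> 0 \<and> (\<forall>x. cmod (iter_partial is f x) \<le> B * wt r x) \<and> integrable lborel (\<lambda>x. cmod (g x) * wt r x)" for "is"
    using slow_bound[OF assms(2), of "length is"] rapid_integrable_wt[OF assms(1)] by (metis order_refl)
  then show ?thesis using assms by (simp add: dom_def slow_def rapid_def)
qed

lemma schwartz_corr:
  assumes "rapid g" "f \<in> schwartz"
  shows "corr g f \<in> schwartz"
  unfolding schwartz_iff
proof safe
  have d: "dom g f" using assms by (intro dom_rapid_slow schwartz_slow)
  then show "smooth (corr g f)" by (rule smooth_corr)
  fix r "is"
  obtain B where "B \<ge> 0" "\<And>x. cmod (iter_partial is f x) \<le> B * wt r x" using schwartz_bound[OF assms(2)] by metis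
  then have "cmod (iter_partial is (corr g f) y) \<le> B * (\<integral>x. cmod (g x) * wt \<bar>r\<bar> x \<partial>lborel) * wt r y" for y
    unfolding iter_partial_corr[OF d]
    by (intro corr_decay(2) rapid_integrable_wt assms rapid_borel smooth_borel smooth_iter_partial schwartz_smooth)
  then show "\<exists>B. \<forall>x. cmod (iter_partial is (corr g f) x) \<le> B * wt r x" by blast
qed

lemma integral_shift:
  fixes f :: "'a::euclidean_space \<Rightarrow> complex"
  assumes "f \<in> borel_measurable borel"
  shows "(\<integral>x. f (x + y) \<partial>lborel) = (\<integral>x. f x \<partial>lborel)"
  using integral_lborel_affine[OF assms, of 1 y] by (simp add: add.commute)

lemma integral_reflect:
  fixes f :: "'a::euclidean_space \<Rightarrow> complex"
  assumes "f \<in> borel_measurable borel"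
  shows "(\<integral>x. f (y - x) \<partial>lborel) = (\<integral>x. f x \<partial>lborel)"
  using integral_lborel_affine[OF assms, of "-1" y] by simp

text \<open>By translation invariance the correlation of \<open>f\<close> with the constant 1 is
  constant in the shift; its derivative is the integral in question. This takes the place of
  integration by parts.\<close>

lemma integral_partial_deriv_zero:
  assumes "f \<in> schwartz"
  shows "(\<integral>x. partial_deriv i f x \<partial>lborel) = 0"
proof -
  have d: "dom (\<lambda>x. 1) f"
    by (rule dom_poly_schwartz(1)[where C=1 and m=0]) (use assms in auto)
  have "corr (\<lambda>x. 1) f = (\<lambda>y. \<integral>x. f x \<partial>lborel)"
    unfolding corr_def using integral_shift[OF smooth_borel[OF schwartz_smooth[OF assms]]] by auto
  with partial_deriv_corr[OF d, of i] have "corr (\<lambda>x. 1) (partial_deriv i f) = (\<lambda>x. 0)" by simp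
  then have "corr (\<lambda>x. 1) (partial_deriv i f) 0 = 0" by meson
  then show ?thesis by (simp add: corr_def)
qed

lemma fubini_swap:
  fixes F :: "'a::euclidean_space \<Rightarrow> 'b::euclidean_space \<Rightarrow> complex"
  assumes m [measurable]: "case_prod F \<in> borel_measurable (borel \<Otimes>\<^sub>M borel)"
    and g: "integrable lborel g" and h: "integrable lborel h"
    and b: "\<And>x y. norm (F x y) \<le> g x * h y"
  shows "(\<integral>x. (\<integral>y. F x y \<partial>lborel) \<partial>lborel) = (\<integral>y. (\<integral>x. F x y \<partial>lborel) \<partial>lborel)"
    and "integrable lborel (\<lambda>x. \<integral>y. F x y \<partial>lborel)"
    and "integrable lborel (\<lambda>y. \<integral>x. F x y \<partial>lborel)"
proof -
  have m1: "F x \<in> borel_measurable borel" for x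
    using measurable_compose[OF measurable_Pair1' m, of x] by simp
  have i1: "integrable lborel (F x)" for x
    by (rule integrable_bound_real[OF integrable_mult_right[OF h, of "g x"]]) (use m1 b in auto)
  have int: "integrable (lborel \<Otimes>\<^sub>M lborel) (case_prod F)"
  proof (rule lborel_pair.Fubini_integrable)
    show "integrable lborel (\<lambda>x. \<integral>y. norm (case_prod F (x, y)) \<partial>lborel)"
    proof (rule integrable_bound_real[OF integrable_mult_left[OF g, of "integral\<^sup>L lborel h"]])
      fix x
      have "(\<integral>y. norm (F x y) \<partial>lborel) \<le> (\<integral>y. g x * h y \<partial>lborel)"
        using i1 h b by (intro integral_mono) auto
      then show "norm (\<integral>y. norm (case_prod F (x, y)) \<partial>lborel) \<le> g x * integral\<^sup>L lborel h" by simp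
    qed simp
  qed (use i1 in auto)
  from lborel_pair.Fubini_integral[OF int]
  show "(\<integral>x. (\<integral>y. F x y \<partial>lborel) \<partial>lborel) = (\<integral>y. (\<integral>x. F x y \<partial>lborel) \<partial>lborel)" by simp
  from lborel_pair.integrable_fst'[OF int] show "integrable lborel (\<lambda>x. \<integral>y. F x y \<partial>lborel)" by simp
  from lborel_pair.integrable_snd[OF int] show "integrable lborel (\<lambda>y. \<integral>x. F x y \<partial>lborel)" by simp
qed

subsection \<open>The Fourier transform on Schwartz functions\<close>

definition fconst :: "'n::finite itself \<Rightarrow> real" where
  "fconst _ = (2 * pi) powr (- real CARD('n) / 2)"

lemma fconst_pos: "fconst TYPE('n::finite) > 0"
  by (simp add: fconst_def)

lemma fourier_eq: "fourier f \<xi> = of_real (fconst TYPE('n)) * (\<integral>x. cis (- (x \<bullet> \<xi>)) * f x \<partial>lborel)"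
  for f :: "real^'n::finite \<Rightarrow> complex"
  by (simp add: fourier_def fconst_def)

lemma inv_fourier_eq_fourier: "inv_fourier f x = fourier f (- x)"
  by (simp add: fourier_def inv_fourier_def inner_commute[of x])

lemma borel_measurable_cis [measurable]: "cis \<in> borel_measurable borel"
  by (intro borel_measurable_continuous_onI continuous_intros)

lemma fourier_bound:
  fixes f :: "real^'n::finite \<Rightarrow> complex"
  assumes "integrable lborel f"
  shows "cmod (fourier f \<xi>) \<le> fconst TYPE('n) * (\<integral>x. cmod (f x) \<partial>lborel)"
proof -
  have [measurable]: "f \<in> borel_measurable borel" using assms by auto
  have "cmod (\<integral>x. cis (- (x \<bullet> \<xi>)) * f x \<partial>lborel) \<le> (\<integral>x. cmod (f x) \<partial>lborel)"
    by (rule integral_bound_real) (use assms in \<open>auto simp: norm_mult\<close>)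
  then show ?thesis using fconst_pos[where 'n='n] by (simp add: fourier_eq norm_mult mult_left_mono)
qed

lemma smooth_exponential:
  fixes \<xi> :: "real^'n::finite"
  shows "partial_deriv j (\<lambda>x. cis (- (x \<bullet> \<xi>))) = (\<lambda>x. (- \<i> * of_real (\<xi> $ j)) * cis (- (x \<bullet> \<xi>)))"
    and "slow (\<lambda>x. cis (- (x \<bullet> \<xi>)))"
proof -
  have d: "((\<lambda>x. cis (- (x \<bullet> \<xi>))) has_derivative (\<lambda>h. (- (h \<bullet> \<xi>)) *\<^sub>R (\<i> * cis (- (x \<bullet> \<xi>))))) (at x)" for x
    by (auto intro!: derivative_eq_intros)
  show pd: "partial_deriv j (\<lambda>x. cis (- (x \<bullet> \<xi>))) = (\<lambda>x. (- \<i> * of_real (\<xi> $ j)) * cis (- (x \<bullet> \<xi>)))" for j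
    using partial_deriv_eq[OF d, of j] by (auto simp: inner_axis' scaleR_conv_of_real fun_eq_iff)
  have dd: "(\<lambda>x. cis (- (x \<bullet> \<xi>))) differentiable at x" for x using d by (auto simp: differentiable_def)
  have sm: "smooth (\<lambda>x. cis (- (x \<bullet> \<xi>)))"
  proof (rule smooth_coinduct[where C="range (\<lambda>c x. c * cis (- (x \<bullet> \<xi>)))"])
    show "(\<lambda>x. cis (- (x \<bullet> \<xi>))) \<in> range (\<lambda>c x. c * cis (- (x \<bullet> \<xi>)))" by (rule range_eqI[of _ _ 1]) simp
    fix g x j assume "g \<in> range (\<lambda>c x. c * cis (- (x \<bullet> \<xi>)))"
    then obtain c where g: "g = (\<lambda>x. c * cis (- (x \<bullet> \<xi>)))" by auto
    show "g differentiable at x" unfolding g using dd by (intro differentiable_mult) auto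
    have "partial_deriv j g = (\<lambda>x. (c * (- \<i> * of_real (\<xi> $ j))) * cis (- (x \<bullet> \<xi>)))"
      unfolding g using dd by (auto simp: partial_deriv_mult pd)
    then show "partial_deriv j g \<in> range (\<lambda>c x. c * cis (- (x \<bullet> \<xi>)))"
      by (rule range_eqI)
  qed
  have "\<exists>c. iter_partial is (\<lambda>x. cis (- (x \<bullet> \<xi>))) = (\<lambda>x. c * cis (- (x \<bullet> \<xi>)))" for "is"
  proof (induction "is")
    case Nil
    show ?case by (rule exI[of _ 1]) simp
  next
    case (Cons j "is")
    then obtain c where c: "iter_partial is (\<lambda>x. cis (- (x \<bullet> \<xi>))) = (\<lambda>x. c * cis (- (x \<bullet> \<xi>)))" by auto
    have "partial_deriv j (\<lambda>x. c * cis (- (x \<bullet> \<xi>))) = (\<lambda>x. (c * (- \<i> * of_real (\<xi> $ j))) * cis (- (x \<bullet> \<xi>)))"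
      using dd by (auto simp: partial_deriv_mult pd)
    then show ?case unfolding iter_partial_simps c by (rule exI)
  qed
  then have "\<exists>r B. \<forall>x. cmod (iter_partial is (\<lambda>x. cis (- (x \<bullet> \<xi>))) x) \<le> B * wt r x" for "is"
  proof -
    from \<open>\<exists>c. iter_partial is (\<lambda>x. cis (- (x \<bullet> \<xi>))) = (\<lambda>x. c * cis (- (x \<bullet> \<xi>)))\<close>
    obtain c where "iter_partial is (\<lambda>x. cis (- (x \<bullet> \<xi>))) = (\<lambda>x. c * cis (- (x \<bullet> \<xi>)))" by auto
    then show ?thesis by (intro exI[of _ 0] exI[of _ "cmod c"]) (simp add: norm_mult)
  qed
  with sm show "slow (\<lambda>x. cis (- (x \<bullet> \<xi>)))" by (simp add: slow_def)
qed

lemma coord_mult_schwartz: "f \<in> schwartz \<Longrightarrow> (\<lambda>x. of_real (x $ i) * f x) \<in> schwartz"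
  by (rule slow_mult_schwartz[OF slow_coord])

lemma fourier_has_derivative:
  fixes f :: "real^'n::finite \<Rightarrow> complex"
  assumes f: "f \<in> schwartz"
  shows "(fourier f has_derivative (\<lambda>h. \<Sum>i\<in>UNIV. of_real (h $ i) * fourier (\<lambda>x. - \<i> * (of_real (x $ i) * f x)) \<xi>)) (at \<xi>)"
proof -
  have [measurable]: "f \<in> borel_measurable borel" using f schwartz_smooth smooth_borel by blast
  have int: "integrable lborel (\<lambda>x. cis (- (x \<bullet> \<xi>)) * g x)" if "g \<in> schwartz" for g :: "real^'n \<Rightarrow> complex" and \<xi>
    by (rule schwartz_integrable[OF slow_mult_schwartz[OF smooth_exponential(2) that]])
  have "((\<lambda>\<xi>. \<integral>x. cis (- (x \<bullet> \<xi>)) * f x \<partial>lborel) has_derivative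
         (\<lambda>h. \<integral>x. ((- (x \<bullet> h)) *\<^sub>R (\<i> * cis (- (x \<bullet> \<xi>)))) * f x \<partial>lborel)) (at \<xi>)"
  proof (rule has_derivative_integral[where r=1 and G="\<lambda>x. cmod (f x) * wt 1 x"
      and D="\<lambda>\<xi> x h. ((- (x \<bullet> h)) *\<^sub>R (\<i> * cis (- (x \<bullet> \<xi>)))) * f x"])
    fix \<xi>' x h :: "real^'n"
    show "((\<lambda>\<xi>. cis (- (x \<bullet> \<xi>)) * f x) has_derivative (\<lambda>h. ((- (x \<bullet> h)) *\<^sub>R (\<i> * cis (- (x \<bullet> \<xi>')))) * f x)) (at \<xi>')"
      by (auto intro!: derivative_eq_intros)
    have "norm (((- (x \<bullet> h)) *\<^sub>R (\<i> * cis (- (x \<bullet> \<xi>')))) * f x) = \<bar>x \<bullet> h\<bar> * cmod (f x)"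
      by (simp add: norm_mult)
    also have "\<dots> \<le> (wt 1 x * norm h) * cmod (f x)"
    proof (rule mult_right_mono)
      have "\<bar>x \<bullet> h\<bar> \<le> norm x * norm h" by (rule Cauchy_Schwarz_ineq2)
      also have "\<dots> \<le> wt 1 x * norm h" by (intro mult_right_mono) (auto simp: wt_def)
      finally show "\<bar>x \<bullet> h\<bar> \<le> wt 1 x * norm h" .
    qed simp
    finally show "norm (((- (x \<bullet> h)) *\<^sub>R (\<i> * cis (- (x \<bullet> \<xi>')))) * f x) \<le> cmod (f x) * wt 1 x * norm h"
      by (simp add: mult_ac)
  qed (use int[OF f] rapid_integrable_wt[OF schwartz_rapid[OF f]] in auto)
  then have "(fourier f has_derivative
     (\<lambda>h. of_real (fconst TYPE('n)) * (\<integral>x. ((- (x \<bullet> h)) *\<^sub>R (\<i> * cis (- (x \<bullet> \<xi>)))) * f x \<partial>lborel))) (at \<xi>)"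
    unfolding fourier_eq[abs_def] by (rule has_derivative_mult_right)
  also have "(\<lambda>h. of_real (fconst TYPE('n)) * (\<integral>x. ((- (x \<bullet> h)) *\<^sub>R (\<i> * cis (- (x \<bullet> \<xi>)))) * f x \<partial>lborel))
     = (\<lambda>h. \<Sum>i\<in>UNIV. of_real (h $ i) * fourier (\<lambda>x. - \<i> * (of_real (x $ i) * f x)) \<xi>)"
  proof
    fix h :: "real^'n"
    have "(\<integral>x. ((- (x \<bullet> h)) *\<^sub>R (\<i> * cis (- (x \<bullet> \<xi>)))) * f x \<partial>lborel)
       = (\<integral>x. (\<Sum>i\<in>UNIV. of_real (h $ i) * (cis (- (x \<bullet> \<xi>)) * (- \<i> * (of_real (x $ i) * f x)))) \<partial>lborel)"
      by (intro Bochner_Integration.integral_cong)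
         (auto simp: inner_vec_def scaleR_conv_of_real sum_distrib_left sum_distrib_right sum_negf mult_ac)
    also have "\<dots> = (\<Sum>i\<in>UNIV. of_real (h $ i) * (\<integral>x. cis (- (x \<bullet> \<xi>)) * (- \<i> * (of_real (x $ i) * f x)) \<partial>lborel))"
      using int[OF schwartz_cmult[OF coord_mult_schwartz[OF f]]]
      by (subst Bochner_Integration.integral_sum) (auto intro!: integrable_mult_right simp del: integral_mult_right_zero simp: integral_mult_right)
    finally show "of_real (fconst TYPE('n)) * (\<integral>x. ((- (x \<bullet> h)) *\<^sub>R (\<i> * cis (- (x \<bullet> \<xi>)))) * f x \<partial>lborel)
      = (\<Sum>i\<in>UNIV. of_real (h $ i) * fourier (\<lambda>x. - \<i> * (of_real (x $ i) * f x)) \<xi>)"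
      by (simp add: fourier_eq sum_distrib_left mult_ac)
  qed
  finally show ?thesis .
qed

lemma partial_deriv_fourier:
  assumes "f \<in> schwartz"
  shows "partial_deriv i (fourier f) = fourier (\<lambda>x. - \<i> * (of_real (x $ i) * f x))"
  using partial_deriv_eq[OF fourier_has_derivative[OF assms]] by (auto simp: sum_axis)

text \<open>The derivative of the product of the exponential and \<open>f\<close> has integral 0;
  expanding it by the product rule gives the identity.\<close>

lemma fourier_partial_deriv:
  fixes f :: "real^'n::finite \<Rightarrow> complex"
  assumes f: "f \<in> schwartz"
  shows "of_real (\<xi> $ j) * fourier f \<xi> = fourier (\<lambda>x. - \<i> * partial_deriv j f x) \<xi>"
proof -
  let ?e = "\<lambda>x. cis (- (x \<bullet> \<xi>))"
  have h: "(\<lambda>x. ?e x * f x) \<in> schwartz" by (rule slow_mult_schwartz[OF smooth_exponential(2) f])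
  have i1: "integrable lborel (\<lambda>x. ?e x * f x)" "integrable lborel (\<lambda>x. ?e x * partial_deriv j f x)"
    by (intro schwartz_integrable slow_mult_schwartz[OF smooth_exponential(2)] schwartz_partial_deriv f)+
  have "0 = (\<integral>x. partial_deriv j (\<lambda>x. ?e x * f x) x \<partial>lborel)"
    by (rule integral_partial_deriv_zero[OF h, symmetric])
  also have "partial_deriv j (\<lambda>x. ?e x * f x) = (\<lambda>x. (- \<i> * of_real (\<xi> $ j)) * (?e x * f x) + ?e x * partial_deriv j f x)"
    using smooth_exponential(2)[of \<xi>] by (subst partial_deriv_mult_smooth) (auto simp: smooth_exponential(1) slow_def schwartz_smooth f mult_ac)
  also have "(\<integral>x. (- \<i> * of_real (\<xi> $ j)) * (?e x * f x) + ?e x * partial_deriv j f x \<partial>lborel)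
      = (- \<i> * of_real (\<xi> $ j)) * (\<integral>x. ?e x * f x \<partial>lborel) + (\<integral>x. ?e x * partial_deriv j f x \<partial>lborel)"
    using i1 by (subst Bochner_Integration.integral_add) (auto intro!: integrable_mult_right)
  finally have "(\<integral>x. ?e x * partial_deriv j f x \<partial>lborel) = \<i> * of_real (\<xi> $ j) * (\<integral>x. ?e x * f x \<partial>lborel)"
    by (simp add: algebra_simps)
  moreover have "(\<integral>x. ?e x * (- \<i> * partial_deriv j f x) \<partial>lborel) = - \<i> * (\<integral>x. ?e x * partial_deriv j f x \<partial>lborel)"
    by (subst integral_mult_right_zero[symmetric]) (simp add: mult_ac)
  ultimately have "(\<integral>x. ?e x * (- \<i> * partial_deriv j f x) \<partial>lborel) = of_real (\<xi> $ j) * (\<integral>x. ?e x * f x \<partial>lborel)"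
    by (simp add: mult.assoc)
  then show ?thesis unfolding fourier_eq by (simp only: mult_ac)
qed

text \<open>A further power of the weight costs 1 + \<Sum> |\<xi>_j|, and multiplication of the
  transform by \<xi>_j amounts to a derivative of \<open>f\<close>, to which the induction
  hypothesis applies.\<close>

lemma fourier_decay:
  fixes f :: "real^'n::finite \<Rightarrow> complex"
  assumes "f \<in> schwartz"
  shows "\<exists>B. \<forall>\<xi>. wt (real m) \<xi> * cmod (fourier f \<xi>) \<le> B"
  using assms
proof (induction m arbitrary: f)
  case 0
  then show ?case using fourier_bound[OF schwartz_integrable] by auto
next
  case (Suc m)
  obtain B where B: "\<And>\<xi>. wt (real m) \<xi> * cmod (fourier f \<xi>) \<le> B" using Suc by blast
  have "\<exists>B. \<forall>\<xi>. wt (real m) \<xi> * cmod (fourier (\<lambda>x. - \<i> * partial_deriv j f x) \<xi>) \<le> B" for j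
    by (intro Suc.IH schwartz_cmult schwartz_partial_deriv Suc.prems)
  then obtain b where b: "\<And>j \<xi>. wt (real m) \<xi> * cmod (fourier (\<lambda>x. - \<i> * partial_deriv j f x) \<xi>) \<le> b j" by metis
  have "wt (real (Suc m)) \<xi> * cmod (fourier f \<xi>) \<le> B + (\<Sum>j\<in>UNIV. b j)" for \<xi>
  proof -
    have "wt (real (Suc m)) \<xi> = wt (real m) \<xi> * (1 + norm \<xi>)" by (simp add: wt_nat del: of_nat_Suc)
    also have "\<dots> \<le> wt (real m) \<xi> * (1 + (\<Sum>j\<in>UNIV. \<bar>\<xi> $ j\<bar>))"
      using norm_le_l1_cart[of \<xi>] by (intro mult_left_mono) auto
    finally have "wt (real (Suc m)) \<xi> * cmod (fourier f \<xi>) \<le> (wt (real m) \<xi> * (1 + (\<Sum>j\<in>UNIV. \<bar>\<xi> $ j\<bar>))) * cmod (fourier f \<xi>)"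
      by (intro mult_right_mono) auto
    also have "\<dots> = wt (real m) \<xi> * cmod (fourier f \<xi>) + (\<Sum>j\<in>UNIV. wt (real m) \<xi> * cmod (of_real (\<xi> $ j) * fourier f \<xi>))"
      by (simp add: algebra_simps sum_distrib_left sum_distrib_right norm_mult)
    also have "\<dots> \<le> B + (\<Sum>j\<in>UNIV. b j)"
      unfolding fourier_partial_deriv[OF Suc.prems] by (intro add_mono B sum_mono b)
    finally show ?thesis .
  qed
  then show ?case by blast
qed

lemma schwartz_fourier:
  fixes f :: "real^'n::finite \<Rightarrow> complex"
  assumes "f \<in> schwartz" shows "fourier f \<in> schwartz"
proof -
  have st: "\<exists>g\<in>schwartz. iter_partial is (fourier f) = fourier g" for "is"
  proof (induction "is")
    case (Cons i "is")
    then obtain g where g: "g \<in> schwartz" "iter_partial is (fourier f) = fourier g" by auto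
    then show ?case
      by (intro bexI[of _ "\<lambda>x. - \<i> * (of_real (x $ i) * g x)"] schwartz_cmult coord_mult_schwartz)
         (simp_all add: partial_deriv_fourier)
  qed (use assms in auto)
  have "smooth (fourier f)"
  proof (rule smooth_coinduct[where C="fourier ` schwartz"])
    fix h :: "real^'n \<Rightarrow> complex" and x i assume "h \<in> fourier ` schwartz"
    then obtain g where g: "g \<in> schwartz" "h = fourier g" by auto
    show "h differentiable at x" using fourier_has_derivative[OF g(1)] g(2) by (auto simp: differentiable_def)
    show "partial_deriv i h \<in> fourier ` schwartz"
      unfolding g(2) partial_deriv_fourier[OF g(1)] by (intro imageI schwartz_cmult coord_mult_schwartz g)
  qed (use assms in auto)
  moreover have "\<exists>B. \<forall>x. cmod (iter_partial is (fourier f) x) \<le> B * wt r x" for r "is"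
  proof -
    obtain g where g: "g \<in> schwartz" "iter_partial is (fourier f) = fourier g" using st by blast
    define m where "m = nat \<lceil>- r\<rceil>"
    obtain B where B: "\<And>\<xi>. wt (real m) \<xi> * cmod (fourier g \<xi>) \<le> B" using fourier_decay[OF g(1)] by blast
    have B0: "B \<ge> 0" using order_trans[OF _ B[of 0]] by simp
    have "cmod (iter_partial is (fourier f) x) \<le> B * wt r x" for x
    proof -
      have "cmod (fourier g x) = wt (- real m) x * (wt (real m) x * cmod (fourier g x))"
        by (simp add: mult.assoc[symmetric] wt_mult)
      also have "\<dots> \<le> wt (- real m) x * B" using B by (intro mult_left_mono) auto
      also have "\<dots> \<le> wt r x * B" using B0 by (intro mult_right_mono wt_mono) (auto simp: m_def, linarith)
      finally show ?thesis by (simp add: g mult.commute)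
    qed
    then show ?thesis by blast
  qed
  ultimately show ?thesis by (simp add: schwartz_iff)
qed

lemma schwartz_inv_fourier: "f \<in> schwartz \<Longrightarrow> inv_fourier f \<in> schwartz"
  using schwartz_uminus[OF schwartz_fourier] unfolding inv_fourier_eq_fourier[abs_def] .

subsection \<open>The inversion formula\<close>

text \<open>The characteristic function of the standard normal law, freed of its
  normalisation.\<close>

lemma gaussian_1d:
  "(\<integral>x. exp (- x\<^sup>2 / 2) *\<^sub>R cis (x * t) \<partial>lborel) = of_real (sqrt (2 * pi) * exp (- t\<^sup>2 / 2))"
  "integrable lborel (\<lambda>x. exp (- x\<^sup>2 / 2) *\<^sub>R cis (x * t))"
proof -
  have i: "integrable lborel std_normal_density" by (simp add: integrable_normal_density)
  have "of_real (exp (- t\<^sup>2 / 2)) = char std_normal_distribution t"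
    by (simp add: char_std_normal_distribution)
  also have "\<dots> = (\<integral>x. std_normal_density x *\<^sub>R cis (t * x) \<partial>lborel)"
    unfolding char_def by (subst integral_density) (auto simp: cis_conv_exp)
  also have "\<dots> = (\<integral>x. (1 / sqrt (2 * pi)) *\<^sub>R (exp (- x\<^sup>2 / 2) *\<^sub>R cis (x * t)) \<partial>lborel)"
    by (simp add: std_normal_density_def mult.commute[of t])
  also have "\<dots> = (1 / sqrt (2 * pi)) *\<^sub>R (\<integral>x. exp (- x\<^sup>2 / 2) *\<^sub>R cis (x * t) \<partial>lborel)"
    by (rule integral_scaleR_right)
  finally have "of_real (exp (- t\<^sup>2 / 2)) = (1 / sqrt (2 * pi)) *\<^sub>R (\<integral>x. exp (- x\<^sup>2 / 2) *\<^sub>R cis (x * t) \<partial>lborel)" .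
  then have "sqrt (2 * pi) *\<^sub>R complex_of_real (exp (- t\<^sup>2 / 2)) = (\<integral>x. exp (- x\<^sup>2 / 2) *\<^sub>R cis (x * t) \<partial>lborel)"
    by simp
  then show 1: "(\<integral>x. exp (- x\<^sup>2 / 2) *\<^sub>R cis (x * t) \<partial>lborel) = of_real (sqrt (2 * pi) * exp (- t\<^sup>2 / 2))"
    by (simp add: scaleR_conv_of_real)
  show "integrable lborel (\<lambda>x. exp (- x\<^sup>2 / 2) *\<^sub>R cis (x * t))"
  \<comment> \<open>A function that is not integrable has Bochner integral 0 by convention, but the
    value just computed is not 0.\<close>
  proof (rule ccontr)
    assume "\<not> ?thesis"
    then have "(\<integral>x. exp (- x\<^sup>2 / 2) *\<^sub>R cis (x * t) \<partial>lborel) = 0" by (rule not_integrable_integral_eq)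
    with 1 show False by simp
  qed
qed

lemma gaussian_fourier:
  fixes \<xi> :: "'a::euclidean_space"
  shows "(\<integral>x. exp (- (norm x)\<^sup>2 / 2) *\<^sub>R cis (x \<bullet> \<xi>) \<partial>lborel)
     = of_real ((2 * pi) powr (real DIM('a) / 2) * exp (- (norm \<xi>)\<^sup>2 / 2))"
proof -
  interpret product_sigma_finite "\<lambda>_::'a. lborel :: real measure"
    unfolding product_sigma_finite_def using sigma_finite_lborel by blast
  let ?s = "\<lambda>f. \<Sum>b\<in>Basis. f b *\<^sub>R b :: 'a"
  have nrm: "(norm (?s f))\<^sup>2 = (\<Sum>b\<in>Basis. (f b)\<^sup>2)" for f
    unfolding power2_norm_eq_inner euclidean_inner[of "?s f" "?s f"]
    by (intro sum.cong refl) (simp add: power2_eq_square)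
  have inn: "?s f \<bullet> \<xi> = (\<Sum>b\<in>Basis. f b * (\<xi> \<bullet> b))" for f
    by (simp add: inner_sum_left inner_commute[of \<xi>])
  have cs: "cis (\<Sum>b\<in>A. g b) = (\<Prod>b\<in>A. cis (g b))" if "finite A" for g :: "'a \<Rightarrow> real" and A
    using that by (induction A) (auto simp: cis_mult[symmetric])
  have "(\<integral>x. exp (- (norm x)\<^sup>2 / 2) *\<^sub>R cis (x \<bullet> \<xi>) \<partial>(lborel :: 'a measure))
     = (\<integral>f. exp (- (norm (?s f))\<^sup>2 / 2) *\<^sub>R cis (?s f \<bullet> \<xi>) \<partial>(\<Pi>\<^sub>M b\<in>Basis. lborel))"
    by (subst lborel_eq, subst integral_distr) auto
  also have "\<dots> = (\<integral>f. (\<Prod>b\<in>Basis. exp (- (f b)\<^sup>2 / 2) *\<^sub>R cis (f b * (\<xi> \<bullet> b))) \<partial>(\<Pi>\<^sub>M b\<in>Basis. lborel))"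
  proof -
    have "exp (- (\<Sum>b\<in>Basis. (f b)\<^sup>2) / 2) *\<^sub>R cis (\<Sum>b\<in>Basis. f b * (\<xi> \<bullet> b))
        = (\<Prod>b\<in>Basis. exp (- (f b)\<^sup>2 / 2) *\<^sub>R cis (f b * (\<xi> \<bullet> b)))" for f :: "'a \<Rightarrow> real"
    proof -
      have "exp (- (\<Sum>b\<in>Basis. (f b)\<^sup>2) / 2) = (\<Prod>b\<in>Basis. exp (- (f b)\<^sup>2 / 2))"
        by (simp add: exp_sum[symmetric] sum_negf sum_divide_distrib)
      then show ?thesis by (simp add: cs scaleR_conv_of_real prod.distrib)
    qed
    then show ?thesis unfolding nrm inn by simp
  qed
  also have "\<dots> = (\<Prod>b\<in>Basis. \<integral>x. exp (- x\<^sup>2 / 2) *\<^sub>R cis (x * (\<xi> \<bullet> b)) \<partial>lborel)"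
    by (rule product_integral_prod[OF finite_Basis gaussian_1d(2)])
  also have "\<dots> = of_real (\<Prod>b\<in>Basis. sqrt (2 * pi) * exp (- (\<xi> \<bullet> b)\<^sup>2 / 2))"
    by (simp only: gaussian_1d(1) of_real_prod)
  also have "(\<Prod>b\<in>Basis. sqrt (2 * pi) * exp (- (\<xi> \<bullet> b)\<^sup>2 / 2)) = sqrt (2 * pi) ^ DIM('a) * exp (- (norm \<xi>)\<^sup>2 / 2)"
  proof -
    have "(norm \<xi>)\<^sup>2 = (\<Sum>b\<in>Basis. (\<xi> \<bullet> b)\<^sup>2)"
      unfolding power2_norm_eq_inner euclidean_inner[of \<xi> \<xi>] by (simp add: power2_eq_square)
    then have "(\<Prod>b\<in>Basis. exp (- (\<xi> \<bullet> b)\<^sup>2 / 2)) = exp (- (norm \<xi>)\<^sup>2 / 2)"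
      by (simp add: exp_sum[symmetric] sum_negf sum_divide_distrib)
    then show ?thesis by (simp add: prod.distrib)
  qed
  also have "sqrt (2 * pi) ^ DIM('a) = (2 * pi) powr (real DIM('a) / 2)"
    by (simp add: powr_half_sqrt[symmetric] powr_realpow[symmetric] powr_powr)
  finally show ?thesis .
qed

lemma gaussian_integrable: "integrable lborel (\<lambda>x::'a::euclidean_space. exp (- (norm x)\<^sup>2 / 2))"
proof (rule ccontr)
  assume "\<not> ?thesis"
  then have z: "(\<integral>x. exp (- (norm (x::'a))\<^sup>2 / 2) \<partial>lborel) = 0" by (rule not_integrable_integral_eq)
  have "(\<lambda>x. exp (- (norm x)\<^sup>2 / 2) *\<^sub>R cis (x \<bullet> (0::'a))) = (\<lambda>x. complex_of_real (exp (- (norm x)\<^sup>2 / 2)))"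
    by (simp add: scaleR_conv_of_real)
  then have "(\<integral>x. exp (- (norm x)\<^sup>2 / 2) *\<^sub>R cis (x \<bullet> (0::'a)) \<partial>lborel) = 0"
    using z by (simp only: integral_complex_of_real of_real_0)
  then show False unfolding gaussian_fourier by simp
qed

lemma gaussian_scaled:
  fixes v :: "'a::euclidean_space"
  assumes "\<epsilon> > 0"
  shows "(\<integral>\<xi>. exp (- (norm (\<epsilon> *\<^sub>R \<xi>))\<^sup>2 / 2) *\<^sub>R cis (v \<bullet> \<xi>) \<partial>lborel)
    = of_real ((1 / \<epsilon>) ^ DIM('a) * ((2 * pi) powr (real DIM('a) / 2) * exp (- (norm ((1/\<epsilon>) *\<^sub>R v))\<^sup>2 / 2)))"
proof -
  have "(\<integral>\<xi>. exp (- (norm (\<epsilon> *\<^sub>R \<xi>))\<^sup>2 / 2) *\<^sub>R cis (v \<bullet> \<xi>) \<partial>lborel)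
     = of_real (\<bar>1/\<epsilon>\<bar> ^ DIM('a)) * (\<integral>\<xi>. exp (- (norm (\<epsilon> *\<^sub>R (0 + (1/\<epsilon>) *\<^sub>R \<xi>)))\<^sup>2 / 2) *\<^sub>R cis (v \<bullet> (0 + (1/\<epsilon>) *\<^sub>R \<xi>)) \<partial>lborel)"
    using assms by (intro integral_lborel_affine) auto
  also have "(\<integral>\<xi>. exp (- (norm (\<epsilon> *\<^sub>R (0 + (1/\<epsilon>) *\<^sub>R \<xi>)))\<^sup>2 / 2) *\<^sub>R cis (v \<bullet> (0 + (1/\<epsilon>) *\<^sub>R \<xi>)) \<partial>lborel)
     = (\<integral>\<xi>. exp (- (norm \<xi>)\<^sup>2 / 2) *\<^sub>R cis (\<xi> \<bullet> ((1/\<epsilon>) *\<^sub>R v)) \<partial>lborel)"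
    using assms by (simp add: inner_commute)
  finally show ?thesis unfolding gaussian_fourier using assms by simp
qed

lemma fconst_inverse: "fconst TYPE('n::finite) * (2 * pi) powr (real CARD('n) / 2) = 1"
  by (simp add: fconst_def powr_add[symmetric])

text \<open>Gaussian regularisation. The integrals \<open>A n\<close>, damped by a Gaussian of width
  1 / \<open>\<epsilon> n\<close>, are computed twice: dominated convergence gives the inverse
  transform, and Fubini turns them into Gaussian averages of \<open>f\<close> at scale
  \<open>\<epsilon> n\<close> around \<open>x\<close>, which tend to \<open>f x\<close>.\<close>

lemma fourier_inversion:
  fixes f :: "real^'n::finite \<Rightarrow> complex"
  assumes f: "f \<in> schwartz"
  shows "inv_fourier (fourier f) = f"
proof
  fix x :: "real^'n"
  let ?c = "fconst TYPE('n)"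
  define K where "K = (2 * pi) powr (real CARD('n) / 2)"
  have cK: "?c * K = 1" using fconst_inverse[where 'n='n] by (simp add: K_def)
  define \<epsilon> where "\<epsilon> n = inverse (real (Suc n))" for n
  have eps: "\<epsilon> n > 0" for n by (simp add: \<epsilon>_def)
  have eps0: "\<epsilon> \<longlonglongrightarrow> 0" unfolding \<epsilon>_def by (rule LIMSEQ_inverse_real_of_nat)
  define g where "g = fourier f"
  have g: "g \<in> schwartz" unfolding g_def by (rule schwartz_fourier[OF f])
  have [measurable]: "f \<in> borel_measurable borel" "g \<in> borel_measurable borel"
    using f g schwartz_smooth smooth_borel by blast+
  define G where "G z = exp (- (norm z)\<^sup>2 / 2)" for z :: "real^'n"
  have Gm [measurable]: "G \<in> borel_measurable borel" unfolding G_def by measurable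
  have Gi: "integrable lborel G" unfolding G_def by (rule gaussian_integrable)
  have G1: "0 \<le> G z" "G z \<le> 1" for z by (simp_all add: G_def)
  have Gi': "integrable lborel (\<lambda>\<xi>. G (\<epsilon> n *\<^sub>R \<xi>))" for n
    using integrable_lborel_affine[OF Gi, of "\<epsilon> n" 0] eps[of n] by simp
  define A where "A n = ?c *\<^sub>R (\<integral>\<xi>. G (\<epsilon> n *\<^sub>R \<xi>) *\<^sub>R (cis (x \<bullet> \<xi>) * g \<xi>) \<partial>lborel)" for n
  have lim1: "A \<longlonglongrightarrow> inv_fourier g x"
  proof -
    have "(\<lambda>n. \<integral>\<xi>. G (\<epsilon> n *\<^sub>R \<xi>) *\<^sub>R (cis (x \<bullet> \<xi>) * g \<xi>) \<partial>lborel) \<longlonglongrightarrow> (\<integral>\<xi>. cis (x \<bullet> \<xi>) * g \<xi> \<partial>lborel)"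
    proof (rule integral_dominated_convergence[where w="\<lambda>\<xi>. cmod (g \<xi>)"])
      show "AE \<xi> in lborel. (\<lambda>n. G (\<epsilon> n *\<^sub>R \<xi>) *\<^sub>R (cis (x \<bullet> \<xi>) * g \<xi>)) \<longlonglongrightarrow> cis (x \<bullet> \<xi>) * g \<xi>"
      proof (rule AE_I2)
        fix \<xi>
        have "(\<lambda>n. G (\<epsilon> n *\<^sub>R \<xi>) *\<^sub>R (cis (x \<bullet> \<xi>) * g \<xi>)) \<longlonglongrightarrow> exp (- (norm (0 *\<^sub>R \<xi>))\<^sup>2 / 2) *\<^sub>R (cis (x \<bullet> \<xi>) * g \<xi>)"
          unfolding G_def by (intro tendsto_intros eps0) simp
        then show "(\<lambda>n. G (\<epsilon> n *\<^sub>R \<xi>) *\<^sub>R (cis (x \<bullet> \<xi>) * g \<xi>)) \<longlonglongrightarrow> cis (x \<bullet> \<xi>) * g \<xi>" by simp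
      qed
      show "AE \<xi> in lborel. norm (G (\<epsilon> n *\<^sub>R \<xi>) *\<^sub>R (cis (x \<bullet> \<xi>) * g \<xi>)) \<le> cmod (g \<xi>)" for n
        using G1 by (auto simp: norm_mult intro!: mult_left_le_one_le)
      show "integrable lborel (\<lambda>\<xi>. cmod (g \<xi>))" using schwartz_integrable[OF g] by simp
    qed measurable
    then have "A \<longlonglongrightarrow> ?c *\<^sub>R (\<integral>\<xi>. cis (x \<bullet> \<xi>) * g \<xi> \<partial>lborel)"
      unfolding A_def by (intro tendsto_intros)
    then show ?thesis by (simp add: inv_fourier_def fconst_def scaleR_conv_of_real)
  qed
  \<comment> \<open>Fubini reduces the \<xi>-integral to the transform of a Gaussian, and the
    substitution y = x + \<epsilon> z moves the scale into the argument of \<open>f\<close>.\<close>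
  have A_eq: "A n = ?c *\<^sub>R (\<integral>z. G z *\<^sub>R f (x + \<epsilon> n *\<^sub>R z) \<partial>lborel)" for n
  proof -
    let ?F = "\<lambda>\<xi> y. f y * (G (\<epsilon> n *\<^sub>R \<xi>) *\<^sub>R cis ((x - y) \<bullet> \<xi>))"
    have "(\<integral>\<xi>. G (\<epsilon> n *\<^sub>R \<xi>) *\<^sub>R (cis (x \<bullet> \<xi>) * g \<xi>) \<partial>lborel) = (\<integral>\<xi>. of_real ?c * (\<integral>y. ?F \<xi> y \<partial>lborel) \<partial>lborel)"
    proof (intro Bochner_Integration.integral_cong refl)
      fix \<xi>
      have "G (\<epsilon> n *\<^sub>R \<xi>) *\<^sub>R (cis (x \<bullet> \<xi>) * g \<xi>) = of_real ?c * ((of_real (G (\<epsilon> n *\<^sub>R \<xi>)) * cis (x \<bullet> \<xi>)) * (\<integral>y. cis (- (y \<bullet> \<xi>)) * f y \<partial>lborel))"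
        by (simp add: g_def fourier_eq scaleR_conv_of_real)
      also have "\<dots> = of_real ?c * (\<integral>y. (of_real (G (\<epsilon> n *\<^sub>R \<xi>)) * cis (x \<bullet> \<xi>)) * (cis (- (y \<bullet> \<xi>)) * f y) \<partial>lborel)"
        by (subst integral_mult_right_zero) simp
      also have "(\<lambda>y. (of_real (G (\<epsilon> n *\<^sub>R \<xi>)) * cis (x \<bullet> \<xi>)) * (cis (- (y \<bullet> \<xi>)) * f y)) = ?F \<xi>"
      proof
        fix y
        have "cis ((x - y) \<bullet> \<xi>) = cis (x \<bullet> \<xi>) * cis (- (y \<bullet> \<xi>))" by (simp add: cis_mult inner_diff_left)
        then show "(of_real (G (\<epsilon> n *\<^sub>R \<xi>)) * cis (x \<bullet> \<xi>)) * (cis (- (y \<bullet> \<xi>)) * f y) = ?F \<xi> y"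
          by (simp add: scaleR_conv_of_real mult_ac)
      qed
      finally show "G (\<epsilon> n *\<^sub>R \<xi>) *\<^sub>R (cis (x \<bullet> \<xi>) * g \<xi>) = of_real ?c * (\<integral>y. ?F \<xi> y \<partial>lborel)" .
    qed
    also have "\<dots> = of_real ?c * (\<integral>\<xi>. (\<integral>y. ?F \<xi> y \<partial>lborel) \<partial>lborel)"
      by (rule integral_mult_right_zero)
    also have "(\<integral>\<xi>. (\<integral>y. ?F \<xi> y \<partial>lborel) \<partial>lborel) = (\<integral>y. (\<integral>\<xi>. ?F \<xi> y \<partial>lborel) \<partial>lborel)"
    proof (rule fubini_swap(1))
      show "integrable lborel (\<lambda>\<xi>. G (\<epsilon> n *\<^sub>R \<xi>))" by (rule Gi')
      show "integrable lborel (\<lambda>y. cmod (f y))" using schwartz_integrable[OF f] by simp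
      show "norm (?F \<xi> y) \<le> G (\<epsilon> n *\<^sub>R \<xi>) * cmod (f y)" for \<xi> y using G1 by (simp add: norm_mult)
    qed measurable
    also have "\<dots> = (\<integral>y. f y * of_real ((1 / \<epsilon> n) ^ CARD('n) * (K * G ((1 / \<epsilon> n) *\<^sub>R (x - y)))) \<partial>lborel)"
    proof (intro Bochner_Integration.integral_cong refl)
      fix y
      have "(\<integral>\<xi>. ?F \<xi> y \<partial>lborel) = f y * (\<integral>\<xi>. G (\<epsilon> n *\<^sub>R \<xi>) *\<^sub>R cis ((x - y) \<bullet> \<xi>) \<partial>lborel)"
        by (rule integral_mult_right_zero)
      also have "(\<integral>\<xi>. G (\<epsilon> n *\<^sub>R \<xi>) *\<^sub>R cis ((x - y) \<bullet> \<xi>) \<partial>lborel) = of_real ((1 / \<epsilon> n) ^ CARD('n) * (K * G ((1 / \<epsilon> n) *\<^sub>R (x - y))))"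
        using gaussian_scaled[OF eps[of n], of "x - y"] by (simp add: G_def K_def)
      finally show "(\<integral>\<xi>. ?F \<xi> y \<partial>lborel) = f y * of_real ((1 / \<epsilon> n) ^ CARD('n) * (K * G ((1 / \<epsilon> n) *\<^sub>R (x - y))))" .
    qed
    also have "\<dots> = of_real (\<bar>\<epsilon> n\<bar> ^ DIM(real^'n)) * (\<integral>z. f (x + \<epsilon> n *\<^sub>R z) * of_real ((1 / \<epsilon> n) ^ CARD('n) * (K * G ((1 / \<epsilon> n) *\<^sub>R (x - (x + \<epsilon> n *\<^sub>R z))))) \<partial>lborel)"
      using eps[of n] by (intro integral_lborel_affine) auto
    also have "\<dots> = (\<integral>z. of_real (\<bar>\<epsilon> n\<bar> ^ DIM(real^'n)) * (f (x + \<epsilon> n *\<^sub>R z) * of_real ((1 / \<epsilon> n) ^ CARD('n) * (K * G ((1 / \<epsilon> n) *\<^sub>R (x - (x + \<epsilon> n *\<^sub>R z)))))) \<partial>lborel)"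
      by (rule integral_mult_right_zero[symmetric])
    also have "\<dots> = (\<integral>z. of_real K * (G z *\<^sub>R f (x + \<epsilon> n *\<^sub>R z)) \<partial>lborel)"
    proof (intro Bochner_Integration.integral_cong refl)
      fix z
      have "G ((1 / \<epsilon> n) *\<^sub>R (x - (x + \<epsilon> n *\<^sub>R z))) = G z" using eps[of n] by (simp add: G_def)
      then show "of_real (\<bar>\<epsilon> n\<bar> ^ DIM(real^'n)) * (f (x + \<epsilon> n *\<^sub>R z) * of_real ((1 / \<epsilon> n) ^ CARD('n) * (K * G ((1 / \<epsilon> n) *\<^sub>R (x - (x + \<epsilon> n *\<^sub>R z))))))
        = of_real K * (G z *\<^sub>R f (x + \<epsilon> n *\<^sub>R z))"
        using eps[of n] by (simp add: scaleR_conv_of_real power_one_over field_simps)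
    qed
    also have "\<dots> = of_real K * (\<integral>z. G z *\<^sub>R f (x + \<epsilon> n *\<^sub>R z) \<partial>lborel)"
      by (rule integral_mult_right_zero)
    finally have "A n = ?c *\<^sub>R (of_real ?c * (of_real K * (\<integral>z. G z *\<^sub>R f (x + \<epsilon> n *\<^sub>R z) \<partial>lborel)))"
      unfolding A_def by simp
    also have "of_real ?c * (of_real K * (\<integral>z. G z *\<^sub>R f (x + \<epsilon> n *\<^sub>R z) \<partial>lborel)) = of_real (?c * K) * (\<integral>z. G z *\<^sub>R f (x + \<epsilon> n *\<^sub>R z) \<partial>lborel)"
      by simp
    finally show ?thesis by (simp only: cK of_real_1 mult_1)
  qed
  have lim2: "A \<longlonglongrightarrow> f x"
  proof -
    obtain B where B: "B \<ge> 0" "\<And>x. cmod (f x) \<le> B * wt 0 x" using schwartz_bound0[OF f] by metis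
    have "(\<lambda>n. \<integral>z. G z *\<^sub>R f (x + \<epsilon> n *\<^sub>R z) \<partial>lborel) \<longlonglongrightarrow> (\<integral>z. G z *\<^sub>R f x \<partial>lborel)"
    proof (rule integral_dominated_convergence[where w="\<lambda>z. B * G z"])
      show "AE z in lborel. (\<lambda>n. G z *\<^sub>R f (x + \<epsilon> n *\<^sub>R z)) \<longlonglongrightarrow> G z *\<^sub>R f x"
      proof (rule AE_I2)
        fix z
        have "(\<lambda>n. x + \<epsilon> n *\<^sub>R z) \<longlonglongrightarrow> x + 0 *\<^sub>R z" by (intro tendsto_intros eps0)
        moreover have "isCont f (x + 0 *\<^sub>R z)"
          using smooth_continuous[OF schwartz_smooth[OF f], of UNIV] by (simp add: continuous_on_eq_continuous_at)
        ultimately have "(\<lambda>n. f (x + \<epsilon> n *\<^sub>R z)) \<longlonglongrightarrow> f (x + 0 *\<^sub>R z)" by (intro isCont_tendsto_compose[where g=f])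
        then show "(\<lambda>n. G z *\<^sub>R f (x + \<epsilon> n *\<^sub>R z)) \<longlonglongrightarrow> G z *\<^sub>R f x" by (intro tendsto_intros) simp
      qed
      show "AE z in lborel. norm (G z *\<^sub>R f (x + \<epsilon> n *\<^sub>R z)) \<le> B * G z" for n
        using B G1 by (auto simp: mult.commute[of B] intro!: mult_left_mono)
    qed (use Gi in auto)
    then have "A \<longlonglongrightarrow> ?c *\<^sub>R (\<integral>z. G z *\<^sub>R f x \<partial>lborel)"
      unfolding A_eq[abs_def] by (intro tendsto_intros)
    also have "(\<integral>z. G z *\<^sub>R f x \<partial>lborel) = (\<integral>z. G z \<partial>lborel) *\<^sub>R f x"
      using Gi by (intro integral_scaleR_left) auto
    also have "(\<integral>z. G z \<partial>lborel) = K"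
    proof -
      have "complex_of_real (\<integral>z. G z \<partial>lborel) = (\<integral>z. G z *\<^sub>R cis (z \<bullet> 0) \<partial>lborel)"
        by (simp add: scaleR_conv_of_real integral_complex_of_real)
      also have "\<dots> = of_real K" using gaussian_fourier[of "0 :: real^'n"] by (simp add: G_def K_def)
      finally show ?thesis using of_real_eq_iff by blast
    qed
    finally show ?thesis using cK by simp
  qed
  show "inv_fourier (fourier f) x = f x" using LIMSEQ_unique[OF lim1 lim2] by (simp add: g_def)
qed

subsection \<open>Convolutions\<close>

definition conv :: "(real^'n \<Rightarrow> complex) \<Rightarrow> (real^'n \<Rightarrow> complex) \<Rightarrow> real^'n::finite \<Rightarrow> complex" where
  "conv k \<psi> x = (\<integral>y. k (x - y) * \<psi> y \<partial>lborel)"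

lemma conv_alt:
  assumes [measurable]: "k \<in> borel_measurable borel" "\<psi> \<in> borel_measurable borel"
  shows "conv k \<psi> x = (\<integral>y. k y * \<psi> (x - y) \<partial>lborel)"
  using integral_reflect[of "\<lambda>z. k z * \<psi> (x - z)" x] by (simp add: conv_def)

lemma conv_corr:
  assumes [measurable]: "k \<in> borel_measurable borel" "\<psi> \<in> borel_measurable borel"
  shows "conv k \<psi> = corr (\<lambda>z. k (- z)) \<psi>"
proof
  fix x
  show "conv k \<psi> x = corr (\<lambda>z. k (- z)) \<psi> x"
    unfolding conv_alt[OF assms] corr_def
    using integral_reflect[of "\<lambda>z. k z * \<psi> (x - z)" 0] by (simp add: add.commute)
qed

lemma rapid_uminus: "rapid g \<Longrightarrow> rapid (\<lambda>z. g (- z))"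
proof -
  assume g: "rapid g"
  then have [measurable]: "g \<in> borel_measurable borel" by (rule rapid_borel)
  have "\<exists>B. \<forall>x. cmod (g (- x)) \<le> B * wt r x" for r
    using rapid_bound[OF g, of r] by (metis wt_minus)
  then show "rapid (\<lambda>z. g (- z))" by (simp add: rapid_def)
qed

lemma schwartz_conv:
  assumes "rapid k" "\<psi> \<in> schwartz" shows "conv k \<psi> \<in> schwartz"
  using assms by (simp add: conv_corr rapid_borel smooth_borel schwartz_smooth schwartz_corr rapid_uminus)

lemma conv_assoc:
  assumes "rapid f" "rapid g" "rapid h"
  shows "conv f (conv g h) = conv (conv f g) h"
proof
  fix x
  have [measurable]: "f \<in> borel_measurable borel" "g \<in> borel_measurable borel" "h \<in> borel_measurable borel"
    using assms rapid_borel by auto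
  obtain B where B: "B \<ge> 0" "\<And>x. cmod (g x) \<le> B * wt 0 x" using rapid_bound[OF assms(2)] by metis
  have "conv f (conv g h) x = (\<integral>y. (\<integral>z. f (x - y) * (g (y - z) * h z) \<partial>lborel) \<partial>lborel)"
    unfolding conv_def by simp
  also have "\<dots> = (\<integral>z. (\<integral>y. f (x - y) * (g (y - z) * h z) \<partial>lborel) \<partial>lborel)"
  proof (rule fubini_swap(1)[where g="\<lambda>y. cmod (f (x - y)) * B" and h="\<lambda>z. cmod (h z)"])
    show "integrable lborel (\<lambda>y. cmod (f (x - y)) * B)"
      using integrable_lborel_affine[OF rapid_integrable[OF assms(1)], of "-1" x] by (intro integrable_mult_left) simp
    show "integrable lborel (\<lambda>z. cmod (h z))" using rapid_integrable[OF assms(3)] by simp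
    show "norm (f (x - y) * (g (y - z) * h z)) \<le> cmod (f (x - y)) * B * cmod (h z)" for y z
      using B(2)[of "y - z"] by (auto simp: norm_mult mult.assoc intro!: mult_left_mono mult_right_mono)
  qed measurable
  also have "\<dots> = (\<integral>z. conv f g (x - z) * h z \<partial>lborel)"
  proof (intro Bochner_Integration.integral_cong refl)
    fix z
    have "(\<integral>y. f (x - y) * (g (y - z) * h z) \<partial>lborel) = (\<integral>y. f (x - y) * g (y - z) \<partial>lborel) * h z"
      by (simp add: mult.assoc[symmetric])
    also have "(\<integral>y. f (x - y) * g (y - z) \<partial>lborel) = (\<integral>y. f (x - (y + z)) * g ((y + z) - z) \<partial>lborel)"
      by (rule integral_shift[symmetric]) measurable
    also have "\<dots> = conv f g (x - z)" unfolding conv_def by (simp add: algebra_simps)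
    finally show "(\<integral>y. f (x - y) * (g (y - z) * h z) \<partial>lborel) = conv f g (x - z) * h z" .
  qed
  finally show "conv f (conv g h) x = conv (conv f g) h x" by (simp add: conv_def)
qed

lemma iter_partial_conv:
  assumes "rapid k" "slow \<psi>"
  shows "iter_partial is (conv k \<psi>) = conv k (iter_partial is \<psi>)"
proof -
  have "smooth \<psi>" using assms by (simp add: slow_def)
  then show ?thesis
    using assms iter_partial_corr[OF dom_rapid_slow[OF rapid_uminus[OF assms(1)] assms(2)], of "is"]
    by (simp add: conv_corr rapid_borel smooth_borel smooth_iter_partial)
qed

subsection \<open>Convolution kernels of Fourier multipliers\<close>

text \<open>The forward transform appears because a multiplier acts on a distribution by acting on
  its test functions: this is the reflection of the usual kernel, normalised so that
  \<open>fourier_mult_conv\<close> carries no constant.\<close>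

definition kern :: "(real^'n \<Rightarrow> complex) \<Rightarrow> real^'n::finite \<Rightarrow> complex" where
  "kern a x = of_real (fconst TYPE('n)) * fourier a x"

lemma schwartz_kern: "a \<in> schwartz \<Longrightarrow> kern a \<in> schwartz"
  unfolding kern_def[abs_def] by (intro schwartz_cmult schwartz_fourier)

lemma fourier_mult_conv:
  fixes a \<psi> :: "real^'n::finite \<Rightarrow> complex"
  assumes a: "a \<in> schwartz" and \<psi>: "\<psi> \<in> schwartz"
  shows "fourier (\<lambda>\<xi>. a \<xi> * inv_fourier \<psi> \<xi>) = conv (kern a) \<psi>"
proof
  fix x :: "real^'n"
  let ?c = "complex_of_real (fconst TYPE('n))"
  have [measurable]: "a \<in> borel_measurable borel" "\<psi> \<in> borel_measurable borel"
    using a \<psi> schwartz_smooth smooth_borel by blast+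
  let ?F = "\<lambda>\<xi> y. (cis (- (\<xi> \<bullet> (x - y))) * a \<xi>) * \<psi> y"
  have "fourier (\<lambda>\<xi>. a \<xi> * inv_fourier \<psi> \<xi>) x = ?c * (\<integral>\<xi>. ?c * (\<integral>y. ?F \<xi> y \<partial>lborel) \<partial>lborel)"
    unfolding fourier_eq
  proof (intro arg_cong[of _ _ "\<lambda>t. ?c * t"] Bochner_Integration.integral_cong refl)
    fix \<xi>
    have "cis (- (\<xi> \<bullet> x)) * (a \<xi> * inv_fourier \<psi> \<xi>) = ?c * ((cis (- (\<xi> \<bullet> x)) * a \<xi>) * (\<integral>y. cis (\<xi> \<bullet> y) * \<psi> y \<partial>lborel))"
      by (simp add: inv_fourier_def fconst_def mult_ac)
    also have "\<dots> = ?c * (\<integral>y. (cis (- (\<xi> \<bullet> x)) * a \<xi>) * (cis (\<xi> \<bullet> y) * \<psi> y) \<partial>lborel)"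
      by (subst integral_mult_right_zero) simp
    also have "(\<lambda>y. (cis (- (\<xi> \<bullet> x)) * a \<xi>) * (cis (\<xi> \<bullet> y) * \<psi> y)) = ?F \<xi>"
    proof
      fix y
      have "cis (- (\<xi> \<bullet> (x - y))) = cis (- (\<xi> \<bullet> x)) * cis (\<xi> \<bullet> y)" by (simp add: cis_mult inner_diff_right)
      then show "(cis (- (\<xi> \<bullet> x)) * a \<xi>) * (cis (\<xi> \<bullet> y) * \<psi> y) = ?F \<xi> y" by (simp add: mult_ac)
    qed
    finally show "cis (- (\<xi> \<bullet> x)) * (a \<xi> * inv_fourier \<psi> \<xi>) = ?c * (\<integral>y. ?F \<xi> y \<partial>lborel)" .
  qed
  also have "\<dots> = ?c * (?c * (\<integral>\<xi>. (\<integral>y. ?F \<xi> y \<partial>lborel) \<partial>lborel))"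
    by (simp only: integral_mult_right_zero)
  also have "(\<integral>\<xi>. (\<integral>y. ?F \<xi> y \<partial>lborel) \<partial>lborel) = (\<integral>y. (\<integral>\<xi>. ?F \<xi> y \<partial>lborel) \<partial>lborel)"
  proof (rule fubini_swap(1)[where g="\<lambda>\<xi>. cmod (a \<xi>)" and h="\<lambda>y. cmod (\<psi> y)"])
    show "integrable lborel (\<lambda>\<xi>. cmod (a \<xi>))" "integrable lborel (\<lambda>\<xi>. cmod (\<psi> \<xi>))"
      using schwartz_integrable a \<psi> by auto
  qed (auto simp: norm_mult)
  also have "\<dots> = (\<integral>y. (\<integral>\<xi>. cis (- (\<xi> \<bullet> (x - y))) * a \<xi> \<partial>lborel) * \<psi> y \<partial>lborel)"
    by (simp only: integral_mult_left_zero)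
  also have "?c * (?c * \<dots>) = (\<integral>y. ?c * (?c * ((\<integral>\<xi>. cis (- (\<xi> \<bullet> (x - y))) * a \<xi> \<partial>lborel) * \<psi> y)) \<partial>lborel)"
    by (simp only: integral_mult_right_zero)
  also have "\<dots> = conv (kern a) \<psi> x"
    unfolding conv_def kern_def fourier_eq by (simp only: mult.assoc)
  finally show "fourier (\<lambda>\<xi>. a \<xi> * inv_fourier \<psi> \<xi>) x = conv (kern a) \<psi> x" .
qed

lemma fourier_cmult: "fourier (\<lambda>x. c * f x) = (\<lambda>\<xi>. c * fourier f \<xi>)"
proof
  fix \<xi>
  have "(\<lambda>x. cis (- (x \<bullet> \<xi>)) * (c * f x)) = (\<lambda>x. c * (cis (- (x \<bullet> \<xi>)) * f x))" by (simp add: mult_ac)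
  then show "fourier (\<lambda>x. c * f x) \<xi> = c * fourier f \<xi>"
    unfolding fourier_eq by (simp only: integral_mult_right_zero) (simp only: mult_ac)
qed

lemma conv_kern:
  fixes a b :: "real^'n::finite \<Rightarrow> complex"
  assumes "a \<in> schwartz" "b \<in> schwartz"
  shows "conv (kern a) (kern b) = kern (\<lambda>\<xi>. a \<xi> * b \<xi>)"
proof -
  let ?c = "complex_of_real (fconst TYPE('n))"
  have "inv_fourier (kern b) = (\<lambda>\<xi>. ?c * b \<xi>)"
    using fourier_inversion[OF assms(2)]
    by (simp add: kern_def[abs_def] inv_fourier_eq_fourier[abs_def] fourier_cmult fun_eq_iff)
  then have "conv (kern a) (kern b) = fourier (\<lambda>\<xi>. a \<xi> * (?c * b \<xi>))"
    using fourier_mult_conv[OF assms(1) schwartz_kern[OF assms(2)]] by simp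
  also have "(\<lambda>\<xi>. a \<xi> * (?c * b \<xi>)) = (\<lambda>\<xi>. ?c * (a \<xi> * b \<xi>))" by (simp add: mult_ac)
  finally show ?thesis by (simp add: fourier_cmult kern_def[abs_def])
qed

section \<open>Moments of kernels\<close>

text \<open>Monomials indexed by lists of coordinates, to match \<open>iter_partial\<close>; a
  multiindex occurs once for each ordering of its entries.\<close>

definition xpow :: "'n list \<Rightarrow> real^'n::finite \<Rightarrow> complex" where
  "xpow is y = (\<Prod>i\<leftarrow>is. of_real (y $ i))"

lemma xpow_simps [simp]: "xpow [] y = 1" "xpow (i # is) y = of_real (y $ i) * xpow is y"
  by (simp_all add: xpow_def)

lemma integral_fourier:
  fixes f :: "real^'n::finite \<Rightarrow> complex"
  assumes "f \<in> schwartz"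
  shows "of_real (fconst TYPE('n)) * (\<integral>\<xi>. fourier f \<xi> \<partial>lborel) = f 0"
  using fun_cong[OF fourier_inversion[OF assms], of 0] by (simp add: inv_fourier_def fconst_def)

lemma xpow_fourier:
  assumes "a \<in> schwartz"
  shows "\<exists>g\<in>schwartz. (\<forall>\<xi>. xpow is \<xi> * fourier a \<xi> = fourier g \<xi>) \<and> g = (\<lambda>x. (- \<i>) ^ length is * iter_partial is a x)"
proof (induction "is")
  case (Cons i "is")
  then obtain g where g: "g \<in> schwartz" "\<And>\<xi>. xpow is \<xi> * fourier a \<xi> = fourier g \<xi>"
    "g = (\<lambda>x. (- \<i>) ^ length is * iter_partial is a x)" by blast
  show ?case
  proof (intro bexI conjI allI)
    show "(\<lambda>x. - \<i> * partial_deriv i g x) \<in> schwartz" by (intro schwartz_cmult schwartz_partial_deriv g)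
    show "xpow (i # is) \<xi> * fourier a \<xi> = fourier (\<lambda>x. - \<i> * partial_deriv i g x) \<xi>" for \<xi>
      using g(2)[of \<xi>] fourier_partial_deriv[OF g(1), of \<xi> i] by (simp add: mult.assoc)
    show "(\<lambda>x. - \<i> * partial_deriv i g x) = (\<lambda>x. (- \<i>) ^ length (i # is) * iter_partial (i # is) a x)"
      unfolding g(3) using assms
      by (subst partial_deriv_mult_smooth) (auto simp: smooth_const smooth_iter_partial schwartz_smooth)
  qed
qed (use assms in auto)

text \<open>Multiplying a Fourier transform by a monomial differentiates \<open>a\<close>, and the
  normalised integral of a Fourier transform is, by inversion, the value of the function at
  0.\<close>

lemma kern_moments:
  fixes a :: "real^'n::finite \<Rightarrow> complex"
  assumes "a \<in> schwartz"
  shows "(\<integral>y. xpow is y * kern a y \<partial>lborel) = (- \<i>) ^ length is * iter_partial is a 0"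
proof -
  obtain g where g: "g \<in> schwartz" "\<And>\<xi>. xpow is \<xi> * fourier a \<xi> = fourier g \<xi>"
    "g = (\<lambda>x. (- \<i>) ^ length is * iter_partial is a x)" using xpow_fourier[OF assms] by blast
  have "(\<integral>y. xpow is y * kern a y \<partial>lborel) = (\<integral>y. of_real (fconst TYPE('n)) * fourier g y \<partial>lborel)"
    by (simp add: kern_def g(2)[symmetric] mult_ac)
  also have "\<dots> = g 0" using integral_fourier[OF g(1)] by simp
  finally show ?thesis by (simp add: g(3))
qed

lemma kern_scale:
  fixes a :: "real^'n::finite \<Rightarrow> complex"
  assumes "a \<in> borel_measurable borel" "t > 0"
  shows "kern (\<lambda>\<xi>. a ((1 / t) *\<^sub>R \<xi>)) x = of_real (t ^ CARD('n)) * kern a (t *\<^sub>R x)"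
proof -
  have [measurable]: "a \<in> borel_measurable borel" by fact
  have "(\<integral>\<xi>. cis (- (\<xi> \<bullet> x)) * a ((1 / t) *\<^sub>R \<xi>) \<partial>lborel)
      = of_real (\<bar>t\<bar> ^ DIM(real^'n)) * (\<integral>\<xi>. cis (- ((0 + t *\<^sub>R \<xi>) \<bullet> x)) * a ((1 / t) *\<^sub>R (0 + t *\<^sub>R \<xi>)) \<partial>lborel)"
    using assms by (intro integral_lborel_affine) auto
  also have "\<dots> = of_real (t ^ CARD('n)) * (\<integral>\<xi>. cis (- (\<xi> \<bullet> (t *\<^sub>R x))) * a \<xi> \<partial>lborel)"
    using assms(2) by simp
  finally show ?thesis by (simp add: kern_def fourier_eq mult_ac)
qed

lemma fourier_diff:
  assumes "integrable lborel f" "integrable lborel g"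
  shows "fourier (\<lambda>x. f x - g x) \<xi> = fourier f \<xi> - fourier g \<xi>"
proof -
  have i: "integrable lborel (\<lambda>x. cis (- (x \<bullet> \<xi>)) * h x)" if "integrable lborel h" for h :: "real^'a \<Rightarrow> complex"
  proof (rule integrable_bound_real[where g="\<lambda>x. cmod (h x)"])
    have [measurable]: "h \<in> borel_measurable borel" using that by auto
    show "(\<lambda>x. cis (- (x \<bullet> \<xi>)) * h x) \<in> borel_measurable lborel" by measurable
  qed (use that in \<open>auto simp: norm_mult\<close>)
  show ?thesis
    unfolding fourier_eq right_diff_distrib using i[OF assms(1)] i[OF assms(2)]
    by (simp add: right_diff_distrib)
qed

lemma kern_diff:
  assumes "a \<in> schwartz" "b \<in> schwartz"
  shows "kern (\<lambda>\<xi>. a \<xi> - b \<xi>) = (\<lambda>x. kern a x - kern b x)"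
  using fourier_diff[OF schwartz_integrable[OF assms(1)] schwartz_integrable[OF assms(2)]]
  by (auto simp: kern_def right_diff_distrib)

subsection \<open>Taylor expansion by averaging\<close>

definition unit_interval :: "real measure" where
  "unit_interval = restrict_space lborel {0..1}"

text \<open>Clamping keeps integrands along a segment continuous and bounded for every real
  parameter. \<open>has_derivative_integral\<close> asks for its bounds at all points of the type,
  not only on the space of the measure.\<close>

definition clamp01 :: "real \<Rightarrow> real" where
  "clamp01 t = max 0 (min 1 t)"

lemma clamp01: "0 \<le> clamp01 t" "clamp01 t \<le> 1" "t \<in> {0..1} \<Longrightarrow> clamp01 t = t"
  by (auto simp: clamp01_def)

lemma clamp01_continuous: "continuous_on S clamp01"
  unfolding clamp01_def by (intro continuous_intros)

lemma prob_space_unit_interval: "prob_space unit_interval"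
  by (rule prob_spaceI) (simp add: unit_interval_def emeasure_restrict_space space_restrict_space)

interpretation unit_interval: prob_space unit_interval
  by (rule prob_space_unit_interval)

lemma borel_measurable_unit_interval:
  "continuous_on UNIV f \<Longrightarrow> f \<in> borel_measurable unit_interval"
  unfolding unit_interval_def
  by (intro measurable_restrict_space1) (simp add: borel_measurable_continuous_onI)

lemma integrable_unit_interval:
  fixes f :: "real \<Rightarrow> complex"
  assumes "continuous_on UNIV f" "\<And>t. cmod (f t) \<le> B"
  shows "integrable unit_interval f"
  by (rule unit_interval.integrable_const_bound[of _ B])
     (use assms borel_measurable_unit_interval in auto)

text \<open>The factor \<open>t ^ m\<close> is what the chain rule leaves behind after
  \<open>m\<close> derivatives of y \<mapsto> g (t y), so these averages are closed under
  differentiation.\<close>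

definition ray_avg :: "nat \<Rightarrow> (real^'n \<Rightarrow> complex) \<Rightarrow> real^'n::finite \<Rightarrow> complex" where
  "ray_avg m g y = (\<integral>t. of_real (clamp01 t ^ m) * g (clamp01 t *\<^sub>R y) \<partial>unit_interval)"

lemma ray_in_cball: "norm (clamp01 t *\<^sub>R y) \<le> norm y"
  using clamp01(1,2)[of t] by (simp add: mult_left_le_one_le)

lemma ray_continuous:
  assumes "smooth g"
  shows "continuous_on S (\<lambda>t. of_real (clamp01 t ^ m) * g (clamp01 t *\<^sub>R y))"
  by (intro continuous_intros clamp01_continuous continuous_on_compose2[OF smooth_continuous[OF assms, of UNIV]]) auto

lemma ray_bound:
  assumes "cmod (g (clamp01 t *\<^sub>R y)) \<le> B"
  shows "cmod (of_real (clamp01 t ^ m) * g (clamp01 t *\<^sub>R y)) \<le> B"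
proof -
  have "cmod (of_real (clamp01 t ^ m) * g (clamp01 t *\<^sub>R y)) = clamp01 t ^ m * cmod (g (clamp01 t *\<^sub>R y))"
    using clamp01(1) by (simp add: norm_mult norm_power)
  also have "\<dots> \<le> 1 * B" using clamp01(1,2)[of t] assms by (intro mult_mono power_le_one) auto
  finally show ?thesis by simp
qed

lemma ray_integrable:
  assumes "smooth g"
  shows "integrable unit_interval (\<lambda>t. of_real (clamp01 t ^ m) * g (clamp01 t *\<^sub>R y))"
proof -
  obtain B where B: "\<And>is x. length is \<le> 0 \<Longrightarrow> x \<in> cball 0 (norm y) \<Longrightarrow> cmod (iter_partial is g x) \<le> B"
    using smooth_bounded_compact[OF assms compact_cball] by metis
  have "cmod (g (clamp01 t *\<^sub>R y)) \<le> B" for t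
    using B[of "[]" "clamp01 t *\<^sub>R y"] ray_in_cball[of t y] by simp
  then show ?thesis by (intro integrable_unit_interval[of _ B] ray_continuous assms ray_bound)
qed

lemma ray_avg_bound:
  assumes "smooth g" "\<And>t. t \<in> {0..1} \<Longrightarrow> cmod (g (t *\<^sub>R y)) \<le> B"
  shows "cmod (ray_avg m g y) \<le> B"
proof -
  have B: "cmod (g (clamp01 t *\<^sub>R y)) \<le> B" for t using assms(2)[of "clamp01 t"] clamp01 by simp
  have "cmod (ray_avg m g y) \<le> (\<integral>t. B \<partial>unit_interval)"
    unfolding ray_avg_def
  proof (rule integral_bound_real)
    show "norm (of_real (clamp01 t ^ m) * g (clamp01 t *\<^sub>R y)) \<le> B" for t by (rule ray_bound) (rule B)
  qed (use borel_measurable_unit_interval[OF ray_continuous[OF assms(1)]] in auto)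
  then show ?thesis using unit_interval.prob_space by simp
qed

lemma ray_avg_has_derivative:
  fixes g :: "real^'n::finite \<Rightarrow> complex"
  assumes g: "smooth g"
  shows "(ray_avg m g has_derivative (\<lambda>h. \<Sum>i\<in>UNIV. of_real (h $ i) * ray_avg (Suc m) (partial_deriv i g) y)) (at y)"
proof -
  obtain B where B: "B \<ge> 0" "\<And>is x. length is \<le> 1 \<Longrightarrow> x \<in> cball 0 (norm y + 1) \<Longrightarrow> cmod (iter_partial is g x) \<le> B"
    using smooth_bounded_compact[OF g compact_cball] by metis
  let ?D = "\<lambda>y t h. of_real (clamp01 t ^ m) * (\<Sum>i\<in>UNIV. of_real ((clamp01 t *\<^sub>R h) $ i) * partial_deriv i g (clamp01 t *\<^sub>R y))"
  have "((\<lambda>y. \<integral>t. of_real (clamp01 t ^ m) * g (clamp01 t *\<^sub>R y) \<partial>unit_interval) has_derivative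
     (\<lambda>h. \<integral>t. ?D y t h \<partial>unit_interval)) (at y)"
  proof (rule has_derivative_integral[where r=1 and D="?D" and G="\<lambda>t. real CARD('n) * B"])
    fix y' t and h :: "real^'n" assume y': "y' \<in> ball y 1"
    have "((\<lambda>y. g (clamp01 t *\<^sub>R y)) has_derivative (\<lambda>h. \<Sum>i\<in>UNIV. of_real ((clamp01 t *\<^sub>R h) $ i) * partial_deriv i g (clamp01 t *\<^sub>R y'))) (at y')"
      by (rule has_derivative_compose[OF _ smooth_has_derivative[OF g]]) (auto intro!: derivative_eq_intros)
    then show "((\<lambda>y. of_real (clamp01 t ^ m) * g (clamp01 t *\<^sub>R y)) has_derivative ?D y' t) (at y')"
      by (rule has_derivative_mult_right)
    have "norm y' \<le> norm y + 1"
      using y' norm_triangle_ineq2[of y' y] by (simp add: dist_norm norm_minus_commute)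
    then have in_cb: "clamp01 t *\<^sub>R y' \<in> cball 0 (norm y + 1)" using ray_in_cball[of t y'] by simp
    have "cmod (of_real (clamp01 t ^ m) * (\<Sum>i\<in>UNIV. of_real ((clamp01 t *\<^sub>R h) $ i) * partial_deriv i g (clamp01 t *\<^sub>R y')))
       = clamp01 t ^ m * cmod (\<Sum>i\<in>UNIV. of_real ((clamp01 t *\<^sub>R h) $ i) * partial_deriv i g (clamp01 t *\<^sub>R y'))"
      using clamp01(1) by (simp add: norm_mult norm_power)
    also have "\<dots> \<le> 1 * (\<Sum>i\<in>(UNIV::'n set). norm h * B)"
    proof (intro mult_mono power_le_one order_trans[OF norm_sum] sum_mono)
      fix i
      have "\<bar>(clamp01 t *\<^sub>R h) $ i\<bar> \<le> norm h"
        using component_le_norm_cart[of "clamp01 t *\<^sub>R h" i] ray_in_cball[of t h] by linarith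
      moreover have "cmod (partial_deriv i g (clamp01 t *\<^sub>R y')) \<le> B"
        using B(2)[of "[i]", OF _ in_cb] by simp
      ultimately show "cmod (of_real ((clamp01 t *\<^sub>R h) $ i) * partial_deriv i g (clamp01 t *\<^sub>R y')) \<le> norm h * B"
        unfolding norm_mult norm_of_real by (intro mult_mono) auto
    qed (use clamp01 B in \<open>auto intro: sum_nonneg\<close>)
    finally show "norm (?D y' t h) \<le> real CARD('n) * B * norm h" by (simp add: mult_ac)
  next
    show "integrable unit_interval (\<lambda>t. of_real (clamp01 t ^ m) * g (clamp01 t *\<^sub>R y'))" for y'
      by (rule ray_integrable[OF g])
    show "(\<lambda>t. ?D y t h) \<in> borel_measurable unit_interval" for h
      by (intro borel_measurable_unit_interval continuous_intros clamp01_continuous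
          continuous_on_compose2[OF smooth_continuous[OF smooth_partial_deriv[OF g], of UNIV]]) auto
  qed auto
  also have "(\<lambda>y. \<integral>t. of_real (clamp01 t ^ m) * g (clamp01 t *\<^sub>R y) \<partial>unit_interval) = ray_avg m g"
    by (auto simp: ray_avg_def)
  also have "(\<lambda>h. \<integral>t. ?D y t h \<partial>unit_interval) = (\<lambda>h. \<Sum>i\<in>UNIV. of_real (h $ i) * ray_avg (Suc m) (partial_deriv i g) y)"
  proof
    fix h :: "real^'n"
    have "(\<integral>t. ?D y t h \<partial>unit_interval) = (\<integral>t. (\<Sum>i\<in>UNIV. of_real (h $ i) * (of_real (clamp01 t ^ Suc m) * partial_deriv i g (clamp01 t *\<^sub>R y))) \<partial>unit_interval)"
      by (simp add: sum_distrib_left mult_ac)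
    also have "\<dots> = (\<Sum>i\<in>UNIV. \<integral>t. of_real (h $ i) * (of_real (clamp01 t ^ Suc m) * partial_deriv i g (clamp01 t *\<^sub>R y)) \<partial>unit_interval)"
      by (intro Bochner_Integration.integral_sum integrable_mult_right ray_integrable smooth_partial_deriv g)
    finally show "(\<integral>t. ?D y t h \<partial>unit_interval) = (\<Sum>i\<in>UNIV. of_real (h $ i) * ray_avg (Suc m) (partial_deriv i g) y)"
      by (simp only: integral_mult_right_zero ray_avg_def)
  qed
  finally show ?thesis .
qed

lemma partial_deriv_ray_avg:
  assumes "smooth g" shows "partial_deriv i (ray_avg m g) = ray_avg (Suc m) (partial_deriv i g)"
  using partial_deriv_eq[OF ray_avg_has_derivative[OF assms]] by (auto simp: sum_axis)

lemma iter_partial_ray_avg: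
  assumes "smooth g" shows "iter_partial is (ray_avg m g) = ray_avg (m + length is) (iter_partial is g)"
  by (induction "is") (auto simp: partial_deriv_ray_avg smooth_iter_partial assms)

lemma smooth_ray_avg:
  fixes g :: "real^'n::finite \<Rightarrow> complex"
  assumes "smooth g" shows "smooth (ray_avg m g)"
proof (rule smooth_coinduct[where C="{ray_avg m g | m g. smooth g}"])
  show "ray_avg m g \<in> {ray_avg m g | m g. smooth g}" using assms by auto
  fix h :: "real^'n \<Rightarrow> complex" and x i assume "h \<in> {ray_avg m g | m g. smooth g}"
  then obtain m g where g: "h = ray_avg m g" "smooth g" by auto
  show "h differentiable at x" using ray_avg_has_derivative[OF g(2)] g(1) by (auto simp: differentiable_def)
  show "partial_deriv i h \<in> {ray_avg m g | m g. smooth g}"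
    using partial_deriv_ray_avg[OF g(2), of i m] smooth_partial_deriv[OF g(2), of i] g(1) by auto
qed

text \<open>Hadamard's lemma: the fundamental theorem of calculus along the segment from 0 to
  \<open>y\<close>.\<close>

lemma ray_avg_expand:
  fixes g :: "real^'n::finite \<Rightarrow> complex"
  assumes g: "smooth g"
  shows "g y = g 0 + (\<Sum>i\<in>UNIV. of_real (y $ i) * ray_avg 0 (partial_deriv i g) y)"
proof -
  have hv: "((\<lambda>t. g (t *\<^sub>R y)) has_vector_derivative (\<Sum>i\<in>UNIV. of_real (y $ i) * partial_deriv i g (t *\<^sub>R y))) (at t within {0..1})" for t
  proof -
    have "((\<lambda>t. g (t *\<^sub>R y)) has_derivative (\<lambda>s. \<Sum>i\<in>UNIV. of_real ((s *\<^sub>R y) $ i) * partial_deriv i g (t *\<^sub>R y))) (at t within {0..1})"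
      by (rule has_derivative_compose[OF _ smooth_has_derivative[OF g]]) (auto intro!: derivative_eq_intros)
    moreover have "(\<lambda>s. \<Sum>i\<in>UNIV. of_real ((s *\<^sub>R y) $ i) * partial_deriv i g (t *\<^sub>R y))
       = (\<lambda>s. s *\<^sub>R (\<Sum>i\<in>UNIV. of_real (y $ i) * partial_deriv i g (t *\<^sub>R y)))"
    proof
      fix s
      have "of_real ((s *\<^sub>R y) $ i) * z = s *\<^sub>R (of_real (y $ i) * z)" for i and z :: complex
        by (simp add: scaleR_conv_of_real[where 'a=complex] mult.assoc)
      then show "(\<Sum>i\<in>UNIV. of_real ((s *\<^sub>R y) $ i) * partial_deriv i g (t *\<^sub>R y))
         = s *\<^sub>R (\<Sum>i\<in>UNIV. of_real (y $ i) * partial_deriv i g (t *\<^sub>R y))"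
        unfolding scaleR_sum_right by (intro sum.cong refl)
    qed
    ultimately show ?thesis
      unfolding has_vector_derivative_def by argo
  qed
  have "g y - g 0 = (\<integral>t. indicator {0..1} t *\<^sub>R (\<Sum>i\<in>UNIV. of_real (y $ i) * partial_deriv i g (t *\<^sub>R y)) \<partial>lborel)"
  proof (subst integral_FTC_atLeastAtMost[of 0 1 "\<lambda>t. g (t *\<^sub>R y)"])
    show "continuous_on {0..1} (\<lambda>t. \<Sum>i\<in>UNIV. of_real (y $ i) * partial_deriv i g (t *\<^sub>R y))"
      by (intro continuous_intros continuous_on_compose2[OF smooth_continuous[OF smooth_partial_deriv[OF g], of UNIV]]) auto
  qed (use hv in auto)
  also have "\<dots> = (\<integral>t. (\<Sum>i\<in>UNIV. of_real (y $ i) * partial_deriv i g (t *\<^sub>R y)) \<partial>unit_interval)"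
    unfolding unit_interval_def by (rule integral_restrict_space[symmetric]) simp
  also have "\<dots> = (\<integral>t. (\<Sum>i\<in>UNIV. of_real (y $ i) * (of_real (clamp01 t ^ 0) * partial_deriv i g (clamp01 t *\<^sub>R y))) \<partial>unit_interval)"
    by (intro Bochner_Integration.integral_cong refl) (auto simp: unit_interval_def space_restrict_space clamp01)
  also have "\<dots> = (\<Sum>i\<in>UNIV. \<integral>t. of_real (y $ i) * (of_real (clamp01 t ^ 0) * partial_deriv i g (clamp01 t *\<^sub>R y)) \<partial>unit_interval)"
    by (intro Bochner_Integration.integral_sum integrable_mult_right ray_integrable smooth_partial_deriv g)
  also have "\<dots> = (\<Sum>i\<in>UNIV. of_real (y $ i) * ray_avg 0 (partial_deriv i g) y)"
    by (simp only: integral_mult_right_zero ray_avg_def)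
  finally show ?thesis by (simp add: algebra_simps)
qed

text \<open>Iteration of Hadamard's lemma. The coefficients are kept as smooth functions of
  \<open>y\<close>, because a distribution will be applied to the Taylor remainder, for which a mere
  bound on its values would not suffice.\<close>

fun taylor_coeff :: "'n list \<Rightarrow> (real^'n::finite \<Rightarrow> complex) \<Rightarrow> real^'n \<Rightarrow> complex" where
  "taylor_coeff [] f = f"
| "taylor_coeff (i # is) f = ray_avg 0 (partial_deriv i (taylor_coeff is f))"

lemma smooth_taylor_coeff: "smooth f \<Longrightarrow> smooth (taylor_coeff is f)"
  by (induction "is") (auto intro: smooth_ray_avg smooth_partial_deriv)

text \<open>Averaging over segments towards the origin never exceeds the supremum on the segment.
  Derivatives of a coefficient are averages of derivatives of \<open>f\<close>, so the same bound
  serves them.\<close>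

lemma taylor_coeff_bound:
  assumes "smooth f" "\<And>t. t \<in> {0..1} \<Longrightarrow> cmod (iter_partial (js @ is) f (t *\<^sub>R y)) \<le> B"
  shows "cmod (iter_partial js (taylor_coeff is f) y) \<le> B"
  using assms(2)
proof (induction "is" arbitrary: js y)
  case Nil
  then show ?case using Nil[of 1] by simp
next
  case (Cons i "is")
  have e: "iter_partial js (taylor_coeff (i # is) f) = ray_avg (length js) (iter_partial (js @ [i]) (taylor_coeff is f))"
    using iter_partial_ray_avg[OF smooth_partial_deriv[OF smooth_taylor_coeff[OF assms(1)]], of js 0]
    by (simp add: iter_partial_append)
  show ?case unfolding e
  proof (rule ray_avg_bound)
    show "smooth (iter_partial (js @ [i]) (taylor_coeff is f))"
      by (intro smooth_iter_partial smooth_taylor_coeff assms)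
    fix t :: real assume t: "t \<in> {0..1}"
    show "cmod (iter_partial (js @ [i]) (taylor_coeff is f) (t *\<^sub>R y)) \<le> B"
    proof (rule Cons.IH)
      fix s :: real assume s: "s \<in> {0..1}"
      have "s * t \<in> {0..1}" using s t by (auto intro: mult_le_one)
      from Cons.prems[OF this] show "cmod (iter_partial ((js @ [i]) @ is) f (s *\<^sub>R t *\<^sub>R y)) \<le> B" by simp
    qed
  qed
qed

lemma finite_lists_length: "finite {is :: 'n::finite list. length is = m}"
  using finite_lists_length_eq[of "UNIV :: 'n set" m] by simp

lemma sum_lists_Suc:
  "(\<Sum>is\<in>{is :: 'n::finite list. length is = Suc m}. F is) = (\<Sum>is\<in>{is. length is = m}. \<Sum>i\<in>UNIV. F (i # is))"
  (is "?l = ?r")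
proof -
  have "?r = (\<Sum>(is, i)\<in>{is :: 'n list. length is = m} \<times> UNIV. F (i # is))"
    by (simp add: sum.cartesian_product)
  also have "\<dots> = ?l"
    by (rule sum.reindex_bij_witness[where i="\<lambda>is. (tl is, hd is)" and j="\<lambda>(is, i). i # is"])
       (auto simp: length_Suc_conv)
  finally show ?thesis ..
qed

lemma taylor_expansion:
  fixes f :: "real^'n::finite \<Rightarrow> complex"
  assumes "smooth f"
  shows "f y = (\<Sum>m<M. \<Sum>is\<in>{is. length is = m}. xpow is y * taylor_coeff is f 0)
    + (\<Sum>is\<in>{is. length is = M}. xpow is y * taylor_coeff is f y)"
proof (induction M)
  case (Suc M)
  have "(\<Sum>is\<in>{is. length is = M}. xpow is y * taylor_coeff is f y)
     = (\<Sum>is\<in>{is. length is = M}. xpow is y * taylor_coeff is f 0 + (\<Sum>i\<in>UNIV. xpow (i # is) y * taylor_coeff (i # is) f y))"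
  proof (rule sum.cong[OF refl])
    fix "is" :: "'n list"
    show "xpow is y * taylor_coeff is f y = xpow is y * taylor_coeff is f 0 + (\<Sum>i\<in>UNIV. xpow (i # is) y * taylor_coeff (i # is) f y)"
      by (subst ray_avg_expand[OF smooth_taylor_coeff[OF assms]])
         (simp add: distrib_left sum_distrib_left mult_ac)
  qed
  then have "(\<Sum>is\<in>{is. length is = M}. xpow is y * taylor_coeff is f y)
     = (\<Sum>is\<in>{is. length is = M}. xpow is y * taylor_coeff is f 0) + (\<Sum>is\<in>{is. length is = Suc M}. xpow is y * taylor_coeff is f y)"
    by (simp add: sum.distrib sum_lists_Suc)
  with Suc show ?case by simp
qed simp

lemma norm_xpow: "cmod (xpow is y) \<le> norm y ^ length is"
proof (induction "is")
  case (Cons i "is")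
  then show ?case using component_le_norm_cart[of y i] by (auto simp: norm_mult intro!: mult_mono)
qed simp

lemma slow_xpow: "slow (xpow is)"
proof (induction "is")
  case Nil
  then show ?case using slow_const[of 1] by (simp add: xpow_def[abs_def])
next
  case (Cons i "is")
  have "xpow (i # is) = (\<lambda>y. of_real (y $ i) * xpow is y)" by auto
  then show ?case using slow_mult[OF slow_coord[of i] Cons] by simp
qed

lemma norm_power_le_wt: "norm y ^ m \<le> wt (real m) y"
  unfolding wt_nat by (intro power_mono) auto

text \<open>The vanishing moments of the kernel replace a function by its Taylor remainder.\<close>

lemma corr_cancellation:
  fixes k f :: "real^'n::finite \<Rightarrow> complex"
  assumes k: "rapid k" and f: "slow f"
    and mom: "\<And>is. length is < M \<Longrightarrow> (\<integral>y. xpow is y * k y \<partial>lborel) = 0"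
    and B: "\<And>is x. length is = M \<Longrightarrow> cmod (iter_partial is f x) \<le> B * wt r x"
  shows "cmod (corr k f v) \<le> real (CARD('n) ^ M) * B * wt r v * (\<integral>y. cmod (k y) * (norm y ^ M * wt \<bar>r\<bar> y) \<partial>lborel)"
proof -
  define g where "g y = f (y + v)" for y
  have sf: "smooth f" using f by (simp add: slow_def)
  then have sg: "smooth g" unfolding g_def using smooth_affine[of f 1 v] by simp
  have ig: "iter_partial is g = (\<lambda>y. iter_partial is f (y + v))" for "is"
    unfolding g_def using iter_partial_affine[OF sf, of "is" 1 v] by simp
  have [measurable]: "k \<in> borel_measurable borel" using k by (rule rapid_borel)
  have [measurable]: "xpow is \<in> borel_measurable borel" for "is" :: "'n list"
    using slow_xpow[of "is"] smooth_borel by (auto simp: slow_def)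
  have [measurable]: "taylor_coeff is g \<in> borel_measurable borel" for "is"
    by (intro smooth_borel smooth_taylor_coeff sg)
  let ?L = "{is :: 'n list. length is = M}"
  have cardL: "card ?L = CARD('n) ^ M" using card_lists_length_eq[of "UNIV :: 'n set" M] by simp
  have B0: "B \<ge> 0"
  proof -
    obtain "is" :: "'n list" where "length is = M" using Ex_list_of_length by blast
    from order_trans[OF norm_ge_zero B[OF this, of 0]] show ?thesis by simp
  qed
  let ?w = "\<lambda>y. cmod (k y) * (norm y ^ M * wt \<bar>r\<bar> y)"
  have wi: "integrable lborel ?w"
  proof (rule integrable_bound_real[OF rapid_integrable_wt[OF k, of "real M + \<bar>r\<bar>"]])
    fix y :: "real^'n"
    have "norm y ^ M * wt \<bar>r\<bar> y \<le> wt (real M + \<bar>r\<bar>) y"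
      unfolding wt_mult[symmetric] by (intro mult_right_mono norm_power_le_wt) auto
    then show "norm (?w y) \<le> cmod (k y) * wt (real M + \<bar>r\<bar>) y" by (simp add: mult_left_mono)
  qed measurable
  \<comment> \<open>The derivative of \<open>f\<close> is evaluated at
    \<open>v + t *\<^sub>R y\<close>; Peetre's inequality separates the weight in \<open>v\<close>
    from a factor in \<open>y\<close> that is integrable against \<open>k\<close>.\<close>
  have rem: "cmod (k y * (xpow is y * taylor_coeff is g y)) \<le> B * wt r v * ?w y" if "is \<in> ?L" for "is" y
  proof -
    have "cmod (iter_partial [] (taylor_coeff is g) y) \<le> B * (wt r v * wt \<bar>r\<bar> y)"
    proof (rule taylor_coeff_bound[OF sg])
      fix t :: real assume t: "t \<in> {0..1}"
      have "cmod (iter_partial is g (t *\<^sub>R y)) \<le> B * wt r (v + t *\<^sub>R y)"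
        using B[of "is" "t *\<^sub>R y + v"] that by (simp add: ig add.commute)
      also have "\<dots> \<le> B * (wt r v * wt \<bar>r\<bar> (t *\<^sub>R y))"
        using B0 by (intro mult_left_mono wt_peetre)
      also have "\<dots> \<le> B * (wt r v * wt \<bar>r\<bar> y)"
      proof -
        have "norm (t *\<^sub>R y) \<le> norm y" using t by (simp add: mult_left_le_one_le)
        then have "wt \<bar>r\<bar> (t *\<^sub>R y) \<le> wt \<bar>r\<bar> y" unfolding wt_def by (intro powr_mono2) auto
        then show ?thesis using B0 by (intro mult_left_mono) auto
      qed
      finally show "cmod (iter_partial ([] @ is) g (t *\<^sub>R y)) \<le> B * (wt r v * wt \<bar>r\<bar> y)" by simp
    qed
    moreover have "cmod (xpow is y) \<le> norm y ^ M" using norm_xpow[of "is" y] that by simp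
    ultimately have "cmod (xpow is y) * cmod (taylor_coeff is g y) \<le> norm y ^ M * (B * (wt r v * wt \<bar>r\<bar> y))"
      by (intro mult_mono) auto
    then have "cmod (k y) * (cmod (xpow is y) * cmod (taylor_coeff is g y)) \<le> cmod (k y) * (norm y ^ M * (B * (wt r v * wt \<bar>r\<bar> y)))"
      by (intro mult_left_mono) auto
    then show ?thesis by (simp add: norm_mult mult_ac)
  qed
  have ri: "integrable lborel (\<lambda>y. k y * (xpow is y * taylor_coeff is g y))" if "is \<in> ?L" for "is"
    by (rule integrable_bound_real[OF integrable_mult_right[OF wi, of "B * wt r v"] _ rem[OF that]]) measurable
  have pi: "integrable lborel (\<lambda>y. k y * (xpow is y * c))" for "is" c
  proof (rule integrable_bound_real[OF integrable_mult_right[OF rapid_integrable_wt[OF k, of "real (length is)"], of "cmod c"]])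
    fix y
    have "cmod (k y) * (cmod (xpow is y) * cmod c) \<le> cmod (k y) * (wt (real (length is)) y * cmod c)"
      using order_trans[OF norm_xpow norm_power_le_wt] by (intro mult_left_mono mult_right_mono) auto
    then show "norm (k y * (xpow is y * c)) \<le> cmod c * (cmod (k y) * wt (real (length is)) y)" by (simp add: norm_mult mult_ac)
  qed measurable
  have p0: "(\<integral>y. k y * (xpow is y * c) \<partial>lborel) = 0" if "length is < M" for "is" c
  proof -
    have "(\<integral>y. k y * (xpow is y * c) \<partial>lborel) = (\<integral>y. c * (xpow is y * k y) \<partial>lborel)" by (simp add: mult_ac)
    also have "\<dots> = 0" using mom[OF that] by (simp only: integral_mult_right_zero mult_zero_right)
    finally show ?thesis .
  qed
  have "corr k f v = (\<integral>y. k y * g y \<partial>lborel)" by (simp add: corr_def g_def)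
  also have "\<dots> = (\<integral>y. (\<Sum>m<M. \<Sum>is\<in>{is. length is = m}. k y * (xpow is y * taylor_coeff is g 0))
      + (\<Sum>is\<in>?L. k y * (xpow is y * taylor_coeff is g y)) \<partial>lborel)"
    by (subst taylor_expansion[OF sg, of _ M]) (simp add: distrib_left sum_distrib_left)
  also have "\<dots> = (\<Sum>is\<in>?L. \<integral>y. k y * (xpow is y * taylor_coeff is g y) \<partial>lborel)"
  proof -
    have "(\<integral>y. (\<Sum>m<M. \<Sum>is\<in>{is. length is = m}. k y * (xpow is y * taylor_coeff is g 0)) \<partial>lborel) = 0"
      by (subst Bochner_Integration.integral_sum, (intro Bochner_Integration.integrable_sum pi))+
         (simp add: p0)
    moreover have "(\<integral>y. (\<Sum>is\<in>?L. k y * (xpow is y * taylor_coeff is g y)) \<partial>lborel)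
        = (\<Sum>is\<in>?L. \<integral>y. k y * (xpow is y * taylor_coeff is g y) \<partial>lborel)"
      by (intro Bochner_Integration.integral_sum ri)
    ultimately show ?thesis
      by (subst Bochner_Integration.integral_add)
         ((intro Bochner_Integration.integrable_sum ri pi; assumption)+, simp_all)
  qed
  finally have "cmod (corr k f v) \<le> (\<Sum>is\<in>?L. cmod (\<integral>y. k y * (xpow is y * taylor_coeff is g y) \<partial>lborel))"
    by (simp add: norm_sum)
  also have "\<dots> \<le> (\<Sum>is\<in>?L. B * wt r v * integral\<^sup>L lborel ?w)"
  proof (rule sum_mono)
    fix "is" assume "is \<in> ?L"
    from integral_bound_real[OF integrable_mult_right[OF wi, of "B * wt r v"] _ rem[OF this]]
    show "cmod (\<integral>y. k y * (xpow is y * taylor_coeff is g y) \<partial>lborel) \<le> B * wt r v * integral\<^sup>L lborel ?w"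
      by simp
  qed
  finally show ?thesis by (simp add: cardL mult_ac)
qed

subsection \<open>The surface spline\<close>

text \<open>Functions on the punctured space built from powers and logarithms of the square norm, with
  degree of homogeneity up to logarithms; with the flag set, arbitrary smooth factors are admitted
  and the degree carries no information.\<close>

inductive homlog :: "bool \<Rightarrow> real \<Rightarrow> (real^'n::finite \<Rightarrow> complex) \<Rightarrow> bool" where
  pow: "homlog s (2 * c) (\<lambda>x. of_real ((x \<bullet> x) powr c))"
| log: "homlog s 0 (\<lambda>x. of_real (ln (x \<bullet> x)))"
| coord: "homlog s 1 (\<lambda>x. of_real (x $ i))"
| const: "homlog s 0 (\<lambda>x. c)"
| add: "homlog s a f \<Longrightarrow> homlog s a g \<Longrightarrow> homlog s a (\<lambda>x. f x + g x)"
| mult: "homlog s a f \<Longrightarrow> homlog s b g \<Longrightarrow> homlog s (a + b) (\<lambda>x. f x * g x)"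
| smooth: "smooth u \<Longrightarrow> homlog True a u"

lemma homlog_zero: "homlog s a (\<lambda>x. 0)"
  using homlog.mult[OF homlog.pow[of s "a/2"] homlog.const[of s 0]] by simp

text \<open>The generators are chosen so that the class is stable off the origin: differentiating a
  power or the logarithm of \<open>x \<bullet> x\<close> yields a power times a coordinate, and the
  degree drops by one.\<close>

lemma homlog_deriv:
  fixes f :: "real^'n::finite \<Rightarrow> complex"
  assumes "homlog s a f"
  shows "\<exists>g. (\<forall>i. homlog s (a - 1) (g i)) \<and> (\<forall>x. x \<noteq> 0 \<longrightarrow> f differentiable at x \<and> (\<forall>i. partial_deriv i f x = g i x))"
  using assms
proof induction
  case (pow s c)
  have d: "((\<lambda>x. complex_of_real ((x \<bullet> x) powr c)) has_derivative (\<lambda>h. of_real (c * (x \<bullet> x) powr (c - 1) * (2 * (x \<bullet> h))))) (at x)"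
    if "x \<noteq> 0" for x :: "real^'n"
  proof -
    have "((\<lambda>x. x \<bullet> x) has_derivative (\<lambda>h. 2 * (x \<bullet> h))) (at x)"
      by (auto intro!: derivative_eq_intros simp: inner_commute)
    moreover have "((\<lambda>z. z powr c) has_derivative (\<lambda>h. c * (x \<bullet> x) powr (c - 1) * h)) (at (x \<bullet> x))"
      using has_real_derivative_powr[of "x \<bullet> x" c] that by (simp add: has_field_derivative_def mult_commute_abs)
    ultimately have "((\<lambda>x. (x \<bullet> x) powr c) has_derivative (\<lambda>h. c * (x \<bullet> x) powr (c - 1) * (2 * (x \<bullet> h)))) (at x)"
      by (rule has_derivative_compose)
    then show ?thesis by (rule bounded_linear.has_derivative[OF bounded_linear_of_real])
  qed
  define g where "g i x = complex_of_real ((x \<bullet> x) powr (c - 1)) * (of_real (x $ i) * of_real (2 * c))" for i and x :: "real^'n"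
  show ?case
  proof (intro exI[of _ g] conjI allI impI)
    fix i
    show "homlog s (2 * c - 1) (g i)"
      using homlog.mult[OF homlog.pow[of s "c - 1"] homlog.mult[OF homlog.coord[of s i] homlog.const[of s "of_real (2 * c)"]]]
      by (simp add: g_def[abs_def] algebra_simps)
    fix x :: "real^'n" assume x: "x \<noteq> 0"
    show "(\<lambda>x. complex_of_real ((x \<bullet> x) powr c)) differentiable at x" using d[OF x] by (auto simp: differentiable_def)
    show "partial_deriv i (\<lambda>x. complex_of_real ((x \<bullet> x) powr c)) x = g i x"
      using partial_deriv_eq[OF d[OF x], of i] by (simp add: g_def inner_axis)
  qed
next
  case (log s)
  have d: "((\<lambda>x. complex_of_real (ln (x \<bullet> x))) has_derivative (\<lambda>h. of_real (inverse (x \<bullet> x) * (2 * (x \<bullet> h))))) (at x)"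
    if "x \<noteq> 0" for x :: "real^'n"
  proof -
    have "((\<lambda>x. x \<bullet> x) has_derivative (\<lambda>h. 2 * (x \<bullet> h))) (at x)"
      by (auto intro!: derivative_eq_intros simp: inner_commute)
    moreover have "(ln has_derivative (\<lambda>h. inverse (x \<bullet> x) * h)) (at (x \<bullet> x))"
      using DERIV_ln[of "x \<bullet> x"] that by (simp add: has_field_derivative_def mult_commute_abs)
    ultimately have "((\<lambda>x. ln (x \<bullet> x)) has_derivative (\<lambda>h. inverse (x \<bullet> x) * (2 * (x \<bullet> h)))) (at x)"
      by (rule has_derivative_compose)
    then show ?thesis by (rule bounded_linear.has_derivative[OF bounded_linear_of_real])
  qed
  define g where "g i x = complex_of_real ((x \<bullet> x) powr (-1)) * (of_real (x $ i) * of_real 2)" for i and x :: "real^'n"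
  show ?case
  proof (intro exI[of _ g] conjI allI impI)
    fix i
    show "homlog s (0 - 1) (g i)"
      using homlog.mult[OF homlog.pow[of s "-1"] homlog.mult[OF homlog.coord[of s i] homlog.const[of s "of_real 2"]]]
      by (simp add: g_def[abs_def])
    fix x :: "real^'n" assume x: "x \<noteq> 0"
    show "(\<lambda>x. complex_of_real (ln (x \<bullet> x))) differentiable at x" using d[OF x] by (auto simp: differentiable_def)
    have "(x \<bullet> x) powr (-1) = inverse (x \<bullet> x)" using x by (simp add: powr_minus)
    then show "partial_deriv i (\<lambda>x. complex_of_real (ln (x \<bullet> x))) x = g i x"
      using partial_deriv_eq[OF d[OF x], of i] by (simp add: g_def inner_axis)
  qed
next
  case (coord s i)
  show ?case
  proof (intro exI[of _ "\<lambda>j x. complex_of_real (axis j 1 $ i)"] conjI allI impI)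
    fix j and x :: "real^'n"
    show "homlog s (1 - 1) (\<lambda>x::real^'n. complex_of_real (axis j 1 $ i))"
      using homlog.const[of s "complex_of_real (axis j 1 $ i)"] by simp
    show "(\<lambda>x. complex_of_real (x $ i)) differentiable at x"
      by (rule smooth_differentiable[OF smooth_coord])
    have "((\<lambda>x. complex_of_real (x $ i)) has_derivative (\<lambda>h. complex_of_real (h $ i))) (at x)"
      by (intro bounded_linear.has_derivative[OF bounded_linear_of_real] bounded_linear.has_derivative[OF bounded_linear_vec_nth] has_derivative_ident)
    from partial_deriv_eq[OF this, of j]
    show "partial_deriv j (\<lambda>x. complex_of_real (x $ i)) x = complex_of_real (axis j 1 $ i)" .
  qed
next
  case (const s c)
  show ?case
  proof (intro exI[of _ "\<lambda>i x. 0"] conjI allI impI)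
    show "homlog s (0 - 1) (\<lambda>x. 0)" by (rule homlog_zero)
  qed simp_all
next
  case (add s a f g)
  obtain f' where f': "(\<forall>i. homlog s (a - 1) (f' i)) \<and> (\<forall>x. x \<noteq> 0 \<longrightarrow> f differentiable at x \<and> (\<forall>i. partial_deriv i f x = f' i x))"
    using add.IH(1) by (rule exE)
  obtain g' where g': "(\<forall>i. homlog s (a - 1) (g' i)) \<and> (\<forall>x. x \<noteq> 0 \<longrightarrow> g differentiable at x \<and> (\<forall>i. partial_deriv i g x = g' i x))"
    using add.IH(2) by (rule exE)
  have f: "\<And>i. homlog s (a - 1) (f' i)" "\<And>x. x \<noteq> 0 \<Longrightarrow> f differentiable at x" "\<And>x i. x \<noteq> 0 \<Longrightarrow> partial_deriv i f x = f' i x"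
    and g: "\<And>i. homlog s (a - 1) (g' i)" "\<And>x. x \<noteq> 0 \<Longrightarrow> g differentiable at x" "\<And>x i. x \<noteq> 0 \<Longrightarrow> partial_deriv i g x = g' i x"
    using f' g' by simp_all
  show ?case
  proof (intro exI[of _ "\<lambda>i x. f' i x + g' i x"] conjI allI impI)
    fix i and x :: "real^'n"
    show "homlog s (a - 1) (\<lambda>x. f' i x + g' i x)" by (intro homlog.add f g)
    assume x: "x \<noteq> 0"
    show "(\<lambda>x. f x + g x) differentiable at x" by (intro differentiable_add f g x)
    show "partial_deriv i (\<lambda>x. f x + g x) x = f' i x + g' i x"
      using f(2,3)[OF x] g(2,3)[OF x] by (simp add: partial_deriv_add)
  qed
next
  case (mult s a f b g)
  obtain f' where f': "(\<forall>i. homlog s (a - 1) (f' i)) \<and> (\<forall>x. x \<noteq> 0 \<longrightarrow> f differentiable at x \<and> (\<forall>i. partial_deriv i f x = f' i x))"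
    using mult.IH(1) by (rule exE)
  obtain g' where g': "(\<forall>i. homlog s (b - 1) (g' i)) \<and> (\<forall>x. x \<noteq> 0 \<longrightarrow> g differentiable at x \<and> (\<forall>i. partial_deriv i g x = g' i x))"
    using mult.IH(2) by (rule exE)
  have f: "\<And>i. homlog s (a - 1) (f' i)" "\<And>x. x \<noteq> 0 \<Longrightarrow> f differentiable at x" "\<And>x i. x \<noteq> 0 \<Longrightarrow> partial_deriv i f x = f' i x"
    and g: "\<And>i. homlog s (b - 1) (g' i)" "\<And>x. x \<noteq> 0 \<Longrightarrow> g differentiable at x" "\<And>x i. x \<noteq> 0 \<Longrightarrow> partial_deriv i g x = g' i x"
    using f' g' by simp_all
  have e: "a - 1 + b = a + b - 1" "a + (b - 1) = a + b - 1" by simp_all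
  show ?case
  proof (intro exI[of _ "\<lambda>i x. f' i x * g x + f x * g' i x"] conjI allI impI)
    fix i and x :: "real^'n"
    show "homlog s (a + b - 1) (\<lambda>x. f' i x * g x + f x * g' i x)"
      using homlog.mult[OF f(1)[of i] mult.hyps(2)] homlog.mult[OF mult.hyps(1) g(1)[of i]]
      unfolding e by (rule homlog.add)
    assume x: "x \<noteq> 0"
    show "(\<lambda>x. f x * g x) differentiable at x" by (intro differentiable_mult f g x)
    show "partial_deriv i (\<lambda>x. f x * g x) x = f' i x * g x + f x * g' i x"
      using f(2,3)[OF x] g(2,3)[OF x] by (simp add: partial_deriv_mult)
  qed
next
  case (smooth u a)
  then show ?case
    by (intro exI[of _ "\<lambda>i. partial_deriv i u"] conjI allI impI homlog.smooth smooth_partial_deriv smooth_differentiable refl)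
qed

lemma homlog_iter_partial:
  fixes f :: "real^'n::finite \<Rightarrow> complex"
  assumes "homlog s a f"
  shows "\<exists>g. homlog s (a - real (length is)) g \<and> (\<forall>x. x \<noteq> 0 \<longrightarrow> iter_partial is f differentiable at x \<and> iter_partial is f x = g x)"
proof (induction "is")
  case Nil
  show ?case using assms homlog_deriv[OF assms] by (intro exI[of _ f]) auto
next
  case (Cons i "is")
  then obtain g where g: "homlog s (a - real (length is)) g" "\<And>x. x \<noteq> 0 \<Longrightarrow> iter_partial is f x = g x" by auto
  obtain h where h: "(\<forall>i. homlog s (a - real (length is) - 1) (h i)) \<and> (\<forall>x. x \<noteq> 0 \<longrightarrow> g differentiable at x \<and> (\<forall>i. partial_deriv i g x = h i x))"
    using homlog_deriv[OF g(1)] by (rule exE)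
  define g' where "g' = h"
  have g': "\<And>i. homlog s (a - real (length is) - 1) (g' i)" "\<And>x. x \<noteq> 0 \<Longrightarrow> partial_deriv i g x = g' i x"
    using h by (simp_all add: g'_def)
  have o: "open (- {0 :: real^'n})" by auto
  have eq: "partial_deriv i (iter_partial is f) x = g' i x" if "x \<noteq> 0" for x
    using partial_deriv_local[OF o, of x "iter_partial is f" g i] that g(2) g'(2)[OF that] by simp
  have D: "g' i differentiable at x" if "x \<noteq> 0" for x using homlog_deriv[OF g'(1)[of i]] that by (elim exE conjE) simp
  have "partial_deriv i (iter_partial is f) differentiable at x" if nz: "x \<noteq> 0" for x
  proof -
    obtain E where "(g' i has_derivative E) (at x)" using D[OF nz] by (auto simp: differentiable_def)
    then have "(partial_deriv i (iter_partial is f) has_derivative E) (at x)"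
      by (rule has_derivative_transform_within_open[OF _ o]) (use nz eq in auto)
    then show ?thesis by (auto simp: differentiable_def)
  qed
  then show ?case using eq g'(1)[of i] by (intro exI[of _ "g' i"]) (auto simp: algebra_simps)
qed

text \<open>Away from the unit ball a logarithm is dominated by any small positive power. A product
  splits the loss \<epsilon> evenly between its factors. Arbitrary smooth factors obey no such
  bound, hence the cleared flag.\<close>

lemma homlog_bound:
  assumes "homlog s a f" "\<not> s" "\<epsilon> > 0"
  shows "\<exists>C\<ge>0. \<forall>x. norm x \<ge> 1 \<longrightarrow> cmod (f x) \<le> C * norm x powr (a + \<epsilon>)"
  using assms
proof (induction arbitrary: \<epsilon>)
  case (pow s c)
  have "cmod (of_real ((x \<bullet> x) powr c)) \<le> 1 * norm x powr (2 * c + \<epsilon>)" if "norm x \<ge> 1" for x :: "real^'a"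
  proof -
    have "(x \<bullet> x) powr c = norm x powr (2 * c)"
    proof -
      have "x \<bullet> x = norm x powr 2" using that by (simp add: power2_norm_eq_inner[symmetric])
      then show ?thesis by (simp only: powr_powr)
    qed
    also have "\<dots> \<le> norm x powr (2 * c + \<epsilon>)" using that pow by (intro powr_mono) auto
    finally show ?thesis by simp
  qed
  then show ?case by (intro exI[of _ 1]) auto
next
  case (log s)
  have "cmod (of_real (ln (x \<bullet> x))) \<le> (2 / \<epsilon>) * norm x powr (0 + \<epsilon>)" if "norm x \<ge> 1" for x :: "real^'a"
  proof -
    have "ln (x \<bullet> x) = 2 * ln (norm x)"
      using that by (subst power2_norm_eq_inner[symmetric]) (simp add: ln_realpow)
    moreover have "ln (norm x) \<le> norm x powr \<epsilon> / \<epsilon>" using ln_powr_bound[OF that] log by simp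
    moreover have "ln (norm x) \<ge> 0" using that by simp
    ultimately show ?thesis by simp
  qed
  then show ?case using log by (intro exI[of _ "2 / \<epsilon>"]) auto
next
  case (coord s i)
  have "cmod (of_real (x $ i)) \<le> 1 * norm x powr (1 + \<epsilon>)" if "norm x \<ge> 1" for x :: "real^'a"
  proof -
    have "\<bar>x $ i\<bar> \<le> norm x powr 1" using component_le_norm_cart[of x i] that by simp
    also have "\<dots> \<le> norm x powr (1 + \<epsilon>)" using that coord by (intro powr_mono) auto
    finally show ?thesis by simp
  qed
  then show ?case by (intro exI[of _ 1]) auto
next
  case (const s c)
  have "cmod c \<le> cmod c * norm x powr (0 + \<epsilon>)" if "norm x \<ge> 1" for x :: "real^'a"
  proof -
    have "1 = norm x powr 0" using that by auto
    also have "\<dots> \<le> norm x powr (0 + \<epsilon>)" using that const by (intro powr_mono) auto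
    finally show ?thesis by (simp add: mult_le_cancel_left1)
  qed
  then show ?case by (intro exI[of _ "cmod c"]) auto
next
  case (add s a f g)
  obtain C where C: "C \<ge> 0" "\<And>x. norm x \<ge> 1 \<Longrightarrow> cmod (f x) \<le> C * norm x powr (a + \<epsilon>)" using add by meson
  obtain D where D: "D \<ge> 0" "\<And>x. norm x \<ge> 1 \<Longrightarrow> cmod (g x) \<le> D * norm x powr (a + \<epsilon>)" using add by meson
  have "cmod (f x + g x) \<le> (C + D) * norm x powr (a + \<epsilon>)" if "norm x \<ge> 1" for x
    using norm_triangle_mono[OF C(2)[OF that] D(2)[OF that]] by (simp add: distrib_right)
  then show ?case using C D by (intro exI[of _ "C + D"]) auto
next
  case (mult s a f b g)
  have e2: "\<epsilon> / 2 > 0" using mult by simp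
  obtain C where C: "C \<ge> 0" "\<And>x. norm x \<ge> 1 \<Longrightarrow> cmod (f x) \<le> C * norm x powr (a + \<epsilon> / 2)" using mult.IH(1)[OF mult.prems(1) e2] by blast
  obtain D where D: "D \<ge> 0" "\<And>x. norm x \<ge> 1 \<Longrightarrow> cmod (g x) \<le> D * norm x powr (b + \<epsilon> / 2)" using mult.IH(2)[OF mult.prems(1) e2] by blast
  have "cmod (f x * g x) \<le> (C * D) * norm x powr (a + b + \<epsilon>)" if "norm x \<ge> 1" for x
  proof -
    have "cmod (f x * g x) \<le> (C * norm x powr (a + \<epsilon> / 2)) * (D * norm x powr (b + \<epsilon> / 2))"
      unfolding norm_mult using C D that by (intro mult_mono) auto
    also have "\<dots> = (C * D) * norm x powr ((a + \<epsilon> / 2) + (b + \<epsilon> / 2))" by (simp only: powr_add mult_ac)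
    also have "(a + \<epsilon> / 2) + (b + \<epsilon> / 2) = a + b + \<epsilon>" by simp
    finally show ?thesis .
  qed
  then show ?case using C D by (intro exI[of _ "C * D"]) auto
next
  case (smooth u a)
  then show ?case by simp
qed

lemma homlog_spline: "homlog s \<theta> (surface_spline \<theta> :: real^'n::finite \<Rightarrow> complex)"
proof -
  have p: "(x \<bullet> x) powr (\<theta> / 2) = norm x powr \<theta>" for x :: "real^'n"
  proof (cases "x = 0")
    case False
    then have "x \<bullet> x = norm x powr 2" by (simp add: power2_norm_eq_inner[symmetric])
    then have "(x \<bullet> x) powr (\<theta> / 2) = norm x powr (2 * (\<theta> / 2))" by (simp only: powr_powr)
    then show ?thesis by simp
  qed simp
  have l: "ln (x \<bullet> x) = 2 * ln (norm x)" for x :: "real^'n"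
  proof (cases "x = 0")
    case False
    then show ?thesis by (subst power2_norm_eq_inner[symmetric]) (simp add: ln_realpow)
  qed simp
  show ?thesis
  proof (cases "\<exists>k::nat. \<theta> = 2 * real k")
    case True
    have "(surface_spline \<theta> :: real^'n \<Rightarrow> complex) = (\<lambda>x. of_real ((x \<bullet> x) powr (\<theta> / 2)) * (of_real (ln (x \<bullet> x)) * of_real (1/2)))"
      using True by (auto simp: surface_spline_def p l)
    then show ?thesis
      using homlog.mult[OF homlog.pow[of s "\<theta> / 2"] homlog.mult[OF homlog.log[of s] homlog.const[of s "of_real (1/2)"]]] by simp
  next
    case False
    have "(surface_spline \<theta> :: real^'n \<Rightarrow> complex) = (\<lambda>x. of_real ((x \<bullet> x) powr (\<theta> / 2)))"
      using False by (auto simp: surface_spline_def p)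
    then show ?thesis using homlog.pow[of s "\<theta> / 2"] by simp
  qed
qed

lemma spline_borel [measurable]: "(surface_spline \<theta> :: real^'n::finite \<Rightarrow> complex) \<in> borel_measurable borel"
  unfolding surface_spline_def[abs_def] by (cases "\<exists>k::nat. \<theta> = 2 * real k") simp_all

text \<open>For |x| >= 1 the logarithm is at most |x|, which explains the exponent \<theta> + 1. For
  |x| < 1 the inequality ln (1/|x|) <= |x| powr (-\<theta>) / \<theta> makes the product with |x|
  powr \<theta> at most 1/\<theta>.\<close>

lemma spline_bound:
  assumes "\<theta> > 0"
  shows "cmod (surface_spline \<theta> (x :: real^'n::finite)) \<le> (1 + 1 / \<theta>) * wt (\<theta> + 1) x"
proof -
  have w: "norm x powr \<theta> \<le> wt (\<theta> + 1) x"
  proof -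
    have "norm x powr \<theta> \<le> wt \<theta> x" unfolding wt_def using assms by (intro powr_mono2) auto
    also have "\<dots> \<le> wt (\<theta> + 1) x" by (rule wt_mono) simp
    finally show ?thesis .
  qed
  have l: "norm x powr \<theta> * \<bar>ln (norm x)\<bar> \<le> (1 + 1 / \<theta>) * wt (\<theta> + 1) x"
  proof (cases "norm x \<ge> 1")
    case True
    have "\<bar>ln (norm x)\<bar> \<le> norm x powr 1" using ln_powr_bound[OF True, of 1] True by simp
    then have "norm x powr \<theta> * \<bar>ln (norm x)\<bar> \<le> norm x powr \<theta> * norm x powr 1" by (intro mult_left_mono) auto
    also have "\<dots> = norm x powr (\<theta> + 1)" by (simp only: powr_add)
    also have "\<dots> \<le> 1 * wt (\<theta> + 1) x" unfolding wt_def using assms by (simp add: powr_mono2)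
    also have "\<dots> \<le> (1 + 1 / \<theta>) * wt (\<theta> + 1) x" using assms by (intro mult_right_mono) auto
    finally show ?thesis .
  next
    case False
    show ?thesis
    proof (cases "x = 0")
      case False
      with \<open>\<not> 1 \<le> norm x\<close> have x: "0 < norm x" "norm x < 1" by auto
      have "ln (1 / norm x) \<le> (1 / norm x) powr \<theta> / \<theta>" using x assms by (intro ln_powr_bound) auto
      moreover have "(1 / norm x) powr \<theta> = norm x powr (- \<theta>)" using x by (simp add: powr_divide powr_minus_divide)
      ultimately have "\<bar>ln (norm x)\<bar> \<le> norm x powr (- \<theta>) / \<theta>" using x by (simp add: ln_div)
      then have "norm x powr \<theta> * \<bar>ln (norm x)\<bar> \<le> norm x powr \<theta> * (norm x powr (- \<theta>) / \<theta>)"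
        by (intro mult_left_mono) auto
      also have "\<dots> = 1 / \<theta>" using x by (simp add: powr_minus)
      also have "\<dots> \<le> (1 + 1 / \<theta>) * 1" by simp
      also have "\<dots> \<le> (1 + 1 / \<theta>) * wt (\<theta> + 1) x" using assms by (intro mult_left_mono wt_ge_1) auto
      finally show ?thesis .
    qed (use assms in simp)
  qed
  show ?thesis
  proof (cases "\<exists>k::nat. \<theta> = 2 * real k")
    case True
    then have "cmod (surface_spline \<theta> x) = norm x powr \<theta> * \<bar>ln (norm x)\<bar>"
      by (simp add: surface_spline_def norm_mult abs_mult)
    then show ?thesis using l by simp
  next
    case False
    then have "cmod (surface_spline \<theta> x) = norm x powr \<theta>" by (simp add: surface_spline_def)
    also have "\<dots> \<le> (1 + 1 / \<theta>) * wt (\<theta> + 1) x" using w assms mult_right_mono[of 1 "1 + 1 / \<theta>" "wt (\<theta> + 1) x"] by simp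
    finally show ?thesis .
  qed
qed

lemma generator_test: "lp_generator \<Phi> \<Longrightarrow> \<Phi> \<in> test_functions"
proof -
  assume \<Phi>: "lp_generator \<Phi>"
  have "{x. \<Phi> x \<noteq> 0} \<subseteq> cball 0 2" using \<Phi> by (force simp: lp_generator_def)
  then have "fun_support \<Phi> \<subseteq> cball 0 2" unfolding fun_support_def by (intro closure_minimal) auto
  then have "compact (fun_support \<Phi>)"
    by (metis bounded_cball bounded_subset closed_closure compact_eq_bounded_closed fun_support_def)
  with \<Phi> show "\<Phi> \<in> test_functions" by (simp add: test_functions_def lp_generator_def)
qed

lemma generator_schwartz: "lp_generator \<Phi> \<Longrightarrow> \<Phi> \<in> schwartz"
  by (intro test_schwartz generator_test)

section \<open>Singular core and smooth tail of the spline kernel\<close>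

text \<open>The Littlewood-Paley generator also serves as the cutoff: being 1 on the unit ball, it
  removes the singularity at the origin; being 0 outside the ball of radius 2, it leaves the
  behaviour at infinity unchanged.\<close>

definition spline_smooth :: "(real^'n \<Rightarrow> complex) \<Rightarrow> real \<Rightarrow> real^'n::finite \<Rightarrow> complex" where
  "spline_smooth \<Phi> \<theta> x = (1 - \<Phi> x) * surface_spline \<theta> x"

definition spline_core :: "(real^'n \<Rightarrow> complex) \<Rightarrow> real \<Rightarrow> real^'n::finite \<Rightarrow> complex" where
  "spline_core \<Phi> \<theta> x = \<Phi> x * surface_spline \<theta> x"

lemma spline_split: "surface_spline \<theta> x = spline_core \<Phi> \<theta> x + spline_smooth \<Phi> \<theta> x"
  by (simp add: spline_core_def spline_smooth_def algebra_simps)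

lemma spline_core_rapid:
  fixes \<Phi> :: "real^'n::finite \<Rightarrow> complex"
  assumes \<Phi>: "lp_generator \<Phi>" and \<theta>: "\<theta> > 0"
  shows "rapid (spline_core \<Phi> \<theta>)"
proof -
  have r: "rapid \<Phi>" using \<Phi> by (intro schwartz_rapid generator_schwartz)
  then have [measurable]: "\<Phi> \<in> borel_measurable borel" by (rule rapid_borel)
  have "\<exists>B. \<forall>x. cmod (spline_core \<Phi> \<theta> x) \<le> B * wt t x" for t
  proof -
    obtain B where B: "B \<ge> 0" "\<And>x. cmod (\<Phi> x) \<le> B * wt (t - \<theta> - 1) x" using rapid_bound[OF r] by metis
    have "cmod (spline_core \<Phi> \<theta> x) \<le> (B * (1 + 1 / \<theta>)) * wt t x" for x
    proof -
      have "cmod (spline_core \<Phi> \<theta> x) \<le> (B * wt (t - \<theta> - 1) x) * ((1 + 1 / \<theta>) * wt (\<theta> + 1) x)"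
        unfolding spline_core_def norm_mult using B by (intro mult_mono spline_bound \<theta>) auto
      also have "\<dots> = (B * (1 + 1 / \<theta>)) * (wt (t - \<theta> - 1) x * wt (\<theta> + 1) x)" by (simp only: mult_ac)
      finally show ?thesis by (simp add: wt_mult)
    qed
    then show ?thesis by blast
  qed
  then show ?thesis by (simp add: rapid_def spline_core_def[abs_def])
qed

text \<open>Off the origin the function belongs to \<open>homlog\<close> with the flag set, which
  admits the cutoff factor; near the origin it vanishes identically.\<close>

lemma spline_smooth_smooth:
  fixes \<Phi> :: "real^'n::finite \<Rightarrow> complex"
  assumes \<Phi>: "lp_generator \<Phi>"
  shows "smooth (spline_smooth \<Phi> \<theta>)"
  unfolding smooth_def
proof safe
  fix "is" and x :: "real^'n"
  have "smooth (\<lambda>x. 1 - \<Phi> x)" using \<Phi> by (intro smooth_diff smooth_const) (simp add: lp_generator_def)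
  then have h: "homlog True (0 + \<theta>) (\<lambda>x. (1 - \<Phi> x) * surface_spline \<theta> x)"
    by (intro homlog.mult homlog.smooth homlog_spline)
  show "iter_partial is (spline_smooth \<Phi> \<theta>) differentiable at x"
  proof (cases "x = 0")
    case False
    then show ?thesis using homlog_iter_partial[OF h, of "is"] by (auto simp: spline_smooth_def[abs_def])
  next
    case True
    have "iter_partial is (spline_smooth \<Phi> \<theta>) y = 0" if "y \<in> ball 0 1" for y
      by (rule iter_partial_zero_on_open[of "ball 0 1"])
         (use \<Phi> that in \<open>auto simp: spline_smooth_def lp_generator_def\<close>)
    then have "(iter_partial is (spline_smooth \<Phi> \<theta>) has_derivative (\<lambda>h. 0)) (at x)"
      using True by (intro has_derivative_transform_within_open[OF has_derivative_const, of "ball 0 1"]) auto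
    then show ?thesis by (auto simp: differentiable_def)
  qed
qed

lemma spline_smooth_bound:
  fixes \<Phi> :: "real^'n::finite \<Rightarrow> complex"
  assumes \<Phi>: "lp_generator \<Phi>" and \<epsilon>: "\<epsilon> > 0"
  shows "\<exists>C\<ge>0. \<forall>x. cmod (iter_partial is (spline_smooth \<Phi> \<theta>) x) \<le> C * wt (\<theta> + \<epsilon> - real (length is)) x"
proof -
  define e where "e = \<theta> + \<epsilon> - real (length is)"
  obtain g where g: "homlog False (\<theta> - real (length is)) g"
    "\<And>x. x \<noteq> 0 \<Longrightarrow> iter_partial is (surface_spline \<theta> :: real^'n \<Rightarrow> complex) x = g x"
    using homlog_iter_partial[OF homlog_spline[of False \<theta>], of "is"] by (elim exE conjE) simp
  obtain C where C: "C \<ge> 0" "\<And>x. norm x \<ge> 1 \<Longrightarrow> cmod (g x) \<le> C * norm x powr e"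
    using homlog_bound[OF g(1) _ \<epsilon>] by (auto simp: e_def algebra_simps)
  obtain D where D: "D \<ge> 0" "\<And>x. x \<in> cball 0 2 \<Longrightarrow> cmod (iter_partial is (spline_smooth \<Phi> \<theta>) x) \<le> D"
    using smooth_bounded_compact[OF spline_smooth_smooth[OF \<Phi>] compact_cball, of "length is" 0 2 \<theta>] by (metis order_refl)
  \<comment> \<open>For |x| <= 2 the weight of exponent \<open>e\<close> is at least 3 powr
    (-\<bar>e\<bar>). For |x| > 2 the inequalities |x| <= 1 + |x| <= 2 |x| convert the power of |x|
    into the weight at the cost of 2 powr \<bar>e\<bar>.\<close>
  have "cmod (iter_partial is (spline_smooth \<Phi> \<theta>) x) \<le> (C * 2 powr \<bar>e\<bar> + D * 3 powr \<bar>e\<bar>) * wt e x" for x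
  proof (cases "norm x \<le> 2")
    case True
    have "1 \<le> 3 powr \<bar>e\<bar> * wt e x"
    proof -
      have "wt (- e) x \<le> 3 powr \<bar>e\<bar>"
      proof -
        have "wt (- e) x \<le> wt \<bar>e\<bar> x" by (rule wt_mono) simp
        also have "\<dots> \<le> 3 powr \<bar>e\<bar>" unfolding wt_def using True by (intro powr_mono2) auto
        finally show ?thesis .
      qed
      then have "wt (- e) x * wt e x \<le> 3 powr \<bar>e\<bar> * wt e x" by (intro mult_right_mono) auto
      then show ?thesis by (simp add: wt_mult)
    qed
    then have "D \<le> D * (3 powr \<bar>e\<bar> * wt e x)" using D(1) mult_left_mono[of 1 _ D] by simp
    moreover have "cmod (iter_partial is (spline_smooth \<Phi> \<theta>) x) \<le> D" using D(2) True by simp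
    moreover have "0 \<le> C * 2 powr \<bar>e\<bar> * wt e x" using C(1) by simp
    ultimately show ?thesis by (simp add: distrib_right mult.assoc)
  next
    case False
    have o: "open (- cball (0::real^'n) 2)" by auto
    have "iter_partial is (spline_smooth \<Phi> \<theta>) x = iter_partial is (surface_spline \<theta>) x"
      by (rule iter_partial_local[OF o]) (use False \<Phi> in \<open>auto simp: spline_smooth_def lp_generator_def\<close>)
    also have "\<dots> = g x" using False by (intro g(2)) auto
    finally have 1: "cmod (iter_partial is (spline_smooth \<Phi> \<theta>) x) \<le> C * norm x powr e" using C(2)[of x] False by simp
    have "norm x powr e \<le> 2 powr \<bar>e\<bar> * wt e x"
    proof (cases "e \<ge> 0")
      case True
      have "norm x powr e \<le> 1 * wt e x" unfolding wt_def using True by (simp add: powr_mono2)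
      also have "\<dots> \<le> 2 powr \<bar>e\<bar> * wt e x" by (intro mult_right_mono ge_one_powr_ge_zero) auto
      finally show ?thesis .
    next
      case neg: False
      have "norm x powr e \<le> ((1 + norm x) / 2) powr e" using neg False by (intro powr_mono2') auto
      also have "\<dots> = 2 powr \<bar>e\<bar> * wt e x"
        using neg by (simp add: wt_def powr_divide powr_minus_divide)
      finally show ?thesis .
    qed
    then have "C * norm x powr e \<le> C * (2 powr \<bar>e\<bar> * wt e x)" using C(1) by (intro mult_left_mono)
    moreover have "0 \<le> D * 3 powr \<bar>e\<bar> * wt e x" using D(1) by simp
    ultimately show ?thesis using 1 by (simp add: distrib_right mult.assoc)
  qed
  then show ?thesis using C(1) D(1) unfolding e_def[symmetric] by (intro exI[of _ "C * 2 powr \<bar>e\<bar> + D * 3 powr \<bar>e\<bar>"]) auto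
qed

lemma spline_smooth_slow:
  assumes \<Phi>: "lp_generator \<Phi>"
  shows "slow (spline_smooth \<Phi> \<theta>)"
  unfolding slow_def
proof (intro conjI allI spline_smooth_smooth \<Phi>)
  fix "is" :: "'a list"
  show "\<exists>r B. \<forall>x. cmod (iter_partial is (spline_smooth \<Phi> \<theta>) x) \<le> B * wt r x"
    using spline_smooth_bound[OF \<Phi>, of 1 "is" \<theta>] by auto
qed

lemma spline_dom: "\<theta> > 0 \<Longrightarrow> f \<in> schwartz \<Longrightarrow> dom (surface_spline \<theta>) f"
  by (rule dom_poly_schwartz(1)[OF spline_borel spline_bound])

lemma corr_swap:
  assumes [measurable]: "f \<in> borel_measurable borel" "g \<in> borel_measurable borel"
  shows "corr g f v = corr f g (- v)"
  unfolding corr_def using integral_shift[of "\<lambda>x. g x * f (x + v)" "- v"] by (simp add: mult.commute)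

text \<open>\<open>corr_swap\<close> is applied to the second term so that \<open>k\<close> becomes
  the integrating kernel and the tail the function that is differentiated or expanded.\<close>

lemma corr_spline_split:
  fixes \<Phi> k :: "real^'n::finite \<Rightarrow> complex"
  assumes \<Phi>: "lp_generator \<Phi>" and \<theta>: "\<theta> > 0" and k: "k \<in> schwartz"
  shows "corr (surface_spline \<theta>) k v = corr (spline_core \<Phi> \<theta>) k v + corr k (spline_smooth \<Phi> \<theta>) (- v)"
proof -
  have [measurable]: "k \<in> borel_measurable borel" "spline_smooth \<Phi> \<theta> \<in> borel_measurable borel"
    using schwartz_smooth[OF k] spline_smooth_smooth[OF \<Phi>] smooth_borel by blast+
  have d1: "integrable lborel (\<lambda>x. surface_spline \<theta> x * k (x + v))"
    by (intro dom_integrable spline_dom \<theta> k)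
  have d2: "integrable lborel (\<lambda>x. spline_core \<Phi> \<theta> x * k (x + v))"
    by (intro dom_integrable dom_rapid_slow spline_core_rapid schwartz_slow \<Phi> \<theta> k)
  have "corr (surface_spline \<theta>) k v - corr (spline_core \<Phi> \<theta>) k v = corr (spline_smooth \<Phi> \<theta>) k v"
    unfolding corr_def using d1 d2 by (simp add: Bochner_Integration.integral_diff[symmetric] spline_split[of \<theta> _ \<Phi>] distrib_right)
  also have "\<dots> = corr k (spline_smooth \<Phi> \<theta>) (- v)" by (rule corr_swap) measurable
  finally show ?thesis by (simp add: algebra_simps)
qed

text \<open>Moments vanishing to every order turn the decay of the high derivatives of the tail into
  decay of the correlation to any prescribed order. The core contributes a Schwartz
  function.\<close>

lemma corr_spline_rapid:
  fixes \<Phi> k :: "real^'n::finite \<Rightarrow> complex"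
  assumes \<Phi>: "lp_generator \<Phi>" and \<theta>: "\<theta> > 0" and k: "k \<in> schwartz"
    and mom: "\<And>is. (\<integral>y. xpow is y * k y \<partial>lborel) = 0"
  shows "rapid (corr (surface_spline \<theta>) k)"
proof -
  have sm: "smooth (corr (surface_spline \<theta>) k)" by (intro smooth_corr spline_dom \<theta> k)
  have "\<exists>B. \<forall>v. cmod (corr (surface_spline \<theta>) k v) \<le> B * wt r v" for r
  proof -
    obtain A where A: "\<And>v. cmod (corr (spline_core \<Phi> \<theta>) k v) \<le> A * wt r v"
      using schwartz_bound0[OF schwartz_corr[OF spline_core_rapid[OF \<Phi> \<theta>] k], of r] by metis
    \<comment> \<open>Derivatives of the tail of order \<open>M\<close> are bounded by the weight of
      exponent \<theta> + 1 - M; \<open>M\<close> is taken large enough to bring this below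
      \<open>r\<close>.\<close>
    define M where "M = nat \<lceil>\<theta> + 1 - r\<rceil>"
    have M: "\<theta> + 1 - real M \<le> r" unfolding M_def by linarith
    have "\<exists>C\<ge>0. \<forall>x. cmod (iter_partial is (spline_smooth \<Phi> \<theta>) x) \<le> C * wt (\<theta> + 1 - real (length is)) x" for "is"
      by (rule spline_smooth_bound[OF \<Phi>]) simp
    then obtain C where C: "\<And>is. C is \<ge> 0" "\<And>is x. cmod (iter_partial is (spline_smooth \<Phi> \<theta>) x) \<le> C is * wt (\<theta> + 1 - real (length is)) x"
      by metis
    define B where "B = (\<Sum>is\<in>{is. length is = M}. C is)"
    define R where "R = (\<integral>y. cmod (k y) * (norm y ^ M * wt \<bar>r\<bar> y) \<partial>lborel)"
    have "cmod (corr k (spline_smooth \<Phi> \<theta>) (- v)) \<le> real (CARD('n) ^ M) * B * wt r (- v) * R" for v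
      unfolding R_def
    proof (rule corr_cancellation[OF schwartz_rapid[OF k] spline_smooth_slow[OF \<Phi>] mom])
      fix "is" :: "'n list" and x :: "real^'n" assume l: "length is = M"
      have "C is \<le> B" unfolding B_def using l C(1) by (intro member_le_sum finite_lists_length) auto
      then show "cmod (iter_partial is (spline_smooth \<Phi> \<theta>) x) \<le> B * wt r x"
        using C(2)[of "is" x] M l C(1)[of "is"]
        by (intro order_trans[OF C(2)] mult_mono wt_mono) auto
    qed
    then have "cmod (corr (surface_spline \<theta>) k v) \<le> A * wt r v + real (CARD('n) ^ M) * B * wt r (- v) * R" for v
      unfolding corr_spline_split[OF \<Phi> \<theta> k] by (intro norm_triangle_mono A)
    then have "cmod (corr (surface_spline \<theta>) k v) \<le> (A + real (CARD('n) ^ M) * B * R) * wt r v" for v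
      by (simp add: algebra_simps)
    then show ?thesis by blast
  qed
  then show ?thesis using sm by (simp add: rapid_def smooth_borel)
qed

text \<open>For the mollified kernel of the block j = 0, where no moment condition is available:
  smoothing preserves the estimates on the derivatives of the tail, and the core adds a Schwartz
  function.\<close>

lemma corr_spline_deriv_bound:
  fixes \<Phi> k :: "real^'n::finite \<Rightarrow> complex"
  assumes \<Phi>: "lp_generator \<Phi>" and \<theta>: "\<theta> > 0" and k: "k \<in> schwartz" and \<epsilon>: "\<epsilon> > 0"
  shows "\<exists>C\<ge>0. \<forall>v. cmod (iter_partial is (corr (surface_spline \<theta>) k) v) \<le> C * wt (\<theta> + \<epsilon> - real (length is)) v"
proof -
  define e where "e = \<theta> + \<epsilon> - real (length is)"
  let ?s = "spline_smooth \<Phi> \<theta>" and ?c = "corr (spline_core \<Phi> \<theta>) k"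
  have dom: "dom k ?s" by (intro dom_rapid_slow schwartz_rapid k spline_smooth_slow \<Phi>)
  have sc: "?c \<in> schwartz" by (intro schwartz_corr spline_core_rapid \<Phi> \<theta> k)
  have eq: "corr (surface_spline \<theta>) k = (\<lambda>v. ?c v + corr k ?s ((-1) *\<^sub>R v + 0))"
    using corr_spline_split[OF \<Phi> \<theta> k] by auto
  have it: "iter_partial is (corr (surface_spline \<theta>) k) = (\<lambda>v. iter_partial is ?c v + (-1) ^ length is * corr k (iter_partial is ?s) (- v))"
  proof -
    have sh: "smooth (\<lambda>v. corr k ?s ((-1) *\<^sub>R v + 0))" by (rule smooth_affine[OF smooth_corr[OF dom]])
    have ih: "iter_partial is (\<lambda>v. corr k ?s ((-1) *\<^sub>R v + 0)) = (\<lambda>v. of_real (-1) ^ length is * iter_partial is (corr k ?s) ((-1) *\<^sub>R v + 0))"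
      by (rule iter_partial_affine[OF smooth_corr[OF dom]])
    show ?thesis
      unfolding eq iter_partial_add[OF schwartz_smooth[OF sc] sh] ih iter_partial_corr[OF dom] by simp
  qed
  obtain A where A: "A \<ge> 0" "\<And>v. cmod (iter_partial is ?c v) \<le> A * wt e v" using schwartz_bound[OF sc] by metis
  obtain B where B: "B \<ge> 0" "\<And>x. cmod (iter_partial is ?s x) \<le> B * wt e x"
    using spline_smooth_bound[OF \<Phi> \<epsilon>, of "is" \<theta>] unfolding e_def by blast
  define R where "R = (\<integral>x. cmod (k x) * wt \<bar>e\<bar> x \<partial>lborel)"
  have R: "R \<ge> 0" unfolding R_def by simp
  have "cmod (corr k (iter_partial is ?s) (- v)) \<le> B * R * wt e (- v)" for v
    unfolding R_def
  proof (rule corr_decay(2))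
    show "iter_partial is ?s \<in> borel_measurable borel"
      by (intro smooth_borel smooth_iter_partial spline_smooth_smooth \<Phi>)
    show "k \<in> borel_measurable borel" by (intro smooth_borel schwartz_smooth k)
    show "integrable lborel (\<lambda>x. cmod (k x) * wt \<bar>e\<bar> x)" by (intro rapid_integrable_wt schwartz_rapid k)
  qed (use B in auto)
  then have "cmod (iter_partial is (corr (surface_spline \<theta>) k) v) \<le> (A + B * R) * wt e v" for v
    unfolding it distrib_right using A(2)[of v]
    by (intro norm_triangle_mono) (auto simp: norm_mult norm_power)
  then show ?thesis using A B R unfolding e_def[symmetric] by (intro exI[of _ "A + B * R"]) auto
qed

section \<open>Polynomials and dilations of the spline kernel\<close>

text \<open>Polynomials are described by the vanishing of their higher derivatives, the form in
  which \<open>corr_cancellation\<close> consumes them.\<close>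

definition polyn :: "nat \<Rightarrow> (real^'n::finite \<Rightarrow> complex) \<Rightarrow> bool" where
  "polyn d f \<longleftrightarrow> slow f \<and> (\<forall>is. length is > d \<longrightarrow> iter_partial is f = (\<lambda>x. 0))"

lemma iter_partial_mult_vanish:
  assumes "smooth f" "smooth g"
    "\<And>is. length is > d \<Longrightarrow> iter_partial is f = (\<lambda>x. 0)" "\<And>is. length is > e \<Longrightarrow> iter_partial is g = (\<lambda>x. 0)"
    "length js > d + e"
  shows "iter_partial js (\<lambda>x. f x * g x) = (\<lambda>x. 0)"
  using assms
proof (induction js arbitrary: d e f g rule: rev_induct)
  case (snoc i js)
  have e: "iter_partial (js @ [i]) (\<lambda>x. f x * g x) = (\<lambda>x. iter_partial js (\<lambda>x. partial_deriv i f x * g x) x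
         + iter_partial js (\<lambda>x. f x * partial_deriv i g x) x)"
    unfolding iter_partial_append using snoc.prems(1,2)
    by (simp add: partial_deriv_mult_smooth iter_partial_add smooth_mult smooth_partial_deriv)
  have 1: "iter_partial js (\<lambda>x. partial_deriv i f x * g x) = (\<lambda>x. 0)"
  proof (cases d)
    case 0
    then have "partial_deriv i f = (\<lambda>x. 0)" using snoc.prems(3)[of "[i]"] by simp
    then show ?thesis by simp
  next
    case (Suc d')
    show ?thesis
    proof (rule snoc.IH[of "partial_deriv i f" g d' e])
      show "iter_partial is (partial_deriv i f) = (\<lambda>x. 0)" if "length is > d'" for "is"
        using snoc.prems(3)[of "is @ [i]"] that Suc by (simp add: iter_partial_append)
    qed (use snoc.prems Suc smooth_partial_deriv in auto)
  qed
  have 2: "iter_partial js (\<lambda>x. f x * partial_deriv i g x) = (\<lambda>x. 0)"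
  proof (cases e)
    case 0
    then have "partial_deriv i g = (\<lambda>x. 0)" using snoc.prems(4)[of "[i]"] by simp
    then show ?thesis by simp
  next
    case (Suc e')
    show ?thesis
    proof (rule snoc.IH[of f "partial_deriv i g" d e'])
      show "iter_partial is (partial_deriv i g) = (\<lambda>x. 0)" if "length is > e'" for "is"
        using snoc.prems(4)[of "is @ [i]"] that Suc by (simp add: iter_partial_append)
    qed (use snoc.prems Suc smooth_partial_deriv in auto)
  qed
  show ?case unfolding e 1 2 by simp
qed simp

lemma polyn_mult: "polyn d f \<Longrightarrow> polyn e g \<Longrightarrow> polyn (d + e) (\<lambda>x. f x * g x)"
proof -
  assume f: "polyn d f" and g: "polyn e g"
  then have s: "slow f" "slow g" by (simp_all add: polyn_def)
  then have sm: "smooth f" "smooth g" by (simp_all add: slow_def)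
  have "iter_partial is (\<lambda>x. f x * g x) = (\<lambda>x. 0)" if "length is > d + e" for "is"
    by (rule iter_partial_mult_vanish[OF sm _ _ that]) (use f g in \<open>auto simp: polyn_def\<close>)
  then show ?thesis using slow_mult[OF s] by (simp add: polyn_def)
qed

lemma polyn_const: "polyn 0 (\<lambda>x. c)"
proof -
  have "iter_partial is (\<lambda>x. c) = (\<lambda>x. 0)" if "length is > 0" for "is" :: "'a list"
    using that by (cases "is" rule: rev_cases) (auto simp: iter_partial_append)
  then show ?thesis by (simp add: polyn_def slow_const)
qed

lemma polyn_coord: "polyn 1 (\<lambda>x::real^'n::finite. of_real (x $ i))"
proof -
  have hd: "((\<lambda>x. of_real (x $ i)) has_derivative (\<lambda>h. complex_of_real (h $ i))) (at x)" for x :: "real^'n"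
    by (intro bounded_linear.has_derivative[OF bounded_linear_of_real] bounded_linear.has_derivative[OF bounded_linear_vec_nth] has_derivative_ident)
  have pd: "partial_deriv j (\<lambda>x::real^'n. of_real (x $ i)) = (\<lambda>x. of_real (axis j 1 $ i))" for j
    using partial_deriv_eq[OF hd] by auto
  have "iter_partial is (\<lambda>x. of_real (x $ i)) = (\<lambda>x. 0)" if len: "length is > 1" for "is" :: "'n list"
  proof -
    have "is \<noteq> []" using len by auto
    then obtain js j where js: "is = js @ [j]" by (cases "is" rule: rev_cases) auto
    then have "length js > 0" using len by simp
    then show ?thesis unfolding js iter_partial_append iter_partial_simps pd
      using polyn_const[of "of_real (axis j 1 $ i)", where ?'a = 'n] by (simp add: polyn_def)
  qed
  then show ?thesis by (simp add: polyn_def slow_coord)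
qed

lemma slow_add:
  assumes "slow f" "slow g" shows "slow (\<lambda>x. f x + g x)"
proof -
  have "\<exists>r B. \<forall>x. cmod (iter_partial is (\<lambda>x. f x + g x) x) \<le> B * wt r x" for "is"
  proof -
    obtain r A where A: "A \<ge> 0" "r \<ge> 0" "\<And>x. cmod (iter_partial is f x) \<le> A * wt r x"
      using slow_bound[OF assms(1), of "length is"] by (metis order_refl)
    obtain t B where B: "B \<ge> 0" "t \<ge> 0" "\<And>x. cmod (iter_partial is g x) \<le> B * wt t x"
      using slow_bound[OF assms(2), of "length is"] by (metis order_refl)
    have "cmod (iter_partial is (\<lambda>x. f x + g x) x) \<le> (A + B) * wt (max r t) x" for x
    proof -
      have "cmod (iter_partial is f x + iter_partial is g x) \<le> A * wt (max r t) x + B * wt (max r t) x"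
        using A B by (intro norm_triangle_mono order_trans[OF A(3)] order_trans[OF B(3)] mult_left_mono wt_mono) auto
      then show ?thesis using assms by (simp add: slow_def iter_partial_add distrib_right)
    qed
    then show ?thesis by blast
  qed
  then show ?thesis using assms by (simp add: slow_def smooth_add)
qed

lemma polyn_add: "polyn d f \<Longrightarrow> polyn d g \<Longrightarrow> polyn d (\<lambda>x. f x + g x)"
  by (auto simp: polyn_def slow_add iter_partial_add slow_def[of f] slow_def[of g])

lemma polyn_norm_power: "polyn (2 * k) (\<lambda>x::real^'n::finite. of_real ((x \<bullet> x) ^ k))"
proof (induction k)
  case 0
  then show ?case using polyn_const[of 1] by simp
next
  case (Suc k)
  have "polyn 2 (\<lambda>x::real^'n. \<Sum>i\<in>A. of_real (x $ i) * of_real (x $ i))" if "finite A" for A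
    using that
  proof induction
    case empty
    show ?case using polyn_const[of 0] by (simp add: polyn_def slow_const)
  next
    case (insert a A)
    then show ?case
      using polyn_add[OF polyn_mult[OF polyn_coord[of a] polyn_coord[of a]], of "\<lambda>x. \<Sum>i\<in>A. of_real (x $ i) * of_real (x $ i)"]
      by (simp add: numeral_2_eq_2)
  qed
  from polyn_mult[OF this[OF finite[of UNIV]] Suc.IH]
  show ?case by (simp add: inner_vec_def)
qed

text \<open>A Taylor expansion of order \<open>Suc d\<close> has no remainder, so
  \<open>corr_cancellation\<close> applies with the bound 0.\<close>

lemma corr_polyn_zero:
  assumes "rapid k" "\<And>is. (\<integral>y. xpow is y * k y \<partial>lborel) = 0" "polyn d f"
  shows "corr k f v = 0"
proof -
  have "cmod (corr k f v) \<le> real (CARD('a) ^ Suc d) * 0 * wt 0 v * (\<integral>y. cmod (k y) * (norm y ^ Suc d * wt \<bar>0\<bar> y) \<partial>lborel)"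
    by (rule corr_cancellation[OF assms(1) _ assms(2)]) (use assms(3) in \<open>auto simp: polyn_def\<close>)
  then show ?thesis by simp
qed

text \<open>In the logarithmic case ln (t |x|) = ln t + ln |x|, and the extra term is a multiple of
  |x|^(2k), a polynomial because \<theta> = 2k.\<close>

lemma spline_scale:
  assumes \<theta>: "\<theta> > 0" and t: "t > 0"
  shows "\<exists>P d c. polyn d P \<and> (\<forall>x::real^'n::finite. surface_spline \<theta> (t *\<^sub>R x) = of_real (t powr \<theta>) * surface_spline \<theta> x + c * P x)"
proof (cases "\<exists>k::nat. \<theta> = 2 * real k")
  case True
  then obtain k :: nat where k: "\<theta> = 2 * real k" by blast
  show ?thesis
  proof (rule exI, rule exI, rule exI[of _ "of_real (t powr \<theta> * ln t)"], rule conjI[OF polyn_norm_power[of k]], rule allI)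
    fix x :: "real^'n"
    show "surface_spline \<theta> (t *\<^sub>R x) = of_real (t powr \<theta>) * surface_spline \<theta> x + of_real (t powr \<theta> * ln t) * of_real ((x \<bullet> x) ^ k)"
    proof (cases "x = 0")
      case True
      have "k > 0" using \<theta> k by (cases k) auto
      then show ?thesis using \<open>x = 0\<close> by (simp add: surface_spline_def)
    next
      case False
      have "(x \<bullet> x) ^ k = norm x powr \<theta>"
      proof -
        have "(x \<bullet> x) ^ k = norm x ^ (2 * k)" by (simp only: power2_norm_eq_inner[symmetric] power_mult[symmetric])
        also have "\<dots> = norm x powr real (2 * k)" using False by (intro powr_realpow[symmetric]) simp
        finally show ?thesis by (simp add: k)
      qed
      moreover have "surface_spline \<theta> y = of_real (norm y powr \<theta> * ln (norm y))" for y :: "real^'n"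
        using True by (simp add: surface_spline_def)
      ultimately show ?thesis
        using False t by (simp add: powr_mult ln_mult algebra_simps)
    qed
  qed
next
  case False
  show ?thesis
    by (rule exI, rule exI, rule exI[of _ 0], rule conjI[OF polyn_const[of 0]])
       (use False t in \<open>simp add: surface_spline_def powr_mult\<close>)
qed

text \<open>A change of variables in which the polynomial error of \<open>spline_scale\<close> is
  removed by the moments of \<open>k\<close>. The factor \<open>t ^ CARD('n)\<close> is that of the
  dilations in \<open>lpk_scale\<close>.\<close>

lemma corr_spline_scale:
  fixes k :: "real^'n::finite \<Rightarrow> complex"
  assumes \<theta>: "\<theta> > 0" and t: "t > 0" and k: "k \<in> schwartz"
    and mom: "\<And>is. (\<integral>y. xpow is y * k y \<partial>lborel) = 0"
  shows "corr (surface_spline \<theta>) (\<lambda>x. of_real (t ^ CARD('n)) * k (t *\<^sub>R x)) v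
    = of_real (t powr (- \<theta>)) * corr (surface_spline \<theta>) k (t *\<^sub>R v)"
proof -
  have [measurable]: "k \<in> borel_measurable borel" using schwartz_smooth[OF k] smooth_borel by blast
  have t': "1 / t > 0" using t by simp
  obtain P d c where Pc: "polyn d P \<and> (\<forall>x::real^'n. surface_spline \<theta> ((1/t) *\<^sub>R x) = of_real ((1/t) powr \<theta>) * surface_spline \<theta> x + c * P x)"
    by (rule exE[OF spline_scale[OF \<theta> t', where 'n='n]], elim exE) (rule that)
  have P: "polyn d P" "\<And>x::real^'n. surface_spline \<theta> ((1/t) *\<^sub>R x) = of_real ((1/t) powr \<theta>) * surface_spline \<theta> x + c * P x"
    using Pc by simp_all
  have [measurable]: "P \<in> borel_measurable borel" using P(1) smooth_borel by (auto simp: polyn_def slow_def)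
  have i1: "integrable lborel (\<lambda>x. surface_spline \<theta> x * k (x + t *\<^sub>R v))"
    by (intro dom_integrable spline_dom \<theta> k)
  have "integrable lborel (\<lambda>x. k x * P (x + - (t *\<^sub>R v)))"
    using P(1) by (intro dom_integrable dom_rapid_slow schwartz_rapid k) (simp add: polyn_def)
  from integrable_lborel_affine[OF this, of 1 "t *\<^sub>R v"]
  have i2: "integrable lborel (\<lambda>x. P x * k (x + t *\<^sub>R v))" by (simp add: mult.commute add.commute)
  have z: "(\<integral>x. P x * k (x + t *\<^sub>R v) \<partial>lborel) = 0"
    using corr_swap[of k P "t *\<^sub>R v"] corr_polyn_zero[OF schwartz_rapid[OF k] mom P(1), of "- (t *\<^sub>R v)"] by (simp add: corr_def)
  have "corr (surface_spline \<theta>) (\<lambda>x. of_real (t ^ CARD('n)) * k (t *\<^sub>R x)) v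
     = of_real (\<bar>1/t\<bar> ^ DIM(real^'n)) * (\<integral>x. surface_spline \<theta> (0 + (1/t) *\<^sub>R x) * (of_real (t ^ CARD('n)) * k (t *\<^sub>R ((0 + (1/t) *\<^sub>R x) + v))) \<partial>lborel)"
    unfolding corr_def using t by (intro integral_lborel_affine) auto
  also have "(\<lambda>x. surface_spline \<theta> (0 + (1/t) *\<^sub>R x) * (of_real (t ^ CARD('n)) * k (t *\<^sub>R ((0 + (1/t) *\<^sub>R x) + v))))
     = (\<lambda>x. of_real (t ^ CARD('n)) * (of_real ((1/t) powr \<theta>) * (surface_spline \<theta> x * k (x + t *\<^sub>R v)) + c * (P x * k (x + t *\<^sub>R v))))"
    using t by (auto simp: P(2) scaleR_right_distrib algebra_simps)
  also have "(\<integral>x. of_real (t ^ CARD('n)) * (of_real ((1/t) powr \<theta>) * (surface_spline \<theta> x * k (x + t *\<^sub>R v)) + c * (P x * k (x + t *\<^sub>R v))) \<partial>lborel)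
     = of_real (t ^ CARD('n)) * (of_real ((1/t) powr \<theta>) * (\<integral>x. surface_spline \<theta> x * k (x + t *\<^sub>R v) \<partial>lborel) + c * (\<integral>x. P x * k (x + t *\<^sub>R v) \<partial>lborel))"
    by (subst integral_mult_right_zero, subst Bochner_Integration.integral_add)
       (use i1 i2 in \<open>simp_all only: integral_mult_right_zero integrable_mult_right\<close>)
  also have "of_real (\<bar>1/t\<bar> ^ DIM(real^'n)) * \<dots> = of_real (t powr (- \<theta>)) * corr (surface_spline \<theta>) k (t *\<^sub>R v)"
    using t by (simp add: z corr_def powr_divide powr_minus_divide power_divide)
  finally show ?thesis .
qed

subsection \<open>Tempered distributions\<close>

lemma tempered_lin:
  "tempered T \<Longrightarrow> f \<in> schwartz \<Longrightarrow> g \<in> schwartz \<Longrightarrow> T (\<lambda>x. a * f x + b * g x) = a * T f + b * T g"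
  by (simp add: tempered_def)

lemma tempered_add: "tempered T \<Longrightarrow> f \<in> schwartz \<Longrightarrow> g \<in> schwartz \<Longrightarrow> T (\<lambda>x. f x + g x) = T f + T g"
  using tempered_lin[of T f g 1 1] by simp

lemma tempered_diff: "tempered T \<Longrightarrow> f \<in> schwartz \<Longrightarrow> g \<in> schwartz \<Longrightarrow> T (\<lambda>x. f x - g x) = T f - T g"
  using tempered_lin[of T f g 1 "-1"] by simp

lemma tempered_cmult: "tempered T \<Longrightarrow> f \<in> schwartz \<Longrightarrow> T (\<lambda>x. a * f x) = a * T f"
  using tempered_lin[of T f f a 0] by simp

lemma tempered_zero: "tempered T \<Longrightarrow> T (\<lambda>x. 0) = 0"
  using tempered_cmult[of T "\<lambda>x. 0" 0] schwartz_zero by simp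

lemma tempered_sum:
  "tempered T \<Longrightarrow> (\<And>a. a \<in> A \<Longrightarrow> f a \<in> schwartz) \<Longrightarrow> T (\<lambda>x. \<Sum>a\<in>A. f a x) = (\<Sum>a\<in>A. T (f a))"
proof (induction A rule: infinite_finite_induct)
  case (insert a A)
  have "T (\<lambda>x. f a x + (\<Sum>b\<in>A. f b x)) = T (f a) + T (\<lambda>x. \<Sum>b\<in>A. f b x)"
    using insert.prems by (intro tempered_add schwartz_sum) auto
  then show ?case using insert by simp
qed (simp_all add: tempered_zero)

lemma tempered_bound:
  assumes "tempered T"
  obtains C k where "C \<ge> 0" "\<And>\<psi>. \<psi> \<in> schwartz \<Longrightarrow> cmod (T \<psi>) \<le> C * schwartz_seminorm k \<psi>"
proof -
  obtain C k where C: "\<forall>\<psi>\<in>schwartz. cmod (T \<psi>) \<le> C * schwartz_seminorm k \<psi>"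
    using assms unfolding tempered_def by (elim conjE exE)
  show thesis
  proof (rule that[of "\<bar>C\<bar>" k])
    fix \<psi> :: "real^'a \<Rightarrow> complex" assume \<psi>: "\<psi> \<in> schwartz"
    have "C * schwartz_seminorm k \<psi> \<le> \<bar>C\<bar> * schwartz_seminorm k \<psi>"
      by (intro mult_right_mono seminorm_nonneg \<psi>) auto
    then show "cmod (T \<psi>) \<le> \<bar>C\<bar> * schwartz_seminorm k \<psi>" using C \<psi> by force
  qed simp
qed

lemma tempered_limit:
  assumes T: "tempered T" and g: "g \<in> schwartz" and gn: "\<And>n. gn n \<in> schwartz"
    and b: "\<And>k. \<exists>C. \<forall>n. schwartz_seminorm k (\<lambda>x. gn n x - g x) \<le> C * a n" and a: "a \<longlonglongrightarrow> 0"
  shows "(\<lambda>n. T (gn n)) \<longlonglongrightarrow> T g"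
proof -
  obtain C k where C: "C \<ge> 0" "\<And>\<psi>. \<psi> \<in> schwartz \<Longrightarrow> cmod (T \<psi>) \<le> C * schwartz_seminorm k \<psi>"
    using tempered_bound[OF T] by metis
  obtain D where D: "\<And>n. schwartz_seminorm k (\<lambda>x. gn n x - g x) \<le> D * a n" using b by blast
  have "(\<lambda>n. T (gn n) - T g) \<longlonglongrightarrow> 0"
  proof (rule Lim_null_comparison)
    show "\<forall>\<^sub>F n in sequentially. norm (T (gn n) - T g) \<le> C * (D * a n)"
    proof (rule always_eventually, rule allI)
      fix n
      have "norm (T (gn n) - T g) \<le> C * schwartz_seminorm k (\<lambda>x. gn n x - g x)"
        unfolding tempered_diff[OF T gn g, symmetric] by (rule C(2)[OF schwartz_diff[OF gn g]])
      also have "\<dots> \<le> C * (D * a n)" by (rule mult_left_mono[OF D C(1)])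
      finally show "norm (T (gn n) - T g) \<le> C * (D * a n)" .
    qed
    have "(\<lambda>n. C * (D * a n)) \<longlonglongrightarrow> C * (D * 0)" by (intro tendsto_intros a)
    then show "(\<lambda>n. C * (D * a n)) \<longlonglongrightarrow> 0" by simp
  qed
  then show ?thesis by (simp add: LIM_zero_iff)
qed

section \<open>Supports and cutoffs\<close>

lemma fun_support_subset: "closed K \<Longrightarrow> (\<And>x. f x \<noteq> 0 \<Longrightarrow> x \<in> K) \<Longrightarrow> fun_support f \<subseteq> K"
  unfolding fun_support_def by (intro closure_minimal) auto

lemma test_mult:
  assumes "\<psi> \<in> test_functions" "smooth f"
  shows "(\<lambda>x. f x * \<psi> x) \<in> test_functions"
proof -
  have "fun_support (\<lambda>x. f x * \<psi> x) \<subseteq> fun_support \<psi>"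
    unfolding fun_support_def by (intro closure_mono) auto
  moreover have "closed (fun_support (\<lambda>x. f x * \<psi> x))" by (simp add: fun_support_def)
  ultimately have "compact (fun_support (\<lambda>x. f x * \<psi> x))"
    using assms(1) compact_Int_closed[of "fun_support \<psi>" "fun_support (\<lambda>x. f x * \<psi> x)"]
    by (simp add: test_functions_def Int_absorb1)
  then show ?thesis using assms by (auto simp: test_functions_def intro: smooth_mult)
qed

text \<open>A rescaled Littlewood--Paley generator serves as bump function throughout.\<close>

definition bump :: "(real^'n \<Rightarrow> complex) \<Rightarrow> real^'n \<Rightarrow> real \<Rightarrow> real^'n::finite \<Rightarrow> complex" where
  "bump \<Phi> c r x = \<Phi> ((1 / r) *\<^sub>R (x - c))"

lemma smooth_bump: "lp_generator \<Phi> \<Longrightarrow> smooth (bump \<Phi> c r)"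
  using smooth_affine[of \<Phi> "1/r" "- ((1/r) *\<^sub>R c)"]
  by (simp add: bump_def[abs_def] lp_generator_def scaleR_right_diff_distrib)

lemma bump_one: "lp_generator \<Phi> \<Longrightarrow> r > 0 \<Longrightarrow> x \<in> cball c r \<Longrightarrow> bump \<Phi> c r x = 1"
  by (simp add: bump_def lp_generator_def dist_norm norm_minus_commute)

lemma bump_zero: "lp_generator \<Phi> \<Longrightarrow> r > 0 \<Longrightarrow> x \<notin> ball c (2 * r) \<Longrightarrow> bump \<Phi> c r x = 0"
  by (simp add: bump_def lp_generator_def dist_norm norm_minus_commute le_divide_eq not_less)

lemma bump_test:
  assumes "lp_generator \<Phi>" "r > 0" shows "bump \<Phi> c r \<in> test_functions"
proof -
  have s: "fun_support (bump \<Phi> c r) \<subseteq> cball c (2 * r)"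
    using bump_zero[OF assms, of _ c] by (intro fun_support_subset) force+
  have "closed (fun_support (bump \<Phi> c r))" by (simp add: fun_support_def)
  then have "compact (fun_support (bump \<Phi> c r))"
    using s compact_Int_closed[OF compact_cball[of c "2 * r"]] by (metis Int_absorb1)
  then show ?thesis using smooth_bump[OF assms(1)] by (simp add: test_functions_def)
qed

text \<open>A partition of unity built by peeling: the part multiplied by the bump lives in one of
  the small balls where T vanishes, and the part multiplied by 1 minus the bump is covered by the
  remaining balls.\<close>

lemma distr_vanish_cover:
  fixes \<Phi> \<psi> :: "real^'n::finite \<Rightarrow> complex"
  assumes \<Phi>: "lp_generator \<Phi>" and T: "tempered T"
    and fin: "finite F"
    and good: "\<And>c r \<eta>. (c, r) \<in> F \<Longrightarrow> r > 0 \<and> (\<eta> \<in> test_functions \<longrightarrow> fun_support \<eta> \<subseteq> cball c (2 * r) \<longrightarrow> T \<eta> = 0)"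
    and \<psi>: "\<psi> \<in> test_functions" and cov: "\<And>x. \<psi> x \<noteq> 0 \<Longrightarrow> \<exists>(c, r)\<in>F. x \<in> ball c r"
  shows "T \<psi> = 0"
  using fin good \<psi> cov
proof (induction F arbitrary: \<psi> rule: finite_induct)
  case empty
  have "\<psi> = (\<lambda>x. 0)"
  proof
    fix x show "\<psi> x = 0" using empty.prems(3)[of x] by auto
  qed
  then show ?case using tempered_zero[OF T] by simp
next
  case (insert a F)
  obtain c r where a: "a = (c, r)" by (cases a)
  have r: "r > 0" using insert.prems(1)[of c r "\<lambda>x. 0"] a by simp
  have sm: "smooth (bump \<Phi> c r)" "smooth (\<lambda>x. 1 - bump \<Phi> c r x)"
    by (intro smooth_diff smooth_const smooth_bump \<Phi>)+
  have t1: "(\<lambda>x. bump \<Phi> c r x * \<psi> x) \<in> test_functions" by (rule test_mult[OF insert.prems(2) sm(1)])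
  have t2: "(\<lambda>x. (1 - bump \<Phi> c r x) * \<psi> x) \<in> test_functions" by (rule test_mult[OF insert.prems(2) sm(2)])
  have "fun_support (\<lambda>x. bump \<Phi> c r x * \<psi> x) \<subseteq> cball c (2 * r)"
    using bump_zero[OF \<Phi> r, of _ c] by (intro fun_support_subset) force+
  then have 1: "T (\<lambda>x. bump \<Phi> c r x * \<psi> x) = 0"
    using insert.prems(1)[of c r "\<lambda>x. bump \<Phi> c r x * \<psi> x"] a t1 by simp
  have 2: "T (\<lambda>x. (1 - bump \<Phi> c r x) * \<psi> x) = 0"
  proof (rule insert.IH[OF _ t2])
    fix c' r' \<eta> assume "(c', r') \<in> F"
    then show "r' > 0 \<and> (\<eta> \<in> test_functions \<longrightarrow> fun_support \<eta> \<subseteq> cball c' (2 * r') \<longrightarrow> T \<eta> = 0)"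
      by (intro insert.prems(1) insertI2)
  next
    fix x assume nz: "(1 - bump \<Phi> c r x) * \<psi> x \<noteq> 0"
    then have "x \<notin> ball c r" using bump_one[OF \<Phi> r, of x c] by auto
    moreover have "\<exists>(c, r)\<in>insert a F. x \<in> ball c r" using nz by (intro insert.prems(3)) simp
    ultimately show "\<exists>(c, r)\<in>F. x \<in> ball c r" using a by auto
  qed
  have "T (\<lambda>x. bump \<Phi> c r x * \<psi> x + (1 - bump \<Phi> c r x) * \<psi> x) = 0"
    using 1 2 tempered_add[OF T test_schwartz[OF t1] test_schwartz[OF t2]] by simp
  then show ?case by (simp add: algebra_simps)
qed

lemma distr_vanish_off_support:
  fixes \<Phi> \<psi> :: "real^'n::finite \<Rightarrow> complex"
  assumes \<Phi>: "lp_generator \<Phi>" and T: "tempered T" and \<psi>: "\<psi> \<in> test_functions"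
    and disj: "fun_support \<psi> \<inter> distr_support T = {}"
  shows "T \<psi> = 0"
proof -
  have "\<exists>r>0. \<forall>\<eta>\<in>test_functions. fun_support \<eta> \<subseteq> cball x (2 * r) \<longrightarrow> T \<eta> = 0" if "x \<in> fun_support \<psi>" for x
  proof -
    have "x \<notin> distr_support T" using disj that by auto
    then obtain U where U: "open U" "x \<in> U" "\<And>\<eta>. \<eta> \<in> test_functions \<Longrightarrow> fun_support \<eta> \<subseteq> U \<Longrightarrow> T \<eta> = 0"
      unfolding distr_support_def by blast
    obtain e where e: "e > 0" "cball x e \<subseteq> U" using U(1,2) open_contains_cball by blast
    show ?thesis using U(3) e by (intro exI[of _ "e / 2"]) auto
  qed
  then obtain R where R: "\<And>x. x \<in> fun_support \<psi> \<Longrightarrow> R x > 0"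
    "\<And>x \<eta>. x \<in> fun_support \<psi> \<Longrightarrow> \<eta> \<in> test_functions \<Longrightarrow> fun_support \<eta> \<subseteq> cball x (2 * R x) \<Longrightarrow> T \<eta> = 0"
    by metis
  have 1: "compact (fun_support \<psi>)" using \<psi> by (simp add: test_functions_def)
  have 2: "fun_support \<psi> \<subseteq> (\<Union>x\<in>fun_support \<psi>. ball x (R x))" using R(1) by force
  obtain K where K: "K \<subseteq> fun_support \<psi>" "finite K" "fun_support \<psi> \<subseteq> (\<Union>x\<in>K. ball x (R x))"
    by (rule compactE_image[OF 1 open_ball 2])
  show ?thesis
  proof (rule distr_vanish_cover[OF \<Phi> T, of "(\<lambda>x. (x, R x)) ` K"])
    show "finite ((\<lambda>x. (x, R x)) ` K)" using K(2) by simp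
    show "r > 0 \<and> (\<eta> \<in> test_functions \<longrightarrow> fun_support \<eta> \<subseteq> cball c (2 * r) \<longrightarrow> T \<eta> = 0)"
      if "(c, r) \<in> (\<lambda>x. (x, R x)) ` K" for c r \<eta>
      using that K(1) R by auto
    show "\<exists>(c, r)\<in>(\<lambda>x. (x, R x)) ` K. x \<in> ball c r" if "\<psi> x \<noteq> 0" for x
    proof -
      have "x \<in> fun_support \<psi>" using that closure_subset unfolding fun_support_def by fastforce
      then obtain y where "y \<in> K" "x \<in> ball y (R y)" using K(3) by blast
      then show ?thesis by auto
    qed
  qed (rule \<psi>)
qed

text \<open>Both cutoffs equal 1 near the support of T, so their difference times \<open>f\<close>
  is a test function supported away from it. This makes the choice hidden in \<open>pairing\<close>
  harmless.\<close>

lemma cutoff_independent: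
  fixes \<Phi> f :: "real^'n::finite \<Rightarrow> complex"
  assumes \<Phi>: "lp_generator \<Phi>" and T: "tempered T"
    and z: "support_cutoff T \<zeta>" "support_cutoff T \<zeta>'" and f: "smooth f"
  shows "T (\<lambda>x. \<zeta> x * f x) = T (\<lambda>x. \<zeta>' x * f x)"
proof -
  have t: "(\<lambda>x. f x * \<zeta> x) \<in> test_functions" "(\<lambda>x. f x * \<zeta>' x) \<in> test_functions"
    using z f by (auto simp: support_cutoff_def intro: test_mult)
  obtain U where U: "open U" "distr_support T \<subseteq> U" "\<And>x. x \<in> U \<Longrightarrow> \<zeta> x = 1" using z(1) unfolding support_cutoff_def by blast
  obtain V where V: "open V" "distr_support T \<subseteq> V" "\<And>x. x \<in> V \<Longrightarrow> \<zeta>' x = 1" using z(2) unfolding support_cutoff_def by blast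
  let ?g = "\<lambda>x. f x * \<zeta> x - f x * \<zeta>' x"
  have "fun_support ?g \<subseteq> - (U \<inter> V)"
    using U V by (intro fun_support_subset) (auto simp: closed_Compl)
  then have d: "fun_support ?g \<inter> distr_support T = {}" using U(2) V(2) by auto
  have sub: "fun_support ?g \<subseteq> fun_support (\<lambda>x. f x * \<zeta> x) \<union> fun_support (\<lambda>x. f x * \<zeta>' x)"
    unfolding fun_support_def closure_Un[symmetric] by (intro closure_mono) auto
  have "compact (fun_support (\<lambda>x. f x * \<zeta> x) \<union> fun_support (\<lambda>x. f x * \<zeta>' x))"
    using t by (intro compact_Un) (auto simp: test_functions_def)
  then have "compact (fun_support ?g)"
  proof -
    assume K: "compact (fun_support (\<lambda>x. f x * \<zeta> x) \<union> fun_support (\<lambda>x. f x * \<zeta>' x))"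
    have "closed (fun_support ?g)" unfolding fun_support_def by (rule closed_closure)
    from compact_Int_closed[OF K this] show ?thesis unfolding Int_absorb1[OF sub] .
  qed
  moreover have "smooth ?g"
  proof (rule smooth_diff)
    show "smooth (\<lambda>x. f x * \<zeta> x)" "smooth (\<lambda>x. f x * \<zeta>' x)" using t by (simp_all add: test_functions_def)
  qed
  ultimately have "?g \<in> test_functions" by (simp add: test_functions_def)
  then have "T ?g = 0" by (rule distr_vanish_off_support[OF \<Phi> T _ d])
  moreover have "T ?g = T (\<lambda>x. f x * \<zeta> x) - T (\<lambda>x. f x * \<zeta>' x)"
    by (rule tempered_diff[OF T test_schwartz[OF t(1)] test_schwartz[OF t(2)]])
  moreover have "(\<lambda>x. f x * \<zeta> x) = (\<lambda>x. \<zeta> x * f x)" "(\<lambda>x. f x * \<zeta>' x) = (\<lambda>x. \<zeta>' x * f x)"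
    by (simp_all add: mult.commute)
  ultimately show ?thesis by simp
qed

lemma support_cutoff_bump:
  assumes "lp_generator \<Phi>" "r > 0" "distr_support T \<subseteq> ball 0 r"
  shows "support_cutoff T (bump \<Phi> 0 r)"
  unfolding support_cutoff_def
  using assms bump_test[OF assms(1,2), of 0] bump_one[OF assms(1,2), of _ 0]
  by (auto intro!: exI[of _ "ball 0 r"])

lemma pairing_eq:
  assumes \<Phi>: "lp_generator \<Phi>" and T: "tempered T" and r: "r > 0" "distr_support T \<subseteq> ball 0 r" and f: "smooth f"
  shows "pairing T f = T (\<lambda>x. bump \<Phi> 0 r x * f x)"
proof -
  have c: "support_cutoff T (bump \<Phi> 0 r)" by (rule support_cutoff_bump[OF \<Phi> r])
  then have "support_cutoff T (SOME \<zeta>. support_cutoff T \<zeta>)" by (rule someI[where P="support_cutoff T"])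
  from cutoff_independent[OF \<Phi> T this c f] show ?thesis by (simp add: pairing_def)
qed

text \<open>Dilation by a factor \<open>n >= 1\<close> only shrinks derivatives, so one bound serves
  all radii.\<close>

lemma bump_deriv_bound:
  assumes \<Phi>: "lp_generator \<Phi>"
  shows "\<exists>A\<ge>0. \<forall>n>0. \<forall>is x. length is \<le> k \<longrightarrow> cmod (iter_partial is (\<lambda>x. bump \<Phi> 0 (real n) x - 1) x) \<le> A"
proof -
  have S: "\<Phi> \<in> schwartz" by (rule generator_schwartz[OF \<Phi>])
  have sm: "smooth \<Phi>" using \<Phi> by (simp add: lp_generator_def)
  define A where "A = schwartz_seminorm k \<Phi> + 1"
  have "cmod (iter_partial is (\<lambda>x. bump \<Phi> 0 (real n) x - 1) x) \<le> A" if "n > 0" and l: "length is \<le> k" for n x and "is" :: "'a list"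
  proof -
    have b: "bump \<Phi> 0 (real n) = (\<lambda>x. \<Phi> ((1 / real n) *\<^sub>R x + 0))" by (auto simp: bump_def)
    have "cmod (iter_partial is (bump \<Phi> 0 (real n)) x) = (1 / real n) ^ length is * cmod (iter_partial is \<Phi> ((1 / real n) *\<^sub>R x))"
      unfolding b iter_partial_affine[OF sm] by (simp add: norm_mult norm_power norm_divide)
    also have "\<dots> \<le> 1 * (schwartz_seminorm k \<Phi> * wt (- real k) ((1 / real n) *\<^sub>R x))"
      using that by (intro mult_mono power_le_one seminorm_bound S) auto
    also have "\<dots> \<le> 1 * (schwartz_seminorm k \<Phi> * 1)"
      by (intro mult_left_mono wt_le_1 seminorm_nonneg S) auto
    finally have 1: "cmod (iter_partial is (bump \<Phi> 0 (real n)) x) \<le> schwartz_seminorm k \<Phi>" by simp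
    have 2: "cmod (iter_partial is (\<lambda>x. 1) x) \<le> 1"
      by (cases "is" rule: rev_cases) (auto simp: iter_partial_append)
    show ?thesis
      unfolding iter_partial_diff[OF smooth_bump[OF \<Phi>] smooth_const] A_def
      using norm_triangle_ineq4[of "iter_partial is (bump \<Phi> 0 (real n)) x" "iter_partial is (\<lambda>x. 1) x"] 1 2 by linarith
  qed
  then show ?thesis using seminorm_nonneg[OF S, of k] by (intro exI[of _ A]) (auto simp: A_def)
qed

text \<open>The error vanishes on the ball of radius \<open>Suc n\<close>; outside it one surplus
  order of decay of \<open>g\<close> gives the factor 1 / \<open>Suc n\<close>, which is why the
  seminorm of index \<open>Suc k\<close> appears.\<close>

lemma bump_limit:
  assumes \<Phi>: "lp_generator \<Phi>" and T: "tempered T" and g: "g \<in> schwartz"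
  shows "(\<lambda>n. T (\<lambda>x. bump \<Phi> 0 (real (Suc n)) x * g x)) \<longlonglongrightarrow> T g"
proof (rule tempered_limit[OF T g, where a="\<lambda>n. 1 / real (Suc n)"])
  have sl: "slow (bump \<Phi> 0 r)" if "r > 0" for r
    by (intro schwartz_slow test_schwartz bump_test[OF \<Phi> that])
  show "(\<lambda>x. bump \<Phi> 0 (real (Suc n)) x * g x) \<in> schwartz" for n
    by (intro slow_mult_schwartz sl g) simp
  show "(\<lambda>n. 1 / real (Suc n)) \<longlonglongrightarrow> 0" using LIMSEQ_inverse_real_of_nat by (simp add: inverse_eq_divide)
  fix k
  obtain A where A: "A \<ge> 0" "\<And>n is x. n > 0 \<Longrightarrow> length is \<le> k \<Longrightarrow> cmod (iter_partial is (\<lambda>x. bump \<Phi> 0 (real n) x - 1) x) \<le> A"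
    using bump_deriv_bound[OF \<Phi>, of k] by metis
  let ?N = "schwartz_seminorm (Suc k) g"
  have "schwartz_seminorm k (\<lambda>x. bump \<Phi> 0 (real (Suc n)) x * g x - g x) \<le> 2 ^ k * A * ?N * (1 / real (Suc n))" for n
  proof (rule seminorm_least)
    fix "is" :: "'a list" and x assume l: "length is \<le> k"
    let ?h = "\<lambda>x. (bump \<Phi> 0 (real (Suc n)) x - 1) * g x"
    have "cmod (iter_partial is ?h x) \<le> 2 ^ k * A * ?N * (1 / real (Suc n)) * wt (- real k) x"
    proof (cases "x \<in> ball 0 (real (Suc n))")
      case True
      have "iter_partial is ?h x = 0"
        by (rule iter_partial_zero_on_open[OF open_ball True]) (simp add: bump_one[OF \<Phi>])
      then show ?thesis using A(1) seminorm_nonneg[OF g, of "Suc k"] by simp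
    next
      case False
      have "cmod (iter_partial is ?h x) \<le> 2 ^ k * A * (?N * wt (- real (Suc k)) x)"
      proof (rule leibniz_bound[where n=k])
        show "smooth (\<lambda>x. bump \<Phi> 0 (real (Suc n)) x - 1)" by (intro smooth_diff smooth_bump smooth_const \<Phi>)
        show "cmod (iter_partial js g x) \<le> ?N * wt (- real (Suc k)) x" if "length js \<le> k" for js
          using that by (intro seminorm_bound g) simp
        show "cmod (iter_partial js (\<lambda>x. bump \<Phi> 0 (real (Suc n)) x - 1) x) \<le> A" if "length js \<le> k" for js
          by (rule A(2)[OF _ that]) simp
      qed (use A l schwartz_smooth[OF g] in auto)
      also have "wt (- real (Suc k)) x = wt (- real k) x * wt (-1) x" by (simp add: wt_mult algebra_simps)
      also have "2 ^ k * A * (?N * (wt (- real k) x * wt (-1) x)) \<le> 2 ^ k * A * (?N * (wt (- real k) x * (1 / real (Suc n))))"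
      proof -
        have "wt (-1) x = 1 / (1 + norm x)" using norm_ge_zero[of x] by (simp add: wt_def powr_minus_divide)
        then have "wt (-1) x \<le> 1 / real (Suc n)" using False by (simp add: frac_le)
        then show ?thesis using A(1) seminorm_nonneg[OF g, of "Suc k"] by (intro mult_left_mono) auto
      qed
      finally show ?thesis by (simp only: mult_ac)
    qed
    then show "cmod (iter_partial is (\<lambda>x. bump \<Phi> 0 (real (Suc n)) x * g x - g x) x) \<le> 2 ^ k * A * ?N * (1 / real (Suc n)) * wt (- real k) x"
      by (simp add: left_diff_distrib)
  qed
  then show "\<exists>C. \<forall>n. schwartz_seminorm k (\<lambda>x. bump \<Phi> 0 (real (Suc n)) x * g x - g x) \<le> C * (1 / real (Suc n))" by blast
qed

text \<open>The support is defined through test functions; this extends its effect to Schwartz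
  functions. All large cutoffs give the same value by \<open>cutoff_independent\<close>, and by
  \<open>bump_limit\<close> these values converge to \<open>T g\<close>.\<close>

lemma tempered_cutoff:
  assumes \<Phi>: "lp_generator \<Phi>" and T: "tempered T" and r: "r > 0" "distr_support T \<subseteq> ball 0 r" and g: "g \<in> schwartz"
  shows "T (\<lambda>x. bump \<Phi> 0 r x * g x) = T g"
proof -
  define n0 where "n0 = nat \<lceil>r\<rceil>"
  have "T (\<lambda>x. bump \<Phi> 0 (real (Suc (n + n0))) x * g x) = T (\<lambda>x. bump \<Phi> 0 r x * g x)" for n
  proof (rule cutoff_independent[OF \<Phi> T _ _ schwartz_smooth[OF g]])
    have "r \<le> real (Suc (n + n0))" unfolding n0_def by linarith
    then show "support_cutoff T (bump \<Phi> 0 (real (Suc (n + n0))))"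
      using r(2) by (intro support_cutoff_bump[OF \<Phi>]) auto
  qed (rule support_cutoff_bump[OF \<Phi> r])
  moreover have "(\<lambda>n. T (\<lambda>x. bump \<Phi> 0 (real (Suc (n + n0))) x * g x)) \<longlonglongrightarrow> T g"
    by (rule LIMSEQ_ignore_initial_segment[OF bump_limit[OF \<Phi> T g]])
  ultimately have "(\<lambda>n::nat. T (\<lambda>x. bump \<Phi> 0 r x * g x)) \<longlonglongrightarrow> T g" by simp
  then show ?thesis by (rule LIMSEQ_unique[OF tendsto_const])
qed

subsection \<open>Littlewood--Paley blocks as convolutions\<close>

definition lpk :: "(real^'n \<Rightarrow> complex) \<Rightarrow> nat \<Rightarrow> real^'n::finite \<Rightarrow> complex" where
  "lpk \<Phi> j = kern (dyadic \<Phi> j)"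

lemma dilate_schwartz: "lp_generator \<Phi> \<Longrightarrow> (\<lambda>\<xi>. \<Phi> ((1 / 2 ^ j) *\<^sub>R \<xi>)) \<in> schwartz"
  using schwartz_affine[OF generator_schwartz, of \<Phi> "1 / 2 ^ j" 0] by simp

lemma dyadic_schwartz: "lp_generator \<Phi> \<Longrightarrow> dyadic \<Phi> j \<in> schwartz"
  unfolding dyadic_def[abs_def]
  by (cases "j = 0") (simp_all add: generator_schwartz schwartz_diff dilate_schwartz)

lemma lpk_schwartz: "lp_generator \<Phi> \<Longrightarrow> lpk \<Phi> j \<in> schwartz"
  unfolding lpk_def by (intro schwartz_kern dyadic_schwartz)

lemma lp_block_conv:
  "lp_generator \<Phi> \<Longrightarrow> \<psi> \<in> schwartz \<Longrightarrow> lp_block \<Phi> j T \<psi> = T (conv (lpk \<Phi> j) \<psi>)"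
  by (simp add: lp_block_def inv_fourier_distr_def mult_distr_def fourier_distr_def lpk_def
      fourier_mult_conv dyadic_schwartz)

lemma lpk_sum:
  assumes "lp_generator \<Phi>"
  shows "(\<Sum>j\<le>J. lpk \<Phi> j x) = kern (\<lambda>\<xi>. \<Phi> ((1 / 2 ^ J) *\<^sub>R \<xi>)) x"
proof (induction J)
  case 0
  have "dyadic \<Phi> 0 = \<Phi>" by (auto simp: dyadic_def)
  then show ?case by (simp add: lpk_def)
next
  case (Suc J)
  have "dyadic \<Phi> (Suc J) = (\<lambda>\<xi>. \<Phi> ((1 / 2 ^ Suc J) *\<^sub>R \<xi>) - \<Phi> ((1 / 2 ^ J) *\<^sub>R \<xi>))"
    by (auto simp: dyadic_def)
  then have "lpk \<Phi> (Suc J) x = kern (\<lambda>\<xi>. \<Phi> ((1 / 2 ^ Suc J) *\<^sub>R \<xi>)) x - kern (\<lambda>\<xi>. \<Phi> ((1 / 2 ^ J) *\<^sub>R \<xi>)) x"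
    unfolding lpk_def using kern_diff[OF dilate_schwartz[OF assms, of "Suc J"] dilate_schwartz[OF assms, of J]] by simp
  then show ?case using Suc by simp
qed

text \<open>Only the kernels from index 1 on are dilates of a single function; the multiplier of the
  block 0 is the low-pass function itself.\<close>

lemma lpk_scale:
  fixes \<Phi> :: "real^'n::finite \<Rightarrow> complex"
  assumes "lp_generator \<Phi>"
  shows "lpk \<Phi> (Suc j) = (\<lambda>x. of_real ((2 ^ j) ^ CARD('n)) * lpk \<Phi> 1 ((2 ^ j) *\<^sub>R x))"
proof
  fix x
  have "dyadic \<Phi> (Suc j) = (\<lambda>\<xi>. dyadic \<Phi> 1 ((1 / 2 ^ j) *\<^sub>R \<xi>))"
    by (auto simp: dyadic_def)
  then show "lpk \<Phi> (Suc j) x = of_real ((2 ^ j) ^ CARD('n)) * lpk \<Phi> 1 ((2 ^ j) *\<^sub>R x)"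
    unfolding lpk_def using kern_scale[of "dyadic \<Phi> 1" "2 ^ j" x] smooth_borel[OF schwartz_smooth[OF dyadic_schwartz[OF assms]]]
    by simp
qed

lemma kern_dilate_scale:
  fixes \<Phi> :: "real^'n::finite \<Rightarrow> complex"
  assumes "lp_generator \<Phi>"
  shows "kern (\<lambda>\<xi>. \<Phi> ((1 / 2 ^ J) *\<^sub>R \<xi>)) x = of_real ((2 ^ J) ^ CARD('n)) * kern \<Phi> ((2 ^ J) *\<^sub>R x)"
  using kern_scale[of \<Phi> "2 ^ J" x] smooth_borel[OF schwartz_smooth[OF generator_schwartz[OF assms]]] by simp

text \<open>Moments are derivatives of the multiplier at 0, and for positive index the multiplier
  vanishes on the unit ball.\<close>

lemma lpk_moments:
  assumes "lp_generator \<Phi>"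
  shows "(\<integral>y. xpow is y * lpk \<Phi> (Suc j) y \<partial>lborel) = 0"
proof -
  have "iter_partial is (dyadic \<Phi> (Suc j)) 0 = 0"
  proof (rule iter_partial_zero_on_open[of "ball 0 1"])
    fix \<xi> :: "real^'a" assume xi: "\<xi> \<in> ball 0 1"
    have "\<Phi> ((1 / 2 ^ i) *\<^sub>R \<xi>) = 1" for i
    proof -
      have "(1::real) \<le> 2 ^ i" by simp
      then have "norm \<xi> \<le> 2 ^ i" using xi by (simp del: one_le_power)
      then have "norm ((1 / 2 ^ i) *\<^sub>R \<xi>) \<le> 1" by (simp add: divide_le_eq)
      then show ?thesis using assms by (simp only: lp_generator_def)
    qed
    from this[of "Suc j"] this[of j] show "dyadic \<Phi> (Suc j) \<xi> = 0" by (simp add: dyadic_def)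
  qed auto
  then show ?thesis unfolding lpk_def by (subst kern_moments[OF dyadic_schwartz[OF assms]]) simp
qed

section \<open>Overlapping dyadic blocks\<close>

text \<open>The subtraction is truncated, so \<open>near 0\<close> consists of 0 and 1 only.\<close>

definition near :: "nat \<Rightarrow> nat set" where
  "near j = {j - 1..j + 1}"

lemma dyadic_partial_sum: "(\<Sum>i\<le>J. dyadic \<Phi> i \<xi>) = \<Phi> ((1 / 2 ^ J) *\<^sub>R \<xi>)"
  by (induction J) (auto simp: dyadic_def)

text \<open>The sum telescopes to \<Phi> at scale j + 1, minus \<Phi> at scale j - 2 if j >= 2.
  Wherever \<open>dyadic \<Phi> j\<close> is not 0, the first value is 1 and the second is
  0.\<close>

lemma dyadic_near:
  assumes \<Phi>: "lp_generator \<Phi>"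
  shows "(\<Sum>i\<in>near j. dyadic \<Phi> i \<xi>) * dyadic \<Phi> j \<xi> = dyadic \<Phi> j \<xi>"
proof (cases "dyadic \<Phi> j \<xi> = 0")
  case False
  have one: "\<Phi> \<eta> = 1" if "norm \<eta> \<le> 1" for \<eta> using \<Phi> that by (simp add: lp_generator_def)
  have zero: "\<Phi> \<eta> = 0" if "norm \<eta> \<ge> 2" for \<eta> using \<Phi> that by (simp add: lp_generator_def)
  have up: "norm \<xi> \<le> 2 ^ (j + 1)"
  proof (rule ccontr)
    assume "\<not> ?thesis"
    then have big: "norm \<xi> > 2 * 2 ^ j" by simp
    then have 1: "\<Phi> ((1 / 2 ^ j) *\<^sub>R \<xi>) = 0" by (intro zero) (simp add: le_divide_eq)
    have "\<Phi> ((1 / 2 ^ (j - 1)) *\<^sub>R \<xi>) = 0"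
    proof (rule zero)
      have "2 * 2 ^ (j - 1) \<le> 2 * (2 ^ j :: real)" by (intro mult_left_mono power_increasing) auto
      then have "2 * 2 ^ (j - 1) \<le> norm \<xi>" using big by linarith
      then show "2 \<le> norm ((1 / 2 ^ (j - 1)) *\<^sub>R \<xi>)" by (simp add: le_divide_eq)
    qed
    with 1 False show False by (auto simp: dyadic_def split: if_splits)
  qed
  have S: "\<Phi> ((1 / 2 ^ (j + 1)) *\<^sub>R \<xi>) = 1" using up by (intro one) (simp add: divide_le_eq)
  have "(\<Sum>i\<in>near j. dyadic \<Phi> i \<xi>) = 1"
  proof (cases "j \<le> 1")
    case True
    then have "near j = {..j + 1}" by (auto simp: near_def)
    then show ?thesis using S dyadic_partial_sum[of \<Phi> \<xi> "j + 1"] by simp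
  next
    case j: False
    then obtain i where i: "j = Suc (Suc i)" by (metis One_nat_def Suc_le_eq less_imp_Suc_add not_le add_Suc_right add_0)
    have "{..j + 1} = {..i} \<union> near j" "{..i} \<inter> near j = {}" by (auto simp: near_def i)
    then have "(\<Sum>i\<le>j + 1. dyadic \<Phi> i \<xi>) = (\<Sum>k\<le>i. dyadic \<Phi> k \<xi>) + (\<Sum>i\<in>near j. dyadic \<Phi> i \<xi>)"
      by (simp add: sum.union_disjoint near_def)
    moreover have "\<Phi> ((1 / 2 ^ i) *\<^sub>R \<xi>) = 0"
    proof (rule zero, rule ccontr)
      assume "\<not> 2 \<le> norm ((1 / 2 ^ i) *\<^sub>R \<xi>)"
      then have "norm \<xi> \<le> 2 ^ Suc i" by (simp add: le_divide_eq not_le)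
      then have "norm \<xi> \<le> 2 ^ Suc i" "norm \<xi> \<le> 2 ^ Suc (Suc i)" by (auto intro: order_trans)
      then have "\<Phi> ((1 / 2 ^ Suc i) *\<^sub>R \<xi>) = 1" "\<Phi> ((1 / 2 ^ Suc (Suc i)) *\<^sub>R \<xi>) = 1"
        by (intro one; simp add: divide_le_eq)+
      then show False using False by (simp add: dyadic_def i)
    qed
    ultimately show ?thesis using S by (simp add: dyadic_partial_sum)
  qed
  then show ?thesis by simp
qed simp

lemma fourier_sum:
  assumes "\<And>a. a \<in> A \<Longrightarrow> f a \<in> schwartz"
  shows "fourier (\<lambda>x. \<Sum>a\<in>A. f a x) \<xi> = (\<Sum>a\<in>A. fourier (f a) \<xi>)"
proof -
  have i: "integrable lborel (\<lambda>x. cis (- (x \<bullet> \<xi>)) * f a x)" if "a \<in> A" for a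
    by (rule schwartz_integrable[OF slow_mult_schwartz[OF smooth_exponential(2) assms[OF that]]])
  show ?thesis
    unfolding fourier_eq sum_distrib_left using i by (subst Bochner_Integration.integral_sum) (auto simp: sum_distrib_left)
qed

text \<open>The left side consists of convolutions with the kernels of the blocks, so a distribution
  whose blocks are functions can be evaluated on it by integrals.\<close>

lemma lpk_reproducing:
  assumes \<Phi>: "lp_generator \<Phi>" and \<psi>: "\<psi> \<in> schwartz"
  shows "(\<Sum>i\<in>near j. conv (lpk \<Phi> i) (conv (lpk \<Phi> j) \<psi>) x) = conv (lpk \<Phi> j) \<psi> x"
proof -
  note D = dyadic_schwartz[OF \<Phi>]
  have DD: "(\<lambda>\<xi>. dyadic \<Phi> i \<xi> * dyadic \<Phi> j \<xi>) \<in> schwartz" for i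
    by (intro slow_mult_schwartz schwartz_slow D)
  have inv: "inv_fourier \<psi> \<in> schwartz" by (rule schwartz_inv_fourier[OF \<psi>])
  have rr: "rapid (lpk \<Phi> i)" for i by (intro schwartz_rapid lpk_schwartz \<Phi>)
  have c: "conv (lpk \<Phi> i) (conv (lpk \<Phi> j) \<psi>) = fourier (\<lambda>\<xi>. (dyadic \<Phi> i \<xi> * dyadic \<Phi> j \<xi>) * inv_fourier \<psi> \<xi>)" for i
  proof -
    have "conv (lpk \<Phi> i) (conv (lpk \<Phi> j) \<psi>) = conv (conv (lpk \<Phi> i) (lpk \<Phi> j)) \<psi>"
      by (rule conv_assoc[OF rr rr schwartz_rapid[OF \<psi>]])
    also have "conv (lpk \<Phi> i) (lpk \<Phi> j) = kern (\<lambda>\<xi>. dyadic \<Phi> i \<xi> * dyadic \<Phi> j \<xi>)"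
      unfolding lpk_def by (rule conv_kern[OF D D])
    finally show ?thesis by (simp add: fourier_mult_conv[OF DD \<psi>])
  qed
  have "(\<Sum>i\<in>near j. conv (lpk \<Phi> i) (conv (lpk \<Phi> j) \<psi>) x)
      = fourier (\<lambda>\<xi>. \<Sum>i\<in>near j. (dyadic \<Phi> i \<xi> * dyadic \<Phi> j \<xi>) * inv_fourier \<psi> \<xi>) x"
    unfolding c by (rule fourier_sum[symmetric]) (intro slow_mult_schwartz schwartz_slow DD inv)
  also have "(\<lambda>\<xi>. \<Sum>i\<in>near j. (dyadic \<Phi> i \<xi> * dyadic \<Phi> j \<xi>) * inv_fourier \<psi> \<xi>) = (\<lambda>\<xi>. dyadic \<Phi> j \<xi> * inv_fourier \<psi> \<xi>)"
    unfolding sum_distrib_right[symmetric] dyadic_near[OF \<Phi>] ..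
  also have "fourier \<dots> = conv (lpk \<Phi> j) \<psi>" unfolding lpk_def by (rule fourier_mult_conv[OF D \<psi>])
  finally show ?thesis .
qed

lemma conv_commute:
  assumes "f \<in> borel_measurable borel" "g \<in> borel_measurable borel"
  shows "conv f g = conv g f"
  using conv_alt[OF assms] by (auto simp: conv_def mult.commute)

text \<open>Correlation with \<open>u\<close> commutes with translations and hence with convolution.
  The growth of \<open>u\<close> is compensated by the decay of \<open>k'\<close>, and Peetre's
  inequality splits the joint bound into a product majorant for Fubini.\<close>

lemma corr_conv:
  fixes k k' u :: "real^'n::finite \<Rightarrow> complex"
  assumes u [measurable]: "u \<in> borel_measurable borel" and ub: "\<And>x. cmod (u x) \<le> C * wt m x"
    and k: "rapid k" and k': "k' \<in> schwartz"
  shows "corr u (conv k k') = conv k (corr u k')"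
proof
  fix y
  have [measurable]: "k \<in> borel_measurable borel" "k' \<in> borel_measurable borel"
    using rapid_borel[OF k] smooth_borel[OF schwartz_smooth[OF k']] by auto
  have [measurable]: "corr u k' \<in> borel_measurable borel"
    by (intro smooth_borel smooth_corr dom_poly_schwartz(1)[OF u ub k'])
  define r where "r = - m - real CARD('n) - 1"
  obtain B where B: "B \<ge> 0" "\<And>x. cmod (k' x) \<le> B * wt r x" using schwartz_bound0[OF k'] by metis
  have ui: "integrable lborel (\<lambda>x. cmod (u x) * wt r x)"
    unfolding r_def by (rule dom_poly_schwartz(2)[OF u ub k'])
  have "corr u (conv k k') y = (\<integral>x. (\<integral>w. u x * (k w * k' (x + y - w)) \<partial>lborel) \<partial>lborel)"
    unfolding corr_def by (simp add: conv_alt)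
  also have "\<dots> = (\<integral>w. (\<integral>x. u x * (k w * k' (x + y - w)) \<partial>lborel) \<partial>lborel)"
  proof (rule fubini_swap(1)[where g="\<lambda>x. cmod (u x) * wt r x" and h="\<lambda>w. (B * wt \<bar>r\<bar> y) * (cmod (k w) * wt \<bar>r\<bar> w)"])
    show "integrable lborel (\<lambda>w. (B * wt \<bar>r\<bar> y) * (cmod (k w) * wt \<bar>r\<bar> w))"
      by (intro integrable_mult_right rapid_integrable_wt k)
    fix x w
    have "wt r (x + (y - w)) \<le> wt r x * (wt \<bar>r\<bar> y * wt \<bar>r\<bar> w)"
    proof -
      have "wt r (x + (y - w)) \<le> wt r x * wt \<bar>r\<bar> (y + - w)" using wt_peetre[of r x "y - w"] by simp
      also have "\<dots> \<le> wt r x * (wt \<bar>r\<bar> y * wt \<bar>r\<bar> w)"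
        using wt_peetre[of "\<bar>r\<bar>" y "- w"] by (intro mult_left_mono) auto
      finally show ?thesis .
    qed
    then have "cmod (k' (x + y - w)) \<le> B * (wt r x * (wt \<bar>r\<bar> y * wt \<bar>r\<bar> w))"
      using B(2)[of "x + y - w"] B(1) by (smt (verit) add_diff_eq mult_left_mono)
    then have "cmod (u x) * cmod (k w) * cmod (k' (x + y - w)) \<le> cmod (u x) * cmod (k w) * (B * (wt r x * (wt \<bar>r\<bar> y * wt \<bar>r\<bar> w)))"
      by (intro mult_left_mono) auto
    then show "norm (u x * (k w * k' (x + y - w))) \<le> cmod (u x) * wt r x * ((B * wt \<bar>r\<bar> y) * (cmod (k w) * wt \<bar>r\<bar> w))"
      by (simp add: norm_mult mult_ac)
  qed (use ui in measurable)
  also have "\<dots> = (\<integral>w. k w * corr u k' (y - w) \<partial>lborel)"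
  proof (intro Bochner_Integration.integral_cong refl)
    fix w
    have "(\<lambda>x. u x * (k w * k' (x + y - w))) = (\<lambda>x. k w * (u x * k' (x + (y - w))))"
      by (auto simp: mult_ac add_diff_eq)
    then show "(\<integral>x. u x * (k w * k' (x + y - w)) \<partial>lborel) = k w * corr u k' (y - w)"
      unfolding corr_def by (simp only: integral_mult_right_zero)
  qed
  also have "\<dots> = conv k (corr u k') y" by (simp add: conv_alt)
  finally show "corr u (conv k k') y = conv k (corr u k') y" .
qed

subsection \<open>Lebesgue norms\<close>

text \<open>A real bound \<open>A\<close> replaces the norm, so that calculations with finite
  exponents take place on p-th powers and avoid infinite values.\<close>

definition Lp_le :: "ennreal \<Rightarrow> (real^'n::finite \<Rightarrow> complex) \<Rightarrow> real \<Rightarrow> bool" where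
  "Lp_le p f A \<longleftrightarrow> f \<in> borel_measurable borel \<and> A \<ge> 0 \<and>
     (if p = \<infinity> then AE x in lborel. cmod (f x) \<le> A
      else (\<integral>\<^sup>+x. ennreal (cmod (f x) powr enn2real p) \<partial>lborel) \<le> ennreal (A powr enn2real p))"

lemma enn2real_ge_1: "1 \<le> p \<Longrightarrow> p \<noteq> \<infinity> \<Longrightarrow> enn2real p \<ge> 1"
  by (cases p) (auto simp: ennreal_le_1 ennreal_ge_1)

lemma Lp_leI:
  assumes f: "f \<in> borel_measurable borel" and p: "1 \<le> p" and A: "Lp_norm p f < ennreal A"
  shows "Lp_le p f A"
proof -
  have A0: "A > 0" using A by (metis ennreal_neg not_less less_ennreal.rep_eq ennreal_less_zero_iff not_le zero_le)
  show ?thesis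
  proof (cases "p = \<infinity>")
    case True
    have "AE x in lborel. ennreal (cmod (f x)) \<le> esssup lborel (\<lambda>x. ennreal (cmod (f x)))"
      using f by (intro esssup_AE) measurable
    moreover have "esssup lborel (\<lambda>x. ennreal (cmod (f x))) \<le> ennreal A" using A True by (simp add: Lp_norm_def)
    ultimately have "AE x in lborel. cmod (f x) \<le> A"
    proof (elim AE_mp, intro AE_I2 impI)
      fix x assume "ennreal (cmod (f x)) \<le> esssup lborel (\<lambda>x. ennreal (cmod (f x)))"
      then have "ennreal (cmod (f x)) \<le> ennreal A"
        using \<open>esssup lborel (\<lambda>x. ennreal (cmod (f x))) \<le> ennreal A\<close> by (rule order_trans)
      then show "cmod (f x) \<le> A" using A0 by (simp add: ennreal_le_iff)
    qed
    then show ?thesis using f A0 True by (simp add: Lp_le_def)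
  next
    case False
    define P where "P = enn2real p"
    have P: "P \<ge> 1" unfolding P_def by (rule enn2real_ge_1[OF p False])
    let ?I = "\<integral>\<^sup>+x. ennreal (cmod (f x) powr P) \<partial>lborel"
    have n: "Lp_norm p f = ennreal_powr ?I (1 / P)"
      using False by (simp add: Lp_norm_def ennreal_powr_def P_def)
    have "?I \<noteq> \<infinity>" using A n by (auto simp: ennreal_powr_def)
    then obtain r where r: "r \<ge> 0" "?I = ennreal r" by (cases ?I) auto
    have "ennreal (r powr (1 / P)) < ennreal A" using A n r by (simp add: ennreal_powr_def)
    then have "r powr (1 / P) < A" using ennreal_less_iff[of "r powr (1/P)" A] by simp
    then have "(r powr (1 / P)) powr P \<le> A powr P" using P by (intro powr_mono2) auto
    then have "r \<le> A powr P" using P r by (simp add: powr_powr)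
    then show ?thesis using f A0 False r by (simp add: Lp_le_def P_def[symmetric] ennreal_leI)
  qed
qed

lemma Lp_leD:
  assumes p: "1 \<le> p" and A: "Lp_le p f A"
  shows "Lp_norm p f \<le> ennreal A"
proof (cases "p = \<infinity>")
  case True
  have "esssup lborel (\<lambda>x. ennreal (cmod (f x))) \<le> ennreal A"
  proof (rule esssup_I)
    have [measurable]: "f \<in> borel_measurable borel" using A by (simp add: Lp_le_def)
    show "(\<lambda>x. ennreal (cmod (f x))) \<in> borel_measurable lborel" by measurable
    show "AE x in lborel. ennreal (cmod (f x)) \<le> ennreal A"
      using A True by (auto simp: Lp_le_def elim!: AE_mp intro!: ennreal_leI)
  qed
  then show ?thesis using True by (simp add: Lp_norm_def)
next
  case False
  define P where "P = enn2real p"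
  have P: "P \<ge> 1" unfolding P_def by (rule enn2real_ge_1[OF p False])
  let ?I = "\<integral>\<^sup>+x. ennreal (cmod (f x) powr P) \<partial>lborel"
  have n: "Lp_norm p f = ennreal_powr ?I (1 / P)"
    using False by (simp add: Lp_norm_def ennreal_powr_def P_def)
  have le: "?I \<le> ennreal (A powr P)" using A False by (simp add: Lp_le_def P_def)
  then have "?I \<noteq> \<infinity>" by (auto simp: top_unique)
  then obtain r where r: "r \<ge> 0" "?I = ennreal r" by (cases ?I) auto
  have "r \<le> A powr P" using le r by (simp add: ennreal_le_iff)
  then have "r powr (1 / P) \<le> (A powr P) powr (1 / P)" using r P by (intro powr_mono2) auto
  also have "\<dots> = A" using P A by (simp add: powr_powr Lp_le_def)
  finally show ?thesis using n r by (simp add: ennreal_powr_def ennreal_leI)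
qed

lemma Lp_le_mono: "Lp_le p f A \<Longrightarrow> A \<le> B \<Longrightarrow> 1 \<le> p \<Longrightarrow> Lp_le p f B"
proof -
  assume A: "Lp_le p f A" "A \<le> B" "1 \<le> p"
  show ?thesis
  proof (cases "p = \<infinity>")
    case True
    then have "AE x in lborel. cmod (f x) \<le> A" using A by (simp add: Lp_le_def)
    then have "AE x in lborel. cmod (f x) \<le> B" by eventually_elim (use A in simp)
    then show ?thesis using A True by (simp add: Lp_le_def)
  next
    case False
    have P: "enn2real p \<ge> 1" by (rule enn2real_ge_1[OF A(3) False])
    have A0: "A \<ge> 0" using A by (simp add: Lp_le_def)
    have "A powr enn2real p \<le> B powr enn2real p" using P A A0 by (intro powr_mono2) auto
    then have "ennreal (A powr enn2real p) \<le> ennreal (B powr enn2real p)" by (rule ennreal_leI)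
    then show ?thesis using A False A0 by (auto simp: Lp_le_def intro: order_trans)
  qed
qed

text \<open>In place of Hoelder's inequality: t <= 1 + t powr P for t = |f| / A. The summand 1 is
  integrated against the weight, the other one against its upper bound \<open>W\<close>.\<close>

lemma Lp_weight:
  fixes f :: "real^'n::finite \<Rightarrow> complex"
  assumes p: "1 \<le> p" and f: "Lp_le p f A" and A: "A > 0"
    and w: "integrable lborel w" "\<And>x. 0 \<le> w x" "\<And>x. w x \<le> W"
  shows "integrable lborel (\<lambda>x. cmod (f x) * w x)"
    and "(\<integral>x. cmod (f x) * w x \<partial>lborel) \<le> A * (integral\<^sup>L lborel w + W)"
proof -
  have [measurable]: "f \<in> borel_measurable borel" using f by (simp add: Lp_le_def)
  have [measurable]: "w \<in> borel_measurable borel" using w(1) by auto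
  have W: "W \<ge> 0" using order_trans[OF w(2,3)] .
  have "\<exists>h. integrable lborel h \<and> (AE x in lborel. cmod (f x) * w x \<le> h x) \<and> integral\<^sup>L lborel h \<le> A * (integral\<^sup>L lborel w + W)"
  proof (cases "p = \<infinity>")
    case True
    then have "AE x in lborel. cmod (f x) \<le> A" using f by (simp add: Lp_le_def)
    then have "AE x in lborel. cmod (f x) * w x \<le> A * w x"
      by eventually_elim (intro mult_right_mono w(2))
    then show ?thesis using w(1) A W by (intro exI[of _ "\<lambda>x. A * w x"]) (simp add: distrib_left)
  next
    case False
    define P where "P = enn2real p"
    have P: "P \<ge> 1" unfolding P_def by (rule enn2real_ge_1[OF p False])
    have I: "(\<integral>\<^sup>+x. ennreal (cmod (f x) powr P) \<partial>lborel) \<le> ennreal (A powr P)"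
      using f False by (simp add: Lp_le_def P_def)
    have fi: "integrable lborel (\<lambda>x. cmod (f x) powr P)"
      by (rule integrableI_nonneg) (use le_less_trans[OF I] in auto)
    have fI: "(\<integral>x. cmod (f x) powr P \<partial>lborel) \<le> A powr P"
    proof -
      have "ennreal (\<integral>x. cmod (f x) powr P \<partial>lborel) = (\<integral>\<^sup>+x. ennreal (cmod (f x) powr P) \<partial>lborel)"
        using fi by (intro nn_integral_eq_integral[symmetric]) auto
      also note I
      finally show ?thesis by (simp add: ennreal_le_iff)
    qed
    define h where "h x = A * w x + (A * W / A powr P) * (cmod (f x) powr P)" for x
    have pt: "cmod (f x) * w x \<le> h x" for x
    proof -
      define t where "t = cmod (f x) / A"
      have t: "t \<ge> 0" "cmod (f x) = A * t" using A by (auto simp: t_def)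
      have "t \<le> 1 + t powr P"
      proof (cases "t \<le> 1")
        case False
        then have "t powr 1 \<le> t powr P" using P by (intro powr_mono) auto
        then show ?thesis using False by simp
      qed (use powr_ge_zero[of t P] in linarith)
      then have "t * w x \<le> (1 + t powr P) * w x" by (intro mult_right_mono w(2))
      also have "\<dots> \<le> w x + t powr P * W" using w(3)[of x] by (simp add: distrib_right mult_left_mono)
      finally have "A * (t * w x) \<le> A * (w x + t powr P * W)" using A by (intro mult_left_mono) auto
      moreover have "cmod (f x) powr P = A powr P * t powr P" using A t by (simp add: powr_mult)
      ultimately show ?thesis using A t(2) by (simp add: h_def algebra_simps)
    qed
    have "integral\<^sup>L lborel h = A * integral\<^sup>L lborel w + (A * W / A powr P) * (\<integral>x. cmod (f x) powr P \<partial>lborel)"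
      unfolding h_def using w(1) fi by simp
    also have "\<dots> \<le> A * integral\<^sup>L lborel w + (A * W / A powr P) * A powr P"
      using A W fI by (intro add_left_mono mult_left_mono) auto
    also have "\<dots> = A * (integral\<^sup>L lborel w + W)" using A by (simp add: distrib_left)
    finally show ?thesis
      using pt w(1) fi by (intro exI[of _ h]) (auto simp: h_def[abs_def])
  qed
  then obtain h where h: "integrable lborel h" "AE x in lborel. cmod (f x) * w x \<le> h x" "integral\<^sup>L lborel h \<le> A * (integral\<^sup>L lborel w + W)"
    by blast
  show i: "integrable lborel (\<lambda>x. cmod (f x) * w x)"
    by (rule Bochner_Integration.integrable_bound[OF h(1)]) (use h(2) w(2) in \<open>auto elim!: AE_mp\<close>)
  show "(\<integral>x. cmod (f x) * w x \<partial>lborel) \<le> A * (integral\<^sup>L lborel w + W)"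
    using integral_mono_AE[OF i h(1,2)] h(3) by linarith
qed

text \<open>By convexity the graph of the power lies above its tangent at \<open>s\<close>; after
  division by the scale \<open>s\<close> this is Young's inequality for u = x / s.\<close>

lemma powr_tangent:
  fixes x s P :: real
  assumes "x \<ge> 0" "s \<ge> 0" "P \<ge> 1"
  shows "s powr P + P * s powr (P - 1) * (x - s) \<le> x powr P"
proof (cases "s = 0 \<or> x = 0")
  case True
  then show ?thesis
  proof
    assume "x = 0"
    have "s powr P = s powr (P - 1) * s"
      using powr_add[of s "P - 1" 1] assms(2) by simp
    moreover have "1 * (s powr (P - 1) * s) \<le> P * (s powr (P - 1) * s)"
      using assms by (intro mult_right_mono) auto
    ultimately show ?thesis using \<open>x = 0\<close> by simp
  qed simp
next
  case False
  then have pos: "x > 0" "s > 0" using assms by auto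
  define u where "u = x / s"
  have u: "u > 0" "x = u * s" using pos by (auto simp: u_def)
  have "(u powr P) powr (1 / P) * 1 powr (1 - 1 / P) \<le> (1 / P) * u powr P + (1 - 1 / P) * 1"
    using assms u by (intro Youngs_inequality_0) (auto simp: divide_le_eq)
  then have "u \<le> (1 / P) * u powr P + (1 - 1 / P)" using assms u by (simp add: powr_powr)
  then have "P * u \<le> P * ((1 / P) * u powr P + (1 - 1 / P))" using assms by (intro mult_left_mono) auto
  also have "\<dots> = u powr P + (P - 1)" using assms by (simp add: algebra_simps)
  finally have "P * u \<le> u powr P + (P - 1)" .
  then have "s powr P * (P * u) \<le> s powr P * (u powr P + (P - 1))" by (intro mult_left_mono) auto
  moreover have "s powr P = s powr (P - 1) * s" using pos powr_add[of s "P - 1" 1] by simp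
  moreover have "x powr P = s powr P * u powr P" using u pos by (simp add: powr_mult)
  ultimately show ?thesis using u(2) by (simp add: algebra_simps)
qed

text \<open>Jensen's inequality for the measure |l(y - z)| dy bounds the P-th power of the
  convolution by L powr (P - 1) times the integral of |f| powr P against that measure. Integrating
  in z by Tonelli produces the missing factor \<open>L\<close>.\<close>

lemma Young_convolution:
  fixes f l :: "real^'n::finite \<Rightarrow> complex"
  assumes p: "1 \<le> p" and f: "Lp_le p f A" and A: "A > 0" and l: "rapid l"
    and L: "(\<integral>x. cmod (l x) \<partial>lborel) \<le> L" and L0: "L > 0"
  shows "Lp_le p (\<lambda>z. \<integral>y. f y * l (y - z) \<partial>lborel) (A * L)"
proof -
  have [measurable]: "f \<in> borel_measurable borel" using f by (simp add: Lp_le_def)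
  have [measurable]: "l \<in> borel_measurable borel" using l by (rule rapid_borel)
  have li: "integrable lborel (\<lambda>x. cmod (l x))" using rapid_integrable[OF l] by simp
  have lzi: "integrable lborel (\<lambda>y. cmod (l (y - z)))" for z
    using integrable_lborel_affine[OF li, of 1 "- z"] by simp
  have lzI: "(\<integral>y. cmod (l (y - z)) \<partial>lborel) = (\<integral>x. cmod (l x) \<partial>lborel)" for z
  proof -
    have "complex_of_real (\<integral>y. cmod (l (y - z)) \<partial>lborel) = complex_of_real (\<integral>x. cmod (l x) \<partial>lborel)"
      unfolding integral_complex_of_real[symmetric]
      using integral_shift[of "\<lambda>y. complex_of_real (cmod (l y))" "- z"] by simp
    then show ?thesis using of_real_eq_iff by blast
  qed
  define \<Lambda> where "\<Lambda> = (\<integral>x. cmod (l x) \<partial>lborel)"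
  have \<Lambda>: "0 \<le> \<Lambda>" "\<Lambda> \<le> L" using L by (auto simp: \<Lambda>_def)
  obtain W where W: "W \<ge> 0" "\<And>x. cmod (l x) \<le> W * wt 0 x" using rapid_bound[OF l] by metis
  have prod: "integrable lborel (\<lambda>y. cmod (f y) * cmod (l (y - z)))" for z
    by (rule Lp_weight(1)[OF p f A lzi]) (use W(2) in auto)
  define G where "G z = (\<integral>y. f y * l (y - z) \<partial>lborel)" for z
  have [measurable]: "G \<in> borel_measurable borel" unfolding G_def by measurable
  define S where "S z = (\<integral>y. cmod (f y) * cmod (l (y - z)) \<partial>lborel)" for z
  have GS: "cmod (G z) \<le> S z" for z
    unfolding G_def S_def by (rule integral_bound_real[OF prod]) (auto simp: norm_mult)
  have S0: "S z \<ge> 0" for z unfolding S_def by simp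
  have "Lp_le p G (A * L)"
  proof (cases "p = \<infinity>")
    case True
    then have fA: "AE x in lborel. cmod (f x) \<le> A" using f by (simp add: Lp_le_def)
    have "cmod (G z) \<le> A * L" for z
    proof -
      have "S z \<le> (\<integral>y. A * cmod (l (y - z)) \<partial>lborel)"
        unfolding S_def
      proof (rule integral_mono_AE[OF prod])
        show "AE y in lborel. cmod (f y) * cmod (l (y - z)) \<le> A * cmod (l (y - z))"
          using fA by eventually_elim (auto intro: mult_right_mono)
      qed (use lzi in simp)
      also have "\<dots> \<le> A * L" using lzI \<Lambda> A by (simp add: \<Lambda>_def)
      finally show ?thesis using GS[of z] by linarith
    qed
    then show ?thesis using True A L0 by (simp add: Lp_le_def)
  next
    case False
    define P where "P = enn2real p"
    have P: "P \<ge> 1" unfolding P_def by (rule enn2real_ge_1[OF p False])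
    have I: "(\<integral>\<^sup>+x. ennreal (cmod (f x) powr P) \<partial>lborel) \<le> ennreal (A powr P)"
      using f False by (simp add: Lp_le_def P_def)
    have pt: "ennreal (cmod (G z) powr P) \<le> ennreal (L powr (P - 1)) * (\<integral>\<^sup>+y. ennreal (cmod (f y) powr P * cmod (l (y - z))) \<partial>lborel)" for z
    \<comment> \<open>Jensen's inequality divides by the mass \<open>\<Lambda>\<close> and compares
      finite integrals; the two degenerate cases are settled directly.\<close>
    proof (cases "\<Lambda> = 0 \<or> (\<integral>\<^sup>+y. ennreal (cmod (f y) powr P * cmod (l (y - z))) \<partial>lborel) = \<infinity>")
      case True
      then show ?thesis
      proof
        assume "\<Lambda> = 0"
        then have "(\<integral>y. cmod (l (y - z)) \<partial>lborel) = 0" using lzI by (simp add: \<Lambda>_def)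
        then have "AE y in lborel. cmod (l (y - z)) = 0"
          using integral_nonneg_eq_0_iff_AE[OF lzi] by simp
        then have z: "AE y in lborel. cmod (f y) * cmod (l (y - z)) = 0" by eventually_elim simp
        have "S z = (\<integral>y. 0 \<partial>(lborel :: (real^'n) measure))" unfolding S_def
          by (rule integral_cong_AE[OF _ _ z]) measurable
        then have "cmod (G z) = 0" using GS[of z] by simp
        then show ?thesis by simp
      next
        assume "(\<integral>\<^sup>+y. ennreal (cmod (f y) powr P * cmod (l (y - z))) \<partial>lborel) = \<infinity>"
        moreover have "ennreal (L powr (P - 1)) \<noteq> 0" using L0 by simp
        ultimately show ?thesis by (simp add: ennreal_mult_top)
      qed
    next
      case fin: False
      then have \<Lambda>0: "\<Lambda> > 0" using \<Lambda> by simp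
      \<comment> \<open>The mean of |f| under the normalised measure. At this point the linear part
        of the tangent integrates to 0, so \<open>powr_tangent\<close> yields Jensen's
        inequality.\<close>
      define s where "s = S z / \<Lambda>"
      have s: "s \<ge> 0" "S z = s * \<Lambda>" using S0[of z] \<Lambda>0 by (auto simp: s_def)
      have fi: "integrable lborel (\<lambda>y. cmod (f y) powr P * cmod (l (y - z)))"
        by (rule integrableI_nonneg) (use fin in \<open>auto simp: less_top\<close>)
      let ?lin = "\<lambda>y. s powr P * cmod (l (y - z)) + P * s powr (P - 1) * (cmod (f y) * cmod (l (y - z)) - s * cmod (l (y - z)))"
      have "s powr P * \<Lambda> = (\<integral>y. ?lin y \<partial>lborel)"
      proof -
        have "(\<integral>y. ?lin y \<partial>lborel) = s powr P * \<Lambda> + P * s powr (P - 1) * (S z - s * \<Lambda>)"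
          using prod[of z] lzi[of z] lzI[of z] by (simp add: S_def \<Lambda>_def)
        then show ?thesis using s by simp
      qed
      also have "\<dots> \<le> (\<integral>y. cmod (f y) powr P * cmod (l (y - z)) \<partial>lborel)"
      proof (rule integral_mono[OF _ fi])
        show "integrable lborel ?lin" using prod[of z] lzi[of z] by simp
        fix y
        have "(s powr P + P * s powr (P - 1) * (cmod (f y) - s)) * cmod (l (y - z)) \<le> cmod (f y) powr P * cmod (l (y - z))"
          by (intro mult_right_mono powr_tangent s P) auto
        then show "?lin y \<le> cmod (f y) powr P * cmod (l (y - z))" by (simp add: algebra_simps)
      qed
      finally have J: "s powr P * \<Lambda> \<le> (\<integral>y. cmod (f y) powr P * cmod (l (y - z)) \<partial>lborel)" .
      have "cmod (G z) powr P \<le> (s * \<Lambda>) powr P" using GS[of z] s P by (intro powr_mono2) auto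
      also have "\<dots> = \<Lambda> powr (P - 1) * (s powr P * \<Lambda>)"
        using s \<Lambda>0 powr_add[of \<Lambda> "P - 1" 1] by (simp add: powr_mult)
      also have "\<dots> \<le> L powr (P - 1) * (\<integral>y. cmod (f y) powr P * cmod (l (y - z)) \<partial>lborel)"
        using J \<Lambda> \<Lambda>0 P by (intro mult_mono powr_mono2) auto
      finally have "ennreal (cmod (G z) powr P) \<le> ennreal (L powr (P - 1) * (\<integral>y. cmod (f y) powr P * cmod (l (y - z)) \<partial>lborel))"
        by (rule ennreal_leI)
      also have "\<dots> = ennreal (L powr (P - 1)) * ennreal (\<integral>y. cmod (f y) powr P * cmod (l (y - z)) \<partial>lborel)"
        by (rule ennreal_mult') simp
      also have "ennreal (\<integral>y. cmod (f y) powr P * cmod (l (y - z)) \<partial>lborel) = (\<integral>\<^sup>+y. ennreal (cmod (f y) powr P * cmod (l (y - z))) \<partial>lborel)"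
        using fi by (intro nn_integral_eq_integral[symmetric]) auto
      finally show ?thesis .
    qed
    have lnn: "(\<integral>\<^sup>+z. ennreal (cmod (l (y - z))) \<partial>lborel) = ennreal \<Lambda>" for y
    proof -
      have "(\<integral>\<^sup>+z. ennreal (cmod (l z)) \<partial>lborel) = (\<integral>\<^sup>+z. ennreal (cmod (l (y - z))) \<partial>lborel)"
        using nn_integral_lborel_affine[of "\<lambda>z. ennreal (cmod (l z))" "-1" y] by simp
      moreover have "(\<integral>\<^sup>+z. ennreal (cmod (l z)) \<partial>lborel) = ennreal \<Lambda>"
        unfolding \<Lambda>_def using li by (intro nn_integral_eq_integral) auto
      ultimately show ?thesis by simp
    qed
    have "(\<integral>\<^sup>+z. ennreal (cmod (G z) powr P) \<partial>lborel)
       \<le> (\<integral>\<^sup>+z. ennreal (L powr (P - 1)) * (\<integral>\<^sup>+y. ennreal (cmod (f y) powr P * cmod (l (y - z))) \<partial>lborel) \<partial>lborel)"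
      by (intro nn_integral_mono pt)
    also have "\<dots> = ennreal (L powr (P - 1)) * (\<integral>\<^sup>+z. (\<integral>\<^sup>+y. ennreal (cmod (f y) powr P * cmod (l (y - z))) \<partial>lborel) \<partial>lborel)"
      by (intro nn_integral_cmult) measurable
    also have "(\<integral>\<^sup>+z. (\<integral>\<^sup>+y. ennreal (cmod (f y) powr P * cmod (l (y - z))) \<partial>lborel) \<partial>lborel)
       = (\<integral>\<^sup>+y. (\<integral>\<^sup>+z. ennreal (cmod (f y) powr P * cmod (l (y - z))) \<partial>lborel) \<partial>lborel)"
      by (rule lborel_pair.Fubini') measurable
    also have "\<dots> = (\<integral>\<^sup>+y. ennreal (cmod (f y) powr P) * ennreal \<Lambda> \<partial>lborel)"
      by (intro nn_integral_cong) (simp add: ennreal_mult' nn_integral_cmult lnn)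
    also have "\<dots> = (\<integral>\<^sup>+y. ennreal (cmod (f y) powr P) \<partial>lborel) * ennreal \<Lambda>"
      by (intro nn_integral_multc) measurable
    also have "ennreal (L powr (P - 1)) * \<dots> \<le> ennreal (L powr (P - 1)) * (ennreal (A powr P) * ennreal L)"
      by (intro mult_left_mono mult_mono I ennreal_leI \<Lambda>) auto
    also have "\<dots> = ennreal ((A * L) powr P)"
      using A L0 powr_add[of L "P - 1" 1] by (simp add: powr_mult ennreal_mult[symmetric] mult_ac)
    finally show ?thesis using False A L0 by (simp add: Lp_le_def P_def)
  qed
  then show ?thesis unfolding G_def .
qed

text \<open>The triangle inequality up to the factor 2, from |a + b| <= 2 max |a| |b| and the
  superadditivity of t powr P. It is applied to sums over the neighbouring indices.\<close>

lemma Lp_add: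
  fixes f g :: "real^'n::finite \<Rightarrow> complex"
  assumes p: "1 \<le> p" and f: "Lp_le p f A" and g: "Lp_le p g B"
  shows "Lp_le p (\<lambda>x. f x + g x) (2 * (A + B))"
proof -
  have [measurable]: "f \<in> borel_measurable borel" "g \<in> borel_measurable borel" using f g by (auto simp: Lp_le_def)
  have AB: "A \<ge> 0" "B \<ge> 0" using f g by (auto simp: Lp_le_def)
  show ?thesis
  proof (cases "p = \<infinity>")
    case True
    then have "AE x in lborel. cmod (f x) \<le> A" "AE x in lborel. cmod (g x) \<le> B" using f g by (auto simp: Lp_le_def)
    then have "AE x in lborel. cmod (f x + g x) \<le> 2 * (A + B)"
    proof eventually_elim
      case (elim x)
      have "cmod (f x + g x) \<le> A + B" using elim by (rule norm_triangle_mono)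
      then show ?case using AB by simp
    qed
    then show ?thesis using True AB by (simp add: Lp_le_def)
  next
    case False
    define P where "P = enn2real p"
    have P: "P \<ge> 1" unfolding P_def by (rule enn2real_ge_1[OF p False])
    have pt: "cmod (f x + g x) powr P \<le> 2 powr P * (cmod (f x) powr P + cmod (g x) powr P)" for x
    proof -
      have "cmod (f x + g x) \<le> 2 * max (cmod (f x)) (cmod (g x))" using norm_triangle_ineq[of "f x" "g x"] by linarith
      then have "cmod (f x + g x) powr P \<le> (2 * max (cmod (f x)) (cmod (g x))) powr P" using P by (intro powr_mono2) auto
      also have "\<dots> = 2 powr P * (max (cmod (f x)) (cmod (g x))) powr P" by (simp add: powr_mult)
      also have "\<dots> \<le> 2 powr P * (cmod (f x) powr P + cmod (g x) powr P)"
        by (intro mult_left_mono) (auto simp: max_def)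
      finally show ?thesis .
    qed
    have sup: "A powr P + B powr P \<le> (A + B) powr P"
    proof -
      have e: "t powr P = t * t powr (P - 1)" if "t \<ge> 0" for t :: real
        using that powr_add[of t 1 "P - 1"] by simp
      have "A * A powr (P - 1) + B * B powr (P - 1) \<le> A * (A + B) powr (P - 1) + B * (A + B) powr (P - 1)"
        using AB P by (intro add_mono mult_left_mono powr_mono2) auto
      then show ?thesis using AB by (simp add: e distrib_right)
    qed
    have "(\<integral>\<^sup>+x. ennreal (cmod (f x + g x) powr P) \<partial>lborel)
      \<le> (\<integral>\<^sup>+x. ennreal (2 powr P) * (ennreal (cmod (f x) powr P) + ennreal (cmod (g x) powr P)) \<partial>lborel)"
      using pt by (intro nn_integral_mono) (simp add: ennreal_mult'[symmetric] ennreal_plus[symmetric] ennreal_leI del: ennreal_plus)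
    also have "\<dots> = ennreal (2 powr P) * ((\<integral>\<^sup>+x. ennreal (cmod (f x) powr P) \<partial>lborel) + (\<integral>\<^sup>+x. ennreal (cmod (g x) powr P) \<partial>lborel))"
      by (simp add: nn_integral_cmult nn_integral_add)
    also have "\<dots> \<le> ennreal (2 powr P) * (ennreal (A powr P) + ennreal (B powr P))"
      using f g False by (intro mult_left_mono add_mono) (auto simp: Lp_le_def P_def)
    also have "\<dots> = ennreal (2 powr P * (A powr P + B powr P))"
      by (simp add: ennreal_mult'[symmetric] ennreal_plus[symmetric] del: ennreal_plus)
    also have "\<dots> \<le> ennreal ((2 * (A + B)) powr P)"
    proof (rule ennreal_leI)
      have "2 powr P * (A powr P + B powr P) \<le> 2 powr P * (A + B) powr P" using sup by (intro mult_left_mono) auto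
      then show "2 powr P * (A powr P + B powr P) \<le> (2 * (A + B)) powr P" using AB by (simp only: powr_mult)
    qed
    finally show ?thesis using False AB by (simp add: Lp_le_def P_def)
  qed
qed

lemma Lp_zero: "Lp_le p (\<lambda>x. 0) 0"
  by (simp add: Lp_le_def)

lemma Lp_sum:
  assumes p: "1 \<le> p" and "finite I" and "\<And>i. i \<in> I \<Longrightarrow> Lp_le p (f i) (A i)"
  shows "Lp_le p (\<lambda>x. \<Sum>i\<in>I. f i x) (2 ^ card I * (\<Sum>i\<in>I. A i))"
  using assms(2,3)
proof induction
  case (insert i I)
  have A: "A i \<ge> 0" "(\<Sum>i\<in>I. A i) \<ge> 0" using insert.prems by (auto simp: Lp_le_def intro: sum_nonneg)
  have "Lp_le p (\<lambda>x. f i x + (\<Sum>i\<in>I. f i x)) (2 * (A i + 2 ^ card I * (\<Sum>i\<in>I. A i)))"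
    using insert by (intro Lp_add[OF p]) auto
  moreover have "2 * (A i + 2 ^ card I * (\<Sum>i\<in>I. A i)) \<le> 2 ^ card (insert i I) * (\<Sum>i\<in>insert i I. A i)"
  proof -
    have "A i * 1 \<le> A i * 2 ^ card I" using A by (intro mult_left_mono) auto
    then show ?thesis using insert.hyps by (simp add: algebra_simps)
  qed
  ultimately show ?case using insert.hyps p by (simp add: Lp_le_mono)
qed (simp add: Lp_zero)

text \<open>The P-th power of the weight has exponent -a P, integrable because a P > N; for infinite
  p a nonpositive exponent suffices for boundedness. The constant is independent of
  \<open>u\<close>, as the uniform estimate demands.\<close>

lemma Lp_decay:
  assumes p: "1 \<le> p" and a: "a > 0" "p \<noteq> \<infinity> \<Longrightarrow> a * enn2real p > real CARD('n)"
  obtains C where "C > 0" "\<And>u A. u \<in> borel_measurable borel \<Longrightarrow> A \<ge> 0 \<Longrightarrow> (\<And>z. cmod (u z) \<le> A * wt (- a) (z :: real^'n::finite)) \<Longrightarrow> Lp_le p u (A * C)"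
proof (cases "p = \<infinity>")
  case True
  show thesis
  proof (rule that[of 1])
    fix u :: "real^'n \<Rightarrow> complex" and A :: real
    assume u: "u \<in> borel_measurable borel" "A \<ge> 0" "\<And>z. cmod (u z) \<le> A * wt (- a) z"
    have "cmod (u z) \<le> A * 1" for z
      using a u(2) by (intro order_trans[OF u(3)] mult_left_mono wt_le_1) auto
    then show "Lp_le p u (A * 1)" using u True by (simp add: Lp_le_def)
  qed simp
next
  case False
  define P where "P = enn2real p"
  have P: "P \<ge> 1" unfolding P_def by (rule enn2real_ge_1[OF p False])
  define J where "J = (\<integral>z. wt (- (a * P)) (z :: real^'n) \<partial>lborel)"
  have ji: "integrable lborel (wt (- (a * P)) :: real^'n \<Rightarrow> real)"
    using a(2)[OF False] by (intro wt_integrable_cart) (simp add: P_def)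
  have J: "J \<ge> 0" unfolding J_def by simp
  show thesis
  \<comment> \<open>The summand 1 makes the constant positive without computing
    \<open>J\<close>.\<close>
  proof (rule that[of "(J + 1) powr (1 / P)"])
    show "(J + 1) powr (1 / P) > 0" using J by simp
    fix u :: "real^'n \<Rightarrow> complex" and A :: real
    assume u: "u \<in> borel_measurable borel" "A \<ge> 0" "\<And>z. cmod (u z) \<le> A * wt (- a) z"
    have pt: "cmod (u z) powr P \<le> A powr P * wt (- (a * P)) z" for z
    proof -
      have "cmod (u z) powr P \<le> (A * wt (- a) z) powr P" using P u by (intro powr_mono2) auto
      also have "\<dots> = A powr P * wt (- (a * P)) z" by (simp add: powr_mult wt_def powr_powr)
      finally show ?thesis .
    qed
    have "(\<integral>\<^sup>+z. ennreal (cmod (u z) powr P) \<partial>lborel) \<le> (\<integral>\<^sup>+z. ennreal (A powr P * wt (- (a * P)) (z :: real^'n)) \<partial>lborel)"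
      by (rule nn_integral_mono) (rule ennreal_leI[OF pt])
    also have "\<dots> = ennreal (A powr P * J)"
      unfolding J_def using ji by (subst nn_integral_eq_integral) auto
    also have "\<dots> \<le> ennreal ((A * (J + 1) powr (1 / P)) powr P)"
    proof -
      have "(A * (J + 1) powr (1 / P)) powr P = A powr P * (J + 1)"
        using P J u(2) by (simp add: powr_mult powr_powr)
      then show ?thesis by (intro ennreal_leI) (simp add: mult_left_mono)
    qed
    finally show "Lp_le p u (A * (J + 1) powr (1 / P))"
      using u False by (simp add: Lp_le_def P_def)
  qed
qed

subsection \<open>Sequence norms\<close>

lemma lq_ge_term:
  assumes q: "1 \<le> q" shows "a j \<le> lq_norm q a"
proof (cases "q = \<infinity>")
  case True
  then show ?thesis by (simp add: lq_norm_def SUP_upper)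
next
  case False
  define Q where "Q = enn2real q"
  have Q: "Q \<ge> 1" unfolding Q_def by (rule enn2real_ge_1[OF q False])
  let ?S = "\<Sum>j. ennreal_powr (a j) Q"
  have n: "lq_norm q a = ennreal_powr ?S (1 / Q)" using False by (simp add: lq_norm_def Q_def)
  have le: "ennreal_powr (a j) Q \<le> ?S"
    using sum_le_suminf[of "\<lambda>j. ennreal_powr (a j) Q" "{j}"] by simp
  show ?thesis
  proof (cases "?S = \<infinity>")
    case True
    then show ?thesis unfolding n by (simp add: ennreal_powr_def)
  next
    case fin: False
    then obtain S where S: "S \<ge> 0" "?S = ennreal S" by (cases ?S) auto
    have "a j \<noteq> \<infinity>" using le fin by (auto simp: ennreal_powr_def top_unique)
    then obtain x where x: "x \<ge> 0" "a j = ennreal x" by (cases "a j") auto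
    have "x powr Q \<le> S" using le x S by (simp add: ennreal_powr_def ennreal_le_iff)
    then have "(x powr Q) powr (1 / Q) \<le> S powr (1 / Q)" using Q by (intro powr_mono2) auto
    then have "x \<le> S powr (1 / Q)" using Q x by (simp add: powr_powr)
    then show ?thesis unfolding n S x by (simp add: ennreal_powr_def ennreal_leI S)
  qed
qed

text \<open>The term of index 0 is controlled by the whole norm, the others by three neighbours.
  With Q-th powers the three neighbours cost 3 powr Q, the shifted sums together are at most 4 times
  the Q-th power of the norm, and 4 <= 4 powr Q; this gives 12 = 3 * 4.\<close>

lemma lq_neighbour_bound:
  assumes q: "1 \<le> q" and c: "c > 0"
    and b: "\<And>j. b j \<le> ennreal c * (if j = 0 then lq_norm q a else \<Sum>i\<in>near j. a i)"
  shows "lq_norm q b \<le> ennreal (12 * c) * lq_norm q a"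
proof (cases "lq_norm q a = \<infinity>")
  case True
  then show ?thesis using c by (simp add: ennreal_mult_top)
next
  case fin: False
  then obtain \<alpha> where \<alpha>: "\<alpha> \<ge> 0" "lq_norm q a = ennreal \<alpha>" by (cases "lq_norm q a") auto
  have "\<exists>t\<ge>0. a j = ennreal t \<and> t \<le> \<alpha>" for j
  proof -
    have "a j \<le> ennreal \<alpha>" using lq_ge_term[OF q, of a j] \<alpha> by simp
    then show ?thesis using \<alpha>(1) by (cases "a j") (auto simp: ennreal_le_iff top_unique)
  qed
  then obtain t where t: "\<And>j. t j \<ge> 0" "\<And>j. a j = ennreal (t j)" "\<And>j. t j \<le> \<alpha>" by metis
  have b0: "b 0 \<le> ennreal (c * \<alpha>)" using b[of 0] c \<alpha> by (simp add: ennreal_mult)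
  have bS: "b (Suc i) \<le> ennreal (c * (t i + t (Suc i) + t (Suc (Suc i))))" for i
  proof -
    have "near (Suc i) = {i, Suc i, Suc (Suc i)}" by (auto simp: near_def)
    then have "b (Suc i) \<le> ennreal c * (\<Sum>k\<in>{i, Suc i, Suc (Suc i)}. ennreal (t k))" using b[of "Suc i"] t(2) by simp
    also have "(\<Sum>k\<in>{i, Suc i, Suc (Suc i)}. ennreal (t k)) = ennreal (t i + t (Suc i) + t (Suc (Suc i)))"
      using t(1) by (simp add: ennreal_plus[symmetric] add.assoc del: ennreal_plus)
    finally show ?thesis using c t(1) by (simp add: ennreal_mult)
  qed
  have "b j < \<infinity>" for j
    using le_less_trans[OF b0 ennreal_less_top] le_less_trans[OF bS ennreal_less_top] by (cases j) auto
  then have fb: "b j \<noteq> \<infinity>" for j by (metis less_irrefl)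
  show ?thesis
  proof (cases "q = \<infinity>")
    case True
    have "b j \<le> ennreal (12 * c * \<alpha>)" for j
    proof (cases j)
      case 0
      have "c * \<alpha> \<le> 12 * c * \<alpha>" using c \<alpha> by simp
      then show ?thesis using b0 0 by (metis ennreal_leI order_trans)
    next
      case (Suc i)
      have "c * (t i + t (Suc i) + t (Suc (Suc i))) \<le> c * (12 * \<alpha>)"
        using t(3)[of i] t(3)[of "Suc i"] t(3)[of "Suc (Suc i)"] c \<alpha> by (intro mult_left_mono) linarith+
      then have "ennreal (c * (t i + t (Suc i) + t (Suc (Suc i)))) \<le> ennreal (12 * c * \<alpha>)"
        by (intro ennreal_leI) (simp add: mult_ac)
      then show ?thesis using bS[of i] Suc by (metis order_trans)
    qed
    then have "lq_norm q b \<le> ennreal (12 * c * \<alpha>)" using True by (simp add: lq_norm_def SUP_least)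
    then show ?thesis using \<alpha> c by (simp add: ennreal_mult)
  next
    case False
    define Q where "Q = enn2real q"
    have Q: "Q \<ge> 1" unfolding Q_def by (rule enn2real_ge_1[OF q False])
    have n: "lq_norm q x = ennreal_powr (\<Sum>j. ennreal_powr (x j) Q) (1 / Q)" for x using False by (simp add: lq_norm_def Q_def)
    define g where "g j = ennreal (t j powr Q)" for j
    have Sg: "(\<Sum>j. g j) = ennreal (\<alpha> powr Q)"
    proof -
      have e: "(\<Sum>j. ennreal_powr (a j) Q) = (\<Sum>j. g j)" using t by (simp add: ennreal_powr_def g_def)
      have "(\<Sum>j. g j) \<noteq> \<infinity>" using fin unfolding n e by (auto simp: ennreal_powr_def)
      then obtain S where S: "S \<ge> 0" "(\<Sum>j. g j) = ennreal S" by (cases "\<Sum>j. g j") auto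
      have "ennreal (S powr (1 / Q)) = ennreal \<alpha>" using \<alpha>(2) S unfolding n e by (simp add: ennreal_powr_def)
      then have "S powr (1 / Q) = \<alpha>" using \<alpha>(1) by (simp add: ennreal_inj)
      then have "\<alpha> powr Q = S" using S Q by (auto simp: powr_powr)
      then show ?thesis using S by simp
    qed
    \<comment> \<open>The sequence \<open>g\<close> shifted by one index, with the full norm in the
      vacant position 0. This lets the term 0 and the terms \<open>Suc i\<close> be treated by one
      formula.\<close>
    define h where "h j = (case j of 0 \<Rightarrow> ennreal (\<alpha> powr Q) | Suc i \<Rightarrow> g i)" for j
    define K where "K = (3 * c) powr Q"
    have K0: "K \<ge> 0" by (simp add: K_def)
    have pw: "(c * (x + y + z)) powr Q \<le> K * (x powr Q + y powr Q + z powr Q)" if "x \<ge> 0" "y \<ge> 0" "z \<ge> 0" for x y z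
    proof -
      let ?m = "max x (max y z)"
      have "(c * (x + y + z)) powr Q \<le> ((3 * c) * ?m) powr Q"
        using that c Q by (intro powr_mono2) (auto simp: mult_ac intro!: mult_left_mono)
      also have "\<dots> = K * ?m powr Q" using that c by (simp add: K_def powr_mult)
      also have "\<dots> \<le> K * (x powr Q + y powr Q + z powr Q)"
        by (intro mult_left_mono) (auto simp: max_def K_def)
      finally show ?thesis .
    qed
    have term_le: "ennreal_powr (b j) Q \<le> ennreal K * (h j + g j + g (Suc j))" for j
    proof (cases j)
      case 0
      obtain x where x: "x \<ge> 0" "b 0 = ennreal x" using fb[of 0] by (cases "b 0") auto
      have "x \<le> c * \<alpha>" using b0 x c \<alpha> by (simp add: ennreal_le_iff)
      then have "x powr Q \<le> (3 * c * \<alpha>) powr Q" using x Q c \<alpha> by (intro powr_mono2) (auto intro: order_trans)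
      also have "\<dots> = K * \<alpha> powr Q" using c \<alpha> by (simp add: K_def powr_mult)
      finally have "ennreal (x powr Q) \<le> ennreal K * h 0" using K0 by (simp add: h_def ennreal_mult'[symmetric] ennreal_leI)
      also have "\<dots> \<le> ennreal K * (h 0 + g 0 + g (Suc 0))" by (intro mult_left_mono) (auto simp: add.assoc)
      finally show ?thesis using 0 x by (simp add: ennreal_powr_def)
    next
      case (Suc i)
      obtain x where x: "x \<ge> 0" "b j = ennreal x" using fb[of j] by (cases "b j") auto
      have nn: "c * (t i + t (Suc i) + t (Suc (Suc i))) \<ge> 0" using t(1) c by (simp add: add_nonneg_nonneg)
      have "x \<le> c * (t i + t (Suc i) + t (Suc (Suc i)))" using bS[of i] x Suc nn by (simp add: ennreal_le_iff)
      then have "x powr Q \<le> (c * (t i + t (Suc i) + t (Suc (Suc i)))) powr Q" using x Q by (intro powr_mono2) auto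
      also have "\<dots> \<le> K * (t i powr Q + t (Suc i) powr Q + t (Suc (Suc i)) powr Q)" by (intro pw t)
      finally have "ennreal (x powr Q) \<le> ennreal K * (h j + g j + g (Suc j))"
        using K0 by (simp add: Suc h_def g_def ennreal_mult'[symmetric] ennreal_plus[symmetric] ennreal_leI del: ennreal_plus)
      then show ?thesis using x by (simp add: ennreal_powr_def)
    qed
    have part: "(\<Sum>j<m. ennreal_powr (b j) Q) \<le> ennreal K * (4 * ennreal (\<alpha> powr Q))" for m
    proof -
      have g1: "(\<Sum>j<m. g j) \<le> ennreal (\<alpha> powr Q)" for m
        unfolding Sg[symmetric] by (rule sum_le_suminf) auto
      have g2: "(\<Sum>j<m. g (Suc j)) \<le> ennreal (\<alpha> powr Q)"
      proof -
        have "(\<Sum>j<m. g (Suc j)) \<le> (\<Sum>j<Suc m. g j)" unfolding sum.lessThan_Suc_shift by simp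
        then show ?thesis using g1[of "Suc m"] by (rule order_trans)
      qed
      have g3: "(\<Sum>j<m. h j) \<le> ennreal (\<alpha> powr Q) + ennreal (\<alpha> powr Q)"
      proof (cases m)
        case (Suc k)
        have "(\<Sum>j<m. h j) = ennreal (\<alpha> powr Q) + (\<Sum>j<k. g j)"
          unfolding Suc sum.lessThan_Suc_shift by (simp add: h_def)
        then show ?thesis using g1[of k] by (simp add: add_left_mono)
      qed simp
      have "(\<Sum>j<m. ennreal_powr (b j) Q) \<le> (\<Sum>j<m. ennreal K * (h j + g j + g (Suc j)))" by (intro sum_mono term_le)
      also have "\<dots> = ennreal K * ((\<Sum>j<m. h j) + (\<Sum>j<m. g j) + (\<Sum>j<m. g (Suc j)))"
        by (simp add: sum.distrib sum_distrib_left[symmetric])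
      also have "\<dots> \<le> ennreal K * ((ennreal (\<alpha> powr Q) + ennreal (\<alpha> powr Q)) + ennreal (\<alpha> powr Q) + ennreal (\<alpha> powr Q))"
        by (intro mult_left_mono add_mono g1 g2 g3) auto
      also have "(ennreal (\<alpha> powr Q) + ennreal (\<alpha> powr Q)) + ennreal (\<alpha> powr Q) + ennreal (\<alpha> powr Q) = 4 * ennreal (\<alpha> powr Q)"
      proof -
        have "4 * \<gamma> = \<gamma> + \<gamma> + \<gamma> + \<gamma>" for \<gamma> :: ennreal
        proof -
          have "(4::ennreal) = 1 + 1 + 1 + 1" by simp
          then show ?thesis by (simp only: distrib_right mult_1)
        qed
        then show ?thesis by (simp only:)
      qed
      finally show ?thesis .
    qed
    have tot: "(\<Sum>j. ennreal_powr (b j) Q) \<le> ennreal (K * (4 * \<alpha> powr Q))"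
    proof -
      have "(\<Sum>j. ennreal_powr (b j) Q) \<le> ennreal K * (4 * ennreal (\<alpha> powr Q))"
        unfolding suminf_eq_SUP by (intro SUP_least part)
      also have "\<dots> = ennreal (K * (4 * \<alpha> powr Q))"
        by (simp add: ennreal_mult' ennreal_numeral K_def)
      finally show ?thesis .
    qed
    then have "(\<Sum>j. ennreal_powr (b j) Q) \<noteq> \<infinity>" by (auto simp: top_unique)
    then obtain S where S: "S \<ge> 0" "(\<Sum>j. ennreal_powr (b j) Q) = ennreal S" by (cases "\<Sum>j. ennreal_powr (b j) Q") auto
    have "S \<le> K * (4 * \<alpha> powr Q)" using tot S \<alpha> by (simp add: ennreal_le_iff K_def)
    also have "\<dots> \<le> (12 * c * \<alpha>) powr Q"
    proof -
      have "(4::real) powr 1 \<le> 4 powr Q" using Q by (intro powr_mono) auto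
      then have "K * (4 * \<alpha> powr Q) \<le> K * (4 powr Q * \<alpha> powr Q)" by (intro mult_left_mono mult_right_mono) (auto simp: K_def)
      also have "\<dots> = ((3 * c) * (4 * \<alpha>)) powr Q" using c \<alpha> by (simp only: K_def powr_mult)
      also have "(3 * c) * (4 * \<alpha>) = 12 * c * \<alpha>" by simp
      finally show ?thesis .
    qed
    finally have "S powr (1 / Q) \<le> ((12 * c * \<alpha>) powr Q) powr (1 / Q)" using S Q by (intro powr_mono2) auto
    also have "\<dots> = 12 * c * \<alpha>" using Q c \<alpha> by (simp add: powr_powr)
    finally have "lq_norm q b \<le> ennreal (12 * c * \<alpha>)" unfolding n S(2) using S(1) by (simp add: ennreal_powr_def ennreal_leI)
    then show ?thesis using \<alpha> c by (simp add: ennreal_mult)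
  qed
qed

subsection \<open>Distributions with Littlewood--Paley blocks in Lebesgue spaces\<close>

text \<open>\<open>distr_Lp_norm\<close> is an infimum that need not be attained. Representatives
  are therefore chosen with bounds \<open>n j\<close> that may exceed it slightly; positivity is
  asked for because \<open>Young_convolution\<close> and \<open>Lp_weight\<close> divide by the
  bound.\<close>

definition blocks :: "(real^'n::finite \<Rightarrow> complex) \<Rightarrow> ennreal \<Rightarrow> 'n distr \<Rightarrow> (nat \<Rightarrow> real^'n \<Rightarrow> complex) \<Rightarrow> (nat \<Rightarrow> real) \<Rightarrow> bool" where
  "blocks \<Phi> p T f n \<longleftrightarrow> (\<forall>j. represents (f j) (lp_block \<Phi> j T) \<and> Lp_le p (f j) (n j) \<and> n j > 0)"

lemma blocks_exist:
  assumes p: "1 \<le> p" and n: "\<And>j. n j > 0" "\<And>j. distr_Lp_norm p (lp_block \<Phi> j T) < ennreal (n j)"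
  shows "\<exists>f. blocks \<Phi> p T f n"
proof -
  have "\<exists>f. represents f (lp_block \<Phi> j T) \<and> Lp_le p f (n j)" for j
  proof -
    obtain f where f: "represents f (lp_block \<Phi> j T)" "Lp_norm p f < ennreal (n j)"
      using n(2)[of j] unfolding distr_Lp_norm_def Inf_less_iff by blast
    have "f \<in> borel_measurable borel" using f(1) by (simp add: represents_def)
    then show ?thesis using f Lp_leI[OF _ p f(2)] by blast
  qed
  then have "\<forall>j. \<exists>f. represents f (lp_block \<Phi> j T) \<and> Lp_le p f (n j)" by blast
  then obtain f where "\<forall>j. represents (f j) (lp_block \<Phi> j T) \<and> Lp_le p (f j) (n j)" by (rule choice[THEN exE])
  then show ?thesis using n(1) by (auto simp: blocks_def)
qed

lemma blocks_borel: "blocks \<Phi> p T f n \<Longrightarrow> f j \<in> borel_measurable borel"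
  by (simp add: blocks_def Lp_le_def)

lemma blocks_action:
  assumes "lp_generator \<Phi>" "blocks \<Phi> p T f n" "\<psi> \<in> schwartz"
  shows "T (conv (lpk \<Phi> j) \<psi>) = (\<integral>x. f j x * \<psi> x \<partial>lborel)" "integrable lborel (\<lambda>x. f j x * \<psi> x)"
proof -
  have r: "represents (f j) (lp_block \<Phi> j T)" using assms(2) by (simp add: blocks_def)
  have "lp_block \<Phi> j T \<psi> = distr_of_fun (f j) \<psi>" using r assms(3) by (simp add: represents_def)
  then show "T (conv (lpk \<Phi> j) \<psi>) = (\<integral>x. f j x * \<psi> x \<partial>lborel)"
    by (simp add: lp_block_conv[OF assms(1,3)] distr_of_fun_def)
  show "integrable lborel (\<lambda>x. f j x * \<psi> x)" using r assms(3) by (simp add: represents_def)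
qed

lemma conv_lpk_schwartz: "lp_generator \<Phi> \<Longrightarrow> \<psi> \<in> schwartz \<Longrightarrow> conv (lpk \<Phi> j) \<psi> \<in> schwartz"
  by (intro schwartz_conv schwartz_rapid lpk_schwartz)

text \<open>A test function reproduced by the kernels near \<open>j\<close> sees only the
  corresponding blocks of T, so no infinite sum over blocks is involved.\<close>

lemma blocks_action_near:
  assumes \<Phi>: "lp_generator \<Phi>" and T: "tempered T" and f: "blocks \<Phi> p T f n"
    and h: "h \<in> schwartz" "\<And>x. (\<Sum>i\<in>near j. conv (lpk \<Phi> i) h x) = h x"
  shows "T h = (\<Sum>i\<in>near j. \<integral>x. f i x * h x \<partial>lborel)"
proof -
  have "T h = T (\<lambda>x. \<Sum>i\<in>near j. conv (lpk \<Phi> i) h x)" using h(2) by simp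
  also have "\<dots> = (\<Sum>i\<in>near j. T (conv (lpk \<Phi> i) h))"
    by (rule tempered_sum[OF T]) (rule conv_lpk_schwartz[OF \<Phi> h(1)])
  also have "\<dots> = (\<Sum>i\<in>near j. \<integral>x. f i x * h x \<partial>lborel)"
    by (intro sum.cong refl blocks_action(1)[OF \<Phi> f h(1)])
  finally show ?thesis .
qed

text \<open>Reflection is built in since convolutions are correlations with the reflected kernel.\<close>

lemma scaled_kernel_moment:
  fixes k :: "real^'n::finite \<Rightarrow> complex"
  assumes k: "rapid k" and t: "t \<ge> 1" and r: "r \<ge> 0"
  shows "(\<integral>y. cmod (of_real (t ^ CARD('n)) * k (t *\<^sub>R (- y))) * (norm y ^ M * wt r y) \<partial>lborel)
     \<le> (1 / t) ^ M * (\<integral>y. cmod (k y) * (norm y ^ M * wt r y) \<partial>lborel)"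
proof -
  have [measurable]: "k \<in> borel_measurable borel" by (rule rapid_borel[OF k])
  let ?F = "\<lambda>y. cmod (of_real (t ^ CARD('n)) * k (t *\<^sub>R (- y))) * (norm y ^ M * wt r y)"
  let ?G = "\<lambda>y. cmod (k y) * (norm y ^ M * wt r y)"
  have Gi: "integrable lborel ?G"
  proof (rule integrable_bound_real[OF rapid_integrable_wt[OF k, of "real M + r"]])
    fix y :: "real^'n"
    have "norm y ^ M * wt r y \<le> wt (real M + r) y"
      unfolding wt_mult[symmetric] by (intro mult_right_mono norm_power_le_wt) auto
    then show "norm (?G y) \<le> cmod (k y) * wt (real M + r) y" by (simp add: mult_left_mono)
  qed measurable
  have Gi': "integrable lborel (\<lambda>y. cmod (k y) * (norm y ^ M * wt r ((-1/t) *\<^sub>R y)))"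
  proof (rule integrable_bound_real[OF Gi])
    fix y :: "real^'n"
    have "wt r ((-1/t) *\<^sub>R y) \<le> wt r y"
      unfolding wt_def using t r by (intro powr_mono2) (auto simp: divide_le_eq mult_le_cancel_left1)
    then show "norm (cmod (k y) * (norm y ^ M * wt r ((-1/t) *\<^sub>R y))) \<le> ?G y" by (simp add: mult_left_mono)
  qed measurable
  have "complex_of_real (\<integral>y. ?F y \<partial>lborel) = (\<integral>y. complex_of_real (?F y) \<partial>lborel)"
    by (simp only: integral_complex_of_real)
  also have "\<dots> = of_real (\<bar>-1/t\<bar> ^ DIM(real^'n)) * (\<integral>y. complex_of_real (?F (0 + (-1/t) *\<^sub>R y)) \<partial>lborel)"
    using t by (intro integral_lborel_affine) auto
  also have "\<dots> = of_real (\<bar>-1/t\<bar> ^ DIM(real^'n) * (\<integral>y. ?F (0 + (-1/t) *\<^sub>R y) \<partial>lborel))"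
    by (subst integral_complex_of_real, rule of_real_mult[symmetric])
  finally have "(\<integral>y. ?F y \<partial>lborel) = \<bar>-1/t\<bar> ^ DIM(real^'n) * (\<integral>y. ?F (0 + (-1/t) *\<^sub>R y) \<partial>lborel)"
    by (simp only: of_real_eq_iff)
  also have "(\<lambda>y. ?F (0 + (-1/t) *\<^sub>R y)) = (\<lambda>y. (t ^ CARD('n) * (1/t) ^ M) * (cmod (k y) * (norm y ^ M * wt r ((-1/t) *\<^sub>R y))))"
  proof
    fix y :: "real^'n"
    have "t *\<^sub>R (- (0 + (-1/t) *\<^sub>R y)) = y" using t by simp
    then have "?F (0 + (-1/t) *\<^sub>R y) = (t ^ CARD('n) * cmod (k y)) * ((norm ((-1/t) *\<^sub>R y)) ^ M * wt r ((-1/t) *\<^sub>R y))"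
      using t by (simp only: norm_mult norm_of_real add_0) simp
    also have "norm ((-1/t) *\<^sub>R y) ^ M = (1/t) ^ M * norm y ^ M" using t by (simp add: power_mult_distrib power_divide)
    finally show "?F (0 + (-1/t) *\<^sub>R y) = (t ^ CARD('n) * (1/t) ^ M) * (cmod (k y) * (norm y ^ M * wt r ((-1/t) *\<^sub>R y)))"
      by (simp only: mult_ac)
  qed
  also have "\<bar>-1/t\<bar> ^ DIM(real^'n) * (\<integral>y. (t ^ CARD('n) * (1/t) ^ M) * (cmod (k y) * (norm y ^ M * wt r ((-1/t) *\<^sub>R y))) \<partial>lborel)
     = (1/t) ^ M * (\<integral>y. cmod (k y) * (norm y ^ M * wt r ((-1/t) *\<^sub>R y)) \<partial>lborel)"
    using t by (simp add: power_divide)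
  also have "\<dots> \<le> (1/t) ^ M * (\<integral>y. ?G y \<partial>lborel)"
  proof (rule mult_left_mono[OF integral_mono[OF Gi' Gi]])
    fix y :: "real^'n"
    have "wt r ((-1/t) *\<^sub>R y) \<le> wt r y"
      unfolding wt_def using t r by (intro powr_mono2) (auto simp: divide_le_eq mult_le_cancel_left1)
    then show "cmod (k y) * (norm y ^ M * wt r ((-1/t) *\<^sub>R y)) \<le> ?G y" by (intro mult_left_mono) auto
  qed (use t in auto)
  finally show ?thesis .
qed

text \<open>For positive index the kernel has vanishing moments, so a Taylor expansion of
  \<open>h\<close> of order \<open>M\<close> gains (1/2)^M for each dyadic scale. \<open>D0\<close>
  covers the index 0, where no cancellation takes place.\<close>

lemma conv_lpk_decay:
  fixes \<Phi> :: "real^'n::finite \<Rightarrow> complex"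
  assumes \<Phi>: "lp_generator \<Phi>" and a: "a \<ge> 0"
  shows "\<exists>D m. D \<ge> 0 \<and> (\<forall>h\<in>schwartz. \<forall>j x. cmod (conv (lpk \<Phi> j) h x) \<le> D * (1/2) ^ (j * M) * schwartz_seminorm m h * wt (- a) x)"
proof -
  define m where "m = M + nat \<lceil>a\<rceil>"
  have m: "M \<le> m" "- real m \<le> - a" using a unfolding m_def by linarith+
  have rk: "rapid (lpk \<Phi> j)" "rapid (\<lambda>z. lpk \<Phi> j (- z))" for j
    by (intro rapid_uminus schwartz_rapid lpk_schwartz \<Phi>)+
  define D0 where "D0 = (\<integral>x. cmod (lpk \<Phi> 0 (- x)) * wt \<bar>- a\<bar> x \<partial>lborel)"
  define D1 where "D1 = real (CARD('n) ^ M) * (\<integral>y. cmod (lpk \<Phi> 1 y) * (norm y ^ M * wt a y) \<partial>lborel)"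
  have D: "D0 \<ge> 0" "D1 \<ge> 0" by (simp_all add: D0_def D1_def)
  have "cmod (conv (lpk \<Phi> j) h x) \<le> (D0 + D1 * 2 ^ M) * (1/2) ^ (j * M) * schwartz_seminorm m h * wt (- a) x"
    if h: "h \<in> schwartz" for h j x
  proof -
    let ?s = "schwartz_seminorm m h"
    have s0: "?s \<ge> 0" by (rule seminorm_nonneg[OF h])
    have hb: "cmod (iter_partial is h y) \<le> ?s * wt (- a) y" if "length is \<le> m" for "is" y
      using seminorm_bound[OF h that, of y] mult_left_mono[OF wt_mono[OF m(2), of y] s0] by linarith
    have cc: "conv (lpk \<Phi> j) h = corr (\<lambda>z. lpk \<Phi> j (- z)) h"
      by (intro conv_corr rapid_borel rk smooth_borel schwartz_smooth h)
    show ?thesis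
    proof (cases j)
      case 0
      have "cmod (corr (\<lambda>z. lpk \<Phi> 0 (- z)) h x) \<le> ?s * D0 * wt (- a) x"
        unfolding D0_def using hb[of "[]"]
        by (intro corr_decay(2) rapid_borel rk smooth_borel schwartz_smooth h rapid_integrable_wt) simp
      also have "\<dots> \<le> (D0 + D1 * 2 ^ M) * ?s * wt (- a) x"
        using D s0 by (simp add: algebra_simps mult_right_mono)
      finally show ?thesis unfolding cc using 0 by simp
    next
      case (Suc i)
      have mom: "(\<integral>y. xpow is y * lpk \<Phi> (Suc i) (- y) \<partial>lborel) = 0" for "is"
      proof -
        have [measurable]: "lpk \<Phi> (Suc i) \<in> borel_measurable borel" "xpow is \<in> borel_measurable borel"
          using rapid_borel[OF rk(1)] slow_xpow[of "is"] smooth_borel by (auto simp: slow_def)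
        have "(\<integral>y. xpow is y * lpk \<Phi> (Suc i) (- y) \<partial>lborel) = (\<integral>y. xpow is (- y) * lpk \<Phi> (Suc i) y \<partial>lborel)"
          using integral_reflect[of "\<lambda>y. xpow is y * lpk \<Phi> (Suc i) (- y)" 0] by simp
        also have "(\<lambda>y. xpow is (- y) * lpk \<Phi> (Suc i) y) = (\<lambda>y. (-1) ^ length is * (xpow is y * lpk \<Phi> (Suc i) y))"
        proof
          fix y
          have "xpow is (- y) = (-1) ^ length is * xpow is y" by (induction "is") auto
          then show "xpow is (- y) * lpk \<Phi> (Suc i) y = (-1) ^ length is * (xpow is y * lpk \<Phi> (Suc i) y)" by simp
        qed
        also have "(\<integral>y. (-1) ^ length is * (xpow is y * lpk \<Phi> (Suc i) y) \<partial>lborel) = 0"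
          unfolding integral_mult_right_zero lpk_moments[OF \<Phi>] by simp
        finally show ?thesis .
      qed
      let ?I = "\<integral>y. cmod (lpk \<Phi> (Suc i) (- y)) * (norm y ^ M * wt a y) \<partial>lborel"
      have I: "?I \<le> (1/2) ^ (i * M) * (\<integral>y. cmod (lpk \<Phi> 1 y) * (norm y ^ M * wt a y) \<partial>lborel)"
        using scaled_kernel_moment[OF rk(1)[of 1], of "2 ^ i" a M] a
        unfolding lpk_scale[OF \<Phi>, of i] by (simp add: power_mult power_one_over)
      have "cmod (corr (\<lambda>z. lpk \<Phi> (Suc i) (- z)) h x) \<le> real (CARD('n) ^ M) * ?s * wt (- a) x * (\<integral>y. cmod (lpk \<Phi> (Suc i) (- y)) * (norm y ^ M * wt \<bar>- a\<bar> y) \<partial>lborel)"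
        by (rule corr_cancellation[OF rk(2) schwartz_slow[OF h] mom hb]) (use m in auto)
      also have "\<dots> = real (CARD('n) ^ M) * ?s * wt (- a) x * ?I" using a by simp
      also have "\<dots> \<le> real (CARD('n) ^ M) * ?s * wt (- a) x * ((1/2) ^ (i * M) * (\<integral>y. cmod (lpk \<Phi> 1 y) * (norm y ^ M * wt a y) \<partial>lborel))"
        using s0 I by (intro mult_left_mono) auto
      also have "\<dots> = D1 * (1/2) ^ (i * M) * (?s * wt (- a) x)" by (simp only: D1_def mult_ac)
      \<comment> \<open>The kernel of index \<open>Suc i\<close> is the dilate by 2^i; passing from
        \<open>i\<close> to \<open>j\<close> costs the factor 2^M.\<close>
      also have "(1/2 :: real) ^ (i * M) = 2 ^ M * (1/2) ^ (j * M)" by (simp add: Suc power_add power_one_over)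
      also have "D1 * (2 ^ M * (1/2) ^ (j * M)) * (?s * wt (- a) x) \<le> (D0 + D1 * 2 ^ M) * (1/2) ^ (j * M) * ?s * wt (- a) x"
        using D s0 by (simp add: algebra_simps)
      finally show ?thesis unfolding cc Suc[symmetric] .
    qed
  qed
  then show ?thesis using D by (intro exI[of _ "D0 + D1 * 2 ^ M"] exI[of _ m]) auto
qed

section \<open>Low-pass sums and continuity with uniform constants\<close>

text \<open>An approximate identity: the kernels have mass \<Phi>(0) = 1 and are concentrated at
  scale 2^(-J), so a first-order expansion bounds the error by 2^(-J) times a seminorm with one more
  derivative.\<close>

lemma low_pass_limit:
  fixes \<Phi> :: "real^'n::finite \<Rightarrow> complex"
  assumes \<Phi>: "lp_generator \<Phi>" and T: "tempered T" and h: "h \<in> schwartz"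
  shows "(\<lambda>J. T (conv (kern (\<lambda>\<xi>. \<Phi> ((1 / 2 ^ J) *\<^sub>R \<xi>))) h)) \<longlonglongrightarrow> T h"
proof (rule tempered_limit[OF T h, where a="\<lambda>J. (1/2) ^ J"])
  let ?K = "\<lambda>J. kern (\<lambda>\<xi>. \<Phi> ((1 / 2 ^ J) *\<^sub>R \<xi>))"
  have KS: "?K J \<in> schwartz" for J by (intro schwartz_kern dilate_schwartz \<Phi>)
  have rK: "rapid (?K J)" "rapid (\<lambda>y. ?K J (- y))" for J by (intro rapid_uminus schwartz_rapid KS)+
  have r0: "rapid (kern \<Phi>)" by (intro schwartz_rapid schwartz_kern generator_schwartz \<Phi>)
  show "conv (?K J) h \<in> schwartz" for J by (intro schwartz_conv rK h)
  show "(\<lambda>J. (1/2::real) ^ J) \<longlonglongrightarrow> 0" by (rule LIMSEQ_realpow_zero) auto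
  fix m
  let ?s = "schwartz_seminorm (Suc m) h"
  have s0: "?s \<ge> 0" by (rule seminorm_nonneg[OF h])
  define R where "R = (\<integral>y. cmod (kern \<Phi> y) * (norm y ^ 1 * wt (real m) y) \<partial>lborel)"
  have "schwartz_seminorm m (\<lambda>x. conv (?K J) h x - h x) \<le> (real CARD('n) * ?s * R) * (1/2) ^ J" for J
  proof (rule seminorm_least)
    fix "is" :: "'n list" and x assume l: "length is \<le> m"
    define g where "g = iter_partial is h"
    have gS: "g \<in> schwartz" unfolding g_def by (rule schwartz_iter_partial[OF h])
    have [measurable]: "g \<in> borel_measurable borel" "?K J \<in> borel_measurable borel"
      using smooth_borel[OF schwartz_smooth[OF gS]] rapid_borel[OF rK(1)] by auto
    have e: "iter_partial is (\<lambda>x. conv (?K J) h x - h x) x = conv (?K J) g x - g x"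
      unfolding iter_partial_diff[OF schwartz_smooth[OF schwartz_conv[OF rK(1) h]] schwartz_smooth[OF h]]
        iter_partial_conv[OF rK(1) schwartz_slow[OF h]] g_def ..
    have mass: "(\<integral>y. ?K J (- y) \<partial>lborel) = 1"
    proof -
      have "(\<integral>y. ?K J (- y) \<partial>lborel) = (\<integral>y. ?K J y \<partial>lborel)" using integral_reflect[of "?K J" 0] by simp
      also have "\<dots> = 1" using kern_moments[OF dilate_schwartz[OF \<Phi>], of "[]" J] \<Phi> by (simp add: lp_generator_def)
      finally show ?thesis .
    qed
    have i1: "integrable lborel (\<lambda>y. ?K J (- y) * g (y + x))"
      by (intro dom_integrable dom_rapid_slow rK schwartz_slow gS)
    have i2: "integrable lborel (\<lambda>y. ?K J (- y) * g x)"
      by (intro integrable_mult_left rapid_integrable rK)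
    have "conv (?K J) g x = (\<integral>y. ?K J (- y) * g (y + x) \<partial>lborel)"
      by (subst conv_corr) (simp_all add: corr_def)
    moreover have "(\<integral>y. ?K J (- y) * g x \<partial>lborel) = g x"
      by (simp only: integral_mult_left_zero mass mult_1)
    ultimately have d: "conv (?K J) g x - g x = (\<integral>y. ?K J (- y) * g (y + x) - ?K J (- y) * g x \<partial>lborel)"
      using i1 i2 by simp
    have pt: "cmod (?K J (- y) * g (y + x) - ?K J (- y) * g x) \<le> (real CARD('n) * ?s * wt (- real m) x) * (cmod (?K J (- y)) * (norm y ^ 1 * wt (real m) y))" for y
    proof -
      define G where "G y = g (y + x)" for y
      have sG: "smooth G" unfolding G_def using smooth_affine[OF schwartz_smooth[OF gS], of 1 x] by simp
      have tc: "cmod (taylor_coeff [i] G y) \<le> ?s * (wt (- real m) x * wt (real m) y)" for i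
      proof -
        have "cmod (iter_partial [] (taylor_coeff [i] G) y) \<le> ?s * (wt (- real m) x * wt (real m) y)"
        proof (rule taylor_coeff_bound[OF sG])
          fix t :: real assume t: "t \<in> {0..1}"
          have "iter_partial [i] G (t *\<^sub>R y) = iter_partial (i # is) h (t *\<^sub>R y + x)"
            unfolding G_def using iter_partial_affine[OF schwartz_smooth[OF gS], of "[i]" 1 x] by (simp add: g_def)
          also have "cmod \<dots> \<le> ?s * wt (- real (Suc m)) (t *\<^sub>R y + x)"
            using l by (intro seminorm_bound h) simp
          also have "\<dots> \<le> ?s * (wt (- real m) x * wt (real m) y)"
          proof (intro mult_left_mono s0)
            have "wt (- real (Suc m)) (t *\<^sub>R y + x) \<le> wt (- real m) (x + t *\<^sub>R y)"
              unfolding add.commute[of x] by (rule wt_mono) simp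
            also have "\<dots> \<le> wt (- real m) x * wt \<bar>- real m\<bar> (t *\<^sub>R y)" by (rule wt_peetre)
            also have "\<dots> \<le> wt (- real m) x * wt (real m) y"
            proof (intro mult_left_mono)
              have "norm (t *\<^sub>R y) \<le> norm y" using t by (simp add: mult_left_le_one_le)
              then show "wt \<bar>- real m\<bar> (t *\<^sub>R y) \<le> wt (real m) y" unfolding wt_def abs_minus_cancel abs_of_nat by (intro powr_mono2) auto
            qed simp
            finally show "wt (- real (Suc m)) (t *\<^sub>R y + x) \<le> wt (- real m) x * wt (real m) y" .
          qed
          finally show "cmod (iter_partial ([] @ [i]) G (t *\<^sub>R y)) \<le> ?s * (wt (- real m) x * wt (real m) y)" by simp
        qed
        then show ?thesis by simp
      qed
      have "G y = G 0 + (\<Sum>i\<in>UNIV. of_real (y $ i) * taylor_coeff [i] G y)"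
        using ray_avg_expand[OF sG, of y] by simp
      then have "cmod (g (y + x) - g x) = cmod (\<Sum>i\<in>UNIV. of_real (y $ i) * taylor_coeff [i] G y)"
        by (simp add: G_def)
      also have "\<dots> \<le> (\<Sum>i\<in>(UNIV::'n set). norm y * (?s * (wt (- real m) x * wt (real m) y)))"
      proof (intro order_trans[OF norm_sum] sum_mono)
        fix i
        show "cmod (of_real (y $ i) * taylor_coeff [i] G y) \<le> norm y * (?s * (wt (- real m) x * wt (real m) y))"
          unfolding norm_mult norm_of_real using component_le_norm_cart[of y i] tc[of i] by (intro mult_mono) auto
      qed
      finally have "cmod (?K J (- y)) * cmod (g (y + x) - g x) \<le> cmod (?K J (- y)) * (real CARD('n) * (norm y * (?s * (wt (- real m) x * wt (real m) y))))"
        by (intro mult_left_mono) auto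
      then show ?thesis unfolding right_diff_distrib[symmetric] norm_mult power_one_right by (simp only: mult_ac)
    qed
    have wi: "integrable lborel (\<lambda>y. cmod (?K J (- y)) * (norm y ^ 1 * wt (real m) y))"
    proof (rule integrable_bound_real[OF rapid_integrable_wt[OF rK(2)[of J], of "1 + real m"]])
      fix y :: "real^'n"
      have "norm y ^ 1 * wt (real m) y \<le> wt (1 + real m) y"
        unfolding wt_mult[symmetric] using norm_power_le_wt[of y 1] by (intro mult_right_mono) auto
      then show "norm (cmod (?K J (- y)) * (norm y ^ 1 * wt (real m) y)) \<le> cmod (?K J (- y)) * wt (1 + real m) y"
        by (simp add: mult_left_mono)
    qed measurable
    have "cmod (conv (?K J) g x - g x) \<le> (real CARD('n) * ?s * wt (- real m) x) * (\<integral>y. cmod (?K J (- y)) * (norm y ^ 1 * wt (real m) y) \<partial>lborel)"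
      unfolding d using integral_bound_real[OF integrable_mult_right[OF wi, of "real CARD('n) * ?s * wt (- real m) x"] _ pt] by simp
    also have "\<dots> \<le> (real CARD('n) * ?s * wt (- real m) x) * ((1 / 2 ^ J) ^ 1 * R)"
    proof (rule mult_left_mono)
      show "(\<integral>y. cmod (?K J (- y)) * (norm y ^ 1 * wt (real m) y) \<partial>lborel) \<le> (1 / 2 ^ J) ^ 1 * R"
        unfolding R_def kern_dilate_scale[OF \<Phi>] by (rule scaled_kernel_moment[OF r0]) auto
    qed (use s0 in simp)
    also have "\<dots> = (real CARD('n) * ?s * R) * (1/2) ^ J * wt (- real m) x" by (simp add: power_one_over)
    finally show "cmod (iter_partial is (\<lambda>x. conv (?K J) h x - h x) x) \<le> (real CARD('n) * ?s * R) * (1/2) ^ J * wt (- real m) x"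
      unfolding e .
  qed
  then show "\<exists>C. \<forall>J. schwartz_seminorm m (\<lambda>x. conv (?K J) h x - h x) \<le> C * (1/2) ^ J" by blast
qed

text \<open>The kernels of the blocks telescope to the low-pass kernel.\<close>

lemma low_pass_action:
  assumes \<Phi>: "lp_generator \<Phi>" and T: "tempered T" and h: "h \<in> schwartz"
  shows "T (conv (kern (\<lambda>\<xi>. \<Phi> ((1 / 2 ^ J) *\<^sub>R \<xi>))) h) = (\<Sum>j\<le>J. T (conv (lpk \<Phi> j) h))"
proof -
  have "conv (kern (\<lambda>\<xi>. \<Phi> ((1 / 2 ^ J) *\<^sub>R \<xi>))) h = (\<lambda>x. \<Sum>j\<le>J. conv (lpk \<Phi> j) h x)"
  proof
    fix x
    have i: "integrable lborel (\<lambda>y. lpk \<Phi> j (x - y) * h y)" for j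
    proof -
      have "integrable lborel (\<lambda>y. lpk \<Phi> j (- y) * h (y + x))"
        by (intro dom_integrable dom_rapid_slow rapid_uminus schwartz_rapid lpk_schwartz schwartz_slow \<Phi> h)
      from integrable_lborel_affine[OF this, of 1 "- x"] show ?thesis by simp
    qed
    have "conv (kern (\<lambda>\<xi>. \<Phi> ((1 / 2 ^ J) *\<^sub>R \<xi>))) h x = (\<integral>y. (\<Sum>j\<le>J. lpk \<Phi> j (x - y) * h y) \<partial>lborel)"
      unfolding conv_def lpk_sum[OF \<Phi>, symmetric] by (simp add: sum_distrib_right)
    also have "\<dots> = (\<Sum>j\<le>J. conv (lpk \<Phi> j) h x)"
      unfolding conv_def by (intro Bochner_Integration.integral_sum i)
    finally show "conv (kern (\<lambda>\<xi>. \<Phi> ((1 / 2 ^ J) *\<^sub>R \<xi>))) h x = (\<Sum>j\<le>J. conv (lpk \<Phi> j) h x)" .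
  qed
  then show ?thesis
    using tempered_sum[OF T, of "{..J}" "\<lambda>j. conv (lpk \<Phi> j) h"] conv_lpk_schwartz[OF \<Phi> h] by simp
qed

text \<open>\<open>C\<close> and \<open>m\<close> precede the distribution in the quantifiers: T
  enters only through the bound \<open>A\<close> on its blocks. The reproducing formula expresses
  each term by neighbouring blocks of T, and the rapid decay of the blocks of \<open>h\<close> makes
  the series geometric.\<close>

lemma pairing_bound:
  fixes \<Phi> :: "real^'n::finite \<Rightarrow> complex"
  assumes \<Phi>: "lp_generator \<Phi>" and p: "1 \<le> p"
  shows "\<exists>C m. C \<ge> 0 \<and> (\<forall>T f A J. \<forall>h\<in>schwartz. tempered T \<longrightarrow> A > 0 \<longrightarrow> blocks \<Phi> p T f (\<lambda>j. A * 2 powr (- real j * s)) \<longrightarrow>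
     (\<Sum>j\<le>J. cmod (T (conv (lpk \<Phi> j) h))) \<le> C * A * schwartz_seminorm m h)"
proof -
  \<comment> \<open>A neighbour i <= j + 1 contributes at most 2 powr ((j + 1) \<bar>s\<bar>). The
    decay 2 powr (-j M) with M >= \<bar>s\<bar> + 1 absorbs this up to 2 powr \<bar>s\<bar> and
    leaves 2 powr (-j).\<close>
  define M where "M = nat \<lceil>\<bar>s\<bar>\<rceil> + 1"
  have M: "real M \<ge> \<bar>s\<bar> + 1" unfolding M_def by linarith
  \<comment> \<open>Makes the weight of exponent -a integrable as well as bounded by 1, as
    \<open>Lp_weight\<close> requires.\<close>
  define a where "a = real CARD('n) + 1"
  obtain D m where D: "D \<ge> 0" "\<And>h j x. h \<in> schwartz \<Longrightarrow> cmod (conv (lpk \<Phi> j) h x) \<le> D * (1/2) ^ (j * M) * schwartz_seminorm m h * wt (- a) x"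
    using conv_lpk_decay[OF \<Phi>, of a M] unfolding a_def by (metis add_nonneg_nonneg of_nat_0_le_iff zero_le_one)
  define V where "V = (\<integral>x. wt (- a) (x :: real^'n) \<partial>lborel) + 1"
  have V: "V \<ge> 0" unfolding V_def by (simp add: add_nonneg_nonneg)
  \<comment> \<open>Three neighbours times the bound 2 for the geometric sum.\<close>
  define C where "C = 6 * D * V * 2 powr \<bar>s\<bar>"
  have "(\<Sum>j\<le>J. cmod (T (conv (lpk \<Phi> j) h))) \<le> C * A * schwartz_seminorm m h"
    if T: "tempered T" and A: "A > 0" and f: "blocks \<Phi> p T f (\<lambda>j. A * 2 powr (- real j * s))" and h: "h \<in> schwartz" for T f A J h
  proof -
    let ?s = "schwartz_seminorm m h"
    have s0: "?s \<ge> 0" by (rule seminorm_nonneg[OF h])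
    have each: "cmod (T (conv (lpk \<Phi> j) h)) \<le> (3 * D * V * 2 powr \<bar>s\<bar> * A * ?s) * (1/2) ^ j" for j
    proof -
      let ?h = "conv (lpk \<Phi> j) h"
      have hS: "?h \<in> schwartz" by (rule conv_lpk_schwartz[OF \<Phi> h])
      have T_eq: "T ?h = (\<Sum>i\<in>near j. \<integral>x. f i x * ?h x \<partial>lborel)"
        by (rule blocks_action_near[OF \<Phi> T f hS lpk_reproducing[OF \<Phi> h]])
      have ni: "cmod (\<integral>x. f i x * ?h x \<partial>lborel) \<le> D * V * 2 powr \<bar>s\<bar> * A * ?s * (1/2) ^ j" if i: "i \<in> near j" for i
      proof -
        let ?n = "A * 2 powr (- real i * s)"
        have [measurable]: "f i \<in> borel_measurable borel" "?h \<in> borel_measurable borel"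
          using blocks_borel[OF f] smooth_borel[OF schwartz_smooth[OF hS]] by auto
        have wi: "integrable lborel (wt (- a) :: real^'n \<Rightarrow> real)" unfolding a_def by (rule wt_integrable_cart) simp
        have Lp: "Lp_le p (f i) ?n" and n0: "?n > 0" using f by (auto simp: blocks_def)
        note W = Lp_weight[OF p Lp n0 wi wt_nonneg wt_le_1]
        have a0: "- a \<le> 0" by (simp add: a_def)
        have fw: "integrable lborel (\<lambda>x. cmod (f i x) * wt (- a) x)" "(\<integral>x. cmod (f i x) * wt (- a) x \<partial>lborel) \<le> ?n * V"
          unfolding V_def using W[OF a0] by auto
        let ?c = "D * (1/2) ^ (j * M) * ?s"
        have "cmod (\<integral>x. f i x * ?h x \<partial>lborel) \<le> (\<integral>x. ?c * (cmod (f i x) * wt (- a) x) \<partial>lborel)"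
        proof (rule integral_bound_real[OF integrable_mult_right[OF fw(1)]])
          fix x
          have "cmod (f i x) * cmod (?h x) \<le> cmod (f i x) * (?c * wt (- a) x)"
            by (intro mult_left_mono D(2) h) simp
          then show "norm (f i x * ?h x) \<le> ?c * (cmod (f i x) * wt (- a) x)" by (simp add: norm_mult mult_ac)
        qed measurable
        also have "\<dots> = ?c * (\<integral>x. cmod (f i x) * wt (- a) x \<partial>lborel)" by simp
        also have "\<dots> \<le> ?c * (?n * V)" using fw(2) D(1) s0 by (intro mult_left_mono) auto
        also have "\<dots> = (D * V * A * ?s) * ((1/2) ^ (j * M) * 2 powr (- real i * s))" by (simp only: mult_ac)
        also have "\<dots> \<le> (D * V * A * ?s) * (2 powr \<bar>s\<bar> * (1/2) ^ j)"
        proof (rule mult_left_mono)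
          have "real i \<le> real j + 1" using i by (auto simp: near_def)
          then have "real i * \<bar>s\<bar> \<le> (real j + 1) * \<bar>s\<bar>" by (intro mult_right_mono) auto
          moreover have "- (real i * s) \<le> real i * \<bar>s\<bar>"
            using mult_left_mono[of "- s" "\<bar>s\<bar>" "real i"] by simp
          moreover have "real j * (\<bar>s\<bar> + 1) \<le> real j * real M" using M by (intro mult_left_mono) auto
          ultimately have ex: "- real (j * M) + (- real i * s) \<le> \<bar>s\<bar> - real j" by (simp add: algebra_simps)
          have half: "(1/2::real) ^ k = 2 powr (- real k)" for k
            by (simp add: powr_minus_divide powr_realpow power_one_over)
          show "(1/2) ^ (j * M) * 2 powr (- real i * s) \<le> 2 powr \<bar>s\<bar> * (1/2) ^ j"
            unfolding half powr_add[symmetric] using ex by (intro powr_mono) auto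
        qed (use D V A s0 in simp)
        finally show ?thesis by (simp only: mult_ac)
      qed
      have card: "card (near j) \<le> 3" by (simp add: near_def)
      have "cmod (T ?h) \<le> (\<Sum>i\<in>near j. D * V * 2 powr \<bar>s\<bar> * A * ?s * (1/2) ^ j)"
        unfolding T_eq by (intro order_trans[OF norm_sum] sum_mono ni)
      also have "\<dots> = real (card (near j)) * (D * V * 2 powr \<bar>s\<bar> * A * ?s * (1/2) ^ j)" by simp
      also have "\<dots> \<le> 3 * (D * V * 2 powr \<bar>s\<bar> * A * ?s * (1/2) ^ j)"
        using card D V A s0 by (intro mult_right_mono) auto
      finally show ?thesis by (simp only: mult_ac)
    qed
    have geo: "(\<Sum>j\<le>J. (1/2::real) ^ j) \<le> 2"
    proof -
      have "(\<Sum>j\<le>J. (1/2::real) ^ j) = 2 - (1/2) ^ J" by (induction J) auto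
      then show ?thesis by simp
    qed
    have "(\<Sum>j\<le>J. cmod (T (conv (lpk \<Phi> j) h))) \<le> (\<Sum>j\<le>J. (3 * D * V * 2 powr \<bar>s\<bar> * A * ?s) * (1/2) ^ j)"
      by (intro sum_mono each)
    also have "\<dots> = (3 * D * V * 2 powr \<bar>s\<bar> * A * ?s) * (\<Sum>j\<le>J. (1/2) ^ j)" by (simp only: sum_distrib_left)
    also have "\<dots> \<le> (3 * D * V * 2 powr \<bar>s\<bar> * A * ?s) * 2"
      using D V A s0 geo by (intro mult_left_mono) auto
    finally show ?thesis by (simp add: C_def mult_ac)
  qed
  moreover have "C \<ge> 0" using D V by (simp add: C_def)
  ultimately show ?thesis by (intro exI[of _ C] exI[of _ m]) auto
qed

subsection \<open>The convolution with the surface spline\<close>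

text \<open>\<open>E\<close> depends on the cutoff alone, so that it is uniform in the translation
  parameter of the functions \<open>G\<close> inserted later. Within radius \<rho> the weight of the
  seminorm costs at most (1 + \<rho>)^m.\<close>

lemma localized_seminorm:
  fixes \<eta> :: "real^'n::finite \<Rightarrow> complex"
  assumes \<eta>: "\<eta> \<in> schwartz" and \<rho>: "\<rho> \<ge> 0" and z: "\<And>x. norm x > \<rho> \<Longrightarrow> \<eta> x = 0"
  shows "\<exists>E\<ge>0. \<forall>G B. smooth G \<longrightarrow> B \<ge> 0 \<longrightarrow> (\<forall>is y. length is \<le> m \<longrightarrow> norm y \<le> \<rho> \<longrightarrow> cmod (iter_partial is G y) \<le> B)
     \<longrightarrow> schwartz_seminorm m (\<lambda>x. \<eta> x * G x) \<le> E * B"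
proof -
  define E where "E = 2 ^ m * schwartz_seminorm m \<eta> * (1 + \<rho>) ^ m"
  have s0: "schwartz_seminorm m \<eta> \<ge> 0" by (rule seminorm_nonneg[OF \<eta>])
  have "schwartz_seminorm m (\<lambda>x. \<eta> x * G x) \<le> E * B"
    if G: "smooth G" and B: "B \<ge> 0" and GB: "\<And>is y. length is \<le> m \<Longrightarrow> norm y \<le> \<rho> \<Longrightarrow> cmod (iter_partial is G y) \<le> B" for G B
  proof (rule seminorm_least)
    fix "is" :: "'n list" and x :: "real^'n" assume l: "length is \<le> m"
    show "cmod (iter_partial is (\<lambda>x. \<eta> x * G x) x) \<le> E * B * wt (- real m) x"
    proof (cases "norm x \<le> \<rho>")
      case True
      have eb: "cmod (iter_partial js \<eta> x) \<le> schwartz_seminorm m \<eta>" if "length js \<le> m" for js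
        using seminorm_bound[OF \<eta> that, of x] mult_left_mono[OF wt_le_1[of "- real m" x] s0] by simp
      have "cmod (iter_partial is (\<lambda>x. \<eta> x * G x) x) \<le> 2 ^ m * schwartz_seminorm m \<eta> * B"
        by (rule leibniz_bound[OF schwartz_smooth[OF \<eta>] G s0 eb GB l]) (use True in auto)
      also have "\<dots> \<le> 2 ^ m * schwartz_seminorm m \<eta> * B * ((1 + \<rho>) ^ m * wt (- real m) x)"
      proof -
        have "wt (real m) x \<le> (1 + \<rho>) ^ m" unfolding wt_nat using True by (intro power_mono) auto
        then have "wt (real m) x * wt (- real m) x \<le> (1 + \<rho>) ^ m * wt (- real m) x" by (intro mult_right_mono) auto
        then have "1 \<le> (1 + \<rho>) ^ m * wt (- real m) x" by (simp add: wt_mult)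
        then have "(2 ^ m * schwartz_seminorm m \<eta> * B) * 1 \<le> (2 ^ m * schwartz_seminorm m \<eta> * B) * ((1 + \<rho>) ^ m * wt (- real m) x)"
          using s0 B by (intro mult_left_mono) auto
        then show ?thesis by simp
      qed
      also have "\<dots> = E * B * wt (- real m) x" by (simp only: E_def mult_ac)
      finally show ?thesis .
    next
      case False
      have o: "open (- cball (0::real^'n) \<rho>)" by auto
      have "iter_partial is (\<lambda>x. \<eta> x * G x) x = 0"
        by (rule iter_partial_zero_on_open[OF o]) (use False z in auto)
      then show ?thesis using s0 B \<rho> by (simp add: E_def)
    qed
  qed
  then show ?thesis using s0 \<rho> by (intro exI[of _ E]) (auto simp: E_def)
qed

lemma bump_vanish: "lp_generator \<Phi> \<Longrightarrow> R > 0 \<Longrightarrow> norm x > 2 * R \<Longrightarrow> bump \<Phi> 0 R x = 0"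
  by (rule bump_zero) auto

lemma bump_schwartz: "lp_generator \<Phi> \<Longrightarrow> R > 0 \<Longrightarrow> bump \<Phi> 0 R \<in> schwartz"
  by (intro test_schwartz bump_test)

lemma bump_mult_schwartz:
  assumes "lp_generator \<Phi>" "R > 0" "smooth G"
  shows "(\<lambda>x. bump \<Phi> 0 R x * G x) \<in> schwartz"
  using test_schwartz[OF test_mult[OF bump_test[OF assms(1,2), of 0] assms(3)]] by (simp add: mult.commute)

abbreviation (input) spline_conv :: "real \<Rightarrow> 'n::finite distr \<Rightarrow> 'n distr" where
  "spline_conv \<theta> T \<equiv> distr_conv (distr_of_fun (surface_spline \<theta>)) T"

lemma spline_conv_eq:
  assumes \<Phi>: "lp_generator \<Phi>" and \<theta>: "\<theta> > 0" and T: "tempered T" and R: "R > 0" "distr_support T \<subseteq> ball 0 R"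
    and \<psi>: "\<psi> \<in> schwartz"
  shows "spline_conv \<theta> T \<psi> = T (\<lambda>y. bump \<Phi> 0 R y * corr (surface_spline \<theta>) \<psi> y)"
proof -
  have "spline_conv \<theta> T \<psi> = pairing T (corr (surface_spline \<theta>) \<psi>)"
    by (simp add: distr_conv_def distr_of_fun_def corr_def[abs_def])
  also have "\<dots> = T (\<lambda>y. bump \<Phi> 0 R y * corr (surface_spline \<theta>) \<psi> y)"
    by (rule pairing_eq[OF \<Phi> T R smooth_corr[OF spline_dom[OF \<theta> \<psi>]]])
  finally show ?thesis .
qed

lemma spline_conv_tempered:
  fixes \<Phi> :: "real^'n::finite \<Rightarrow> complex" and T :: "'n distr"
  assumes \<Phi>: "lp_generator \<Phi>" and \<theta>: "\<theta> > 0" and T: "tempered T" and R: "R > 0" "distr_support T \<subseteq> ball 0 R"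
  shows "tempered (spline_conv \<theta> T)"
proof -
  let ?S = "surface_spline \<theta> :: real^'n \<Rightarrow> complex" and ?z = "bump \<Phi> 0 R"
  note eq = spline_conv_eq[OF \<Phi> \<theta> T R]
  have zS: "(\<lambda>y. ?z y * corr ?S \<psi> y) \<in> schwartz" if "\<psi> \<in> schwartz" for \<psi>
    by (rule bump_mult_schwartz[OF \<Phi> R(1) smooth_corr[OF spline_dom[OF \<theta> that]]])
  have lin: "spline_conv \<theta> T (\<lambda>x. a * \<phi> x + b * \<psi> x) = a * spline_conv \<theta> T \<phi> + b * spline_conv \<theta> T \<psi>"
    if s: "\<phi> \<in> schwartz" "\<psi> \<in> schwartz" for \<phi> \<psi> a b
  proof -
    have ab: "(\<lambda>x. a * \<phi> x + b * \<psi> x) \<in> schwartz" by (intro schwartz_add schwartz_cmult s)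
    have "corr ?S (\<lambda>x. a * \<phi> x + b * \<psi> x) y = a * corr ?S \<phi> y + b * corr ?S \<psi> y" for y
    proof -
      have "(\<lambda>x. ?S x * (a * \<phi> (x + y) + b * \<psi> (x + y))) = (\<lambda>x. a * (?S x * \<phi> (x + y)) + b * (?S x * \<psi> (x + y)))"
        by (simp add: algebra_simps)
      then show ?thesis
        using dom_integrable[OF spline_dom[OF \<theta> s(1)], of y] dom_integrable[OF spline_dom[OF \<theta> s(2)], of y]
        by (simp add: corr_def)
    qed
    then have "(\<lambda>y. ?z y * corr ?S (\<lambda>x. a * \<phi> x + b * \<psi> x) y) = (\<lambda>y. a * (?z y * corr ?S \<phi> y) + b * (?z y * corr ?S \<psi> y))"
      by (simp add: algebra_simps)
    then show ?thesis
      unfolding eq[OF ab] eq[OF s(1)] eq[OF s(2)] using tempered_lin[OF T zS[OF s(1)] zS[OF s(2)]] by simp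
  qed
  obtain C k where C: "C \<ge> 0" "\<And>\<psi>. \<psi> \<in> schwartz \<Longrightarrow> cmod (T \<psi>) \<le> C * schwartz_seminorm k \<psi>"
    using tempered_bound[OF T] by metis
  obtain E where E: "E \<ge> 0" "\<forall>G B. smooth G \<longrightarrow> B \<ge> 0 \<longrightarrow> (\<forall>is y. length is \<le> k \<longrightarrow> norm y \<le> 2 * R \<longrightarrow> cmod (iter_partial is G y) \<le> B)
     \<longrightarrow> schwartz_seminorm k (\<lambda>x. ?z x * G x) \<le> E * B"
    using localized_seminorm[OF bump_schwartz[OF \<Phi> R(1)], of "2 * R" k] bump_vanish[OF \<Phi> R(1)] R(1) by auto
  \<comment> \<open>Besides \<open>k\<close> derivatives, the seminorm must provide enough decay to
    make the spline kernel integrable: \<theta> + 1 orders for its growth and N + 1 for the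
    volume.\<close>
  define m where "m = k + nat \<lceil>\<theta> + 1 + real CARD('n) + 1\<rceil>"
  have m: "k \<le> m" "- real m \<le> - (\<theta> + 1) - real CARD('n) - 1" unfolding m_def using \<theta> by linarith+
  define I where "I = (\<integral>x. cmod (?S x) * wt (- real m) x \<partial>lborel)"
  have ii: "integrable lborel (\<lambda>x. cmod (?S x) * wt (- real m) x)"
  proof (rule integrable_bound_real[OF dom_poly_schwartz(2)[OF spline_borel spline_bound[OF \<theta>] schwartz_zero]])
    fix x :: "real^'n"
    show "norm (cmod (?S x) * wt (- real m) x) \<le> cmod (?S x) * wt (- (\<theta> + 1) - real CARD('n) - 1) x"
      using m(2) by (simp add: mult_left_mono wt_mono)
  qed measurable
  have I: "I \<ge> 0" unfolding I_def by simp
  define W where "W = (1 + 2 * R) powr real m"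
  have "cmod (spline_conv \<theta> T \<psi>) \<le> (C * E * W * I) * schwartz_seminorm m \<psi>" if \<psi>: "\<psi> \<in> schwartz" for \<psi>
  proof -
    let ?s = "schwartz_seminorm m \<psi>"
    have s0: "?s \<ge> 0" by (rule seminorm_nonneg[OF \<psi>])
    have "schwartz_seminorm k (\<lambda>y. ?z y * corr ?S \<psi> y) \<le> E * (?s * W * I)"
    proof (rule E(2)[rule_format])
      show "smooth (corr ?S \<psi>)" by (rule smooth_corr[OF spline_dom[OF \<theta> \<psi>]])
      show "0 \<le> ?s * W * I" using s0 I by (simp add: W_def)
      fix "is" :: "'n list" and y :: "real^'n" assume l: "length is \<le> k" and y: "norm y \<le> 2 * R"
      have "cmod (corr ?S (iter_partial is \<psi>) y) \<le> ?s * wt \<bar>- real m\<bar> y * I"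
        unfolding I_def
      proof (rule corr_bound(2)[OF _ spline_borel _ ii])
        show "smooth (iter_partial is \<psi>)" by (intro smooth_iter_partial schwartz_smooth \<psi>)
        show "cmod (iter_partial is \<psi> x) \<le> ?s * wt (- real m) x" for x
          using l m(1) by (intro seminorm_bound \<psi>) simp
      qed
      also have "\<dots> \<le> ?s * W * I"
      proof -
        have "wt \<bar>- real m\<bar> y \<le> W"
          unfolding wt_def W_def abs_minus_cancel abs_of_nat using y by (intro powr_mono2) auto
        then show ?thesis using s0 I by (intro mult_right_mono mult_left_mono)
      qed
      finally show "cmod (iter_partial is (corr ?S \<psi>) y) \<le> ?s * W * I"
        unfolding iter_partial_corr[OF spline_dom[OF \<theta> \<psi>]] .
    qed
    then have "C * schwartz_seminorm k (\<lambda>y. ?z y * corr ?S \<psi> y) \<le> C * (E * (?s * W * I))"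
      by (intro mult_left_mono C)
    then show ?thesis
      unfolding eq[OF \<psi>] using C(2)[OF zS[OF \<psi>]] by (simp add: mult_ac)
  qed
  then show ?thesis unfolding tempered_def using lin by blast
qed

subsection \<open>High frequencies\<close>

text \<open>The L^1 norm of the kernel at the first scale; the summand 1 ensures the positivity
  demanded by \<open>Young_convolution\<close>.\<close>

definition high_const :: "(real^'n::finite \<Rightarrow> complex) \<Rightarrow> real \<Rightarrow> real" where
  "high_const \<Phi> \<theta> = (\<integral>v. cmod (corr (surface_spline \<theta>) (lpk \<Phi> 1) v) \<partial>lborel) + 1"

lemma high_const_pos: "high_const \<Phi> \<theta> > 0"
  by (simp add: high_const_def add_nonneg_pos)

lemma high_kernel_rapid:
  assumes \<Phi>: "lp_generator \<Phi>" and \<theta>: "\<theta> > 0"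
  shows "rapid (corr (surface_spline \<theta>) (lpk \<Phi> (Suc i)))"
  by (rule corr_spline_rapid[OF \<Phi> \<theta> lpk_schwartz[OF \<Phi>] lpk_moments[OF \<Phi>]])

text \<open>The source of the gain in smoothness: at the scale t = 2^i homogeneity contributes t
  powr (-\<theta>) and the change of variables in the L^1 norm contributes t powr (-N).\<close>

lemma high_kernel_norm:
  fixes \<Phi> :: "real^'n::finite \<Rightarrow> complex"
  assumes \<Phi>: "lp_generator \<Phi>" and \<theta>: "\<theta> > 0"
  shows "(\<integral>v. cmod (corr (surface_spline \<theta>) (lpk \<Phi> (Suc i)) v) \<partial>lborel) \<le> high_const \<Phi> \<theta> * 2 powr (- real i * (\<theta> + real CARD('n)))"
proof -
  define l0 where "l0 = corr (surface_spline \<theta>) (lpk \<Phi> 1)"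
  define t where "t = (2::real) ^ i"
  have t: "t > 0" by (simp add: t_def)
  have [measurable]: "l0 \<in> borel_measurable borel" using rapid_borel[OF high_kernel_rapid[OF \<Phi> \<theta>, of 0]] by (simp add: l0_def)
  have mom: "(\<integral>y. xpow is y * lpk \<Phi> 1 y \<partial>lborel) = 0" for "is" using lpk_moments[OF \<Phi>, of "is" 0] by simp
  have e: "corr (surface_spline \<theta>) (lpk \<Phi> (Suc i)) v = of_real (t powr (- \<theta>)) * l0 (t *\<^sub>R v)" for v
    unfolding lpk_scale[OF \<Phi>, of i] t_def[symmetric] l0_def by (rule corr_spline_scale[OF \<theta> t lpk_schwartz[OF \<Phi>] mom])
  have "complex_of_real (\<integral>v. cmod (l0 (t *\<^sub>R v)) \<partial>lborel) = (\<integral>v. complex_of_real (cmod (l0 (t *\<^sub>R v))) \<partial>lborel)"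
    by (simp only: integral_complex_of_real)
  also have "\<dots> = of_real (\<bar>1/t\<bar> ^ DIM(real^'n)) * (\<integral>v. complex_of_real (cmod (l0 (t *\<^sub>R (0 + (1/t) *\<^sub>R v)))) \<partial>lborel)"
    using t by (intro integral_lborel_affine) auto
  also have "\<dots> = of_real (\<bar>1/t\<bar> ^ DIM(real^'n) * (\<integral>v. cmod (l0 (t *\<^sub>R (0 + (1/t) *\<^sub>R v))) \<partial>lborel))"
    by (subst integral_complex_of_real, rule of_real_mult[symmetric])
  finally have "(\<integral>v. cmod (l0 (t *\<^sub>R v)) \<partial>lborel) = \<bar>1/t\<bar> ^ DIM(real^'n) * (\<integral>v. cmod (l0 (t *\<^sub>R (0 + (1/t) *\<^sub>R v))) \<partial>lborel)"
    by (simp only: of_real_eq_iff)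
  then have sc: "(\<integral>v. cmod (l0 (t *\<^sub>R v)) \<partial>lborel) = (1/t) ^ CARD('n) * (\<integral>v. cmod (l0 v) \<partial>lborel)"
    using t by simp
  have "(\<integral>v. cmod (corr (surface_spline \<theta>) (lpk \<Phi> (Suc i)) v) \<partial>lborel) = t powr (- \<theta>) * ((1/t) ^ CARD('n) * (\<integral>v. cmod (l0 v) \<partial>lborel))"
    unfolding e norm_mult by (simp add: sc)
  also have "\<dots> \<le> t powr (- \<theta>) * ((1/t) ^ CARD('n) * high_const \<Phi> \<theta>)"
    using t unfolding high_const_def l0_def[symmetric] by (intro mult_left_mono) auto
  also have "\<dots> = high_const \<Phi> \<theta> * 2 powr (- real i * (\<theta> + real CARD('n)))"
  proof -
    have "t = 2 powr real i" by (simp add: t_def powr_realpow)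
    then have 1: "t powr (- \<theta>) = 2 powr (- real i * \<theta>)" by (simp add: powr_powr)
    have "(1/t) ^ CARD('n) = t powr (- real CARD('n))"
      using t by (simp add: powr_minus_divide powr_realpow power_one_over)
    also have "\<dots> = 2 powr (- real i * real CARD('n))" using \<open>t = 2 powr real i\<close> by (simp add: powr_powr)
    finally show ?thesis unfolding 1 by (simp add: powr_add[symmetric] algebra_simps)
  qed
  finally show ?thesis .
qed

text \<open>The test function \<open>h\<close> seen by T is a convolution with the rapidly
  decreasing kernel \<open>l\<close>, hence Schwartz, so the cutoff of the pairing may be dropped.
  It inherits the reproducing property and only meets neighbouring blocks; moving \<open>l\<close>
  onto these by Fubini leaves a convolution for Young's inequality.\<close>

lemma high_block:
  fixes \<Phi> :: "real^'n::finite \<Rightarrow> complex"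
  assumes \<Phi>: "lp_generator \<Phi>" and \<theta>: "\<theta> > 0" and p: "1 \<le> p" and T: "tempered T"
    and R: "R > 0" "distr_support T \<subseteq> ball 0 R" and f: "blocks \<Phi> p T f n"
  shows "distr_Lp_norm p (lp_block \<Phi> (Suc i) (spline_conv \<theta> T))
     \<le> ennreal (8 * (high_const \<Phi> \<theta> * 2 powr (- real i * (\<theta> + real CARD('n)))) * (\<Sum>k\<in>near (Suc i). n k))"
proof -
  let ?S = "surface_spline \<theta> :: real^'n \<Rightarrow> complex"
  let ?k = "lpk \<Phi> (Suc i)"
  define l where "l = corr ?S ?k"
  define \<Lambda> where "\<Lambda> = high_const \<Phi> \<theta> * 2 powr (- real i * (\<theta> + real CARD('n)))"
  have \<Lambda>: "\<Lambda> > 0" unfolding \<Lambda>_def by (intro mult_pos_pos high_const_pos) simp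
  have kS: "?k \<in> schwartz" by (rule lpk_schwartz[OF \<Phi>])
  have rl: "rapid l" unfolding l_def by (rule high_kernel_rapid[OF \<Phi> \<theta>])
  have [measurable]: "l \<in> borel_measurable borel" by (rule rapid_borel[OF rl])
  have fm [measurable]: "f k \<in> borel_measurable borel" for k by (rule blocks_borel[OF f])
  define G where "G k z = (\<integral>y. f k y * l (y - z) \<partial>lborel)" for k z
  have LpG: "Lp_le p (G k) (n k * \<Lambda>)" for k
    unfolding G_def
  proof (rule Young_convolution[OF p _ _ rl])
    show "Lp_le p (f k) (n k)" "n k > 0" using f by (auto simp: blocks_def)
    show "(\<integral>x. cmod (l x) \<partial>lborel) \<le> \<Lambda>" unfolding l_def \<Lambda>_def by (rule high_kernel_norm[OF \<Phi> \<theta>])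
  qed (rule \<Lambda>)
  have rep: "represents (\<lambda>z. \<Sum>k\<in>near (Suc i). G k z) (lp_block \<Phi> (Suc i) (spline_conv \<theta> T))"
    unfolding represents_def
  proof (intro conjI ballI)
    show "(\<lambda>z. \<Sum>k\<in>near (Suc i). G k z) \<in> borel_measurable lborel"
      using LpG by (intro borel_measurable_sum) (simp add: Lp_le_def)
    fix \<psi> :: "real^'n \<Rightarrow> complex" assume \<psi>: "\<psi> \<in> schwartz"
    have [measurable]: "\<psi> \<in> borel_measurable borel" by (rule smooth_borel[OF schwartz_smooth[OF \<psi>]])
    let ?g = "conv ?k \<psi>"
    have gS: "?g \<in> schwartz" by (rule conv_lpk_schwartz[OF \<Phi> \<psi>])
    define h where "h = corr ?S ?g"
    have km: "?k \<in> borel_measurable borel" by (rule smooth_borel[OF schwartz_smooth[OF kS]])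
    have h_eq: "h = conv l \<psi>"
    proof -
      have "h = corr ?S (conv \<psi> ?k)" unfolding h_def by (subst conv_commute) (simp_all add: km)
      also have "\<dots> = conv \<psi> l" unfolding l_def
        by (rule corr_conv[OF spline_borel spline_bound[OF \<theta>] schwartz_rapid[OF \<psi>] kS])
      also have "\<dots> = conv l \<psi>" by (rule conv_commute) measurable
      finally show ?thesis .
    qed
    have hS: "h \<in> schwartz" unfolding h_eq by (rule schwartz_conv[OF rl \<psi>])
    have "lp_block \<Phi> (Suc i) (spline_conv \<theta> T) \<psi> = spline_conv \<theta> T ?g" by (rule lp_block_conv[OF \<Phi> \<psi>])
    also have "\<dots> = T (\<lambda>y. bump \<Phi> 0 R y * h y)" unfolding h_def by (rule spline_conv_eq[OF \<Phi> \<theta> T R gS])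
    also have "\<dots> = T h" by (rule tempered_cutoff[OF \<Phi> T R hS])
    also have "\<dots> = (\<Sum>k\<in>near (Suc i). \<integral>x. f k x * h x \<partial>lborel)"
    proof (rule blocks_action_near[OF \<Phi> T f hS])
      fix x
      have "conv (lpk \<Phi> k) h = corr ?S (conv (lpk \<Phi> k) ?g)" for k
        unfolding h_def
        by (rule corr_conv[OF spline_borel spline_bound[OF \<theta>] schwartz_rapid[OF lpk_schwartz[OF \<Phi>]] gS, symmetric])
      then have "(\<Sum>k\<in>near (Suc i). conv (lpk \<Phi> k) h x) = (\<Sum>k\<in>near (Suc i). \<integral>v. ?S v * conv (lpk \<Phi> k) ?g (v + x) \<partial>lborel)"
        by (simp add: corr_def)
      also have "\<dots> = (\<integral>v. (\<Sum>k\<in>near (Suc i). ?S v * conv (lpk \<Phi> k) ?g (v + x)) \<partial>lborel)"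
        by (intro Bochner_Integration.integral_sum[symmetric] dom_integrable spline_dom \<theta> conv_lpk_schwartz \<Phi> gS)
      also have "\<dots> = h x"
        unfolding sum_distrib_left[symmetric] lpk_reproducing[OF \<Phi> \<psi>] h_def corr_def ..
      finally show "(\<Sum>k\<in>near (Suc i). conv (lpk \<Phi> k) h x) = h x" .
    qed
    finally have T_eq: "lp_block \<Phi> (Suc i) (spline_conv \<theta> T) \<psi> = (\<Sum>k\<in>near (Suc i). \<integral>x. f k x * h x \<partial>lborel)" .
    have sw: "(\<integral>x. f k x * h x \<partial>lborel) = (\<integral>z. G k z * \<psi> z \<partial>lborel)" and gi: "integrable lborel (\<lambda>z. G k z * \<psi> z)" for k
    proof -
      \<comment> \<open>With this decay of \<open>l\<close>, Peetre's inequality gives a product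
        majorant: \<open>f k\<close> against an integrable bounded weight, times
        \<open>\<psi>\<close> against a growing one.\<close>
      define a where "a = real CARD('n) + 1"
      obtain B where B: "B \<ge> 0" "\<And>x. cmod (l x) \<le> B * wt (- a) x" using rapid_bound[OF rl] by metis
      let ?F = "\<lambda>y z. f k y * (l (y - z) * \<psi> z)"
      have wi: "integrable lborel (wt (- a) :: real^'n \<Rightarrow> real)" unfolding a_def by (rule wt_integrable_cart) simp
      have "integrable lborel (\<lambda>y. cmod (f k y) * wt (- a) y)"
        by (rule Lp_weight(1)[OF p _ _ wi wt_nonneg wt_le_1]) (use f in \<open>auto simp: blocks_def a_def\<close>)
      moreover have "integrable lborel (\<lambda>z. B * (cmod (\<psi> z) * wt a z))"
        by (intro integrable_mult_right rapid_integrable_wt schwartz_rapid \<psi>)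
      moreover have "norm (?F y z) \<le> (cmod (f k y) * wt (- a) y) * (B * (cmod (\<psi> z) * wt a z))" for y z
      proof -
        have "wt (- a) (y + - z) \<le> wt (- a) y * wt \<bar>- a\<bar> (- z)" by (rule wt_peetre)
        moreover have "\<bar>- a\<bar> = a" by (simp add: a_def)
        ultimately have "wt (- a) (y - z) \<le> wt (- a) y * wt a z" by simp
        then have "cmod (l (y - z)) \<le> B * (wt (- a) y * wt a z)"
          using B(2)[of "y - z"] mult_left_mono[OF _ B(1)] order_trans by blast
        then have "cmod (f k y) * (cmod (l (y - z)) * cmod (\<psi> z)) \<le> cmod (f k y) * ((B * (wt (- a) y * wt a z)) * cmod (\<psi> z))"
          by (intro mult_left_mono mult_right_mono) auto
        then show ?thesis by (simp add: norm_mult mult_ac)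
      qed
      ultimately have fub: "(\<integral>y. (\<integral>z. ?F y z \<partial>lborel) \<partial>lborel) = (\<integral>z. (\<integral>y. ?F y z \<partial>lborel) \<partial>lborel)"
        "integrable lborel (\<lambda>z. \<integral>y. ?F y z \<partial>lborel)"
        by (intro fubini_swap[of ?F "\<lambda>y. cmod (f k y) * wt (- a) y" "\<lambda>z. B * (cmod (\<psi> z) * wt a z)"]; measurable)+
      have 1: "(\<integral>z. ?F y z \<partial>lborel) = f k y * h y" for y
        unfolding h_eq conv_def by (rule integral_mult_right_zero)
      have 2: "(\<integral>y. ?F y z \<partial>lborel) = G k z * \<psi> z" for z
        unfolding G_def mult.assoc[symmetric] by (rule integral_mult_left_zero)
      show "(\<integral>x. f k x * h x \<partial>lborel) = (\<integral>z. G k z * \<psi> z \<partial>lborel)" using fub(1) unfolding 1 2 .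
      show "integrable lborel (\<lambda>z. G k z * \<psi> z)" using fub(2) unfolding 2 .
    qed
    show "integrable lborel (\<lambda>z. (\<Sum>k\<in>near (Suc i). G k z) * \<psi> z)"
      unfolding sum_distrib_right by (intro Bochner_Integration.integrable_sum gi)
    show "lp_block \<Phi> (Suc i) (spline_conv \<theta> T) \<psi> = distr_of_fun (\<lambda>z. \<Sum>k\<in>near (Suc i). G k z) \<psi>"
      unfolding T_eq sw distr_of_fun_def sum_distrib_right
      by (rule Bochner_Integration.integral_sum[symmetric]) (rule gi)
  qed
  \<comment> \<open>Three neighbours exactly, since the index is positive; \<open>Lp_sum\<close>
    then gives the factor 2^3 = 8.\<close>
  have fin: "finite (near (Suc i))" and card: "card (near (Suc i)) = 3" by (auto simp: near_def)
  have "distr_Lp_norm p (lp_block \<Phi> (Suc i) (spline_conv \<theta> T)) \<le> Lp_norm p (\<lambda>z. \<Sum>k\<in>near (Suc i). G k z)"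
    unfolding distr_Lp_norm_def using rep by (intro Inf_lower) blast
  also have "\<dots> \<le> ennreal (2 ^ card (near (Suc i)) * (\<Sum>k\<in>near (Suc i). n k * \<Lambda>))"
    by (rule Lp_leD[OF p Lp_sum[OF p fin LpG]])
  also have "2 ^ card (near (Suc i)) * (\<Sum>k\<in>near (Suc i). n k * \<Lambda>) = 8 * \<Lambda> * (\<Sum>k\<in>near (Suc i). n k)"
    unfolding card sum_distrib_right[symmetric] by simp
  finally show ?thesis unfolding \<Lambda>_def .
qed

subsection \<open>Low frequencies\<close>

text \<open>Counting occurrences turns the list into a multiindex of total degree
  \<open>length is\<close>, which brings the monomial into the form used by
  \<open>annihilates_polys\<close>.\<close>

lemma poly_annihilated:
  fixes \<Phi> :: "real^'n::finite \<Rightarrow> complex"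
  assumes \<Phi>: "lp_generator \<Phi>" and T: "tempered T" and R: "R > 0" "distr_support T \<subseteq> ball 0 R"
    and ann: "annihilates_polys T d" and l: "length is \<le> d"
  shows "T (\<lambda>y. bump \<Phi> 0 R y * xpow is y) = 0"
proof -
  have "xpow is = (\<lambda>x. of_real (\<Prod>i\<in>UNIV. (x $ i) ^ count_list is i))"
  proof
    fix x :: "real^'n"
    show "xpow is x = of_real (\<Prod>i\<in>UNIV. (x $ i) ^ count_list is i)"
    proof (induction "is")
      case (Cons a "is")
      have "(\<Prod>i\<in>UNIV. (x $ i) ^ count_list (a # is) i) = (\<Prod>i\<in>UNIV. (if i = a then x $ i else 1) * (x $ i) ^ count_list is i)"
        by (intro prod.cong refl) auto
      also have "\<dots> = x $ a * (\<Prod>i\<in>UNIV. (x $ i) ^ count_list is i)"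
        by (simp add: prod.distrib)
      finally show ?case using Cons by simp
    qed simp
  qed
  moreover have "(\<Sum>i\<in>UNIV. count_list is i) = length is"
  proof (induction "is")
    case (Cons a "is")
    have "(\<Sum>i\<in>UNIV. count_list (a # is) i) = (\<Sum>i\<in>UNIV. (if a = i then 1 else 0) + count_list is i)"
      by (intro sum.cong refl) auto
    then show ?case using Cons by (simp only: sum.distrib) simp
  qed simp
  ultimately have "xpow is \<in> poly_degree_le d"
    unfolding poly_degree_le_def using l
    by (intro CollectI exI[of _ "{count_list is}"] exI[of _ "\<lambda>_. 1"]) auto
  then have "pairing T (xpow is) = 0" using ann by (simp add: annihilates_polys_def)
  moreover have "smooth (xpow is)" using slow_xpow[of "is"] by (simp add: slow_def)
  ultimately show ?thesis using pairing_eq[OF \<Phi> T R] by simp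
qed

text \<open>The block is the function \<open>u\<close>, obtained by applying T to the localised
  translates \<open>g v\<close> of \<kappa>. Annihilation removes their Taylor polynomials, and the
  remainders involve derivatives of \<kappa> of order at least L, which decay with exponent -a; by
  \<open>Lp_decay\<close> such a function lies in L^p. All constants are fixed before T.\<close>

lemma low_block:
  fixes \<Phi> :: "real^'n::finite \<Rightarrow> complex"
  assumes \<Phi>: "lp_generator \<Phi>" and \<theta>: "\<theta> > 0" and p: "1 \<le> p" and R: "R > 0"
    and L: "L \<ge> 1" and \<epsilon>: "\<epsilon> > 0" and a: "a = real L - \<theta> - \<epsilon>" "a > 0" "p \<noteq> \<infinity> \<Longrightarrow> a * enn2real p > real CARD('n)"
  shows "\<exists>C\<ge>0. \<forall>T f A. tempered T \<longrightarrow> distr_support T \<subseteq> ball 0 R \<longrightarrow> annihilates_polys T (L - 1) \<longrightarrow> A > 0 \<longrightarrow>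
     blocks \<Phi> p T f (\<lambda>j. A * 2 powr (- real j * s)) \<longrightarrow>
     distr_Lp_norm p (lp_block \<Phi> 0 (spline_conv \<theta> T)) \<le> ennreal (C * A)"
proof -
  let ?S = "surface_spline \<theta> :: real^'n \<Rightarrow> complex" and ?z = "bump \<Phi> 0 R"
  define \<kappa> where "\<kappa> = corr ?S (lpk \<Phi> 0)"
  have kS: "lpk \<Phi> 0 \<in> schwartz" by (rule lpk_schwartz[OF \<Phi>])
  have \<kappa>d: "\<exists>C\<ge>0. \<forall>v. cmod (iter_partial is \<kappa> v) \<le> C * wt (\<theta> + \<epsilon> - real (length is)) v" for "is"
    unfolding \<kappa>_def by (rule corr_spline_deriv_bound[OF \<Phi> \<theta> kS \<epsilon>])
  have \<kappa>sm: "smooth \<kappa>" unfolding \<kappa>_def by (rule smooth_corr[OF spline_dom[OF \<theta> kS]])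
  have [measurable]: "\<kappa> \<in> borel_measurable borel" by (rule smooth_borel[OF \<kappa>sm])
  have [measurable]: "?z \<in> borel_measurable borel" by (rule smooth_borel[OF smooth_bump[OF \<Phi>]])
  have \<kappa>slow: "slow \<kappa>" unfolding slow_def
  proof (intro conjI \<kappa>sm allI)
    fix "is" :: "'n list"
    show "\<exists>r B. \<forall>x. cmod (iter_partial is \<kappa> x) \<le> B * wt r x" using \<kappa>d[of "is"] by blast
  qed
  \<comment> \<open>The translates of the mollified kernel, with \<open>v\<close> as the parameter
    and \<open>y\<close> as the variable on which T acts.\<close>
  define sh where "sh v y = \<kappa> (y - v)" for v y :: "real^'n"
  have sh_sm: "smooth (sh v)" for v
    unfolding sh_def using smooth_affine[OF \<kappa>sm, of 1 "- v"] by simp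
  have sh_it: "iter_partial is (sh v) y = iter_partial is \<kappa> (y - v)" for v y "is"
    unfolding sh_def using iter_partial_affine[OF \<kappa>sm, of "is" 1 "- v"] by simp
  obtain C0 m where C0: "C0 \<ge> 0" "\<forall>T f A J. \<forall>h\<in>schwartz. tempered T \<longrightarrow> A > 0 \<longrightarrow> blocks \<Phi> p T f (\<lambda>j. A * 2 powr (- real j * s)) \<longrightarrow>
     (\<Sum>j\<le>J. cmod (T (conv (lpk \<Phi> j) h))) \<le> C0 * A * schwartz_seminorm m h"
    using pairing_bound[OF \<Phi> p, of s] by (elim exE conjE)
  obtain \<kappa>C where \<kappa>C: "\<And>is. \<kappa>C is \<ge> 0" "\<And>is v. cmod (iter_partial is \<kappa> v) \<le> \<kappa>C is * wt (\<theta> + \<epsilon> - real (length is)) v"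
    using \<kappa>d by metis
  define B2 where "B2 = (\<Sum>is\<in>{is::'n list. length is \<le> m + L}. \<kappa>C is)"
  have B2: "B2 \<ge> 0" unfolding B2_def using \<kappa>C(1) by (intro sum_nonneg) auto
  have B2b: "cmod (iter_partial is \<kappa> v) \<le> B2 * wt (- a) v" if "length is \<ge> L" "length is \<le> m + L" for "is" v
  proof -
    have "\<kappa>C is \<le> B2" unfolding B2_def using that \<kappa>C(1) by (intro member_le_sum finite_lists_le) auto
    then have "\<kappa>C is * wt (\<theta> + \<epsilon> - real (length is)) v \<le> B2 * wt (- a) v"
      using that a(1) B2 by (intro mult_mono wt_mono) auto
    then show ?thesis using \<kappa>C(2)[of "is" v] by linarith
  qed
  obtain r B1 where B1: "B1 \<ge> 0" "r \<ge> 0" "\<And>is v. length is \<le> m \<Longrightarrow> cmod (iter_partial is \<kappa> v) \<le> B1 * wt r v"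
    using slow_bound[OF \<kappa>slow] by metis
  have zv: "?z x = 0" if "norm x > 2 * R" for x by (rule bump_vanish[OF \<Phi> R that])
  have zS: "?z \<in> schwartz" by (rule bump_schwartz[OF \<Phi> R])
  have R2: "2 * R \<ge> 0" using R by simp
  obtain E0 where E0: "E0 \<ge> 0" "\<forall>G B. smooth G \<longrightarrow> B \<ge> 0 \<longrightarrow> (\<forall>is y. length is \<le> m \<longrightarrow> norm y \<le> 2 * R \<longrightarrow> cmod (iter_partial is G y) \<le> B)
     \<longrightarrow> schwartz_seminorm m (\<lambda>x. ?z x * G x) \<le> E0 * B"
  proof -
    have "\<exists>E\<ge>0. \<forall>G B. smooth G \<longrightarrow> B \<ge> 0 \<longrightarrow> (\<forall>is y. length is \<le> m \<longrightarrow> norm y \<le> 2 * R \<longrightarrow> cmod (iter_partial is G y) \<le> B)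
      \<longrightarrow> schwartz_seminorm m (\<lambda>x. ?z x * G x) \<le> E * B"
      by (rule localized_seminorm[OF zS R2]) (rule zv)
    then show thesis using that by (elim exE conjE)
  qed
  have zxS: "(\<lambda>y. ?z y * xpow is y) \<in> schwartz" for "is"
    using slow_xpow[of "is"] by (intro bump_mult_schwartz[OF \<Phi> R]) (simp add: slow_def)
  have "\<forall>js. \<exists>E\<ge>0. \<forall>G B. smooth G \<longrightarrow> B \<ge> 0 \<longrightarrow> (\<forall>is y. length is \<le> m \<longrightarrow> norm y \<le> 2 * R \<longrightarrow> cmod (iter_partial is G y) \<le> B)
     \<longrightarrow> schwartz_seminorm m (\<lambda>x. (?z x * xpow js x) * G x) \<le> E * B"
    by (rule allI, rule localized_seminorm[OF zxS R2]) (simp add: zv)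
  from choice[OF this] obtain E where E': "\<forall>js. 0 \<le> E js \<and> (\<forall>G B. smooth G \<longrightarrow> B \<ge> 0 \<longrightarrow> (\<forall>is y. length is \<le> m \<longrightarrow> norm y \<le> 2 * R \<longrightarrow> cmod (iter_partial is G y) \<le> B)
     \<longrightarrow> schwartz_seminorm m (\<lambda>x. (?z x * xpow js x) * G x) \<le> E js * B)" by (elim exE)
  note E = E'[THEN spec, THEN conjunct1] E'[THEN spec, THEN conjunct2, rule_format]
  define g where "g v y = ?z y * sh v y" for v y
  have gS: "g v \<in> schwartz" for v unfolding g_def by (rule bump_mult_schwartz[OF \<Phi> R sh_sm])
  define W1 where "W1 = (1 + 2 * R) powr r"
  have W1: "W1 \<ge> 0" by (simp add: W1_def)
  \<comment> \<open>A bound of polynomial growth without cancellation. It dominates the partial sums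
    below when they are integrated against a Schwartz function.\<close>
  have crude: "schwartz_seminorm m (g v) \<le> (E0 * B1 * W1) * wt r v" for v
  proof -
    have "schwartz_seminorm m (g v) \<le> E0 * (B1 * (wt r v * W1))"
      unfolding g_def
    proof (rule E0(2)[rule_format, OF sh_sm])
      show "0 \<le> B1 * (wt r v * W1)" using B1 W1 by simp
      fix "is" :: "'n list" and y :: "real^'n" assume l: "length is \<le> m" and y: "norm y \<le> 2 * R"
      have "cmod (iter_partial is (sh v) y) \<le> B1 * wt r (- v + y)"
        using B1(3)[OF l, of "y - v"] by (simp add: sh_it)
      also have "\<dots> \<le> B1 * (wt r (- v) * wt \<bar>r\<bar> y)" by (intro mult_left_mono wt_peetre B1)
      also have "\<dots> \<le> B1 * (wt r v * W1)"
      proof -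
        have "wt \<bar>r\<bar> y \<le> W1" unfolding wt_def W1_def using y B1(2) by (simp add: powr_mono2)
        then show ?thesis using B1(1) by (simp add: mult_left_mono)
      qed
      finally show "cmod (iter_partial is (sh v) y) \<le> B1 * (wt r v * W1)" .
    qed
    then show ?thesis by (simp only: mult_ac)
  qed
  define W2 where "W2 = (1 + 2 * R) powr a"
  have W2: "W2 \<ge> 0" by (simp add: W2_def)
  \<comment> \<open>Up to \<open>m\<close> derivatives fall on a remainder coefficient of order L,
    so derivatives of \<kappa> of orders L to m + L occur; \<open>B2\<close> covers all of them with
    the single exponent -a.\<close>
  have fine: "schwartz_seminorm m (\<lambda>y. (?z y * xpow js y) * taylor_coeff js (sh v) y) \<le> E js * (B2 * (wt (- a) v * W2))"
    if js: "length js = L" for js v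
  proof (rule E(2)[OF smooth_taylor_coeff[OF sh_sm]])
    show "0 \<le> B2 * (wt (- a) v * W2)" using B2 W2 by simp
    fix "is" :: "'n list" and y :: "real^'n" assume l: "length is \<le> m" and y: "norm y \<le> 2 * R"
    show "cmod (iter_partial is (taylor_coeff js (sh v)) y) \<le> B2 * (wt (- a) v * W2)"
    proof (rule taylor_coeff_bound[OF sh_sm])
      fix t :: real assume t: "t \<in> {0..1}"
      have "norm (t *\<^sub>R y) \<le> norm y" using t by (simp add: mult_left_le_one_le)
      then have ty: "norm (t *\<^sub>R y) \<le> 2 * R" using y by linarith
      have "cmod (iter_partial (is @ js) (sh v) (t *\<^sub>R y)) \<le> B2 * wt (- a) (- v + t *\<^sub>R y)"
        using B2b[of "is @ js" "t *\<^sub>R y - v"] js l by (simp add: sh_it)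
      also have "\<dots> \<le> B2 * (wt (- a) (- v) * wt \<bar>- a\<bar> (t *\<^sub>R y))" by (intro mult_left_mono wt_peetre B2)
      also have "\<dots> \<le> B2 * (wt (- a) v * W2)"
      proof -
        have "wt a (t *\<^sub>R y) \<le> W2" unfolding wt_def W2_def using ty a(2) by (intro powr_mono2) auto
        then show ?thesis using B2 a(2) by (simp add: mult_left_mono)
      qed
      finally show "cmod (iter_partial (is @ js) (sh v) (t *\<^sub>R y)) \<le> B2 * (wt (- a) v * W2)" .
    qed
  qed
  define F where "F = (\<Sum>js\<in>{js::'n list. length js = L}. E js)"
  have F: "F \<ge> 0" unfolding F_def using E(1) by (intro sum_nonneg) auto
  obtain C1 where C1: "C1 > 0" "\<And>u A. u \<in> borel_measurable borel \<Longrightarrow> A \<ge> 0 \<Longrightarrow> (\<And>z. cmod (u z) \<le> A * wt (- a) (z :: real^'n)) \<Longrightarrow> Lp_le p u (A * C1)"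
    by (rule Lp_decay[OF p a(2), where 'n='n]) (use a(3) in auto)
  define C where "C = C0 * F * B2 * W2 * C1"
  have "distr_Lp_norm p (lp_block \<Phi> 0 (spline_conv \<theta> T)) \<le> ennreal (C * A)"
    if T: "tempered T" and supp: "distr_support T \<subseteq> ball 0 R" and ann: "annihilates_polys T (L - 1)" and A: "A > 0"
      and f: "blocks \<Phi> p T f (\<lambda>j. A * 2 powr (- real j * s))" for T f A
  proof -
    have [measurable]: "f k \<in> borel_measurable borel" for k by (rule blocks_borel[OF f])
    note low = low_pass_limit[OF \<Phi> T, unfolded low_pass_action[OF \<Phi> T]]
    have PB: "(\<Sum>j\<le>J. cmod (T (conv (lpk \<Phi> j) h))) \<le> C0 * A * schwartz_seminorm m h" if "h \<in> schwartz" for J h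
      using C0(2) T A f that by blast
    have lim: "(\<lambda>J. \<Sum>j\<le>J. T (conv (lpk \<Phi> j) h)) \<longlonglongrightarrow> T h" if h: "h \<in> schwartz" for h
      using low_pass_limit[OF \<Phi> T h] unfolding low_pass_action[OF \<Phi> T h] .
    \<comment> \<open>The sums over finitely many blocks converge to \<open>T h\<close> and share
      one bound. This is continuity of T with a constant proportional to \<open>A\<close>.\<close>
    have Tb: "cmod (T h) \<le> C0 * A * schwartz_seminorm m h" if h: "h \<in> schwartz" for h
    proof (rule LIMSEQ_le_const2[OF tendsto_norm[OF lim[OF h]]])
      show "\<exists>N. \<forall>J\<ge>N. norm (\<Sum>j\<le>J. T (conv (lpk \<Phi> j) h)) \<le> C0 * A * schwartz_seminorm m h"
        using order_trans[OF norm_sum PB[OF h]] by blast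
    qed
    define u where "u v = T (g v)" for v
    \<comment> \<open>To show that \<open>u\<close> is measurable and represents the block, T has to
      be exchanged with an integral over \<open>v\<close>. The partial sums \<open>uJ\<close> are
      given by the functions \<open>f j\<close>, for which Fubini is available; the exchange then
      passes to the limit J \<rightarrow> \<infinity>.\<close>
    define uJ where "uJ J v = (\<Sum>j\<le>J. \<integral>y. f j y * g v y \<partial>lborel)" for J v
    have uJ_eq: "uJ J v = (\<Sum>j\<le>J. T (conv (lpk \<Phi> j) (g v)))" for J v
      unfolding uJ_def by (intro sum.cong refl blocks_action(1)[OF \<Phi> f gS, symmetric])
    have uJm [measurable]: "uJ J \<in> borel_measurable borel" for J
    proof -
      have "(\<lambda>v. \<integral>y. f j y * g v y \<partial>lborel) \<in> borel_measurable borel" for j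
        unfolding g_def sh_def by measurable
      then show ?thesis unfolding uJ_def by (intro borel_measurable_sum)
    qed
    have ulim: "(\<lambda>J. uJ J v) \<longlonglongrightarrow> u v" for v unfolding uJ_eq u_def by (rule lim[OF gS])
    have um [measurable]: "u \<in> borel_measurable borel"
      by (rule borel_measurable_LIMSEQ_metric[OF uJm ulim])
    have uJb: "cmod (uJ J v) \<le> (C0 * A * (E0 * B1 * W1)) * wt r v" for J v
    proof -
      have "cmod (uJ J v) \<le> C0 * A * schwartz_seminorm m (g v)"
        unfolding uJ_eq by (rule order_trans[OF norm_sum PB[OF gS]])
      also have "\<dots> \<le> C0 * A * ((E0 * B1 * W1) * wt r v)" using C0(1) A by (intro mult_left_mono crude) auto
      finally show ?thesis by (simp only: mult_ac)
    qed
    \<comment> \<open>The Taylor terms \<open>?P\<close> of order below L are multiples of localised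
      monomials of degree at most L - 1, which T annihilates; only the remainders \<open>?Q\<close>
      are left.\<close>
    have ub: "cmod (u v) \<le> (C0 * A * F * B2 * W2) * wt (- a) v" for v
    proof -
      let ?P = "\<lambda>js y. taylor_coeff js (sh v) 0 * (?z y * xpow js y)"
      let ?Q = "\<lambda>js y. (?z y * xpow js y) * taylor_coeff js (sh v) y"
      let ?L = "{js :: 'n list. length js = L}"
      have PS: "?P js \<in> schwartz" for js by (intro schwartz_cmult zxS)
      have QS: "?Q js \<in> schwartz" for js
      proof -
        have "(\<lambda>y. ?z y * (xpow js y * taylor_coeff js (sh v) y)) \<in> schwartz"
          using slow_xpow[of js] by (intro bump_mult_schwartz[OF \<Phi> R] smooth_mult smooth_taylor_coeff sh_sm) (simp add: slow_def)
        then show ?thesis by (simp only: mult.assoc)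
      qed
      have P0: "T (?P js) = 0" if "length js < L" for js
        using poly_annihilated[OF \<Phi> T R supp ann, of js] that tempered_cmult[OF T zxS, of "taylor_coeff js (sh v) 0" js] by simp
      have "g v = (\<lambda>y. (\<Sum>k<L. \<Sum>js\<in>{js. length js = k}. ?P js y) + (\<Sum>js\<in>?L. ?Q js y))"
      proof
        fix y
        show "g v y = (\<Sum>k<L. \<Sum>js\<in>{js. length js = k}. ?P js y) + (\<Sum>js\<in>?L. ?Q js y)"
          unfolding g_def taylor_expansion[OF sh_sm, of v y L] distrib_left sum_distrib_left by (simp only: mult_ac)
      qed
      then have "u v = T (\<lambda>y. (\<Sum>k<L. \<Sum>js\<in>{js. length js = k}. ?P js y) + (\<Sum>js\<in>?L. ?Q js y))"
        by (simp only: u_def)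
      also have "\<dots> = T (\<lambda>y. \<Sum>k<L. \<Sum>js\<in>{js. length js = k}. ?P js y) + T (\<lambda>y. \<Sum>js\<in>?L. ?Q js y)"
        by (intro tempered_add[OF T] schwartz_sum PS QS)
      also have "T (\<lambda>y. \<Sum>js\<in>?L. ?Q js y) = (\<Sum>js\<in>?L. T (?Q js))" by (rule tempered_sum[OF T QS])
      also have "T (\<lambda>y. \<Sum>k<L. \<Sum>js\<in>{js. length js = k}. ?P js y) = (\<Sum>k<L. T (\<lambda>y. \<Sum>js\<in>{js. length js = k}. ?P js y))"
        by (rule tempered_sum[OF T schwartz_sum[OF PS]])
      also have "\<dots> = (\<Sum>k<L. \<Sum>js\<in>{js. length js = k}. T (?P js))"
        by (intro sum.cong refl tempered_sum[OF T PS])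
      also have "\<dots> = 0" using P0 by simp
      finally have "u v = (\<Sum>js\<in>?L. T (?Q js))" by simp
      then have "cmod (u v) \<le> (\<Sum>js\<in>?L. cmod (T (?Q js)))" by (simp add: norm_sum)
      also have "\<dots> \<le> (\<Sum>js\<in>?L. C0 * A * (E js * (B2 * (wt (- a) v * W2))))"
      proof (rule sum_mono)
        fix js assume "js \<in> ?L"
        then have "schwartz_seminorm m (?Q js) \<le> E js * (B2 * (wt (- a) v * W2))" by (intro fine) simp
        then have "C0 * A * schwartz_seminorm m (?Q js) \<le> C0 * A * (E js * (B2 * (wt (- a) v * W2)))"
          using C0(1) A by (intro mult_left_mono) auto
        with Tb[OF QS[of js]] show "cmod (T (?Q js)) \<le> C0 * A * (E js * (B2 * (wt (- a) v * W2)))" by (rule order_trans)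
      qed
      also have "\<dots> = (C0 * A * F * B2 * W2) * wt (- a) v"
        unfolding F_def by (simp add: sum_distrib_left sum_distrib_right mult_ac)
      finally show ?thesis .
    qed
    have K0: "C0 * A * F * B2 * W2 \<ge> 0" using C0(1) A F B2 W2 by simp
    have Lu: "Lp_le p u ((C0 * A * F * B2 * W2) * C1)" by (rule C1(2)[OF um K0 ub])
    have rep: "represents u (lp_block \<Phi> 0 (spline_conv \<theta> T))"
      unfolding represents_def
    proof (intro conjI ballI)
      show "u \<in> borel_measurable lborel" using um by simp
      fix \<psi> :: "real^'n \<Rightarrow> complex" assume \<psi>: "\<psi> \<in> schwartz"
      have r\<psi>: "rapid \<psi>" by (rule schwartz_rapid[OF \<psi>])
      have [measurable]: "\<psi> \<in> borel_measurable borel" by (rule rapid_borel[OF r\<psi>])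
      show "integrable lborel (\<lambda>v. u v * \<psi> v)"
      proof (rule integrable_bound_real[OF integrable_mult_right[OF rapid_integrable_wt[OF r\<psi>, of "- a"], of "C0 * A * F * B2 * W2"]])
        fix v
        show "norm (u v * \<psi> v) \<le> C0 * A * F * B2 * W2 * (cmod (\<psi> v) * wt (- a) v)"
          using mult_right_mono[OF ub[of v], of "cmod (\<psi> v)"] by (simp add: norm_mult mult_ac)
      qed measurable
      let ?g = "conv (lpk \<Phi> 0) \<psi>"
      have ggS: "?g \<in> schwartz" by (rule conv_lpk_schwartz[OF \<Phi> \<psi>])
      have km: "lpk \<Phi> 0 \<in> borel_measurable borel" by (rule smooth_borel[OF schwartz_smooth[OF kS]])
      define H where "H = corr ?S ?g"
      have Hsm: "smooth H" unfolding H_def by (rule smooth_corr[OF spline_dom[OF \<theta> ggS]])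
      have H_eq: "H = conv \<psi> \<kappa>"
      proof -
        have "H = corr ?S (conv \<psi> (lpk \<Phi> 0))" unfolding H_def by (subst conv_commute) (simp_all add: km)
        also have "\<dots> = conv \<psi> \<kappa>" unfolding \<kappa>_def
          by (rule corr_conv[OF spline_borel spline_bound[OF \<theta>] r\<psi> kS])
        finally show ?thesis .
      qed
      have Hy: "H y = (\<integral>v. \<psi> v * \<kappa> (y - v) \<partial>lborel)" for y
        unfolding H_eq by (rule conv_alt) measurable
      define \<eta> where "\<eta> y = ?z y * H y" for y
      have \<eta>S: "\<eta> \<in> schwartz" unfolding \<eta>_def by (rule bump_mult_schwartz[OF \<Phi> R Hsm])
      have "lp_block \<Phi> 0 (spline_conv \<theta> T) \<psi> = spline_conv \<theta> T ?g" by (rule lp_block_conv[OF \<Phi> \<psi>])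
      also have "\<dots> = T \<eta>" unfolding \<eta>_def H_def by (rule spline_conv_eq[OF \<Phi> \<theta> T R supp ggS])
      finally have e1: "lp_block \<Phi> 0 (spline_conv \<theta> T) \<psi> = T \<eta>" .
      have gi: "integrable lborel (\<lambda>v. (\<integral>y. f j y * g v y \<partial>lborel) * \<psi> v)"
        and sw: "(\<integral>y. f j y * \<eta> y \<partial>lborel) = (\<integral>v. (\<integral>y. f j y * g v y \<partial>lborel) * \<psi> v \<partial>lborel)" for j
      proof -
        let ?F = "\<lambda>y v. (f j y * ?z y) * (\<psi> v * \<kappa> (y - v))"
        let ?n = "A * 2 powr (- real j * s)"
        obtain B where B: "B \<ge> 0" "\<And>x. cmod (?z x) \<le> B * wt (- r) x" using schwartz_bound0[OF zS] by metis
        have wi: "integrable lborel (\<lambda>x. cmod (?z x) * wt r x)" by (rule rapid_integrable_wt[OF schwartz_rapid[OF zS]])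
        have wB: "cmod (?z x) * wt r x \<le> B" for x
        proof -
          have "cmod (?z x) * wt r x \<le> (B * wt (- r) x) * wt r x" by (intro mult_right_mono B(2)) simp
          then show ?thesis by (simp add: mult.assoc wt_mult)
        qed
        have "integrable lborel (\<lambda>y. cmod (f j y) * (cmod (?z y) * wt r y))"
          by (rule Lp_weight(1)[OF p _ _ wi _ wB, where A="?n"]) (use f in \<open>auto simp: blocks_def\<close>)
        moreover have "integrable lborel (\<lambda>v. B1 * (cmod (\<psi> v) * wt r v))"
          by (intro integrable_mult_right rapid_integrable_wt r\<psi>)
        moreover have "norm (?F y v) \<le> (cmod (f j y) * (cmod (?z y) * wt r y)) * (B1 * (cmod (\<psi> v) * wt r v))" for y v
        proof -
          have "cmod (\<kappa> (y - v)) \<le> B1 * wt r (y + - v)" using B1(3)[of "[]" "y - v"] by simp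
          also have "\<dots> \<le> B1 * (wt r y * wt \<bar>r\<bar> (- v))" by (intro mult_left_mono wt_peetre B1)
          finally have "cmod (\<kappa> (y - v)) \<le> B1 * (wt r y * wt r v)" using B1(2) by simp
          then have "(cmod (f j y) * cmod (?z y)) * (cmod (\<psi> v) * cmod (\<kappa> (y - v))) \<le> (cmod (f j y) * cmod (?z y)) * (cmod (\<psi> v) * (B1 * (wt r y * wt r v)))"
            by (intro mult_left_mono) auto
          then show ?thesis by (simp add: norm_mult mult_ac)
        qed
        ultimately have fub: "(\<integral>y. (\<integral>v. ?F y v \<partial>lborel) \<partial>lborel) = (\<integral>v. (\<integral>y. ?F y v \<partial>lborel) \<partial>lborel)"
          "integrable lborel (\<lambda>v. \<integral>y. ?F y v \<partial>lborel)"
          by (intro fubini_swap[of ?F "\<lambda>y. cmod (f j y) * (cmod (?z y) * wt r y)" "\<lambda>v. B1 * (cmod (\<psi> v) * wt r v)"]; measurable)+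
        have 1: "(\<integral>v. ?F y v \<partial>lborel) = f j y * \<eta> y" for y
          unfolding \<eta>_def Hy by (subst integral_mult_right_zero) (simp only: mult.assoc)
        have 2: "(\<integral>y. ?F y v \<partial>lborel) = (\<integral>y. f j y * g v y \<partial>lborel) * \<psi> v" for v
        proof -
          have "(\<lambda>y. ?F y v) = (\<lambda>y. (f j y * g v y) * \<psi> v)" by (simp add: g_def sh_def mult_ac)
          then show ?thesis by (simp only: integral_mult_left_zero)
        qed
        show "(\<integral>y. f j y * \<eta> y \<partial>lborel) = (\<integral>v. (\<integral>y. f j y * g v y \<partial>lborel) * \<psi> v \<partial>lborel)" using fub(1) unfolding 1 2 .
        show "integrable lborel (\<lambda>v. (\<integral>y. f j y * g v y \<partial>lborel) * \<psi> v)" using fub(2) unfolding 2 .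
      qed
      have part: "(\<Sum>j\<le>J. T (conv (lpk \<Phi> j) \<eta>)) = (\<integral>v. uJ J v * \<psi> v \<partial>lborel)" for J
      proof -
        have "(\<Sum>j\<le>J. T (conv (lpk \<Phi> j) \<eta>)) = (\<Sum>j\<le>J. \<integral>v. (\<integral>y. f j y * g v y \<partial>lborel) * \<psi> v \<partial>lborel)"
          unfolding blocks_action(1)[OF \<Phi> f \<eta>S] sw ..
        also have "\<dots> = (\<integral>v. uJ J v * \<psi> v \<partial>lborel)"
          unfolding uJ_def sum_distrib_right by (rule Bochner_Integration.integral_sum[symmetric]) (rule gi)
        finally show ?thesis .
      qed
      \<comment> \<open>The same sequence of integrals is evaluated in two ways: as partial sums of
        T at \<eta>, and by dominated convergence of \<open>uJ\<close> to \<open>u\<close>.\<close>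
      have l1: "(\<lambda>J. \<integral>v. uJ J v * \<psi> v \<partial>lborel) \<longlonglongrightarrow> T \<eta>" using lim[OF \<eta>S] unfolding part .
      have l2: "(\<lambda>J. \<integral>v. uJ J v * \<psi> v \<partial>lborel) \<longlonglongrightarrow> (\<integral>v. u v * \<psi> v \<partial>lborel)"
      proof (rule integral_dominated_convergence[where w="\<lambda>v. (C0 * A * (E0 * B1 * W1)) * (cmod (\<psi> v) * wt r v)"])
        show "integrable lborel (\<lambda>v. (C0 * A * (E0 * B1 * W1)) * (cmod (\<psi> v) * wt r v))"
          by (intro integrable_mult_right rapid_integrable_wt r\<psi>)
        show "AE v in lborel. (\<lambda>J. uJ J v * \<psi> v) \<longlonglongrightarrow> u v * \<psi> v"
          by (intro AE_I2 tendsto_mult ulim tendsto_const)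
        show "AE v in lborel. norm (uJ J v * \<psi> v) \<le> (C0 * A * (E0 * B1 * W1)) * (cmod (\<psi> v) * wt r v)" for J
        proof (rule AE_I2)
          fix v
          show "norm (uJ J v * \<psi> v) \<le> (C0 * A * (E0 * B1 * W1)) * (cmod (\<psi> v) * wt r v)"
            using mult_right_mono[OF uJb[of J v], of "cmod (\<psi> v)"] by (simp add: norm_mult mult_ac)
        qed
      qed measurable
      show "lp_block \<Phi> 0 (spline_conv \<theta> T) \<psi> = distr_of_fun u \<psi>"
        unfolding e1 distr_of_fun_def by (rule LIMSEQ_unique[OF l1 l2])
    qed
    have "distr_Lp_norm p (lp_block \<Phi> 0 (spline_conv \<theta> T)) \<le> Lp_norm p u"
      unfolding distr_Lp_norm_def using rep by (intro Inf_lower) blast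
    also have "\<dots> \<le> ennreal ((C0 * A * F * B2 * W2) * C1)" by (rule Lp_leD[OF p Lu])
    also have "(C0 * A * F * B2 * W2) * C1 = C * A" by (simp add: C_def mult_ac)
    finally show ?thesis .
  qed
  moreover have "C \<ge> 0" using C0(1) F B2 W2 C1(1) by (simp add: C_def)
  ultimately show ?thesis by (intro exI[of _ C]) auto
qed

subsection \<open>Besov estimate\<close>

text \<open>Lets \<delta> tend to 0 in estimates obtained from representatives whose norms exceed
  the infimum by \<delta>.\<close>

lemma ennreal_le_perturb:
  fixes X y :: real
  assumes X: "X \<ge> 0" and y: "y \<ge> 0" and le: "\<And>\<delta>. \<delta> > 0 \<Longrightarrow> x \<le> ennreal (y + X * \<delta>)"
  shows "x \<le> ennreal y"
proof (rule ennreal_le_epsilon)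
  fix e :: real assume e: "0 < e"
  have "X * (e / (X + 1)) \<le> e" using X e by (simp add: field_simps)
  then have "ennreal (y + X * (e / (X + 1))) \<le> ennreal (y + e)" by (intro ennreal_leI) simp
  moreover have "x \<le> ennreal (y + X * (e / (X + 1)))" using X e by (intro le) simp
  ultimately show "x \<le> ennreal y + ennreal e" using y e by (simp add: ennreal_plus)
qed

text \<open>\<epsilon> is half of the gap L - \<theta> - N/p, with N/p = 0 for infinite p. The other
  half keeps the decay exponent above N/p.\<close>

lemma decay_exponent:
  fixes p :: ennreal and N :: nat
  assumes \<theta>: "\<theta> > 0" and p: "1 \<le> p" and N: "N > 0" and L: "of_nat L > ennreal \<theta> + of_nat N / p"
  shows "\<exists>\<epsilon>>0. 0 < real L - \<theta> - \<epsilon> \<and> (p \<noteq> \<infinity> \<longrightarrow> real N < (real L - \<theta> - \<epsilon>) * enn2real p)"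
proof (cases "p = \<infinity>")
  case True
  have "ennreal \<theta> < ennreal (real L)" using L True by (simp add: ennreal_of_nat_eq_real_of_nat)
  then have "\<theta> < real L" using \<theta> by (simp add: ennreal_less_iff)
  then show ?thesis using True by (intro exI[of _ "(real L - \<theta>) / 2"]) auto
next
  case False
  define P where "P = enn2real p"
  have P: "P \<ge> 1" unfolding P_def by (rule enn2real_ge_1[OF p False])
  have pP: "p = ennreal P" unfolding P_def using False by (simp add: less_top)
  have "ennreal \<theta> + of_nat N / p = ennreal (\<theta> + real N / P)"
    using \<theta> P unfolding pP ennreal_of_nat_eq_real_of_nat by (simp add: divide_ennreal ennreal_plus)
  then have "ennreal (\<theta> + real N / P) < ennreal (real L)" using L by (simp add: ennreal_of_nat_eq_real_of_nat)
  moreover have "0 \<le> \<theta> + real N / P" using \<theta> P by simp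
  ultimately have l: "\<theta> + real N / P < real L" by (simp only: ennreal_less_iff)
  define \<epsilon> where "\<epsilon> = (real L - \<theta> - real N / P) / 2"
  have e: "\<epsilon> > 0" "real L - \<theta> - \<epsilon> > real N / P"
    using l unfolding \<epsilon>_def by (simp, simp add: diff_divide_distrib)
  have "real N / P > 0" using N P by simp
  then have "real L - \<theta> - \<epsilon> > 0" using e(2) by linarith
  moreover have "real N < (real L - \<theta> - \<epsilon>) * P" using e(2) P by (simp add: pos_divide_less_eq)
  ultimately show ?thesis using e(1) unfolding P_def by blast
qed

lemma spline_conv_besov:
  fixes \<Phi> :: "real^'n::finite \<Rightarrow> complex"
  assumes \<Phi>: "lp_generator \<Phi>" and \<theta>: "\<theta> > 0" and p: "1 \<le> p" and q: "1 \<le> q"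
    and L: "of_nat L > ennreal \<theta> + of_nat CARD('n) / p" and R: "R > 0"
  shows "\<exists>C::real. \<forall>T \<in> besov_space \<Phi> s p q. distr_support T \<subseteq> ball 0 R \<longrightarrow> annihilates_polys T (L - 1) \<longrightarrow>
    besov_norm \<Phi> (s + \<theta> + real CARD('n)) p q (spline_conv \<theta> T) \<le> ennreal C * besov_norm \<Phi> s p q T"
proof -
  define N where "N = real CARD('n)"
  obtain \<epsilon> where \<epsilon>: "\<epsilon> > 0" "0 < real L - \<theta> - \<epsilon>" "p \<noteq> \<infinity> \<Longrightarrow> real CARD('n) < (real L - \<theta> - \<epsilon>) * enn2real p"
    using decay_exponent[OF \<theta> p _ L] by auto
  have L1: "L \<ge> 1" using \<epsilon> \<theta> by (cases L) auto
  have "\<exists>C\<ge>0. \<forall>T f A. tempered T \<longrightarrow> distr_support T \<subseteq> ball 0 R \<longrightarrow> annihilates_polys T (L - 1) \<longrightarrow> A > 0 \<longrightarrow>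
     blocks \<Phi> p T f (\<lambda>j. A * 2 powr (- real j * s)) \<longrightarrow>
     distr_Lp_norm p (lp_block \<Phi> 0 (spline_conv \<theta> T)) \<le> ennreal (C * A)"
    by (rule low_block[OF \<Phi> \<theta> p R L1 \<epsilon>(1) refl \<epsilon>(2)]) (rule \<epsilon>(3))
  then obtain C0 where C0: "C0 \<ge> 0" "\<forall>T f A. tempered T \<longrightarrow> distr_support T \<subseteq> ball 0 R \<longrightarrow> annihilates_polys T (L - 1) \<longrightarrow> A > 0 \<longrightarrow>
     blocks \<Phi> p T f (\<lambda>j. A * 2 powr (- real j * s)) \<longrightarrow>
     distr_Lp_norm p (lp_block \<Phi> 0 (spline_conv \<theta> T)) \<le> ennreal (C0 * A)" by (elim exE conjE)
  \<comment> \<open>8 comes from \<open>high_block\<close>, 2 powr (\<theta> + N) from the shift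
    between \<open>i\<close> and \<open>j = Suc i\<close>, and 2 powr \<bar>s\<bar> from comparing
    the weights of neighbouring indices.\<close>
  define H where "H = 8 * high_const \<Phi> \<theta> * 2 powr (\<theta> + N + \<bar>s\<bar>)"
  have H: "H > 0" using high_const_pos[of \<Phi> \<theta>] by (simp add: H_def)
  define c where "c = C0 + H"
  have c: "c > 0" "C0 \<le> c" "H \<le> c" using C0(1) H by (auto simp: c_def)
  have "besov_norm \<Phi> (s + \<theta> + N) p q (spline_conv \<theta> T) \<le> ennreal (12 * c) * besov_norm \<Phi> s p q T"
    if T: "T \<in> besov_space \<Phi> s p q" and supp: "distr_support T \<subseteq> ball 0 R" and ann: "annihilates_polys T (L - 1)" for T
  proof -
    have tT: "tempered T" using T by (simp add: besov_space_def)
    define D where "D j = distr_Lp_norm p (lp_block \<Phi> j T)" for j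
    define a where "a j = ennreal (2 powr (real j * s)) * D j" for j
    have bn: "besov_norm \<Phi> s p q T = lq_norm q a" by (simp add: besov_norm_def a_def[abs_def] D_def)
    define \<alpha> where "\<alpha> = enn2real (lq_norm q a)"
    have "lq_norm q a < \<infinity>" using T bn by (simp add: besov_space_def)
    then have M: "lq_norm q a = ennreal \<alpha>" by (simp add: \<alpha>_def)
    have \<alpha>0: "\<alpha> \<ge> 0" by (simp add: \<alpha>_def)
    define \<nu> where "\<nu> j = enn2real (D j)" for j
    have \<nu>0: "\<nu> j \<ge> 0" for j by (simp add: \<nu>_def)
    have aM: "a j \<le> ennreal \<alpha>" for j using lq_ge_term[OF q, of a j] M by simp
    have D: "D j = ennreal (\<nu> j)" for j
    proof -
      have "D j \<noteq> \<infinity>"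
      proof
        assume "D j = \<infinity>"
        then have "a j = \<infinity>" by (simp add: a_def ennreal_mult_top)
        then show False using aM[of j] by (simp add: top_unique)
      qed
      then show ?thesis by (simp add: \<nu>_def less_top)
    qed
    have a_eq: "a j = ennreal (2 powr (real j * s) * \<nu> j)" for j
      unfolding a_def D by (simp add: ennreal_mult \<nu>0)
    have \<nu>\<alpha>: "\<nu> j \<le> \<alpha> * 2 powr (- real j * s)" for j
    proof -
      have "2 powr (real j * s) * \<nu> j \<le> \<alpha>" using aM[of j] \<alpha>0 unfolding a_eq by (simp add: ennreal_le_iff)
      then show ?thesis by (simp add: powr_minus field_simps)
    qed
    have low: "distr_Lp_norm p (lp_block \<Phi> 0 (spline_conv \<theta> T)) \<le> ennreal (C0 * \<alpha>)"
    proof (rule ennreal_le_perturb[OF C0(1)])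
      show "0 \<le> C0 * \<alpha>" using C0(1) \<alpha>0 by simp
      fix \<delta> :: real assume \<delta>: "\<delta> > 0"
      \<comment> \<open>The low block involves all blocks of T, so one common bound in terms of the
        norm \<alpha> is used. The added \<delta> makes it positive and strictly larger than the
        norms even if \<alpha> = 0.\<close>
      define A where "A = \<alpha> + \<delta>"
      have A: "A > 0" "\<alpha> < A" using \<alpha>0 \<delta> by (simp_all add: A_def)
      have "\<exists>f. blocks \<Phi> p T f (\<lambda>j. A * 2 powr (- real j * s))"
      proof (rule blocks_exist[OF p])
        show "0 < A * 2 powr (- real j * s)" for j using A by simp
        fix j
        have "\<nu> j < A * 2 powr (- real j * s)"
          by (rule le_less_trans[OF \<nu>\<alpha>]) (use A in \<open>simp add: mult_strict_right_mono\<close>)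
        then show "distr_Lp_norm p (lp_block \<Phi> j T) < ennreal (A * 2 powr (- real j * s))"
          unfolding D_def[symmetric] D by (simp add: ennreal_less_iff \<nu>0)
      qed
      then obtain f where f: "blocks \<Phi> p T f (\<lambda>j. A * 2 powr (- real j * s))" by (elim exE)
      have "distr_Lp_norm p (lp_block \<Phi> 0 (spline_conv \<theta> T)) \<le> ennreal (C0 * A)"
        by (rule C0(2)[rule_format, OF tT supp ann A(1) f])
      then show "distr_Lp_norm p (lp_block \<Phi> 0 (spline_conv \<theta> T)) \<le> ennreal (C0 * \<alpha> + C0 * \<delta>)"
        by (simp add: A_def distrib_left)
    qed
    have high: "distr_Lp_norm p (lp_block \<Phi> (Suc i) (spline_conv \<theta> T))
        \<le> ennreal (8 * (high_const \<Phi> \<theta> * 2 powr (- real i * (\<theta> + N))) * (\<Sum>k\<in>near (Suc i). \<nu> k))" for i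
    proof -
      define X where "X = 8 * (high_const \<Phi> \<theta> * 2 powr (- real i * (\<theta> + N)))"
      have X: "X \<ge> 0" using high_const_pos[of \<Phi> \<theta>] by (simp add: X_def)
      have "distr_Lp_norm p (lp_block \<Phi> (Suc i) (spline_conv \<theta> T)) \<le> ennreal (X * (\<Sum>k\<in>near (Suc i). \<nu> k))"
      proof (rule ennreal_le_perturb[where X="X * real (card (near (Suc i)))"])
        show "0 \<le> X * real (card (near (Suc i)))" using X by simp
        show "0 \<le> X * (\<Sum>k\<in>near (Suc i). \<nu> k)" using X \<nu>0 by (simp add: sum_nonneg)
        fix \<delta> :: real assume \<delta>: "\<delta> > 0"
        \<comment> \<open>Here the individual norms must survive, because they are summed in l^q
          afterwards. One \<delta> for all indices suffices, as only the finitely many neighbours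
          enter the estimate.\<close>
        have "\<exists>f. blocks \<Phi> p T f (\<lambda>j. \<nu> j + \<delta>)"
        proof (rule blocks_exist[OF p])
          show "0 < \<nu> j + \<delta>" for j using \<nu>0[of j] \<delta> by simp
          show "distr_Lp_norm p (lp_block \<Phi> j T) < ennreal (\<nu> j + \<delta>)" for j
            unfolding D_def[symmetric] D using \<nu>0[of j] \<delta> by (simp add: ennreal_less_iff)
        qed
        then obtain f where f: "blocks \<Phi> p T f (\<lambda>j. \<nu> j + \<delta>)" by (elim exE)
        have "distr_Lp_norm p (lp_block \<Phi> (Suc i) (spline_conv \<theta> T)) \<le> ennreal (X * (\<Sum>k\<in>near (Suc i). \<nu> k + \<delta>))"
          unfolding X_def N_def by (rule high_block[OF \<Phi> \<theta> p tT R supp f])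
        then show "distr_Lp_norm p (lp_block \<Phi> (Suc i) (spline_conv \<theta> T))
            \<le> ennreal (X * (\<Sum>k\<in>near (Suc i). \<nu> k) + X * real (card (near (Suc i))) * \<delta>)"
          by (simp add: sum.distrib distrib_left mult.assoc)
      qed
      then show ?thesis by (simp only: X_def)
    qed
    define b where "b j = ennreal (2 powr (real j * (s + \<theta> + N))) * distr_Lp_norm p (lp_block \<Phi> j (spline_conv \<theta> T))" for j
    have "lq_norm q b \<le> ennreal (12 * c) * lq_norm q a"
    proof (rule lq_neighbour_bound[OF q c(1)])
      fix j
      show "b j \<le> ennreal c * (if j = 0 then lq_norm q a else \<Sum>i\<in>near j. a i)"
      proof (cases j)
        case 0
        have "b 0 \<le> ennreal (C0 * \<alpha>)" using low by (simp add: b_def)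
        also have "\<dots> \<le> ennreal (c * \<alpha>)" using c \<alpha>0 by (intro ennreal_leI mult_right_mono)
        also have "\<dots> = ennreal c * lq_norm q a" using c \<alpha>0 unfolding M by (simp add: ennreal_mult)
        finally show ?thesis using 0 by simp
      next
        case (Suc i)
        let ?X = "8 * (high_const \<Phi> \<theta> * 2 powr (- real i * (\<theta> + N)))"
        have X: "?X \<ge> 0" using high_const_pos[of \<Phi> \<theta>] by simp
        have S0: "(\<Sum>k\<in>near j. 2 powr (real k * s) * \<nu> k) \<ge> 0" using \<nu>0 by (intro sum_nonneg) simp
        have "2 powr (real j * (s + \<theta> + N)) * (?X * (\<Sum>k\<in>near j. \<nu> k))
          = (8 * high_const \<Phi> \<theta>) * (2 powr (real j * (s + \<theta> + N)) * 2 powr (- real i * (\<theta> + N))) * (\<Sum>k\<in>near j. \<nu> k)"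
          by (simp only: mult_ac)
        also have "2 powr (real j * (s + \<theta> + N)) * 2 powr (- real i * (\<theta> + N)) = 2 powr (\<theta> + N) * 2 powr (real j * s)"
          unfolding powr_add[symmetric] Suc by (simp add: algebra_simps)
        also have "(8 * high_const \<Phi> \<theta>) * (2 powr (\<theta> + N) * 2 powr (real j * s)) * (\<Sum>k\<in>near j. \<nu> k)
          = (8 * high_const \<Phi> \<theta>) * 2 powr (\<theta> + N) * (\<Sum>k\<in>near j. 2 powr (real j * s) * \<nu> k)"
          unfolding sum_distrib_left[symmetric] by (simp only: mult_ac)
        also have "\<dots> \<le> (8 * high_const \<Phi> \<theta>) * 2 powr (\<theta> + N) * (\<Sum>k\<in>near j. 2 powr \<bar>s\<bar> * (2 powr (real k * s) * \<nu> k))"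
        proof (rule mult_left_mono[OF sum_mono])
          fix k assume "k \<in> near j"
          then have "\<bar>real j - real k\<bar> \<le> 1" by (auto simp: near_def)
          then have "\<bar>real j - real k\<bar> * \<bar>s\<bar> \<le> \<bar>s\<bar>" by (simp add: mult_left_le_one_le)
          then have "(real j - real k) * s \<le> \<bar>s\<bar>" using abs_ge_self[of "(real j - real k) * s"] by (simp add: abs_mult)
          then have "real j * s \<le> \<bar>s\<bar> + real k * s" by (simp add: algebra_simps)
          then have "2 powr (real j * s) \<le> 2 powr \<bar>s\<bar> * 2 powr (real k * s)" unfolding powr_add[symmetric] by simp
          from mult_right_mono[OF this \<nu>0[of k]]
          show "2 powr (real j * s) * \<nu> k \<le> 2 powr \<bar>s\<bar> * (2 powr (real k * s) * \<nu> k)" by (simp only: mult.assoc)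
        qed (use high_const_pos[of \<Phi> \<theta>] in simp)
        also have "\<dots> = H * (\<Sum>k\<in>near j. 2 powr (real k * s) * \<nu> k)"
          unfolding H_def powr_add sum_distrib_left[symmetric] by (simp only: mult_ac)
        also have "\<dots> \<le> c * (\<Sum>k\<in>near j. 2 powr (real k * s) * \<nu> k)" by (intro mult_right_mono c S0)
        finally have le: "2 powr (real j * (s + \<theta> + N)) * (?X * (\<Sum>k\<in>near j. \<nu> k)) \<le> c * (\<Sum>k\<in>near j. 2 powr (real k * s) * \<nu> k)" .
        have "b j \<le> ennreal (2 powr (real j * (s + \<theta> + N))) * ennreal (?X * (\<Sum>k\<in>near j. \<nu> k))"
          unfolding b_def Suc by (rule mult_left_mono[OF high]) simp
        also have "\<dots> = ennreal (2 powr (real j * (s + \<theta> + N)) * (?X * (\<Sum>k\<in>near j. \<nu> k)))"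
          using X \<nu>0 by (subst ennreal_mult[symmetric]) (simp_all add: sum_nonneg)
        also have "\<dots> \<le> ennreal (c * (\<Sum>k\<in>near j. 2 powr (real k * s) * \<nu> k))" by (rule ennreal_leI[OF le])
        also have "\<dots> = ennreal c * (\<Sum>k\<in>near j. a k)"
        proof -
          have "(\<Sum>k\<in>near j. a k) = ennreal (\<Sum>k\<in>near j. 2 powr (real k * s) * \<nu> k)"
            unfolding a_eq by (rule sum_ennreal) (simp add: \<nu>0)
          then show ?thesis using c(1) S0 by (simp add: ennreal_mult)
        qed
        finally show ?thesis using Suc by simp
      qed
    qed
    then show ?thesis unfolding bn by (simp add: besov_norm_def b_def[abs_def])
  qed
  then show ?thesis unfolding N_def by (intro exI[of _ "12 * c"]) auto
qed

section \<open>Membership in the Besov space and the estimate on compact sets\<close>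

theorem lemma3p3:
  fixes \<Phi> :: "real^'n::finite \<Rightarrow> complex"
    and \<theta> s :: real and p q :: ennreal and L :: nat
  assumes "lp_generator \<Phi>"
    and "\<theta> > 0" and "1 \<le> p" and "1 \<le> q"
    and "of_nat L > ennreal \<theta> + of_nat CARD('n) / p"
  shows "(\<forall>\<mu> \<in> besov_space \<Phi> s p q.
           compact (distr_support \<mu>) \<and> annihilates_polys \<mu> (L - 1) \<longrightarrow>
           distr_conv (distr_of_fun (surface_spline \<theta>)) \<mu>
             \<in> besov_space \<Phi> (s + \<theta> + real CARD('n)) p q) \<and>
         (\<forall>K. compact K \<longrightarrow> (\<exists>C::real. \<forall>\<mu> \<in> besov_space \<Phi> s p q.
           compact (distr_support \<mu>) \<and> annihilates_polys \<mu> (L - 1) \<and> distr_support \<mu> \<subseteq> K \<longrightarrow>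
           besov_norm \<Phi> (s + \<theta> + real CARD('n)) p q
               (distr_conv (distr_of_fun (surface_spline \<theta>)) \<mu>)
             \<le> ennreal C * besov_norm \<Phi> s p q \<mu>))"
proof (intro conjI ballI allI impI)
  note est = spline_conv_besov[OF assms, where s=s]
  have inball: "\<exists>R>0. K \<subseteq> ball 0 R" if "compact K" for K :: "(real^'n) set"
    using compact_imp_bounded[OF that] bounded_subset_ballD by blast
  {
    fix \<mu> :: "'n distr" assume \<mu>: "\<mu> \<in> besov_space \<Phi> s p q"
      and cpt: "compact (distr_support \<mu>) \<and> annihilates_polys \<mu> (L - 1)"
    \<comment> \<open>For membership the radius may depend on \<mu>; finiteness of the norm then
      follows from the estimate on that ball.\<close>
    obtain R where R: "R > 0" "distr_support \<mu> \<subseteq> ball 0 R" using inball cpt by (elim exE conjE) blast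
    obtain C where "\<forall>T \<in> besov_space \<Phi> s p q. distr_support T \<subseteq> ball 0 R \<longrightarrow> annihilates_polys T (L - 1) \<longrightarrow>
      besov_norm \<Phi> (s + \<theta> + real CARD('n)) p q (spline_conv \<theta> T) \<le> ennreal C * besov_norm \<Phi> s p q T"
      using est[OF R(1)] by (elim exE)
    then have "besov_norm \<Phi> (s + \<theta> + real CARD('n)) p q (spline_conv \<theta> \<mu>) \<le> ennreal C * besov_norm \<Phi> s p q \<mu>"
      using \<mu> R(2) cpt by simp
    moreover have "besov_norm \<Phi> s p q \<mu> < \<infinity>" and T: "tempered \<mu>" using \<mu> by (simp_all add: besov_space_def)
    ultimately have "besov_norm \<Phi> (s + \<theta> + real CARD('n)) p q (spline_conv \<theta> \<mu>) < \<infinity>"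
      by (auto simp: ennreal_mult_less_top intro: le_less_trans)
    then show "spline_conv \<theta> \<mu> \<in> besov_space \<Phi> (s + \<theta> + real CARD('n)) p q"
      using spline_conv_tempered[OF assms(1,2) T R] by (simp add: besov_space_def)
  next
    fix K :: "(real^'n) set" assume "compact K"
    then have "\<exists>R>0. K \<subseteq> ball 0 R" by (rule inball)
    then obtain R where R: "R > 0" "K \<subseteq> ball 0 R" by (elim exE conjE)
    obtain C where C: "\<forall>T \<in> besov_space \<Phi> s p q. distr_support T \<subseteq> ball 0 R \<longrightarrow> annihilates_polys T (L - 1) \<longrightarrow>
      besov_norm \<Phi> (s + \<theta> + real CARD('n)) p q (spline_conv \<theta> T) \<le> ennreal C * besov_norm \<Phi> s p q T"
      using est[OF R(1)] by (elim exE)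
    show "\<exists>C::real. \<forall>\<mu> \<in> besov_space \<Phi> s p q.
        compact (distr_support \<mu>) \<and> annihilates_polys \<mu> (L - 1) \<and> distr_support \<mu> \<subseteq> K \<longrightarrow>
        besov_norm \<Phi> (s + \<theta> + real CARD('n)) p q (spline_conv \<theta> \<mu>) \<le> ennreal C * besov_norm \<Phi> s p q \<mu>"
    proof (intro exI[of _ C] ballI impI)
      fix \<mu> assume \<mu>: "\<mu> \<in> besov_space \<Phi> s p q"
        and h: "compact (distr_support \<mu>) \<and> annihilates_polys \<mu> (L - 1) \<and> distr_support \<mu> \<subseteq> K"
      have "distr_support \<mu> \<subseteq> ball 0 R" using h R(2) by blast
      then show "besov_norm \<Phi> (s + \<theta> + real CARD('n)) p q (spline_conv \<theta> \<mu>) \<le> ennreal C * besov_norm \<Phi> s p q \<mu>"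
        using C \<mu> h by simp
    qed
  }
qed

end
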